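(* (Loss of polyconvexity.) Let $d=s=2$, let $\Omega\subset\mathbb{R}^2$ be a (nonempty) bounded open domain, and consider the sets - $P_1=[0,\tfrac12)\times[0,1)$ and $P_2=[\tfrac12,1)\times[0,1)$; - $\mathfrak{A}_1=\{O,A_1^1,A_1^2\}$ with $O=\mathrm{diag}(0,0)$, $A_1^1=\mathrm{diag}(-\tfrac12,1)$, $A_1^2=\mathrm{diag}(-2,2)$; - $\mathfrak{A}_2=\{O,A_2^1,A_2^2\}$ with $A_2^1=\mathrm{diag}(\tfrac52,1)$, $A_2^2=\mathrm{diag}(3,2)$; - $\mathfrak{B}=\{O,B^1,B^2\}$ with $2B^j=A_1^j+A_2^j$ for $j=1,2$. The following properties hold: (i) $\mathfrak{A}_1$ and $\mathfrak{A}_2$ are both polyconvex sets; (ii) for every fixed $p\ge2$ there exist two polyconvex functions $\mathcal{W}_1,\mathcal{W}_2:\mathbb{M}^{2\times2}\to[0,+\infty)$, $p$-coercive and with $p$-growth, such that $\mathfrak{A}_1=\mathcal{W}_1^{-1}(0)$ and $\mathfrak{A}_2=\mathcal{W}_2^{-1}(0)$; (iii) the homogenized set $\mathfrak{A}_{hom}$ related to $\{(\mathfrak{A}_k,P_k)\}_{k=1,2}$ is not polyconvex; more precisely, $$\mathfrak{B}\subseteq\mathfrak{A}_{hom}\quad\text{and}\quad\mathfrak{B}^{pc}\nsubseteq\mathfrak{A}_{hom},$$ where $\mathfrak{B}^{pc}$ denotes the polyconvex hull of $\mathfrak{B}$; (iv) for $\mathcal{W}_1,\mathcal{W}_2$ as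 in (ii), the homogenized integrand $\mathcal{W}_{hom}$ related to $\mathcal{W}(y,\Lambda):=\chi_{P_1}(y)\,\mathcal{W}_1(\Lambda)+\chi_{P_2}(y)\,\mathcal{W}_2(\Lambda)$ is not polyconvex.
   Context: Notation. $\mathbb{M}^{2\times2}$ is the space of real $2\times2$ matrices; $\square=[0,1)^2$; $\chi_S$ is the characteristic function of $S$; $\langle x\rangle\in\square$ is the componentwise fractional part of $x\in\mathbb{R}^2$. Polyconvexity (case $2\times2$). For $\Lambda\in\mathbb{M}^{2\times2}$ put $\widehat\Lambda=(\Lambda,\det\Lambda)\in\mathbb{R}^5$. A function $\mathcal{W}:\mathbb{M}^{2\times2}\to\mathbb{R}$ is polyconvex if there is a convex $\mathcal{V}:\mathbb{R}^5\to\mathbb{R}$ with $\mathcal{W}(\Lambda)=\mathcal{V}(\widehat\Lambda)$ for all $\Lambda$. A set $\mathfrak{A}\subseteq\mathbb{M}^{2\times2}$ is polyconvex if there is a convex set $\mathfrak{C}\subseteq\mathbb{R}^5$ with $\mathfrak{A}=\{A\in\mathbb{M}^{2\times2}:\widehat A\in\mathfrak{C}\}$. The polyconvex hull $\mathfrak{A}^{pc}$ is the smallest polyconvex set containing $\mathfrak{A}$. Coerciveness and growth. $\mathcal{V}:\mathbb{M}^{2\times2}\to[0,+\infty)$ is $p$-coercive and with $p$-growth if there are constants $c_1,c_2,c_3>0$ with $c_1|\Lambda|^p-c_2\le\mathcal{V}(\Lambda)\le c_3(1+|\Lambda|^p)$ for all $\Lambda$. Homogenized set. Given a measurable partition $\{P_k\}_{k=1,\dots,n}$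 of $\square$ and compact sets $\mathfrak{A}_1,\dots,\mathfrak{A}_n\subseteq\mathbb{M}^{2\times2}$, the homogenized set $\mathfrak{A}_{hom}$ related to $\{(\mathfrak{A}_k,P_k)\}_k$ is the set of matrices $A\in\mathbb{M}^{2\times2}$ such that for every sequence $\varepsilon_h\to0^+$ there exists a sequence $u_h\in W^{1,\infty}(\Omega,\mathbb{R}^2)$ with: (a) $u_h\rightharpoonup Ax$ weakly* in $W^{1,\infty}(\Omega,\mathbb{R}^2)$; (b) $\sum_{k=1}^n\chi_{P_k}(\langle x/\varepsilon_h\rangle)\,\mathrm{dist}(\nabla u_h(x),\mathfrak{A}_k)\to0$ in measure on $\Omega$. $\Gamma$-convergence. With $L^p(\Omega,\mathbb{R}^2)$ carrying its strong topology, $E$ is the $\Gamma(L^p)$-limit of a sequence $E_h$ of functionals $L^p(\Omega,\mathbb{R}^2)\to[0,+\infty]$ if for every $u$: $E(u)\le\inf\{\liminf_h E_h(u_h):u_h\to u\}$ and $E(u)\ge\inf\{\limsup_h E_h(u_h):u_h\to u\}$. $E$ is the $\Gamma(L^p)$-limit of $(E_\varepsilon)_{\varepsilon>0}$ as $\varepsilon\to0^+$ if it is the $\Gamma(L^p)$-limit of $E_{\varepsilon_h}$ for every $\varepsilon_h\to0^+$. Homogenized integrand. For $\varepsilon>0$ let $E_\varepsilon(u)=\int_\Omega\mathcal{W}(\langle x/\varepsilon\rangle,\nabla u(x))\,dx$ if $u\in W^{1,p}(\Omega,\mathbb{R}^2)$ and $E_\varepsilon(u)=+\infty$ for other $u\in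 L^p(\Omega,\mathbb{R}^2)$. It is a standard theorem that $E_\varepsilon$ $\Gamma(L^p)$-converges as $\varepsilon\to0^+$ to $E_{hom}(u)=\int_\Omega\mathcal{W}_{hom}(\nabla u(x))\,dx$ if $u\in W^{1,p}(\Omega,\mathbb{R}^2)$, $+\infty$ otherwise, for a (unique) quasiconvex function $\mathcal{W}_{hom}:\mathbb{M}^{2\times2}\to[0,+\infty)$, called the homogenized integrand related to $\mathcal{W}$. *)

theory Defs
  imports "HOL-Analysis.Analysis"
begin

text \<open>
  Matrices are elements of \<open>real^2^2\<close>, indexed as \<open>\<Lambda> $ row $ column\<close>; their norm and inner product are
  the Euclidean (Frobenius) ones.  The space \<open>(real^2^2) \<times> real\<close> plays the role of \<open>\<real>\<^sup>5\<close>.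
  Functions on an open set \<open>\<Omega>\<close> are total functions of which only the values on \<open>\<Omega>\<close> matter, and classes
  modulo null sets are replaced by representatives.
\<close>

definition diag2 :: "real \<Rightarrow> real \<Rightarrow> real^2^2" where
  "diag2 a b = vector [vector [a, 0], vector [0, b]]"

definition frac_vec :: "real^2 \<Rightarrow> real^2" where
  "frac_vec x = (\<chi> i. frac (x $ i))"


section \<open>Polyconvexity, quasiconvexity, growth\<close>

definition minors :: "real^2^2 \<Rightarrow> (real^2^2) \<times> real" where
  "minors \<Lambda> = (\<Lambda>, det \<Lambda>)"

definition polyconvex_fun :: "(real^2^2 \<Rightarrow> real) \<Rightarrow> bool" where
  "polyconvex_fun W \<longleftrightarrow> (\<exists>V. convex_on UNIV V \<and> (\<forall>\<Lambda>. W \<Lambda> = V (minors \<Lambda>)))"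

definition polyconvex_set :: "(real^2^2) set \<Rightarrow> bool" where
  "polyconvex_set A \<longleftrightarrow> (\<exists>C. convex C \<and> A = {\<Lambda>. minors \<Lambda> \<in> C})"

text \<open>Polyconvex sets are stable under intersection, so \<open>polyconvex_set hull A\<close> is indeed the smallest
  polyconvex set containing \<open>A\<close>.\<close>

lemma polyconvex_set_hull: "polyconvex_set (polyconvex_set hull A)"
proof (rule hull_in)
  fix F :: "(real^2^2) set set"
  assume "\<forall>S\<in>F. polyconvex_set S"
  then have "\<forall>S\<in>F. \<exists>C. convex C \<and> S = {\<Lambda>. minors \<Lambda> \<in> C}"
    by (simp add: polyconvex_set_def)
  then obtain C where C: "\<And>S. S \<in> F \<Longrightarrow> convex (C S)" "\<And>S. S \<in> F \<Longrightarrow> S = {\<Lambda>. minors \<Lambda> \<in> C S}"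
    by metis
  have "convex (\<Inter>S\<in>F. C S)"
    using C(1) by (intro convex_Inter) auto
  moreover have "\<Inter>F = {\<Lambda>. minors \<Lambda> \<in> (\<Inter>S\<in>F. C S)}"
    using C(2) by blast
  ultimately show "polyconvex_set (\<Inter>F)"
    unfolding polyconvex_set_def by blast
qed

definition coercive_growth :: "real \<Rightarrow> (real^2^2 \<Rightarrow> real) \<Rightarrow> bool" where
  "coercive_growth p W \<longleftrightarrow>
     (\<exists>c1>0. \<exists>c2>0. \<exists>c3>0. \<forall>\<Lambda>.
        c1 * norm \<Lambda> powr p - c2 \<le> W \<Lambda> \<and> W \<Lambda> \<le> c3 * (1 + norm \<Lambda> powr p))"


section \<open>Lebesgue and Sobolev spaces\<close>

definition Lp :: "real \<Rightarrow> (real^2) set \<Rightarrow> (real^2 \<Rightarrow> 'b::euclidean_space) \<Rightarrow> bool" where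
  "Lp p \<Omega> f \<longleftrightarrow>
     f \<in> borel_measurable (lebesgue_on \<Omega>) \<and>
     integrable (lebesgue_on \<Omega>) (\<lambda>x. norm (f x) powr p)"

definition Linf :: "(real^2) set \<Rightarrow> (real^2 \<Rightarrow> 'b::euclidean_space) \<Rightarrow> bool" where
  "Linf \<Omega> f \<longleftrightarrow>
     f \<in> borel_measurable (lebesgue_on \<Omega>) \<and>
     (\<exists>C. AE x in lebesgue_on \<Omega>. norm (f x) \<le> C)"

primrec C_k :: "nat \<Rightarrow> (real^2 \<Rightarrow> real) \<Rightarrow> bool" where
  "C_k 0 f \<longleftrightarrow> continuous_on UNIV f"
| "C_k (Suc k) f \<longleftrightarrow>
     (\<exists>f'. (\<forall>x. (f has_derivative f' x) (at x)) \<and> (\<forall>v. C_k k (\<lambda>x. f' x v)))"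

definition test_fun :: "(real^2) set \<Rightarrow> (real^2 \<Rightarrow> real) \<Rightarrow> bool" where
  "test_fun \<Omega> \<phi> \<longleftrightarrow>
     (\<forall>k. C_k k \<phi>) \<and> (\<exists>K. compact K \<and> K \<subseteq> \<Omega> \<and> (\<forall>x. x \<notin> K \<longrightarrow> \<phi> x = 0))"

definition locally_integrable :: "(real^2) set \<Rightarrow> (real^2 \<Rightarrow> 'b::euclidean_space) \<Rightarrow> bool" where
  "locally_integrable \<Omega> f \<longleftrightarrow> (\<forall>K. compact K \<and> K \<subseteq> \<Omega> \<longrightarrow> integrable (lebesgue_on K) f)"

text \<open>The entry \<open>G x $ i $ j\<close> is the weak derivative \<open>\<partial>\<^sub>j u\<^sub>i\<close>.\<close>

definition has_weak_gradient ::
  "(real^2) set \<Rightarrow> (real^2 \<Rightarrow> real^2) \<Rightarrow> (real^2 \<Rightarrow> real^2^2) \<Rightarrow> bool" where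
  "has_weak_gradient \<Omega> u G \<longleftrightarrow>
     locally_integrable \<Omega> u \<and> locally_integrable \<Omega> G \<and>
     (\<forall>\<phi> i j. test_fun \<Omega> \<phi> \<longrightarrow>
        integral\<^sup>L (lebesgue_on \<Omega>) (\<lambda>x. u x $ i * frechet_derivative \<phi> (at x) (axis j 1)) =
        - integral\<^sup>L (lebesgue_on \<Omega>) (\<lambda>x. G x $ i $ j * \<phi> x))"

text \<open>The weak gradient is determined up to null sets of \<open>\<Omega>\<close>; a representative is chosen.  It is
  meaningful only if some weak gradient exists.\<close>

definition weak_grad :: "(real^2) set \<Rightarrow> (real^2 \<Rightarrow> real^2) \<Rightarrow> real^2 \<Rightarrow> real^2^2" where
  "weak_grad \<Omega> u = (SOME G. has_weak_gradient \<Omega> u G)"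

definition W1p :: "real \<Rightarrow> (real^2) set \<Rightarrow> (real^2 \<Rightarrow> real^2) \<Rightarrow> bool" where
  "W1p p \<Omega> u \<longleftrightarrow> Lp p \<Omega> u \<and> (\<exists>G. has_weak_gradient \<Omega> u G \<and> Lp p \<Omega> G)"

definition W1inf :: "(real^2) set \<Rightarrow> (real^2 \<Rightarrow> real^2) \<Rightarrow> bool" where
  "W1inf \<Omega> u \<longleftrightarrow> Linf \<Omega> u \<and> (\<exists>G. has_weak_gradient \<Omega> u G \<and> Linf \<Omega> G)"

definition weak_star_Linf ::
  "(real^2) set \<Rightarrow> (nat \<Rightarrow> real^2 \<Rightarrow> 'b::euclidean_space) \<Rightarrow> (real^2 \<Rightarrow> 'b) \<Rightarrow> bool" where
  "weak_star_Linf \<Omega> f g \<longleftrightarrow>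
     (\<forall>\<psi>. integrable (lebesgue_on \<Omega>) \<psi> \<longrightarrow>
        (\<lambda>h. integral\<^sup>L (lebesgue_on \<Omega>) (\<lambda>x. f h x \<bullet> \<psi> x))
          \<longlonglongrightarrow> integral\<^sup>L (lebesgue_on \<Omega>) (\<lambda>x. g x \<bullet> \<psi> x))"

definition weak_star_W1inf ::
  "(real^2) set \<Rightarrow> (nat \<Rightarrow> real^2 \<Rightarrow> real^2) \<Rightarrow> (real^2 \<Rightarrow> real^2) \<Rightarrow> bool" where
  "weak_star_W1inf \<Omega> u v \<longleftrightarrow>
     weak_star_Linf \<Omega> u v \<and> weak_star_Linf \<Omega> (\<lambda>h. weak_grad \<Omega> (u h)) (weak_grad \<Omega> v)"

definition converges_in_measure ::
  "'a measure \<Rightarrow> (nat \<Rightarrow> 'a \<Rightarrow> real) \<Rightarrow> ('a \<Rightarrow> real) \<Rightarrow> bool" where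
  "converges_in_measure M f g \<longleftrightarrow>
     (\<forall>h. f h \<in> borel_measurable M) \<and> g \<in> borel_measurable M \<and>
     (\<forall>\<delta>>0. (\<lambda>h. emeasure M {x \<in> space M. \<bar>f h x - g x\<bar> > \<delta>}) \<longlonglongrightarrow> 0)"

text \<open>Test functions of \<open>W\<^sub>0\<^sup>1\<^sup>,\<^sup>\<infinity>(D, \<real>\<^sup>2)\<close>, extended by zero, are exactly the Lipschitz functions vanishing
  outside \<open>D\<close>.\<close>

definition quasiconvex_fun :: "(real^2^2 \<Rightarrow> real) \<Rightarrow> bool" where
  "quasiconvex_fun W \<longleftrightarrow>
     W \<in> borel_measurable borel \<and> (\<forall>r. bounded (W ` cball 0 r)) \<and>
     (\<forall>D \<Lambda> \<phi> L. open D \<and> bounded D \<and> L-lipschitz_on UNIV \<phi> \<and> (\<forall>x. x \<notin> D \<longrightarrow> \<phi> x = 0) \<longrightarrow>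
        measure lebesgue D * W \<Lambda>
          \<le> integral\<^sup>L (lebesgue_on D) (\<lambda>x. W (\<Lambda> + weak_grad D \<phi> x)))"


section \<open>The homogenized set\<close>

definition hom_set ::
  "(real^2) set \<Rightarrow> nat \<Rightarrow> (nat \<Rightarrow> (real^2^2) set) \<Rightarrow> (nat \<Rightarrow> (real^2) set) \<Rightarrow> (real^2^2) set" where
  "hom_set \<Omega> n \<AA> P =
     {A. \<forall>\<epsilon>::nat \<Rightarrow> real. (\<forall>h. \<epsilon> h > 0) \<and> \<epsilon> \<longlonglongrightarrow> 0 \<longrightarrow>
        (\<exists>u. (\<forall>h. W1inf \<Omega> (u h)) \<and>
             weak_star_W1inf \<Omega> u (\<lambda>x. A *v x) \<and>
             converges_in_measure (lebesgue_on \<Omega>)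
               (\<lambda>h x. \<Sum>k=1..n. indicator (P k) (frac_vec (x /\<^sub>R \<epsilon> h)) *
                                infdist (weak_grad \<Omega> (u h) x) (\<AA> k))
               (\<lambda>x. 0))}"


section \<open>Gamma-convergence and the homogenized integrand\<close>

definition Lp_tendsto ::
  "real \<Rightarrow> (real^2) set \<Rightarrow> (nat \<Rightarrow> real^2 \<Rightarrow> real^2) \<Rightarrow> (real^2 \<Rightarrow> real^2) \<Rightarrow> bool" where
  "Lp_tendsto p \<Omega> v u \<longleftrightarrow>
     (\<forall>h. Lp p \<Omega> (v h)) \<and>
     (\<lambda>h. integral\<^sup>L (lebesgue_on \<Omega>) (\<lambda>x. norm (v h x - u x) powr p)) \<longlonglongrightarrow> 0"

definition gamma_limit ::
  "real \<Rightarrow> (real^2) set \<Rightarrow> (nat \<Rightarrow> (real^2 \<Rightarrow> real^2) \<Rightarrow> ennreal) \<Rightarrow>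
     ((real^2 \<Rightarrow> real^2) \<Rightarrow> ennreal) \<Rightarrow> bool" where
  "gamma_limit p \<Omega> Eh E \<longleftrightarrow>
     (\<forall>u. Lp p \<Omega> u \<longrightarrow>
        E u \<le> (INF v\<in>{v. Lp_tendsto p \<Omega> v u}. liminf (\<lambda>h. Eh h (v h))) \<and>
        E u \<ge> (INF v\<in>{v. Lp_tendsto p \<Omega> v u}. limsup (\<lambda>h. Eh h (v h))))"

definition gamma_limit_family ::
  "real \<Rightarrow> (real^2) set \<Rightarrow> (real \<Rightarrow> (real^2 \<Rightarrow> real^2) \<Rightarrow> ennreal) \<Rightarrow>
     ((real^2 \<Rightarrow> real^2) \<Rightarrow> ennreal) \<Rightarrow> bool" where
  "gamma_limit_family p \<Omega> E\<epsilon> E \<longleftrightarrow>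
     (\<forall>\<epsilon>::nat \<Rightarrow> real. (\<forall>h. \<epsilon> h > 0) \<and> \<epsilon> \<longlonglongrightarrow> 0 \<longrightarrow> gamma_limit p \<Omega> (\<lambda>h. E\<epsilon> (\<epsilon> h)) E)"

definition energy ::
  "real \<Rightarrow> (real^2) set \<Rightarrow> (real^2 \<Rightarrow> real^2^2 \<Rightarrow> real) \<Rightarrow> (real^2 \<Rightarrow> real^2) \<Rightarrow> ennreal" where
  "energy p \<Omega> F u =
     (if W1p p \<Omega> u then \<integral>\<^sup>+ x. ennreal (F x (weak_grad \<Omega> u x)) \<partial>lebesgue_on \<Omega> else \<infinity>)"

definition homogenized_integrand ::
  "real \<Rightarrow> (real^2) set \<Rightarrow> (real^2 \<Rightarrow> real^2^2 \<Rightarrow> real) \<Rightarrow> (real^2^2 \<Rightarrow> real) \<Rightarrow> bool" where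
  "homogenized_integrand p \<Omega> W Whom \<longleftrightarrow>
     (\<forall>\<Lambda>. 0 \<le> Whom \<Lambda>) \<and> quasiconvex_fun Whom \<and>
     gamma_limit_family p \<Omega>
       (\<lambda>\<epsilon>. energy p \<Omega> (\<lambda>x. W (frac_vec (x /\<^sub>R \<epsilon>))))
       (energy p \<Omega> (\<lambda>x. Whom))"

definition polyconvex_potential :: "real \<Rightarrow> (real^2^2) set \<Rightarrow> (real^2^2 \<Rightarrow> real) \<Rightarrow> bool" where
  "polyconvex_potential p A W \<longleftrightarrow>
     (\<forall>\<Lambda>. 0 \<le> W \<Lambda>) \<and> polyconvex_fun W \<and> coercive_growth p W \<and> A = W -` {0}"

end

theory Submission
  imports Defs
begin

text \<open>
  The polyconvex hull of \<open>\<BB>\<close> contains \<open>C = diag(2/3, 4/3)\<close>, while \<open>C\<close> is not a homogenized gradient.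
  Suppose \<open>u\<^sub>h \<rightarrow> C x\<close> and the gradients of \<open>u\<^sub>h\<close> are close to the phase sets in \<open>L\<^sup>2\<close>.  Subtract from the
  first component the sawtooth whose slopes are the values \<open>-2\<close> and \<open>3\<close> of \<open>\<partial>\<^sub>1u\<^sub>1\<close> attained together with
  \<open>\<partial>\<^sub>2u\<^sub>2 = 2\<close>, and the remaining mean \<open>x\<^sub>1/6\<close>: this gives \<open>r \<rightarrow> 0\<close> such that \<open>\<partial>\<^sub>1r + 1/6\<close> is nonzero only where
  \<open>v = u\<^sub>2 - x\<^sub>2\<close> satisfies \<open>\<partial>\<^sub>2v \<le> 0\<close>.  Let \<open>v'\<close> be the isotonic regression of \<open>v\<close> along \<open>x\<^sub>2\<close>.  As
  \<open>0 \<le> \<partial>\<^sub>2v' \<le> max 0 (\<partial>\<^sub>2v)\<close>, the product \<open>(\<partial>\<^sub>1r + 1/6) \<partial>\<^sub>2v'\<close> vanishes.  On the other hand \<open>\<partial>\<^sub>1v'\<close> and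
  \<open>\<partial>\<^sub>2r\<close> tend to \<open>0\<close> in \<open>L\<^sup>2\<close>, so by two integrations by parts its weighted integral tends to \<open>1/18\<close> times the
  total weight, a contradiction.  The argument is carried out with difference quotients on columns of a lattice.
\<close>

section \<open>Smooth functions\<close>

text \<open>The determinant is a null Lagrangian, so one might test the product of the residual
  slopes of \<open>u\<^sub>1\<close> and \<open>u\<^sub>2\<close> directly. At the matrix
  \<open>O\<close>, however, this product is -2 in the first phase and 3 in the second: it has no
  sign. The negative part of the second slope has to be discarded, and a positive part
  \<open>max 0\<close> of a derivative need not be a derivative with controlled horizontal
  variation. Isotonic regression repairs this. As a projection onto a convex cone it contracts
  distances between neighbouring columns, which bounds its horizontal differences; and it fixes
  increasing sequences, which keeps it near the limit profile. The residual mean slopes are 2/3 -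
  (-2 + 3)/2 = 1/6 and 4/3 - 1 = 1/3, with product 1/18. The choice of matrices rests on one
  identity: for barycentric weights, the defect in the affinity of the determinant is a combination
  of the products of two weights, with the determinants of the pairwise differences as coefficients.
  These have a single sign within each phase, so only the vertices survive, but mixed signs in
  \<BB>, which leaves room for \<open>C\<close>.\<close>

lemma C_k_SucE:
 assumes "C_k (Suc k) f"
 obtains f' where "!!x. (f has_derivative f' x) (at x)" "!!v. C_k k (%x. f' x v)"
 using assms unfolding C_k.simps by blast

lemma C_k_SucI:
 assumes "!!x. (f has_derivative f' x) (at x)" "!!v. C_k k (%x. f' x v)"
 shows "C_k (Suc k) f"
 using assms unfolding C_k.simps by blast

lemma C_k_Suc_imp_C_k: "C_k (Suc k) f ==> C_k k f"
proof (induction k arbitrary: f)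
 case 0
 then obtain f' where "!!x. (f has_derivative f' x) (at x)" by auto
 then show ?case
  by (auto intro!: continuous_at_imp_continuous_on has_derivative_continuous)
next
 case (Suc k)
 from Suc.prems obtain f' where "!!x. (f has_derivative f' x) (at x)" "!!v. C_k (Suc k) (%x. f' x v)"
  by (rule C_k_SucE) blast
 then show ?case
  by (intro C_k_SucI[of f f'] Suc.IH)
qed

lemma C_k_imp_continuous_on: "C_k k f ==> continuous_on UNIV f"
 by (induction k) (auto dest: C_k_Suc_imp_C_k simp del: C_k.simps(2))

lemma C_k_const: "C_k k (%x. c)"
proof (induction k arbitrary: c)
 case (Suc k)
 show ?case
  unfolding C_k.simps using Suc[of 0] by (intro exI[of _ "%x v. 0"]) auto
qed auto

lemma C_k_linear:
 assumes "bounded_linear f" shows "C_k k f"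
proof (cases k)
 case 0
 then show ?thesis using assms by (simp add: linear_continuous_on)
next
 case (Suc l)
 then show ?thesis
  unfolding Suc C_k.simps using assms
  by (intro exI[of _ "%x. f"]) (auto intro: C_k_const bounded_linear_imp_has_derivative)
qed

lemma C_k_add: "C_k k f ==> C_k k g ==> C_k k (%x. f x + g x)"
proof (induction k arbitrary: f g)
 case 0
 then show ?case by (auto intro: continuous_on_add)
next
 case (Suc k)
 obtain f' where f': "!!x. (f has_derivative f' x) (at x)" "!!v. C_k k (%x. f' x v)"
  using Suc.prems(1) by (rule C_k_SucE) blast
 obtain g' where g': "!!x. (g has_derivative g' x) (at x)" "!!v. C_k k (%x. g' x v)"
  using Suc.prems(2) by (rule C_k_SucE) blast
 have "C_k k (%x. f' x v + g' x v)" for v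
  by (intro Suc.IH f' g')
 moreover have "((%x. f x + g x) has_derivative (%v. f' x v + g' x v)) (at x)" for x
  by (intro has_derivative_add f' g')
 ultimately show ?case
  by (intro C_k_SucI[where f' = "%x v. f' x v + g' x v"])
qed

lemma C_k_mult: "C_k k f ==> C_k k g ==> C_k k (%x. f x * g x)"
proof (induction k arbitrary: f g)
 case 0
 then show ?case by (auto intro: continuous_on_mult)
next
 case (Suc k)
 obtain f' where f': "!!x. (f has_derivative f' x) (at x)" "!!v. C_k k (%x. f' x v)"
  using Suc.prems(1) by (rule C_k_SucE) blast
 obtain g' where g': "!!x. (g has_derivative g' x) (at x)" "!!v. C_k k (%x. g' x v)"
  using Suc.prems(2) by (rule C_k_SucE) blast
 have "C_k k f" "C_k k g" using Suc.prems by (blast intro: C_k_Suc_imp_C_k)+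
 then have "C_k k (%x. f x * g' x v + f' x v * g x)" for v
  by (intro C_k_add Suc.IH f' g')
 moreover have "((%x. f x * g x) has_derivative (%v. f x * g' x v + f' x v * g x)) (at x)" for x
  by (intro has_derivative_mult f' g')
 ultimately show ?case
  by (intro C_k_SucI[where f' = "%x v. f x * g' x v + f' x v * g x"])
qed

lemma C_k_real_polynomial_function: "real_polynomial_function f ==> C_k k f"
 by (induction rule: real_polynomial_function.induct)
  (auto intro: C_k_linear C_k_const C_k_add C_k_mult)

lemma C_k_translate: "C_k k f ==> C_k k (%x. f (x + c))"
proof (induction k arbitrary: f)
 case 0
 then show ?case
  by (auto intro!: continuous_on_compose2[of UNIV f] continuous_intros)
next
 case (Suc k)
 obtain f' where *: "!!x. (f has_derivative f' x) (at x)" "!!v. C_k k (%x. f' x v)"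
  using Suc.prems by (rule C_k_SucE) blast
 have "((%x. f (x + c)) has_derivative f' (x + c)) (at x)" for x
  by (rule has_derivative_compose[of "%x. x + c" "%v. v" x UNIV f "f' (x + c)", simplified])
   (use *(1) in \<open>auto intro!: derivative_eq_intros\<close>)
 moreover have "C_k k (%x. f' (x + c) v)" for v
  by (rule Suc.IH[OF *(2)])
 ultimately show ?case unfolding C_k.simps
  by (intro exI[of _ "%x. f' (x + c)"]) auto
qed

section \<open>Flat functions and smooth bumps on boxes\<close>

definition flat_poly :: "real poly => real => real" where
 "flat_poly P t = (if t <= 0 then 0 else poly P (1/t) * exp (-1/t))"

text \<open>The extra power of \<open>s\<close> makes the induction over the polynomial go through:
  each \<open>pCons\<close> raises the exponent by one.\<close>

lemma poly_times_exp_tendsto_0: "((%s. s ^ k * poly P s * exp (-s)) \<longlongrightarrow> 0) (at_top :: real filter)"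
proof (induction P arbitrary: k)
 case (pCons a p)
 have "((%s. a * (s ^ k / exp s) + s ^ Suc k * poly p s * exp (-s)) \<longlongrightarrow> a * 0 + 0) (at_top :: real filter)"
  by (intro tendsto_add tendsto_mult tendsto_const tendsto_power_div_exp_0 pCons.IH)
 then show ?case
  by (simp add: exp_minus field_simps)
qed simp

text \<open>The polynomial parameter makes the family closed under differentiation: with s = 1/t,
  the derivative of P(s) exp(-s) in t is s^2 (P(s) - P'(s)) exp(-s). Smoothness of all orders is
  then a single induction with \<open>P\<close> arbitrary; \<open>P = 1\<close> gives the classical
  exp(-1/t).\<close>

lemma flat_poly_has_derivative:
 "(flat_poly P has_real_derivative flat_poly ([:0,0,1:] * (P - pderiv P)) t) (at t)"
proof -
 let ?Q = "[:0,0,1:] * (P - pderiv P)"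
 consider "t < 0" | "t = 0" | "t > 0" by linarith
 then show ?thesis
 proof cases
  case 1
  have "((%t. 0) has_real_derivative 0) (at t)" by simp
  then have "(flat_poly P has_real_derivative 0) (at t)"
   by (rule has_field_derivative_transform_within_open[where S = "{..<0}"])
    (use 1 in \<open>auto simp: flat_poly_def\<close>)
  then show ?thesis using 1 by (simp add: flat_poly_def)
 next
  case 3
  have "((%t. poly P (1/t) * exp (-1/t)) has_real_derivative flat_poly ?Q t) (at t)"
   using 3
   by (auto intro!: derivative_eq_intros simp: flat_poly_def field_simps power2_eq_square)
  then show ?thesis
   by (rule has_field_derivative_transform_within_open[where S = "{0<..}"])
    (use 3 in \<open>auto simp: flat_poly_def\<close>)
 next
  \<comment> \<open>At the gluing point the difference quotient from the right is s P(s) exp(-s)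
    with s = 1/t, and from the left it is 0.\<close>
  case 2
  have *: "((%s. s * poly P s * exp (-s)) \<longlongrightarrow> 0) at_top"
   using poly_times_exp_tendsto_0[of 1 P] by simp
  have "((%t. flat_poly P t / t) \<longlongrightarrow> 0) (at_right 0)"
  proof (rule Lim_transform_eventually)
   show "((%t. (inverse t) * poly P (inverse t) * exp (-(inverse t))) \<longlongrightarrow> 0) (at_right 0)"
    by (rule filterlim_compose[OF * filterlim_inverse_at_top_right])
   show "\<forall>\<^sub>F t in at_right 0. (inverse t) * poly P (inverse t) * exp (-(inverse t)) = flat_poly P t / t"
    by (auto simp: eventually_at_right_field flat_poly_def field_simps intro!: exI[of _ 1])
  qed
  moreover have "((%t. flat_poly P t / t) \<longlongrightarrow> 0) (at_left 0)"
   by (rule Lim_transform_eventually[OF tendsto_const])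
    (auto simp: eventually_at_left_field flat_poly_def intro!: exI[of _ "-1"])
  ultimately have "((%t. flat_poly P t / t) \<longlongrightarrow> 0) (at 0)"
   by (rule filterlim_split_at[rotated])
  then show ?thesis
   using 2 by (simp add: has_field_derivative_iff flat_poly_def)
 qed
qed

lemma C_k_flat_poly: "C_k k (%x. flat_poly P (s * x $ i + c))"
proof (induction k arbitrary: P)
 case 0
 have "continuous_on UNIV (flat_poly P)"
  by (auto intro!: continuous_at_imp_continuous_on DERIV_isCont flat_poly_has_derivative)
 then show ?case
  by (auto intro!: continuous_on_compose2[of UNIV "flat_poly P"] continuous_intros)
next
 case (Suc k)
 let ?Q = "[:0,0,1:] * (P - pderiv P)"
 have "((%x. flat_poly P (s * x $ i + c)) has_derivative
   (%v. (s * v $ i) * flat_poly ?Q (s * x $ i + c))) (at x)" for x :: "real^2"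
 proof (rule DERIV_compose_FDERIV[where f = "flat_poly P"])
  show "DERIV (flat_poly P) (s * x $ i + c) :> flat_poly ?Q (s * x $ i + c)"
   by (rule flat_poly_has_derivative)
  show "((%x. s * x $ i + c) has_derivative (%v. s * v $ i)) (at x)"
   by (auto intro!: derivative_eq_intros bounded_linear_imp_has_derivative bounded_linear_vec_nth)
 qed
 then show ?case
  unfolding C_k.simps
  by (intro exI[of _ "%x v. (s * v $ i) * flat_poly ?Q (s * x $ i + c)"] conjI allI C_k_mult Suc.IH C_k_const)
qed

text \<open>Positive exactly on the open box. Multiplied by a polynomial it is an admissible test
  function, and on sets where it is bounded below it can be divided out again.\<close>

definition box_bump :: "real^2 => real^2 => real^2 => real" where
 "box_bump a b x = flat_poly 1 (x $ 1 - a $ 1) * flat_poly 1 (b $ 1 - x $ 1) *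
  (flat_poly 1 (x $ 2 - a $ 2) * flat_poly 1 (b $ 2 - x $ 2))"

lemma C_k_box_bump: "C_k k (box_bump a b)"
proof -
 have "C_k k (%x. flat_poly 1 (1 * x $ 1 + (- a $ 1)) * flat_poly 1 ((-1) * x $ 1 + b $ 1) *
  (flat_poly 1 (1 * x $ 2 + (- a $ 2)) * flat_poly 1 ((-1) * x $ 2 + b $ 2)))"
  by (intro C_k_mult C_k_flat_poly)
 then show ?thesis
  by (simp add: box_bump_def[abs_def])
qed

lemma flat_poly_1_bounds: "0 <= flat_poly 1 t" "flat_poly 1 t <= 1" "flat_poly 1 t > 0 \<longleftrightarrow> t > 0"
 by (auto simp: flat_poly_def)

lemma mem_box_2: "x \<in> box a b \<longleftrightarrow> a $ 1 < x $ 1 \<and> x $ 1 < b $ 1 \<and> a $ 2 < x $ 2 \<and> x $ 2 < b $ 2"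
 for x :: "real^2"
 by (auto simp: mem_box_cart forall_2)

lemma mem_cbox_2: "x \<in> cbox a b \<longleftrightarrow> a $ 1 <= x $ 1 \<and> x $ 1 <= b $ 1 \<and> a $ 2 <= x $ 2 \<and> x $ 2 <= b $ 2"
 for x :: "real^2"
 by (auto simp: mem_box_cart forall_2)

lemma box_bump_bounds: "0 <= box_bump a b x" "box_bump a b x <= 1"
 by (auto simp: box_bump_def intro!: mult_le_one mult_nonneg_nonneg flat_poly_1_bounds)

lemma box_bump_pos: "x \<in> box a b ==> box_bump a b x > 0"
 by (auto simp: box_bump_def mem_box_2 intro!: mult_pos_pos) (simp_all add: flat_poly_1_bounds)

lemma box_bump_eq_0: "x \<notin> box a b ==> box_bump a b x = 0"
 unfolding box_bump_def mem_box_2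
 by (auto simp: flat_poly_def)

lemma C_k_imp_borel_measurable: "C_k k f ==> f \<in> borel_measurable borel"
 using C_k_imp_continuous_on borel_measurable_continuous_onI by blast

section \<open>A converse Cauchy-Schwarz inequality on boxes\<close>

section \<open>Testing against smooth functions\<close>

text \<open>Truncating the continuous approximants at height \<open>M\<close> does not disturb the
  limit, because \<open>f\<close> itself stays within that height.\<close>

lemma ae_limit_continuous_bounded:
 fixes f :: "'a::euclidean_space => real"
 assumes f: "f \<in> borel_measurable lborel" and M: "!!x. \<bar>f x\<bar> <= M"
 obtains g where "!!n::nat. continuous_on UNIV (g n)" "!!n x. \<bar>g n x\<bar> <= M"
  "AE x in lborel. (%n. g n x) \<longlonglongrightarrow> f x"
proof -
 have "f \<in> borel_measurable lebesgue"
  using f by (simp add: measurable_completion)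
 then have "f measurable_on UNIV"
  by (intro lebesgue_measurable_imp_measurable_on) auto
 then obtain N g where N: "negligible N" and g: "!!n. continuous_on UNIV (g n)"
  and lim: "!!x. x \<notin> N ==> (%n. g n x) \<longlonglongrightarrow> f x"
  by (auto simp: measurable_on_def)
 have M0: "0 <= M" using M[of 0] by linarith
 let ?h = "%n x. max (-M) (min M (g n x))"
 show ?thesis
 proof (rule that[of ?h])
  show "continuous_on UNIV (?h n)" for n
   by (intro continuous_intros g)
  show "\<bar>?h n x\<bar> <= M" for n x using M0 by auto
  have "(%n. ?h n x) \<longlonglongrightarrow> f x" if "x \<notin> N" for x
  proof -
   have "(%n. ?h n x) \<longlonglongrightarrow> max (-M) (min M (f x))"
    by (intro tendsto_max tendsto_min tendsto_const lim that)
   moreover have "max (-M) (min M (f x)) = f x"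
    using M[of x] by (auto simp: abs_le_iff max_def min_def)
   ultimately show ?thesis by simp
  qed
  moreover have "AE x in lebesgue. x \<notin> N"
   using N by (simp add: negligible_iff_null_sets AE_not_in)
  ultimately have "AE x in lebesgue. (%n. ?h n x) \<longlonglongrightarrow> f x"
   by (auto elim: eventually_mono)
  then show "AE x in lborel. (%n. ?h n x) \<longlonglongrightarrow> f x"
   by (simp add: AE_completion_iff)
 qed
qed

text \<open>A bound of the pairing with smooth functions by their L2 norm is a bound of the L2 norm
  of \<open>w\<close>. It is extended from \<open>box_bump\<close> times polynomials to
  \<open>box_bump\<close> times bounded Borel functions, and then tested with \<open>w\<close>
  itself on sets where \<open>w\<close> is bounded. The case \<open>\<omega> = 0\<close> is the
  fundamental lemma of the calculus of variations.\<close>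

lemma test_duality_bound:
 fixes w :: "real^2 => real"
 assumes w: "integrable lborel w" and \<omega>: "\<omega> >= 0"
  and bd: "!!\<phi>. (!!k. C_k k \<phi>) ==> (!!x. x \<notin> box a b ==> \<phi> x = 0) ==>
   \<bar>\<integral>x. w x * \<phi> x \<partial>lborel\<bar> <= \<omega> * sqrt (\<integral>x. (\<phi> x)\<^sup>2 \<partial>lborel)"
 shows "(\<integral>\<^sup>+x. ennreal ((w x)\<^sup>2) * indicator (box a b) x \<partial>lborel) <= ennreal (\<omega>\<^sup>2)"
proof -
 let ?b = "box_bump a b"
 have [measurable]: "?b \<in> borel_measurable borel"
  by (rule C_k_imp_borel_measurable[OF C_k_box_bump[of 0]])
 have [measurable]: "w \<in> borel_measurable borel" using w by auto
 have [measurable]: "box a b \<in> sets borel" "cbox a b \<in> sets borel" by auto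
 have bsupp: "?b x = indicator (box a b) x * ?b x" for x
  by (auto simp: indicator_def box_bump_eq_0)
 have fin: "integrable lborel (%x. indicator (box a b) x * c)" for c :: real
  by (intro integrable_mult_left integrable_real_indicator) (auto simp: emeasure_lborel_box_eq)
 \<comment> \<open>The inequality survives bounded almost everywhere convergence of the factor
   beside the bump: the left side is dominated by a multiple of \<open>w\<close>, the right side by
   a constant on the box.\<close>
 have lim: "\<bar>\<integral>x. w x * (?b x * f x) \<partial>lborel\<bar> <= \<omega> * sqrt (\<integral>x. (?b x * f x)\<^sup>2 \<partial>lborel)"
  if g: "!!n::nat. \<bar>\<integral>x. w x * (?b x * g n x) \<partial>lborel\<bar> <= \<omega> * sqrt (\<integral>x. (?b x * g n x)\<^sup>2 \<partial>lborel)"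
   and [measurable]: "f \<in> borel_measurable borel" "!!n. g n \<in> borel_measurable borel"
   and M: "!!n x. x \<in> box a b ==> \<bar>g n x\<bar> <= M"
   and ae: "AE x in lborel. x \<in> box a b --> (%n. g n x) \<longlonglongrightarrow> f x"
  for f g M
 proof (rule LIMSEQ_le)
  have le: "\<bar>?b x * g n x\<bar> <= indicator (box a b) x * M" for n x
   using M[of x n] box_bump_bounds[of a b x] mult_mono[of "?b x" 1 "\<bar>g n x\<bar>" M]
   by (auto simp: indicator_def box_bump_eq_0 abs_mult)
  have conv: "AE x in lborel. (%n. ?b x * g n x) \<longlonglongrightarrow> ?b x * f x"
   using ae
  proof eventually_elim
   case (elim x)
   then show ?case
    using tendsto_mult_left[of "%n. g n x" "f x" sequentially "?b x"]
    by (cases "x \<in> box a b") (simp_all add: box_bump_eq_0)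
  qed
  have "(%n. \<integral>x. w x * (?b x * g n x) \<partial>lborel) \<longlonglongrightarrow> (\<integral>x. w x * (?b x * f x) \<partial>lborel)"
  proof (rule integral_dominated_convergence[where w = "%x. \<bar>w x\<bar> * \<bar>M\<bar>"])
   show "integrable lborel (%x. \<bar>w x\<bar> * \<bar>M\<bar>)"
    using w by simp
   show "AE x in lborel. (%n. w x * (?b x * g n x)) \<longlonglongrightarrow> w x * (?b x * f x)"
    using conv by eventually_elim (rule tendsto_mult[OF tendsto_const])
   show "AE x in lborel. norm (w x * (?b x * g n x)) <= \<bar>w x\<bar> * \<bar>M\<bar>" for n
   proof (rule AE_I2)
    fix x
    have "\<bar>?b x * g n x\<bar> <= \<bar>M\<bar>"
     using le[of x n] by (cases "x \<in> box a b") auto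
    then show "norm (w x * (?b x * g n x)) <= \<bar>w x\<bar> * \<bar>M\<bar>"
     unfolding abs_mult real_norm_def by (intro mult_left_mono) auto
   qed
  qed auto
  then show "(%n. \<bar>\<integral>x. w x * (?b x * g n x) \<partial>lborel\<bar>) \<longlonglongrightarrow> \<bar>\<integral>x. w x * (?b x * f x) \<partial>lborel\<bar>"
   by (rule tendsto_rabs)
  have "(%n. \<integral>x. (?b x * g n x)\<^sup>2 \<partial>lborel) \<longlonglongrightarrow> (\<integral>x. (?b x * f x)\<^sup>2 \<partial>lborel)"
  proof (rule integral_dominated_convergence[where w = "%x. indicator (box a b) x * M\<^sup>2"])
   show "integrable lborel (%x. indicator (box a b) x * M\<^sup>2 :: real)" by (rule fin)
   show "AE x in lborel. (%n. (?b x * g n x)\<^sup>2) \<longlonglongrightarrow> (?b x * f x)\<^sup>2"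
    using conv by eventually_elim (intro tendsto_power)
   show "AE x in lborel. norm ((?b x * g n x)\<^sup>2) <= indicator (box a b) x * M\<^sup>2" for n
   proof (rule AE_I2)
    fix x
    have "(?b x * g n x)\<^sup>2 <= (indicator (box a b) x * M)\<^sup>2"
     using le[of x n] by (rule power2_le_iff_abs_le[THEN iffD2, rotated]) (use le[of x n] in linarith)
    then show "norm ((?b x * g n x)\<^sup>2) <= indicator (box a b) x * M\<^sup>2"
     by (auto simp: indicator_def power_mult_distrib split: if_splits)
   qed
  qed auto
  then show "(%n. \<omega> * sqrt (\<integral>x. (?b x * g n x)\<^sup>2 \<partial>lborel)) \<longlonglongrightarrow> \<omega> * sqrt (\<integral>x. (?b x * f x)\<^sup>2 \<partial>lborel)"
   by (intro tendsto_mult tendsto_const tendsto_real_sqrt)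
  show "\<exists>N. \<forall>n\<ge>N. \<bar>\<integral>x. w x * (?b x * g n x) \<partial>lborel\<bar> <= \<omega> * sqrt (\<integral>x. (?b x * g n x)\<^sup>2 \<partial>lborel)"
   using g by auto
 qed
 \<comment> \<open>Polynomials are admissible once multiplied by the bump, and they approximate
   \<open>g\<close> uniformly on the closed box.\<close>
 have cont: "\<bar>\<integral>x. w x * (?b x * g x) \<partial>lborel\<bar> <= \<omega> * sqrt (\<integral>x. (?b x * g x)\<^sup>2 \<partial>lborel)"
  if g: "continuous_on UNIV g" for g
 proof -
  have gc: "continuous_on (cbox a b) g" using g continuous_on_subset by blast
  have "\<exists>p. real_polynomial_function p \<and> (\<forall>x\<in>cbox a b. \<bar>g x - p x\<bar> < inverse (real (Suc n)))" for n
   using Stone_Weierstrass_real_polynomial_function[OF compact_cbox gc, of "inverse (real (Suc n))"]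
   by (metis inverse_positive_iff_positive of_nat_0_less_iff zero_less_Suc)
  then obtain p where p: "!!n. real_polynomial_function (p n)"
   and pg: "!!n x. x \<in> cbox a b ==> \<bar>g x - p n x\<bar> < inverse (real (Suc n))" by metis
  obtain B where B: "!!x. x \<in> cbox a b ==> \<bar>g x\<bar> <= B"
   using compact_imp_bounded[OF compact_continuous_image[OF gc compact_cbox]]
   by (auto simp: bounded_iff)
  show ?thesis
  proof (rule lim[of p])
   show "\<bar>\<integral>x. w x * (?b x * p n x) \<partial>lborel\<bar> <= \<omega> * sqrt (\<integral>x. (?b x * p n x)\<^sup>2 \<partial>lborel)" for n
    by (rule bd) (auto simp: box_bump_eq_0 intro: C_k_mult C_k_box_bump C_k_real_polynomial_function p)
   show "g \<in> borel_measurable borel" using g by (rule borel_measurable_continuous_onI)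
   show "p n \<in> borel_measurable borel" for n
    by (rule C_k_imp_borel_measurable[of 0]) (rule C_k_real_polynomial_function[OF p])
   show "\<bar>p n x\<bar> <= B + 1" if "x \<in> box a b" for n x
   proof -
    have "x \<in> cbox a b" using that box_subset_cbox by blast
    moreover have "inverse (real (Suc n)) <= 1" by (simp add: field_simps)
    ultimately show ?thesis using B[of x] pg[of x n] by linarith
   qed
   have "(%n. p n x) \<longlonglongrightarrow> g x" if "x \<in> box a b" for x
   proof -
    have "x \<in> cbox a b" using that box_subset_cbox by blast
    then have "!!n. norm (p n x - g x) <= inverse (real (Suc n))"
     using pg[of x] by (simp add: abs_minus_commute less_imp_le)
    then have "(%n. p n x - g x) \<longlonglongrightarrow> 0"
     by (intro Lim_null_comparison[OF always_eventually LIMSEQ_inverse_real_of_nat]) auto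
    then show ?thesis by (simp add: LIM_zero_iff)
   qed
   then show "AE x in lborel. x \<in> box a b --> (%n. p n x) \<longlonglongrightarrow> g x" by auto
  qed
 qed
 have bounded: "\<bar>\<integral>x. w x * (?b x * f x) \<partial>lborel\<bar> <= \<omega> * sqrt (\<integral>x. (?b x * f x)\<^sup>2 \<partial>lborel)"
  if f: "f \<in> borel_measurable borel" "!!x. \<bar>f x\<bar> <= M" for f M
 proof -
  obtain g where g: "!!n::nat. continuous_on UNIV (g n)" "!!n x. \<bar>g n x\<bar> <= M"
    "AE x in lborel. (%n. g n x) \<longlonglongrightarrow> f x"
   using ae_limit_continuous_bounded[of f M] f by auto
  show ?thesis
   by (rule lim[of g f M])
    (use g f cont in \<open>auto intro: borel_measurable_continuous_onI elim: eventually_mono\<close>)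
 qed
 \<comment> \<open>On \<open>S n\<close> the quotient of \<open>w\<close> by the bump is bounded by
   n^2, so it is an admissible factor, and its product with the bump is \<open>w\<close> cut off to
   \<open>S n\<close>. The sets increase to the open box.\<close>
 define S where "S n = {x. \<bar>w x\<bar> <= real n \<and> 1 <= real n * ?b x}" for n
 have [measurable]: "S n \<in> sets borel" for n unfolding S_def by measurable
 have Sbox: "S n \<subseteq> box a b" for n
  using box_bump_eq_0 unfolding S_def by fastforce
 have step: "(\<integral>\<^sup>+x. ennreal ((w x)\<^sup>2) * indicator (S n) x \<partial>lborel) <= ennreal (\<omega>\<^sup>2)" for n
 proof -
  define f where "f x = (if x \<in> S n then w x / ?b x else 0)" for x
  have [measurable]: "f \<in> borel_measurable borel" unfolding f_def by measurable
  have fbd: "\<bar>f x\<bar> <= real n * real n" for x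
  proof (cases "x \<in> S n")
   case True
   then have "?b x > 0" using Sbox box_bump_pos by blast
   moreover have "\<bar>w x\<bar> * 1 <= real n * (real n * ?b x)"
    using True unfolding S_def by (intro mult_mono) auto
   ultimately have "\<bar>w x\<bar> / ?b x <= real n * real n"
    by (subst pos_divide_le_eq) (simp_all add: mult.assoc)
   with \<open>?b x > 0\<close> show ?thesis using True by (simp add: f_def)
  qed (simp add: f_def)
  have "f \<in> borel_measurable borel" by measurable
  note b = bounded[OF this fbd]
  have fb: "?b x * f x = indicator (S n) x * w x" for x
   using Sbox[of n] box_bump_pos[of x a b] by (auto simp: f_def indicator_def)
  have wf: "w x * (indicator (S n) x * w x) = indicator (S n) x * (w x)\<^sup>2"
    "(indicator (S n) x * w x)\<^sup>2 = indicator (S n) x * (w x)\<^sup>2" for x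
   by (auto simp: indicator_def power2_eq_square)
  define I where "I = (\<integral>x. indicator (S n) x * (w x)\<^sup>2 \<partial>lborel)"
  have int: "integrable lborel (%x. indicator (S n) x * (w x)\<^sup>2)"
  proof (rule Bochner_Integration.integrable_bound[OF fin[of "(real n)\<^sup>2"]])
   show "AE x in lborel. norm (indicator (S n) x * (w x)\<^sup>2) <= norm (indicator (box a b) x * (real n)\<^sup>2 :: real)"
    using Sbox by (auto simp: indicator_def S_def intro!: power2_le_iff_abs_le[THEN iffD2])
  qed measurable
  have I0: "I >= 0" unfolding I_def by (intro integral_nonneg_AE) auto
  have "I <= \<omega> * sqrt I"
   using b I0 by (simp add: fb wf I_def[symmetric])
  then have "I <= \<omega>\<^sup>2"
  proof -
   have "sqrt I * sqrt I <= \<omega> * sqrt I" using \<open>I <= \<omega> * sqrt I\<close> I0 by simp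
   then have "sqrt I <= \<omega>"
   proof (cases "I = 0")
    case False
    with I0 have "0 < sqrt I" by simp
    with \<open>sqrt I * sqrt I <= \<omega> * sqrt I\<close> show ?thesis by (rule mult_right_le_imp_le)
   qed (use \<omega> in simp)
   then have "(sqrt I)\<^sup>2 <= \<omega>\<^sup>2" using I0 by (intro power_mono) auto
   then show ?thesis using I0 by simp
  qed
  moreover have "(\<integral>\<^sup>+x. ennreal ((w x)\<^sup>2) * indicator (S n) x \<partial>lborel) = ennreal I"
   unfolding I_def
   by (subst nn_integral_eq_integral[OF int, symmetric])
    (auto intro!: nn_integral_cong simp: indicator_def)
  ultimately show ?thesis by (simp add: ennreal_leI)
 qed
 have "(\<integral>\<^sup>+x. ennreal ((w x)\<^sup>2) * indicator (box a b) x \<partial>lborel)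
   = (\<integral>\<^sup>+x. (SUP n. ennreal ((w x)\<^sup>2) * indicator (S n) x) \<partial>lborel)"
 proof (intro nn_integral_cong antisym)
  fix x
  show "(SUP n. ennreal ((w x)\<^sup>2) * indicator (S n) x) <= ennreal ((w x)\<^sup>2) * indicator (box a b) x"
  proof (rule SUP_least)
   fix n
   show "ennreal ((w x)\<^sup>2) * indicator (S n) x <= ennreal ((w x)\<^sup>2) * indicator (box a b) x"
    using Sbox[of n] by (auto simp: indicator_def)
  qed
  show "ennreal ((w x)\<^sup>2) * indicator (box a b) x <= (SUP n. ennreal ((w x)\<^sup>2) * indicator (S n) x)"
  proof (cases "x \<in> box a b")
   case True
   then have pos: "?b x > 0" by (rule box_bump_pos)
   obtain n where n: "real n >= max \<bar>w x\<bar> (1 / ?b x)" using real_arch_simple by blast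
   then have "x \<in> S n" using pos by (auto simp: S_def field_simps)
   then show ?thesis using True by (intro SUP_upper2[of n]) auto
  qed simp
 qed
 also have "\<dots> = (SUP n. \<integral>\<^sup>+x. ennreal ((w x)\<^sup>2) * indicator (S n) x \<partial>lborel)"
 proof (rule nn_integral_monotone_convergence_SUP)
  have "S n \<subseteq> S (Suc n)" for n
   using box_bump_bounds[of a b] by (auto simp: S_def distrib_right intro: add_increasing)
  then have "incseq S" by (rule incseq_SucI)
  then show "incseq (%n x. ennreal ((w x)\<^sup>2) * indicator (S n) x)"
   by (auto simp: incseq_def le_fun_def indicator_def)
 qed measurable
 also have "\<dots> <= ennreal (\<omega>\<^sup>2)"
  by (intro SUP_least step)
 finally show ?thesis .
qed

section \<open>Continuity of translations in L1 and L2, and products of square integrable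
  functions\<close>

section \<open>Translations in Lebesgue spaces\<close>

lemma borel_measurable_translate [measurable]:
 fixes f :: "'a::euclidean_space => real"
 assumes [measurable]: "f \<in> borel_measurable borel"
 shows "(%x. f (x + c)) \<in> borel_measurable borel"
 by measurable

lemma integral_translate:
 fixes f :: "'a::euclidean_space => real"
 assumes [measurable]: "f \<in> borel_measurable borel"
 shows "(\<integral>x. f (x + c) \<partial>lborel) = (\<integral>x. f x \<partial>lborel)"
proof -
 have "(\<integral>x. f x \<partial>lborel) = (\<integral>x. f x \<partial>distr lborel borel ((+) c))"
  by (simp add: lborel_distr_plus)
 also have "\<dots> = (\<integral>x. f (c + x) \<partial>lborel)"
  by (rule integral_distr) auto
 finally show ?thesis by (simp add: add.commute)
qed

lemma nn_integral_translate:
 fixes f :: "'a::euclidean_space => ennreal"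
 assumes [measurable]: "f \<in> borel_measurable borel"
 shows "(\<integral>\<^sup>+x. f (x + c) \<partial>lborel) = (\<integral>\<^sup>+x. f x \<partial>lborel)"
proof -
 have "(\<integral>\<^sup>+x. f x \<partial>lborel) = (\<integral>\<^sup>+x. f x \<partial>distr lborel borel ((+) c))"
  by (simp add: lborel_distr_plus)
 also have "\<dots> = (\<integral>\<^sup>+x. f (c + x) \<partial>lborel)"
  by (rule nn_integral_distr) auto
 finally show ?thesis by (simp add: add.commute)
qed

lemma integrable_translate:
 fixes f :: "'a::euclidean_space => real"
 assumes "integrable lborel f"
 shows "integrable lborel (%x. f (x + c))"
proof -
 have "integrable (distr lborel borel ((+) c)) f"
  using assms by (simp add: lborel_distr_plus)
 then have "integrable lborel (%x. f (c + x))"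
  by (subst (asm) integrable_distr_eq) (use assms in auto)
 then show ?thesis by (simp add: add.commute)
qed

lemma integrable_indicator_cball:
 "integrable lborel (%x::'a::euclidean_space. indicator (cball a r) x * c :: real)"
proof -
 have "emeasure lborel (cball a r) < \<infinity>"
  by (intro emeasure_bounded_finite) auto
 then show ?thesis
  by (intro integrable_mult_left integrable_real_indicator) auto
qed

lemma L1_approx_continuous:
 fixes f :: "'a::euclidean_space => real"
 assumes f: "integrable lborel f" and e: "e > 0"
 obtains g R where "continuous_on UNIV g" "!!x. x \<notin> cball 0 R ==> g x = 0" "integrable lborel g"
  "(\<integral>x. \<bar>f x - g x\<bar> \<partial>lborel) < e"
proof -
 have [measurable]: "f \<in> borel_measurable borel" using f by auto
 define t where "t n x = indicator (cball 0 (real n)) x * max (- real n) (min (real n) (f x))" for n x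
 have tm [measurable]: "t n \<in> borel_measurable borel" for n
  unfolding t_def
  by (intro borel_measurable_times borel_measurable_indicator borel_measurable_max
    borel_measurable_min borel_measurable_const) auto
 have "(%n. \<integral>x. \<bar>f x - t n x\<bar> \<partial>lborel) \<longlonglongrightarrow> (\<integral>x. 0 \<partial>(lborel :: 'a measure))"
 proof (rule integral_dominated_convergence[where w = "%x. \<bar>f x\<bar>"])
  show "AE x in lborel. (%n. \<bar>f x - t n x\<bar>) \<longlonglongrightarrow> 0"
  proof (rule AE_I2)
   fix x
   obtain m where m: "real m >= max (norm x) \<bar>f x\<bar>" using real_arch_simple by blast
   have "\<bar>f x - t n x\<bar> = 0" if "n >= m" for n
   proof -
    have "real n >= real m" using that by simp
    then have "norm x <= real n" "\<bar>f x\<bar> <= real n" using m by auto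
    then show ?thesis by (auto simp: t_def indicator_def)
   qed
   then have "\<forall>\<^sub>F n in sequentially. \<bar>f x - t n x\<bar> = 0"
    by (auto simp: eventually_sequentially)
   then show "(%n. \<bar>f x - t n x\<bar>) \<longlonglongrightarrow> 0"
    by (rule tendsto_eventually)
  qed
  show "AE x in lborel. norm \<bar>f x - t n x\<bar> <= \<bar>f x\<bar>" for n
   by (auto simp: t_def indicator_def)
 qed (use f in auto)
 then have "\<forall>\<^sub>F n in sequentially. (\<integral>x. \<bar>f x - t n x\<bar> \<partial>lborel) < e/2"
  using e by (intro order_tendstoD) auto
 then obtain n where n: "(\<integral>x. \<bar>f x - t n x\<bar> \<partial>lborel) < e/2"
  by (auto simp: eventually_sequentially)
 have "\<bar>t n x\<bar> <= real n" for x by (auto simp: t_def indicator_def)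
 then obtain g where g: "!!m::nat. continuous_on UNIV (g m)" "!!m x. \<bar>g m x\<bar> <= real n"
  "AE x in lborel. (%m. g m x) \<longlonglongrightarrow> t n x"
  using ae_limit_continuous_bounded[of "t n" "real n"] by auto
 define k where "k x = max 0 (min 1 (real n + 1 - norm x))" for x :: 'a
 have k: "0 <= k x" "k x <= 1" "x \<notin> cball 0 (real n + 1) ==> k x = 0" "x \<in> cball 0 (real n) ==> k x = 1" for x
  by (auto simp: k_def)
 have kc: "continuous_on UNIV k" unfolding k_def by (intro continuous_intros)
 have [measurable]: "k \<in> borel_measurable borel" "g m \<in> borel_measurable borel" for m
  using kc g(1) by (auto intro: borel_measurable_continuous_onI)
 have gk: "\<bar>g m x * k x\<bar> <= indicator (cball 0 (real n + 1)) x * real n" for m x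
  using mult_mono[OF g(2)[of m x] k(2)[of x]] k(1,3)[of x] by (cases "x \<in> cball 0 (real n + 1)") (auto simp: abs_mult)
 have tk: "t n x * k x = t n x" for x
  using k(4)[of x] by (auto simp: t_def indicator_def)
 have tn: "\<bar>t n x\<bar> <= indicator (cball 0 (real n + 1)) x * real n" for x
  by (auto simp: t_def indicator_def)
 have int_g: "integrable lborel (%x. g m x * k x)" for m
  by (rule Bochner_Integration.integrable_bound[OF integrable_indicator_cball[of 0 "real n + 1" "real n"]])
   (use gk in \<open>auto simp del: mem_cball intro: order.trans\<close>)
 have int_t: "integrable lborel (t n)"
  by (rule Bochner_Integration.integrable_bound[OF integrable_indicator_cball[of 0 "real n + 1" "real n"]])
   (use tn in \<open>auto simp del: mem_cball intro: order.trans\<close>)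
 have "(%m. \<integral>x. \<bar>t n x - g m x * k x\<bar> \<partial>lborel) \<longlonglongrightarrow> (\<integral>x. 0 \<partial>(lborel :: 'a measure))"
 proof (rule integral_dominated_convergence[where w = "%x. 2 * (indicator (cball 0 (real n + 1)) x * real n)"])
  show "AE x in lborel. (%m. \<bar>t n x - g m x * k x\<bar>) \<longlonglongrightarrow> 0"
   using g(3)
  proof eventually_elim
   case (elim x)
   have "(%m. \<bar>t n x - g m x * k x\<bar>) \<longlonglongrightarrow> \<bar>t n x - t n x * k x\<bar>"
    by (intro tendsto_intros elim)
   then show ?case by (simp add: tk)
  qed
  show "AE x in lborel. norm \<bar>t n x - g m x * k x\<bar> <= 2 * (indicator (cball 0 (real n + 1)) x * real n)" for m
  proof (rule AE_I2)
   fix x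
   show "norm \<bar>t n x - g m x * k x\<bar> <= 2 * (indicator (cball 0 (real n + 1)) x * real n)"
    using gk[of m x] tn[of x] abs_triangle_ineq4[of "t n x" "g m x * k x"] by (simp del: mem_cball)
  qed
 qed (use integrable_indicator_cball in auto)
 then have "\<forall>\<^sub>F m in sequentially. (\<integral>x. \<bar>t n x - g m x * k x\<bar> \<partial>lborel) < e/2"
  using e by (intro order_tendstoD) auto
 then obtain m where m: "(\<integral>x. \<bar>t n x - g m x * k x\<bar> \<partial>lborel) < e/2"
  by (auto simp: eventually_sequentially)
 show ?thesis
 proof (rule that[of "%x. g m x * k x" "real n + 1"])
  show "continuous_on UNIV (%x. g m x * k x)"
   by (intro continuous_intros g kc)
  show "!!x. x \<notin> cball 0 (real n + 1) ==> g m x * k x = 0" using k(3) by simp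
  show "integrable lborel (%x. g m x * k x)" by (rule int_g)
  have "(\<integral>x. \<bar>f x - g m x * k x\<bar> \<partial>lborel) <= (\<integral>x. \<bar>f x - t n x\<bar> + \<bar>t n x - g m x * k x\<bar> \<partial>lborel)"
   using f int_g int_t by (intro integral_mono) auto
  also have "\<dots> = (\<integral>x. \<bar>f x - t n x\<bar> \<partial>lborel) + (\<integral>x. \<bar>t n x - g m x * k x\<bar> \<partial>lborel)"
   using f int_g int_t by (intro Bochner_Integration.integral_add) auto
  finally show "(\<integral>x. \<bar>f x - g m x * k x\<bar> \<partial>lborel) < e" using n m by simp
 qed
qed

lemma L1_translation_continuous:
 fixes f :: "'a::euclidean_space => real"
 assumes f: "integrable lborel f" and e: "e > 0"
 obtains \<delta> where "\<delta> > 0" "!!c. norm c < \<delta> ==> (\<integral>x. \<bar>f (x + c) - f x\<bar> \<partial>lborel) < e"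
proof -
 obtain g R where g: "continuous_on UNIV g" "!!x. x \<notin> cball 0 R ==> g x = 0" "integrable lborel g"
  "(\<integral>x. \<bar>f x - g x\<bar> \<partial>lborel) < e/3"
  using L1_approx_continuous[OF f, of "e/3"] e by auto
 have [measurable]: "f \<in> borel_measurable borel" "g \<in> borel_measurable borel" using f g by auto
 define V where "V = measure lborel (cball (0::'a) (R + 1))"
 define \<eta> where "\<eta> = e / (4 * (V + 1))"
 have "uniformly_continuous_on (cball 0 (R + 2)) g"
  using g(1) by (intro compact_uniformly_continuous) (auto intro: continuous_on_subset)
 moreover have "\<eta> > 0"
  using e by (simp add: V_def \<eta>_def add_nonneg_pos)
 ultimately obtain d where d: "d > 0"
  "!!x y. x \<in> cball 0 (R+2) ==> y \<in> cball 0 (R+2) ==> dist y x < d ==> dist (g y) (g x) < \<eta>"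
  unfolding uniformly_continuous_on_def by metis
 show ?thesis
 proof (rule that[of "min d 1"])
  show "min d 1 > 0" using d by simp
  fix c :: 'a assume c: "norm c < min d 1"
  have pw: "\<bar>g (x + c) - g x\<bar> <= indicator (cball 0 (R + 1)) x * \<eta>" for x
  proof (cases "norm x <= R + 1")
   case True
   have "norm (x + c) <= R + 2" using True c norm_triangle_ineq[of x c] by simp
   then have "dist (g (x + c)) (g x) < \<eta>"
    using True c by (intro d(2)) (auto simp: mem_cball_0 dist_norm simp del: mem_cball)
   then show ?thesis using True by (simp add: dist_real_def)
  next
   case False
   have "norm x <= norm (x + c) + norm c" using norm_triangle_ineq4[of "x + c" c] by simp
   then have "norm (x + c) > R" using False c by simp
   then show ?thesis using False g(2)[of x] g(2)[of "x + c"] by simp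
  qed
  have ig: "integrable lborel (%x. g (x + c))" "integrable lborel (%x. f (x + c))"
   using integrable_translate f g(3) by auto
  have "(\<integral>x. \<bar>g (x + c) - g x\<bar> \<partial>lborel) <= (\<integral>x. indicator (cball 0 (R + 1)) x * \<eta> \<partial>(lborel :: 'a measure))"
   using ig g(3) pw integrable_indicator_cball by (intro integral_mono) auto
  also have "\<dots> = V * \<eta>"
   by (simp add: V_def)
  also have "\<dots> < e/3"
  proof -
   have V0: "V >= 0" by (simp add: V_def)
   have "V * \<eta> <= (V + 1) * \<eta>"
    using e V0 by (intro mult_right_mono) (auto simp: \<eta>_def)
   also have "\<dots> = e/4" using V0 by (simp add: \<eta>_def field_simps)
   finally show ?thesis using e by simp
  qed
  finally have 2: "(\<integral>x. \<bar>g (x + c) - g x\<bar> \<partial>lborel) < e/3" .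
  have 1: "(\<integral>x. \<bar>f (x + c) - g (x + c)\<bar> \<partial>lborel) < e/3"
   using g(4) integral_translate[of "%x. \<bar>f x - g x\<bar>" c] by simp
  have "(\<integral>x. \<bar>f (x + c) - f x\<bar> \<partial>lborel)
   <= (\<integral>x. \<bar>f (x + c) - g (x + c)\<bar> + (\<bar>g (x + c) - g x\<bar> + \<bar>f x - g x\<bar>) \<partial>lborel)"
   using ig f g(3) by (intro integral_mono) auto
  also have "\<dots> = (\<integral>x. \<bar>f (x + c) - g (x + c)\<bar> \<partial>lborel) + ((\<integral>x. \<bar>g (x + c) - g x\<bar> \<partial>lborel) + (\<integral>x. \<bar>f x - g x\<bar> \<partial>lborel))"
   using ig f g(3) by simp
  finally show "(\<integral>x. \<bar>f (x + c) - f x\<bar> \<partial>lborel) < e"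
   using 1 2 g(4) by linarith
 qed
qed

text \<open>The signed square t|t| maps L2 functions to L1 functions. This inequality brings the
  continuity of translations back from L1 to L2 without a second approximation argument.\<close>

lemma sq_diff_le_diff_signed_squares: "(a - b)\<^sup>2 <= 2 * \<bar>a * \<bar>a\<bar> - b * \<bar>b\<bar>\<bar>" for a b :: real
proof -
 have *: "(a - b)\<^sup>2 <= 2 * \<bar>a * \<bar>a\<bar> - b * \<bar>b\<bar>\<bar>" if "b <= a" for a b :: real
 proof -
  consider "0 <= b" | "b < 0" "0 <= a" | "a < 0" using that by linarith
  then show ?thesis
  proof cases
   case 1
   have "0 <= (a - b) * (a + 3 * b)" using 1 that by simp
   then have "(a - b)\<^sup>2 <= 2 * (a * a - b * b)" by (simp add: power2_eq_square algebra_simps)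
   also have "\<dots> = 2 * (a * \<bar>a\<bar> - b * \<bar>b\<bar>)" using 1 that by simp
   also have "\<dots> <= 2 * \<bar>a * \<bar>a\<bar> - b * \<bar>b\<bar>\<bar>" by (intro mult_left_mono abs_ge_self) simp
   finally show ?thesis .
  next
   case 2
   have "0 <= (a + b)\<^sup>2" by simp
   moreover have "a * \<bar>a\<bar> - b * \<bar>b\<bar> = a * a + b * b" using 2 by simp
   ultimately show ?thesis by (simp add: power2_eq_square algebra_simps)
  next
   case 3
   have "0 <= (a - b) * (-3 * a - b)" using 3 that by (intro mult_nonneg_nonneg) auto
   then have "(a - b)\<^sup>2 <= 2 * (b * b - a * a)" by (simp add: power2_eq_square algebra_simps)
   also have "\<dots> = 2 * (a * \<bar>a\<bar> - b * \<bar>b\<bar>)" using 3 that by simp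
   also have "\<dots> <= 2 * \<bar>a * \<bar>a\<bar> - b * \<bar>b\<bar>\<bar>" by (intro mult_left_mono abs_ge_self) simp
   finally show ?thesis .
  qed
 qed
 show ?thesis
  using *[of b a] *[of a b] by (cases "b <= a") (auto simp: power2_commute abs_minus_commute)
qed

lemma L2_translation_continuous:
 fixes f :: "'a::euclidean_space => real"
 assumes [measurable]: "f \<in> borel_measurable borel" and f2: "integrable lborel (%x. (f x)\<^sup>2)" and e: "e > 0"
 obtains \<delta> where "\<delta> > 0" "!!c. norm c < \<delta> ==> (\<integral>x. (f (x + c) - f x)\<^sup>2 \<partial>lborel) < e"
proof -
 let ?g = "%x. f x * \<bar>f x\<bar>"
 have g: "integrable lborel ?g"
  by (rule Bochner_Integration.integrable_bound[OF f2]) (auto simp: abs_mult power2_eq_square)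
 obtain \<delta> where \<delta>: "\<delta> > 0" "!!c. norm c < \<delta> ==> (\<integral>x. \<bar>?g (x + c) - ?g x\<bar> \<partial>lborel) < e/2"
  using L1_translation_continuous[OF g, of "e/2"] e by auto
 show ?thesis
 proof (rule that[OF \<delta>(1)])
  fix c :: 'a assume "norm c < \<delta>"
  have "(\<integral>x. (f (x + c) - f x)\<^sup>2 \<partial>lborel) <= (\<integral>x. 2 * \<bar>?g (x + c) - ?g x\<bar> \<partial>lborel)"
   using g integrable_translate[OF g, of c] by (intro integral_mono_AE') (auto intro: sq_diff_le_diff_signed_squares)
  also have "\<dots> < e" using \<delta>(2)[OF \<open>norm c < \<delta>\<close>] by simp
  finally show "(\<integral>x. (f (x + c) - f x)\<^sup>2 \<partial>lborel) < e" .
 qed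
qed

lemma integrable_mult_squares:
 fixes f g :: "'a => real"
 assumes [measurable]: "f \<in> borel_measurable M" "g \<in> borel_measurable M"
  and "integrable M (%x. (f x)\<^sup>2)" "integrable M (%x. (g x)\<^sup>2)"
 shows "integrable M (%x. f x * g x)"
proof (rule Bochner_Integration.integrable_bound)
 show "integrable M (%x. (f x)\<^sup>2 + (g x)\<^sup>2)" using assms by simp
 show "AE x in M. norm (f x * g x) <= norm ((f x)\<^sup>2 + (g x)\<^sup>2)"
 proof (rule AE_I2)
  fix x
  have "2 * \<bar>f x * g x\<bar> <= (f x)\<^sup>2 + (g x)\<^sup>2"
   using sum_squares_bound[of "\<bar>f x\<bar>" "\<bar>g x\<bar>"] by (simp add: abs_mult)
  then show "norm (f x * g x) <= norm ((f x)\<^sup>2 + (g x)\<^sup>2)" by simp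
 qed
qed simp

lemma integrable_add_squares:
 fixes f g :: "'a => real"
 assumes [measurable]: "f \<in> borel_measurable M" "g \<in> borel_measurable M"
  and "integrable M (%x. (f x)\<^sup>2)" "integrable M (%x. (g x)\<^sup>2)"
 shows "integrable M (%x. (f x + g x)\<^sup>2)" "integrable M (%x. (f x - g x)\<^sup>2)"
 using assms integrable_mult_squares[OF assms] by (auto simp: power2_sum power2_diff mult.assoc)

lemma Cauchy_Schwarz_integral:
 fixes f g :: "'a => real"
 assumes [measurable]: "f \<in> borel_measurable M" "g \<in> borel_measurable M"
  and f2: "integrable M (%x. (f x)\<^sup>2)" and g2: "integrable M (%x. (g x)\<^sup>2)"
 shows "\<bar>\<integral>x. f x * g x \<partial>M\<bar> <= sqrt (\<integral>x. (f x)\<^sup>2 \<partial>M) * sqrt (\<integral>x. (g x)\<^sup>2 \<partial>M)"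
proof -
 define A B C where "A = (\<integral>x. (f x)\<^sup>2 \<partial>M)" and "B = (\<integral>x. (g x)\<^sup>2 \<partial>M)" and "C = (\<integral>x. \<bar>f x\<bar> * \<bar>g x\<bar> \<partial>M)"
 have fg: "integrable M (%x. \<bar>f x\<bar> * \<bar>g x\<bar>)"
  using integrable_mult_squares[OF assms] by (simp add: abs_mult[symmetric])
 have nn: "A >= 0" "B >= 0" "C >= 0" by (auto simp: A_def B_def C_def)
 have "(\<integral>\<^sup>+x. ennreal \<bar>f x\<bar> * ennreal \<bar>g x\<bar> \<partial>M)\<^sup>2 <= (\<integral>\<^sup>+x. (ennreal \<bar>f x\<bar>)\<^sup>2 \<partial>M) * (\<integral>\<^sup>+x. (ennreal \<bar>g x\<bar>)\<^sup>2 \<partial>M)"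
  by (rule Cauchy_Schwarz_nn_integral) auto
 also have "(\<integral>\<^sup>+x. ennreal \<bar>f x\<bar> * ennreal \<bar>g x\<bar> \<partial>M) = ennreal C"
  unfolding C_def using fg by (subst nn_integral_eq_integral[symmetric]) (auto simp: ennreal_mult)
 also have "(\<integral>\<^sup>+x. (ennreal \<bar>f x\<bar>)\<^sup>2 \<partial>M) = ennreal A"
  unfolding A_def using f2 by (subst nn_integral_eq_integral[symmetric]) (auto simp: ennreal_power)
 also have "(\<integral>\<^sup>+x. (ennreal \<bar>g x\<bar>)\<^sup>2 \<partial>M) = ennreal B"
  unfolding B_def using g2 by (subst nn_integral_eq_integral[symmetric]) (auto simp: ennreal_power)
 finally have "C\<^sup>2 <= A * B"
  using nn by (simp add: ennreal_power ennreal_mult[symmetric])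
 then have "C <= sqrt A * sqrt B"
  using nn by (simp add: real_le_rsqrt real_sqrt_mult[symmetric])
 moreover have "\<bar>\<integral>x. f x * g x \<partial>M\<bar> <= C"
  unfolding C_def using integral_abs_bound[of M "%x. f x * g x"] by (simp add: abs_mult)
 ultimately show ?thesis by (simp add: A_def B_def)
qed

section \<open>Difference quotients of weakly differentiable functions\<close>

section \<open>Weak derivatives and difference quotients\<close>

text \<open>Tests only have to vanish off the open box; if the closed box lies in \<Omega>, it
  serves as the compact set that \<open>test_fun\<close> asks for. Integrating Borel functions over
  the whole plane lets translations act freely.\<close>

definition weak_deriv_on ::
 "real^2 => real^2 => real^2 => (real^2 => real) => (real^2 => real) => bool" where
 "weak_deriv_on a b e u g \<longleftrightarrow>
  (\<forall>\<phi>. (\<forall>k. C_k k \<phi>) --> (\<forall>x. x \<notin> box a b --> \<phi> x = 0) -->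
    (\<integral>x. u x * frechet_derivative \<phi> (at x) e \<partial>lborel) = - (\<integral>x. g x * \<phi> x \<partial>lborel))"

lemma C_k_1_directional:
 assumes "C_k (Suc 0) \<phi>"
 obtains \<psi> where "!!x. \<psi> x = frechet_derivative \<phi> (at x) e" "continuous_on UNIV \<psi>"
  "!!x t. ((%t. \<phi> (x + t *\<^sub>R e)) has_real_derivative \<psi> (x + t *\<^sub>R e)) (at t)"
proof -
 obtain f' where f': "!!x. (\<phi> has_derivative f' x) (at x)" "!!v. C_k 0 (%x. f' x v)"
  using assms by (rule C_k_SucE) blast
 show ?thesis
 proof (rule that[of "%x. f' x e"])
  show "f' x e = frechet_derivative \<phi> (at x) e" for x
   using frechet_derivative_at[OF f'(1)] by metis
  show "continuous_on UNIV (%x. f' x e)" using f'(2) by simp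
  fix x t
  have "((%t. x + t *\<^sub>R e) has_derivative (%h. h *\<^sub>R e)) (at t)"
   by (auto intro!: derivative_eq_intros)
  then have "((%t. \<phi> (x + t *\<^sub>R e)) has_derivative (%h. f' (x + t *\<^sub>R e) (h *\<^sub>R e))) (at t)"
   by (rule has_derivative_compose[OF _ f'(1)])
  moreover have "f' (x + t *\<^sub>R e) (h *\<^sub>R e) = f' (x + t *\<^sub>R e) e * h" for h
   using linear_cmul[OF has_derivative_linear[OF f'(1)]] by (simp add: mult.commute)
  ultimately show "((%t. \<phi> (x + t *\<^sub>R e)) has_real_derivative f' (x + t *\<^sub>R e) e) (at t)"
   by (simp add: has_field_derivative_def)
 qed
qed

lemma frechet_derivative_eq_0_outside:
 assumes "closed K" "!!x. x \<notin> K ==> \<phi> x = 0" "x \<notin> K"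
 shows "frechet_derivative \<phi> (at x) e = (0::real)"
proof -
 have "((%x. 0) has_derivative (%h. 0)) (at x)" by simp
 then have "(\<phi> has_derivative (%h. 0)) (at x)"
  by (rule has_derivative_transform_within_open[where s = "- K"])
   (use assms in auto)
 then show ?thesis
  using frechet_derivative_at by metis
qed

text \<open>The shifts of a test function give the difference quotients of \<open>u\<close>; the mean value theorem
 in the shift turns them into a single shift of the weak derivative.\<close>

lemma smooth_bounded_derivative:
 fixes \<phi> :: "real^2 => real"
 assumes C: "C_k (Suc 0) \<phi>" and K: "compact K" "!!x. x \<notin> K ==> \<phi> x = 0"
 obtains B where "B >= 0" "!!x. \<bar>frechet_derivative \<phi> (at x) e\<bar> <= B"
  "!!x t. \<bar>\<phi> (x + t *\<^sub>R e) - \<phi> x\<bar> <= B * \<bar>t\<bar>" "!!x. \<bar>\<phi> x\<bar> <= B"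
proof -
 obtain \<psi> where \<psi>: "!!x. \<psi> x = frechet_derivative \<phi> (at x) e" "continuous_on UNIV \<psi>"
  "!!x t. ((%t. \<phi> (x + t *\<^sub>R e)) has_real_derivative \<psi> (x + t *\<^sub>R e)) (at t)"
  using C_k_1_directional[OF C] by blast
 have "bounded (\<psi> ` K)" "bounded (\<phi> ` K)"
  using \<psi>(2) C_k_imp_continuous_on[OF C] K(1)
  by (auto intro!: compact_imp_bounded compact_continuous_image continuous_on_subset[of UNIV])
 then obtain B1 B2 where B: "!!x. x \<in> K ==> \<bar>\<psi> x\<bar> <= B1" "!!x. x \<in> K ==> \<bar>\<phi> x\<bar> <= B2"
  by (auto simp: bounded_iff)
 let ?B = "max 0 (max B1 B2)"
 have \<psi>0: "\<psi> x = 0" if "x \<notin> K" for x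
  using frechet_derivative_eq_0_outside[of K \<phi> x e] K that by (auto simp: \<psi>(1) compact_imp_closed)
 have 1: "\<bar>\<psi> x\<bar> <= ?B" for x
  using B(1)[of x] \<psi>0[of x] by (cases "x \<in> K") auto
 show ?thesis
 proof (rule that[of ?B])
  show "\<bar>frechet_derivative \<phi> (at x) e\<bar> <= ?B" for x using 1[of x] by (simp add: \<psi>(1))
  show "\<bar>\<phi> x\<bar> <= ?B" for x using B(2)[of x] K(2)[of x] by (cases "x \<in> K") auto
  show "\<bar>\<phi> (x + t *\<^sub>R e) - \<phi> x\<bar> <= ?B * \<bar>t\<bar>" for x t
  proof -
   have "norm (\<phi> (x + t *\<^sub>R e) - \<phi> (x + 0 *\<^sub>R e)) <= ?B * norm (t - 0)"
    by (rule field_differentiable_bound[where S = UNIV and f' = "%t. \<psi> (x + t *\<^sub>R e)"])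
     (use \<psi>(3) 1 in auto)
   then show ?thesis by simp
  qed
 qed simp
qed

text \<open>The shift acts on the smooth factor alone, so the pairing is differentiable in
  \<open>s\<close> although \<open>u\<close> is merely integrable. The Lipschitz constant of
  \<open>\<phi>\<close> supplies the dominating function.\<close>

lemma integral_shifted_test_has_derivative:
 fixes u \<phi> :: "real^2 => real"
 assumes u: "integrable lborel u" and C: "C_k (Suc 0) \<phi>" and K: "compact K" "!!x. x \<notin> K ==> \<phi> x = 0"
 shows "((%s. \<integral>x. u x * \<phi> (x - s *\<^sub>R e) \<partial>lborel) has_real_derivative
   - (\<integral>x. u x * frechet_derivative \<phi> (at (x - s *\<^sub>R e)) e \<partial>lborel)) (at s)"
proof -
 obtain \<psi> where \<psi>: "!!x. \<psi> x = frechet_derivative \<phi> (at x) e" "continuous_on UNIV \<psi>"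
  "!!x t. ((%t. \<phi> (x + t *\<^sub>R e)) has_real_derivative \<psi> (x + t *\<^sub>R e)) (at t)"
  using C_k_1_directional[OF C] by blast
 obtain B where B: "B >= 0" "!!x. \<bar>frechet_derivative \<phi> (at x) e\<bar> <= B"
  "!!x t. \<bar>\<phi> (x + t *\<^sub>R e) - \<phi> x\<bar> <= B * \<bar>t\<bar>" "!!x. \<bar>\<phi> x\<bar> <= B"
  using smooth_bounded_derivative[OF C K] by blast
 have [measurable]: "\<phi> \<in> borel_measurable borel" "\<psi> \<in> borel_measurable borel" "u \<in> borel_measurable borel"
  using \<psi>(2) C_k_imp_continuous_on[OF C] u by (auto intro: borel_measurable_continuous_onI)
 let ?F = "%s. \<integral>x. u x * \<phi> (x - s *\<^sub>R e) \<partial>lborel"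
 have int: "integrable lborel (%x. u x * \<phi> (x - s *\<^sub>R e))" for s
  by (rule Bochner_Integration.integrable_bound[where f = "%x. B * u x"])
   (use u B in \<open>auto simp: abs_mult mult.commute[of "\<bar>u _\<bar>"] intro!: mult_right_mono\<close>)
 have "((%h. (?F (s + h) - ?F s) / h) \<longlongrightarrow> - (\<integral>x. u x * \<psi> (x - s *\<^sub>R e) \<partial>lborel)) (at 0)"
  unfolding tendsto_at_iff_sequentially comp_def
 proof (intro allI impI)
  fix h :: "nat => real" assume h: "\<forall>n. h n \<in> UNIV - {0}" "h \<longlonglongrightarrow> 0"
  have eq: "(?F (s + h n) - ?F s) / h n = (\<integral>x. u x * ((\<phi> (x - (s + h n) *\<^sub>R e) - \<phi> (x - s *\<^sub>R e)) / h n) \<partial>lborel)" for n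
  proof -
   have "?F (s + h n) - ?F s = (\<integral>x. u x * \<phi> (x - (s + h n) *\<^sub>R e) - u x * \<phi> (x - s *\<^sub>R e) \<partial>lborel)"
    by (rule Bochner_Integration.integral_diff[symmetric]) (rule int)+
   then have "(?F (s + h n) - ?F s) / h n
     = (\<integral>x. (u x * \<phi> (x - (s + h n) *\<^sub>R e) - u x * \<phi> (x - s *\<^sub>R e)) / h n \<partial>lborel)"
    by simp
   then show ?thesis by (simp add: algebra_simps)
  qed
  have "(%n. \<integral>x. u x * ((\<phi> (x - (s + h n) *\<^sub>R e) - \<phi> (x - s *\<^sub>R e)) / h n) \<partial>lborel)
   \<longlonglongrightarrow> (\<integral>x. u x * (- \<psi> (x - s *\<^sub>R e)) \<partial>lborel)"
  proof (rule integral_dominated_convergence[where w = "%x. \<bar>u x\<bar> * B"])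
   show "AE x in lborel. (%n. u x * ((\<phi> (x - (s + h n) *\<^sub>R e) - \<phi> (x - s *\<^sub>R e)) / h n)) \<longlonglongrightarrow> u x * (- \<psi> (x - s *\<^sub>R e))"
   proof (rule AE_I2)
    fix x
    let ?y = "x - s *\<^sub>R e"
    have "((%t. (\<phi> (?y + t *\<^sub>R e) - \<phi> ?y) / t) \<longlongrightarrow> \<psi> ?y) (at 0)"
     using \<psi>(3)[of ?y 0] by (simp add: has_field_derivative_iff)
    moreover have "filterlim (%n. - h n) (at 0) sequentially"
     using h tendsto_minus[OF h(2)] by (auto simp: filterlim_at)
    ultimately have "(%n. (\<phi> (?y + (- h n) *\<^sub>R e) - \<phi> ?y) / (- h n)) \<longlonglongrightarrow> \<psi> ?y"
     by (rule filterlim_compose)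
    then have "(%n. - ((\<phi> (?y + (- h n) *\<^sub>R e) - \<phi> ?y) / (- h n))) \<longlonglongrightarrow> - \<psi> ?y"
     by (rule tendsto_minus)
    moreover have eq: "?y + (- h n) *\<^sub>R e = x - (s + h n) *\<^sub>R e" for n
     by (simp add: algebra_simps)
    ultimately have "(%n. (\<phi> (x - (s + h n) *\<^sub>R e) - \<phi> ?y) / h n) \<longlonglongrightarrow> - \<psi> ?y"
     by (simp only: eq divide_minus_right minus_minus)
    then show "(%n. u x * ((\<phi> (x - (s + h n) *\<^sub>R e) - \<phi> (x - s *\<^sub>R e)) / h n)) \<longlonglongrightarrow> u x * (- \<psi> (x - s *\<^sub>R e))"
     by (rule tendsto_mult_left)
   qed
   show "AE x in lborel. norm (u x * ((\<phi> (x - (s + h n) *\<^sub>R e) - \<phi> (x - s *\<^sub>R e)) / h n)) <= \<bar>u x\<bar> * B" for n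
   proof (rule AE_I2)
    fix x
    have eq: "x - (s + h n) *\<^sub>R e = (x - s *\<^sub>R e) + (- h n) *\<^sub>R e" by (simp add: algebra_simps)
    have "\<bar>\<phi> (x - (s + h n) *\<^sub>R e) - \<phi> (x - s *\<^sub>R e)\<bar> <= B * \<bar>h n\<bar>"
     using B(3)[of "x - s *\<^sub>R e" "- h n"] by (simp only: eq abs_minus_cancel)
    then have "\<bar>(\<phi> (x - (s + h n) *\<^sub>R e) - \<phi> (x - s *\<^sub>R e)) / h n\<bar> <= B"
     using h(1)[rule_format, of n] by (simp add: pos_divide_le_eq)
    then show "norm (u x * ((\<phi> (x - (s + h n) *\<^sub>R e) - \<phi> (x - s *\<^sub>R e)) / h n)) <= \<bar>u x\<bar> * B"
     unfolding real_norm_def abs_mult[of "u x"] by (intro mult_left_mono) auto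
   qed
  qed (use u in \<open>auto simp: abs_mult\<close>)
  then show "(%n. (?F (s + h n) - ?F s) / h n) \<longlonglongrightarrow> - (\<integral>x. u x * \<psi> (x - s *\<^sub>R e) \<partial>lborel)"
   unfolding eq by simp
 qed
 then show ?thesis
  by (simp add: DERIV_def \<psi>(1))
qed

lemma C_k_shift: "(!!k. C_k k \<phi>) ==> C_k k (%x. \<phi> (x - c))"
 using C_k_translate[of k \<phi> "-c"] by simp

lemma frechet_derivative_shift:
 assumes "C_k (Suc 0) \<phi>"
 shows "frechet_derivative (%x. \<phi> (x - c)) (at x) = frechet_derivative \<phi> (at (x - c))"
proof -
 obtain f' where f': "!!x. (\<phi> has_derivative f' x) (at x)" "!!v. C_k 0 (%x. f' x v)"
  using assms by (rule C_k_SucE) blast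
 have "((%x. \<phi> (x - c)) has_derivative f' (x - c)) (at x)"
  by (rule has_derivative_compose[of "%x. x - c" "%v. v" x UNIV \<phi> "f' (x - c)", simplified])
   (use f' in \<open>auto intro!: derivative_eq_intros\<close>)
 then show ?thesis
  using frechet_derivative_at f'(1) by metis
qed

text \<open>Paired with a test function, the difference quotient of \<open>u\<close> equals the
  pairing of \<open>g\<close> shifted by one intermediate distance. Cauchy-Schwarz bounds the error
  by the L2 modulus of continuity of \<open>g\<close>, and \<open>test_duality_bound\<close> turns
  this into a norm bound. The larger box holds all shifted supports.\<close>

lemma weak_deriv_difference_quotient:
 fixes u g :: "real^2 => real"
 assumes u: "integrable lborel u" and g: "integrable lborel g" and g2: "integrable lborel (%x. (g x)\<^sup>2)"
  and W: "weak_deriv_on a b e u g" and \<tau>: "\<tau> > 0" and \<omega>: "\<omega> >= 0"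
  and inner: "!!x s. x \<in> box a' b' ==> 0 <= s ==> s <= \<tau> ==> x + s *\<^sub>R e \<in> box a b"
  and bd: "!!s. 0 <= s ==> s <= \<tau> ==> (\<integral>x. (g (x + s *\<^sub>R e) - g x)\<^sup>2 \<partial>lborel) <= \<omega>\<^sup>2"
 shows "(\<integral>\<^sup>+x. ennreal (((u (x + \<tau> *\<^sub>R e) - u x) / \<tau> - g x)\<^sup>2) * indicator (box a' b') x \<partial>lborel) <= ennreal (\<omega>\<^sup>2)"
proof (rule test_duality_bound[OF _ \<omega>])
 note it = integrable_translate
 have [measurable]: "u \<in> borel_measurable borel" "g \<in> borel_measurable borel" using u g by auto
 show "integrable lborel (%x. (u (x + \<tau> *\<^sub>R e) - u x) / \<tau> - g x)"
  using u g it[OF u] by simp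
 fix \<phi> :: "real^2 => real" assume C: "!!k. C_k k \<phi>" and supp: "!!x. x \<notin> box a' b' ==> \<phi> x = 0"
 have suppc: "\<phi> x = 0" if "x \<notin> cbox a' b'" for x
  using supp[of x] that box_subset_cbox by blast
 have [measurable]: "\<phi> \<in> borel_measurable borel" using C_k_imp_borel_measurable[OF C[of 0]] .
 obtain B where B: "B >= 0" "!!x. \<bar>\<phi> x\<bar> <= B"
  using smooth_bounded_derivative[OF C compact_cbox suppc] by metis
 have \<phi>sq: "integrable lborel (%x. (\<phi> x)\<^sup>2)"
 proof (rule Bochner_Integration.integrable_bound[where f = "%x. indicator (cbox a' b') x * B\<^sup>2"])
  show "integrable lborel (%x. indicator (cbox a' b') x * B\<^sup>2 :: real)"
   by (intro integrable_mult_left integrable_real_indicator) (auto simp: emeasure_lborel_cbox_eq)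
  show "AE x in lborel. norm ((\<phi> x)\<^sup>2) <= norm (indicator (cbox a' b') x * B\<^sup>2)"
  proof (rule AE_I2)
   fix x
   have "(\<phi> x)\<^sup>2 <= B\<^sup>2" using B by (simp add: abs_le_square_iff[symmetric])
   then show "norm ((\<phi> x)\<^sup>2) <= norm (indicator (cbox a' b') x * B\<^sup>2)"
    using suppc[of x] by (cases "x \<in> cbox a' b'") auto
  qed
 qed simp
 have prodint: "integrable lborel (%x. f x * \<phi> (x - c))" if f: "integrable lborel f" for f c
  by (rule Bochner_Integration.integrable_bound[where f = "%x. B * f x"])
   (use f B in \<open>auto simp: abs_mult mult.commute[of "\<bar>f _\<bar>"] intro!: mult_right_mono\<close>)
 let ?F = "%s. \<integral>x. u x * \<phi> (x - s *\<^sub>R e) \<partial>lborel"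
 have F': "(?F has_real_derivative (\<integral>x. g x * \<phi> (x - s *\<^sub>R e) \<partial>lborel)) (at s)" if s: "0 <= s" "s <= \<tau>" for s
 proof -
  have "\<phi> (x - s *\<^sub>R e) = 0" if "x \<notin> box a b" for x
   using supp[of "x - s *\<^sub>R e"] inner[of "x - s *\<^sub>R e" s] s that by auto
  then have "(\<integral>x. u x * frechet_derivative (%x. \<phi> (x - s *\<^sub>R e)) (at x) e \<partial>lborel)
    = - (\<integral>x. g x * \<phi> (x - s *\<^sub>R e) \<partial>lborel)"
   using W C_k_shift[OF C] unfolding weak_deriv_on_def by blast
  then show ?thesis
   using integral_shifted_test_has_derivative[OF u C compact_cbox suppc, where e = e and s = s]
   by (simp add: frechet_derivative_shift[OF C])
 qed
 \<comment> \<open>The intermediate shift depends on the test function, which is why the modulus is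
   assumed uniformly for all shifts up to \<open>\<tau>\<close>.\<close>
 obtain z where z: "0 < z" "z < \<tau>" "?F \<tau> - ?F 0 = (\<tau> - 0) * (\<integral>x. g x * \<phi> (x - z *\<^sub>R e) \<partial>lborel)"
  using MVT2[of 0 \<tau> ?F "%s. \<integral>x. g x * \<phi> (x - s *\<^sub>R e) \<partial>lborel"] F' \<tau> by auto
 have tr: "(\<integral>x. f (x + s *\<^sub>R e) * \<phi> x \<partial>lborel) = (\<integral>x. f x * \<phi> (x - s *\<^sub>R e) \<partial>lborel)"
  if "integrable lborel f" for f s
  using integral_translate[of "%x. f x * \<phi> (x - s *\<^sub>R e)" "s *\<^sub>R e"] that by simp
 have "(\<integral>x. ((u (x + \<tau> *\<^sub>R e) - u x) / \<tau> - g x) * \<phi> x \<partial>lborel)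
   = (\<integral>x. (u (x + \<tau> *\<^sub>R e) * \<phi> x - u x * \<phi> x) / \<tau> - g x * \<phi> x \<partial>lborel)"
  by (intro Bochner_Integration.integral_cong) (auto simp: algebra_simps diff_divide_distrib)
 also have "\<dots> = ((\<integral>x. u (x + \<tau> *\<^sub>R e) * \<phi> x \<partial>lborel) - (\<integral>x. u x * \<phi> x \<partial>lborel)) / \<tau> - (\<integral>x. g x * \<phi> x \<partial>lborel)"
  using prodint[of _ 0] u g it[OF u] by simp
 also have "\<dots> = (?F \<tau> - ?F 0) / \<tau> - (\<integral>x. g x * \<phi> x \<partial>lborel)"
  by (simp add: tr[OF u])
 also have "\<dots> = (\<integral>x. g (x + z *\<^sub>R e) * \<phi> x \<partial>lborel) - (\<integral>x. g x * \<phi> x \<partial>lborel)"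
  using z(3) \<tau> by (simp add: tr[OF g])
 also have "\<dots> = (\<integral>x. (g (x + z *\<^sub>R e) - g x) * \<phi> x \<partial>lborel)"
  using prodint[of _ 0] g it[OF g] by (simp add: left_diff_distrib)
 finally have "\<bar>\<integral>x. ((u (x + \<tau> *\<^sub>R e) - u x) / \<tau> - g x) * \<phi> x \<partial>lborel\<bar>
   = \<bar>\<integral>x. (g (x + z *\<^sub>R e) - g x) * \<phi> x \<partial>lborel\<bar>" by simp
 also have "\<dots> <= sqrt (\<integral>x. (g (x + z *\<^sub>R e) - g x)\<^sup>2 \<partial>lborel) * sqrt (\<integral>x. (\<phi> x)\<^sup>2 \<partial>lborel)"
 proof (rule Cauchy_Schwarz_integral[OF _ _ _ \<phi>sq])
  show "integrable lborel (%x. (g (x + z *\<^sub>R e) - g x)\<^sup>2)"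
   using integrable_add_squares(2)[of "%x. g (x + z *\<^sub>R e)" lborel g] g2 it[OF g2] by simp
 qed auto
 also have "\<dots> <= \<omega> * sqrt (\<integral>x. (\<phi> x)\<^sup>2 \<partial>lborel)"
  using bd[of z] z \<omega> by (intro mult_right_mono real_le_lsqrt) auto
 finally show "\<bar>\<integral>x. ((u (x + \<tau> *\<^sub>R e) - u x) / \<tau> - g x) * \<phi> x \<partial>lborel\<bar> <= \<omega> * sqrt (\<integral>x. (\<phi> x)\<^sup>2 \<partial>lborel)" .
qed

text \<open>Translation moves the difference quotient from \<open>l\<close> to the test function.
  Both forms converge by dominated convergence, one by the Lipschitz bound on \<open>l\<close>, the
  other by smoothness of \<open>\<phi>\<close>. The almost everywhere derivative along one sequence
  of steps is an assumption, so no differentiability theorem for Lipschitz functions enters.\<close>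

lemma Lipschitz_weak_derivative:
 fixes l g \<phi> :: "real^2 => real"
 assumes lip: "!!x y. \<bar>l x - l y\<bar> <= L * norm (x - y)"
  and ae: "AE x in lborel. (%n. (l (x + inverse (real (Suc n)) *\<^sub>R e) - l x) / inverse (real (Suc n))) \<longlonglongrightarrow> g x"
  and [measurable]: "g \<in> borel_measurable borel"
  and C: "C_k (Suc 0) \<phi>" and K: "compact K" "!!x. x \<notin> K ==> \<phi> x = 0"
 shows "(\<integral>x. l x * frechet_derivative \<phi> (at x) e \<partial>lborel) = - (\<integral>x. g x * \<phi> x \<partial>lborel)"
proof -
 obtain \<psi> where \<psi>: "!!x. \<psi> x = frechet_derivative \<phi> (at x) e" "continuous_on UNIV \<psi>"
  "!!x t. ((%t. \<phi> (x + t *\<^sub>R e)) has_real_derivative \<psi> (x + t *\<^sub>R e)) (at t)"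
  using C_k_1_directional[OF C] by blast
 obtain B where B: "B >= 0" "!!x. \<bar>frechet_derivative \<phi> (at x) e\<bar> <= B"
  "!!x t. \<bar>\<phi> (x + t *\<^sub>R e) - \<phi> x\<bar> <= B * \<bar>t\<bar>" "!!x. \<bar>\<phi> x\<bar> <= B"
  using smooth_bounded_derivative[OF C K] by blast
 have L0: "L * norm v >= 0" for v :: "real^2" using lip[of v 0] by simp
 have "continuous_on UNIV l"
 proof (rule continuous_onI)
  fix x :: "real^2" and \<epsilon> :: real assume \<epsilon>: "\<epsilon> > 0"
  show "\<exists>d>0. \<forall>y\<in>UNIV. dist y x < d --> dist (l y) (l x) <= \<epsilon>"
  proof (intro exI[of _ "\<epsilon> / (\<bar>L\<bar> + 1)"] conjI ballI impI)
   fix y assume y: "dist y x < \<epsilon> / (\<bar>L\<bar> + 1)"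
   have "dist (l y) (l x) <= \<bar>L\<bar> * dist y x"
    using lip[of y x] mult_right_mono[OF abs_ge_self[of L] norm_ge_zero[of "y - x"]]
    by (simp add: dist_norm)
   also have "\<dots> <= (\<bar>L\<bar> + 1) * (\<epsilon> / (\<bar>L\<bar> + 1))"
    using y by (intro mult_mono) auto
   also have "\<dots> = \<epsilon>" by simp
   finally show "dist (l y) (l x) <= \<epsilon>" .
  qed (use \<epsilon> in auto)
 qed
 then have lc: "continuous_on A l" for A by (rule continuous_on_subset) auto
 have [measurable]: "\<phi> \<in> borel_measurable borel" "\<psi> \<in> borel_measurable borel" "l \<in> borel_measurable borel"
  using \<psi>(2) C_k_imp_continuous_on[OF C] lc by (auto intro: borel_measurable_continuous_onI)
 obtain R where R: "R > 0" "!!x. x \<in> K ==> norm x <= R"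
  using compact_imp_bounded[OF K(1)] by (auto simp: bounded_pos)
 \<comment> \<open>The steps are at most 1, so this radius contains the supports of all shifted test
   functions; \<open>l\<close> is bounded there though perhaps not globally.\<close>
 define R' where "R' = R + norm e"
 have lb: "\<exists>M. \<forall>x\<in>cball 0 r. \<bar>l x\<bar> <= M" for r
  using compact_imp_bounded[OF compact_continuous_image[OF lc compact_cball], of 0 r]
  unfolding bounded_iff by simp
 obtain M where M: "!!x. x \<in> cball 0 R' ==> \<bar>l x\<bar> <= M"
  using lb[of R'] by blast
 define h where "h n = inverse (real (Suc n))" for n
 have h: "h n > 0" "h n <= 1" for n by (auto simp: h_def field_simps)
 have h0: "h \<longlonglongrightarrow> 0" unfolding h_def by (rule LIMSEQ_inverse_real_of_nat)
 have \<phi>0: "\<phi> x = 0" if "norm x > R" for x using K(2)[of x] R(2)[of x] that by force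
 have \<psi>0: "\<psi> x = 0" if "norm x > R" for x
  using frechet_derivative_eq_0_outside[of K \<phi> x e] K R(2)[of x] that by (auto simp: \<psi>(1) compact_imp_closed)
 have il: "integrable lborel (%x. l x * \<phi> (x - c))" for c
 proof -
  obtain M' where M': "!!x. x \<in> cball 0 (R + norm c) ==> \<bar>l x\<bar> <= M'"
   using lb[of "R + norm c"] by blast
  show ?thesis
  proof (rule Bochner_Integration.integrable_bound[OF integrable_indicator_cball[of 0 "R + norm c" "\<bar>M'\<bar> * B"]])
   show "AE x in lborel. norm (l x * \<phi> (x - c)) <= norm (indicator (cball 0 (R + norm c)) x * (\<bar>M'\<bar> * B))"
   proof (rule AE_I2)
    fix x
    show "norm (l x * \<phi> (x - c)) <= norm (indicator (cball 0 (R + norm c)) x * (\<bar>M'\<bar> * B))"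
    proof (cases "x \<in> cball 0 (R + norm c)")
     case True
     have "\<bar>l x\<bar> * \<bar>\<phi> (x - c)\<bar> <= \<bar>M'\<bar> * B"
      using M'[OF True] B(1) B(4)[of "x - c"] by (intro mult_mono) auto
     then show ?thesis using True B(1) by (simp add: abs_mult)
    next
     case False
     then have "norm (x - c) > R" using norm_triangle_ineq2[of x c] by simp
     then show ?thesis by (simp add: \<phi>0)
    qed
   qed
  qed simp
 qed
 have eq: "(\<integral>x. (l (x + h n *\<^sub>R e) - l x) / h n * \<phi> x \<partial>lborel)
   = (\<integral>x. l x * ((\<phi> (x - h n *\<^sub>R e) - \<phi> x) / h n) \<partial>lborel)" for n
 proof -
  have il': "integrable lborel (%x. l (x + h n *\<^sub>R e) * \<phi> x)"
   using integrable_translate[OF il[of "h n *\<^sub>R e"], of "h n *\<^sub>R e"] by simp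
  have "(\<integral>x. (l (x + h n *\<^sub>R e) - l x) / h n * \<phi> x \<partial>lborel)
    = (\<integral>x. (l (x + h n *\<^sub>R e) * \<phi> x - l x * \<phi> x) / h n \<partial>lborel)"
   by (intro Bochner_Integration.integral_cong) (auto simp: algebra_simps)
  also have "\<dots> = ((\<integral>x. l (x + h n *\<^sub>R e) * \<phi> x \<partial>lborel) - (\<integral>x. l x * \<phi> x \<partial>lborel)) / h n"
   using il' il[of 0] by simp
  also have "(\<integral>x. l (x + h n *\<^sub>R e) * \<phi> x \<partial>lborel) = (\<integral>x. l x * \<phi> (x - h n *\<^sub>R e) \<partial>lborel)"
   using integral_translate[of "%x. l x * \<phi> (x - h n *\<^sub>R e)" "h n *\<^sub>R e"] by simp
  also have "((\<integral>x. l x * \<phi> (x - h n *\<^sub>R e) \<partial>lborel) - (\<integral>x. l x * \<phi> x \<partial>lborel)) / h n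
    = (\<integral>x. (l x * \<phi> (x - h n *\<^sub>R e) - l x * \<phi> x) / h n \<partial>lborel)"
   using il il[of 0] by simp
  also have "\<dots> = (\<integral>x. l x * ((\<phi> (x - h n *\<^sub>R e) - \<phi> x) / h n) \<partial>lborel)"
   by (intro Bochner_Integration.integral_cong) (auto simp: algebra_simps)
  finally show ?thesis .
 qed
 have lim1: "(%n. \<integral>x. (l (x + h n *\<^sub>R e) - l x) / h n * \<phi> x \<partial>lborel) \<longlonglongrightarrow> (\<integral>x. g x * \<phi> x \<partial>lborel)"
 proof (rule integral_dominated_convergence[where w = "%x. indicator (cball 0 R) x * (L * norm e * B)"])
  show "AE x in lborel. (%n. (l (x + h n *\<^sub>R e) - l x) / h n * \<phi> x) \<longlonglongrightarrow> g x * \<phi> x"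
   using ae unfolding h_def by eventually_elim (rule tendsto_mult_right)
  show "AE x in lborel. norm ((l (x + h n *\<^sub>R e) - l x) / h n * \<phi> x) <= indicator (cball 0 R) x * (L * norm e * B)" for n
  proof (rule AE_I2)
   fix x
   have "\<bar>l (x + h n *\<^sub>R e) - l x\<bar> <= L * norm e * h n"
    using lip[of "x + h n *\<^sub>R e" x] h[of n] by (simp add: mult.commute mult.left_commute)
   then have "\<bar>(l (x + h n *\<^sub>R e) - l x) / h n\<bar> <= L * norm e"
    using h[of n] by (simp add: pos_divide_le_eq)
   then have "\<bar>(l (x + h n *\<^sub>R e) - l x) / h n\<bar> * \<bar>\<phi> x\<bar> <= L * norm e * B"
    using B(4)[of x] L0[of e] by (intro mult_mono) auto
   then show "norm ((l (x + h n *\<^sub>R e) - l x) / h n * \<phi> x) <= indicator (cball 0 R) x * (L * norm e * B)"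
    using \<phi>0[of x] by (cases "norm x <= R") (auto simp: abs_mult)
  qed
 qed (use integrable_indicator_cball in auto)
 have lim2: "(%n. \<integral>x. l x * ((\<phi> (x - h n *\<^sub>R e) - \<phi> x) / h n) \<partial>lborel) \<longlonglongrightarrow> (\<integral>x. l x * (- \<psi> x) \<partial>lborel)"
 proof (rule integral_dominated_convergence[where w = "%x. indicator (cball 0 R') x * (\<bar>M\<bar> * B)"])
  show "AE x in lborel. (%n. l x * ((\<phi> (x - h n *\<^sub>R e) - \<phi> x) / h n)) \<longlonglongrightarrow> l x * (- \<psi> x)"
  proof (rule AE_I2)
   fix x
   have "((%t. (\<phi> (x + t *\<^sub>R e) - \<phi> x) / t) \<longlongrightarrow> \<psi> x) (at 0)"
    using \<psi>(3)[of x 0] by (simp add: has_field_derivative_iff)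
   moreover have "filterlim (%n. - h n) (at 0) sequentially"
   proof -
    have "- h n ~= 0" for n using h(1)[of n] by simp
    then show ?thesis using tendsto_minus[OF h0] by (simp add: filterlim_at)
   qed
   ultimately have "(%n. (\<phi> (x + (- h n) *\<^sub>R e) - \<phi> x) / (- h n)) \<longlonglongrightarrow> \<psi> x"
    by (rule filterlim_compose)
   then have "(%n. - ((\<phi> (x + (- h n) *\<^sub>R e) - \<phi> x) / (- h n))) \<longlonglongrightarrow> - \<psi> x"
    by (rule tendsto_minus)
   then show "(%n. l x * ((\<phi> (x - h n *\<^sub>R e) - \<phi> x) / h n)) \<longlonglongrightarrow> l x * (- \<psi> x)"
    by (intro tendsto_mult_left) simp
  qed
  show "AE x in lborel. norm (l x * ((\<phi> (x - h n *\<^sub>R e) - \<phi> x) / h n)) <= indicator (cball 0 R') x * (\<bar>M\<bar> * B)" for n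
  proof (rule AE_I2)
   fix x
   show "norm (l x * ((\<phi> (x - h n *\<^sub>R e) - \<phi> x) / h n)) <= indicator (cball 0 R') x * (\<bar>M\<bar> * B)"
   proof (cases "x \<in> cball 0 R'")
    case True
    have "\<bar>\<phi> (x - h n *\<^sub>R e) - \<phi> x\<bar> <= B * h n"
     using B(3)[of x "- h n"] h[of n] by simp
    then have "\<bar>(\<phi> (x - h n *\<^sub>R e) - \<phi> x) / h n\<bar> <= B"
     using h[of n] by (simp add: pos_divide_le_eq)
    then have "\<bar>l x\<bar> * \<bar>(\<phi> (x - h n *\<^sub>R e) - \<phi> x) / h n\<bar> <= \<bar>M\<bar> * B"
     using M[OF True] B(1) by (intro mult_mono) auto
    then show ?thesis using True by (simp add: abs_mult)
   next
    case False
    then have x: "norm x > R + norm e" by (simp add: R'_def)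
    have "norm (h n *\<^sub>R e) <= norm e"
     using h[of n] mult_right_mono[of "h n" 1 "norm e"] by simp
    then have "norm (x - h n *\<^sub>R e) > R" "norm x > R"
     using x norm_triangle_ineq2[of x "h n *\<^sub>R e"] by (smt (verit) norm_ge_zero)+
    then show ?thesis using False by (simp add: \<phi>0)
   qed
  qed
 qed (use integrable_indicator_cball in auto)
 have "(\<integral>x. g x * \<phi> x \<partial>lborel) = (\<integral>x. l x * (- \<psi> x) \<partial>lborel)"
  using LIMSEQ_unique[OF lim1 lim2[unfolded eq[symmetric]]] .
 then show ?thesis by (simp add: \<psi>(1))
qed

section \<open>Least-squares projection onto monotone sequences\<close>

section \<open>Isotonic regression\<close>

definition mono_upto :: "nat => (nat => real) => bool" where
 "mono_upto N y \<longleftrightarrow> (\<forall>j<N. y j <= y (Suc j))"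

definition is_isotonic :: "nat => (nat => real) => (nat => real) => bool" where
 "is_isotonic N v y \<longleftrightarrow> mono_upto N y \<and>
  (\<forall>z. mono_upto N z --> (\<Sum>j\<le>N. (v j - y j)\<^sup>2) <= (\<Sum>j\<le>N. (v j - z j)\<^sup>2))"

lemma mono_upto_convex:
 assumes "mono_upto N y" "mono_upto N z" "0 <= t" "t <= 1"
 shows "mono_upto N (%j. y j + t * (z j - y j))"
 unfolding mono_upto_def
proof (intro allI impI)
 fix j assume "j < N"
 then have "(1 - t) * y j <= (1 - t) * y (Suc j)" "t * z j <= t * z (Suc j)"
  using assms by (auto simp: mono_upto_def intro: mult_left_mono)
 then show "y j + t * (z j - y j) <= y (Suc j) + t * (z (Suc j) - y (Suc j))"
  by (simp add: algebra_simps)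
qed

text \<open>Existence of the projection onto the cone of monotone sequences: a minimising sequence is
 Cauchy by the parallelogram identity.\<close>

lemma isotonic_exists: "\<exists>y. is_isotonic N v y"
proof -
 define \<Phi> where "\<Phi> y = (\<Sum>j\<le>N. (v j - y j)\<^sup>2)" for y
 define d where "d = Inf (\<Phi> ` Collect (mono_upto N))"
 have ne: "\<Phi> ` Collect (mono_upto N) ~= {}"
  by (auto simp: mono_upto_def intro!: exI[of _ "%j. 0"])
 have bdd: "bdd_below (\<Phi> ` Collect (mono_upto N))"
  by (rule bdd_belowI[of _ 0]) (auto simp: \<Phi>_def sum_nonneg)
 have d: "d <= \<Phi> y" if "mono_upto N y" for y
  unfolding d_def using that by (intro cInf_lower bdd) auto
 have "\<exists>y. mono_upto N y \<and> \<Phi> y < d + inverse (real (Suc n))" for n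
  using cInf_lessD[OF ne, of "d + inverse (real (Suc n))"] unfolding d_def by auto
 then obtain Y where Y: "!!n. mono_upto N (Y n)" "!!n. \<Phi> (Y n) < d + inverse (real (Suc n))"
  by metis
 have par: "(\<Sum>j\<le>N. (y j - z j)\<^sup>2) <= 2 * \<Phi> y + 2 * \<Phi> z - 4 * d" if "mono_upto N y" "mono_upto N z" for y z
 proof -
  have "mono_upto N (%j. y j + (1/2) * (z j - y j))"
   using that by (intro mono_upto_convex) auto
  from d[OF this] have "4 * d <= 4 * (\<Sum>j\<le>N. (v j - (y j + (1/2) * (z j - y j)))\<^sup>2)"
   by (simp add: \<Phi>_def)
  also have "\<dots> = 2 * \<Phi> y + 2 * \<Phi> z - (\<Sum>j\<le>N. (y j - z j)\<^sup>2)"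
   unfolding \<Phi>_def sum_distrib_left sum.distrib[symmetric] sum_subtractf[symmetric]
   by (intro sum.cong) (auto simp: power2_eq_square field_simps)
  finally show ?thesis by simp
 qed
 have cauchy: "Cauchy (%n. Y n j)" if j: "j <= N" for j
 proof (rule metric_CauchyI)
  fix e :: real assume e: "e > 0"
  obtain M where M: "inverse (real (Suc M)) < e\<^sup>2 / 4"
   using reals_Archimedean[of "e\<^sup>2 / 4"] e by auto
  have "dist (Y m j) (Y n j) < e" if mn: "m >= M" "n >= M" for m n
  proof -
   have "inverse (real (Suc m)) <= inverse (real (Suc M))" "inverse (real (Suc n)) <= inverse (real (Suc M))"
    using mn by (auto intro!: le_imp_inverse_le)
   moreover have "(Y m j - Y n j)\<^sup>2 <= (\<Sum>j\<le>N. (Y m j - Y n j)\<^sup>2)"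
    using j by (intro member_le_sum) auto
   ultimately have "(Y m j - Y n j)\<^sup>2 < e\<^sup>2"
    using par[OF Y(1) Y(1), of m n] Y(2)[of m] Y(2)[of n] M by linarith
   then have "\<bar>Y m j - Y n j\<bar> < e"
    using e by (metis abs_le_square_iff abs_of_pos linorder_not_less)
   then show ?thesis by (simp add: dist_real_def)
  qed
  then show "\<exists>M. \<forall>m\<ge>M. \<forall>n\<ge>M. dist (Y m j) (Y n j) < e" by blast
 qed
 then have "\<forall>j. \<exists>l. j <= N --> (%n. Y n j) \<longlonglongrightarrow> l"
  using Cauchy_convergent_iff convergent_def by blast
 then obtain y where y: "!!j. j <= N ==> (%n. Y n j) \<longlonglongrightarrow> y j" by metis
 have "mono_upto N y"
  unfolding mono_upto_def
 proof (intro allI impI)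
  fix j assume j: "j < N"
  show "y j <= y (Suc j)"
  proof (rule LIMSEQ_le)
   show "(%n. Y n j) \<longlonglongrightarrow> y j" "(%n. Y n (Suc j)) \<longlonglongrightarrow> y (Suc j)" using j by (auto intro: y)
   show "\<exists>M. \<forall>n\<ge>M. Y n j <= Y n (Suc j)" using Y(1) j by (auto simp: mono_upto_def)
  qed
 qed
 moreover have "\<Phi> y <= d"
 proof (rule LIMSEQ_le)
  show "(%n. \<Phi> (Y n)) \<longlonglongrightarrow> \<Phi> y"
   unfolding \<Phi>_def by (intro tendsto_intros y) auto
  show "(%n. d + inverse (real (Suc n))) \<longlonglongrightarrow> d"
   using tendsto_add[OF tendsto_const[of d] LIMSEQ_inverse_real_of_nat] by simp
  show "\<exists>M. \<forall>n\<ge>M. \<Phi> (Y n) <= d + inverse (real (Suc n))"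
   using Y(2) less_imp_le by blast
 qed
 ultimately have "is_isotonic N v y"
  unfolding is_isotonic_def \<Phi>_def[symmetric] using d by (blast intro: order_trans)
 then show ?thesis by blast
qed

text \<open>Only the indices up to \<open>N\<close> are determined by the minimisation; beyond them
  the chosen sequence is arbitrary.\<close>

definition isotonic :: "nat => (nat => real) => nat => real" where
 "isotonic N v = (SOME y. is_isotonic N v y)"

lemma is_isotonic_isotonic: "is_isotonic N v (isotonic N v)"
 unfolding isotonic_def by (rule someI_ex[OF isotonic_exists])

lemma isotonic_mono: "j < N ==> isotonic N v j <= isotonic N v (Suc j)"
 using is_isotonic_isotonic[of N v] by (auto simp: is_isotonic_def mono_upto_def)

text \<open>The obtuse-angle characterisation of a projection onto a convex set: if the pairing were
  positive, a small step from the projection towards \<open>z\<close> would lower the squared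
  distance.\<close>

lemma isotonic_variational:
 assumes z: "mono_upto N z"
 shows "(\<Sum>j\<le>N. (v j - isotonic N v j) * (z j - isotonic N v j)) <= 0"
proof (rule ccontr)
 define y where "y = isotonic N v"
 define A where "A = (\<Sum>j\<le>N. (v j - y j) * (z j - y j))"
 define B where "B = (\<Sum>j\<le>N. (z j - y j)\<^sup>2)"
 assume "\<not> ?thesis"
 then have A: "A > 0" by (simp add: A_def y_def)
 have B: "B >= 0" unfolding B_def by (intro sum_nonneg) auto
 have y: "mono_upto N y" "!!z. mono_upto N z ==> (\<Sum>j\<le>N. (v j - y j)\<^sup>2) <= (\<Sum>j\<le>N. (v j - z j)\<^sup>2)"
  using is_isotonic_isotonic[of N v] by (auto simp: is_isotonic_def y_def)
 \<comment> \<open>The change of the squared distance is t (t B - 2 A). This step makes t B at most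
   A, hence the change negative; adding 1 to \<open>B\<close> covers B = 0.\<close>
 define t where "t = min 1 (A / (B + 1))"
 have t: "0 < t" "t <= 1" "t * B < 2 * A"
 proof -
  show "0 < t" "t <= 1" using A B by (auto simp: t_def)
  have "t * B <= A / (B + 1) * B" using B by (intro mult_right_mono) (auto simp: t_def)
  also have "\<dots> <= A" using A B by (simp add: field_simps)
  finally show "t * B < 2 * A" using A by simp
 qed
 have "(\<Sum>j\<le>N. (v j - y j)\<^sup>2) <= (\<Sum>j\<le>N. (v j - (y j + t * (z j - y j)))\<^sup>2)"
  by (rule y(2)[OF mono_upto_convex[OF y(1) z]]) (use t in auto)
 also have "\<dots> = (\<Sum>j\<le>N. (v j - y j)\<^sup>2) - 2 * t * A + t * t * B"
  unfolding A_def B_def sum_distrib_left sum.distrib[symmetric] sum_subtractf[symmetric]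
  by (intro sum.cong) (auto simp: power2_eq_square algebra_simps)
 finally have "t * (2 * A) <= t * (t * B)" by (simp add: mult.assoc)
 then show False using t mult_le_cancel_left_pos[OF t(1)] by simp
qed

text \<open>The two variational inequalities, each tested with the other projection, add up to the
  contraction. Applied to two neighbouring columns it controls the horizontal difference quotient of
  the regression by that of the data.\<close>

lemma isotonic_contraction:
 "(\<Sum>j\<le>N. (isotonic N v j - isotonic N w j)\<^sup>2) <= (\<Sum>j\<le>N. (v j - w j)\<^sup>2)"
proof -
 let ?y = "isotonic N v" and ?z = "isotonic N w"
 have m: "mono_upto N ?y" "mono_upto N ?z"
  using is_isotonic_isotonic by (auto simp: is_isotonic_def)
 have "(\<Sum>j\<le>N. (v j - ?y j) * (?z j - ?y j)) + (\<Sum>j\<le>N. (w j - ?z j) * (?y j - ?z j)) <= 0"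
  using isotonic_variational[OF m(2), of v] isotonic_variational[OF m(1), of w] by linarith
 then have "0 <= (\<Sum>j\<le>N. 2 * ((v j - w j) * (?y j - ?z j) - (?y j - ?z j)\<^sup>2))"
  unfolding sum.distrib[symmetric] sum_distrib_left[symmetric]
  by (simp add: sum_negf[symmetric] power2_eq_square algebra_simps sum.distrib sum_subtractf)
 also have "\<dots> <= (\<Sum>j\<le>N. (v j - w j)\<^sup>2 - (?y j - ?z j)\<^sup>2)"
 proof (rule sum_mono)
  fix j
  show "2 * ((v j - w j) * (?y j - ?z j) - (?y j - ?z j)\<^sup>2) <= (v j - w j)\<^sup>2 - (?y j - ?z j)\<^sup>2"
   using zero_le_power2[of "(v j - w j) - (?y j - ?z j)"] by (simp add: power2_diff power2_eq_square algebra_simps)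
 qed
 finally show ?thesis by (simp add: sum_subtractf)
qed

lemma isotonic_of_mono:
 assumes "mono_upto N v" "j <= N"
 shows "isotonic N v j = v j"
proof -
 have "(\<Sum>j\<le>N. (v j - isotonic N v j)\<^sup>2) <= 0"
  using isotonic_variational[OF assms(1), of v] by (simp add: power2_eq_square)
 moreover have "(v j - isotonic N v j)\<^sup>2 <= (\<Sum>j\<le>N. (v j - isotonic N v j)\<^sup>2)"
  using assms(2) by (intro member_le_sum) auto
 ultimately have "(v j - isotonic N v j)\<^sup>2 <= 0" by linarith
 then show ?thesis by simp
qed

text \<open>Where the regression increases, it cannot be improved by moving \<open>y\<^sub>j\<close> up or \<open>y\<^sub>j\<^sub>+\<^sub>1\<close> down.\<close>

lemma isotonic_step_le:
 assumes j: "j < N"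
 shows "isotonic N v (Suc j) - isotonic N v j <= max 0 (v (Suc j) - v j)"
proof (cases "isotonic N v j < isotonic N v (Suc j)")
 case True
 define y where "y = isotonic N v"
 define t where "t = y (Suc j) - y j"
 have t: "t > 0" using True by (simp add: t_def y_def)
 have m: "!!i. i < N ==> y i <= y (Suc i)" by (simp add: y_def isotonic_mono)
 have "mono_upto N (y(j := y (Suc j)))"
  unfolding mono_upto_def
 proof (intro allI impI)
  fix i assume i: "i < N"
  consider "i = j" | "Suc i = j" | "i ~= j" "Suc i ~= j" by blast
  then show "(y(j := y (Suc j))) i <= (y(j := y (Suc j))) (Suc i)"
   using m[OF i] m[OF j] by cases auto
 qed
 moreover have "mono_upto N (y(Suc j := y j))"
  unfolding mono_upto_def
 proof (intro allI impI)
  fix i assume i: "i < N"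
  consider "i = j" | "i = Suc j" | "i ~= j" "i ~= Suc j" by blast
  then show "(y(Suc j := y j)) i <= (y(Suc j := y j)) (Suc i)"
   using m[OF i] m[OF j] by cases auto
 qed
 ultimately have mm: "mono_upto N (y(j := y (Suc j)))" "mono_upto N (y(Suc j := y j))" .
 from mm[THEN isotonic_variational, of v]
 have "(\<Sum>i\<le>N. (v i - y i) * ((y(j := y (Suc j))) i - y i)) <= 0"
  "(\<Sum>i\<le>N. (v i - y i) * ((y(Suc j := y j)) i - y i)) <= 0"
  by (simp_all add: y_def)
 moreover have "(\<Sum>i\<le>N. (v i - y i) * ((y(j := y (Suc j))) i - y i)) = (\<Sum>i\<le>N. if i = j then (v j - y j) * t else 0)"
  by (intro sum.cong) (auto simp: t_def)
 moreover have "(\<Sum>i\<le>N. (v i - y i) * ((y(Suc j := y j)) i - y i)) = (\<Sum>i\<le>N. if i = Suc j then (v (Suc j) - y (Suc j)) * (- t) else 0)"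
  by (intro sum.cong) (auto simp: t_def)
 ultimately have "(v j - y j) * t <= 0" "(v (Suc j) - y (Suc j)) * (- t) <= 0"
  using j by (auto simp: sum.delta)
 then have "v j <= y j" "y (Suc j) <= v (Suc j)"
  using t by (auto simp: mult_le_0_iff zero_le_mult_iff)
 then show ?thesis by (simp add: y_def)
qed auto

text \<open>Serves the measurability of column-wise regressions. In the product topology the
  contraction bound depends on finitely many coordinates and tends to 0.\<close>

lemma isotonic_continuous: "i <= N ==> continuous_on UNIV (%v. isotonic N v i)"
proof (rule continuous_at_imp_continuous_on, intro ballI)
 fix w :: "nat => real" assume i: "i <= N"
 have "continuous_on UNIV (%v::nat => real. \<Sum>j\<le>N. (v j - w j)\<^sup>2)"
  by (intro continuous_intros continuous_on_product_coordinates)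
 then have "isCont (%v::nat => real. \<Sum>j\<le>N. (v j - w j)\<^sup>2) w"
  by (simp add: continuous_on_eq_continuous_at)
 then have "((%v::nat => real. sqrt (\<Sum>j\<le>N. (v j - w j)\<^sup>2)) \<longlongrightarrow> sqrt (\<Sum>j\<le>N. (w j - w j)\<^sup>2)) (at w)"
  by (intro tendsto_real_sqrt) (simp add: isCont_def)
 then have lim: "((%v::nat => real. sqrt (\<Sum>j\<le>N. (v j - w j)\<^sup>2)) \<longlongrightarrow> 0) (at w)" by simp
 have "norm (isotonic N v i - isotonic N w i) <= sqrt (\<Sum>j\<le>N. (v j - w j)\<^sup>2)" for v
 proof -
  have "(isotonic N v i - isotonic N w i)\<^sup>2 <= (\<Sum>j\<le>N. (isotonic N v j - isotonic N w j)\<^sup>2)"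
   using i by (intro member_le_sum) auto
  also have "\<dots> <= (\<Sum>j\<le>N. (v j - w j)\<^sup>2)" by (rule isotonic_contraction)
  finally show ?thesis by (intro real_le_rsqrt) simp
 qed
 then have "((%v. isotonic N v i - isotonic N w i) \<longlongrightarrow> 0) (at w)"
  by (intro Lim_null_comparison[OF always_eventually lim]) auto
 then show "isCont (%v. isotonic N v i) w"
  by (simp add: isCont_def LIM_zero_iff)
qed

lemma borel_measurable_isotonic [measurable (raw)]:
 assumes "!!j. v j \<in> borel_measurable M" "i <= N"
 shows "(%x. isotonic N (%j. v j x) i) \<in> borel_measurable M"
proof -
 have "(%x. %j. v j x) \<in> borel_measurable M"
  using assms(1) by (intro measurable_coordinatewise_then_product)
 then show ?thesis
  using measurable_compose[OF _ borel_measurable_continuous_onI[OF isotonic_continuous[OF assms(2)]]] by blast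
qed

lemma summation_by_parts:
 fixes a z :: "nat => real"
 assumes "a 0 = 0" "a N = 0"
 shows "(\<Sum>j<N. a j * (z (Suc j) - z j)) = - (\<Sum>j<N. (a (Suc j) - a j) * z (Suc j))"
proof -
 have "(\<Sum>j<N. a j * (z (Suc j) - z j)) + (\<Sum>j<N. (a (Suc j) - a j) * z (Suc j)) = (\<Sum>j<N. a (Suc j) * z (Suc j) - a j * z j)"
  unfolding sum.distrib[symmetric] by (intro sum.cong) (auto simp: algebra_simps)
 also have "\<dots> = a N * z N - a 0 * z 0"
  using sum_lessThan_telescope[of "%j. a j * z j" N] by simp
 finally show ?thesis using assms by simp
qed

section \<open>The discrete inequality on columns of lattice points\<close>

section \<open>An inequality for difference quotients on a lattice of columns\<close>

definition diff_quot :: "real => real^2 => (real^2 => real) => real^2 => real" where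
 "diff_quot \<tau> e f x = (f (x + \<tau> *\<^sub>R e) - f x) / \<tau>"

text \<open>A Lipschitz weight is enough, since only difference quotients of the weight occur; its
  steps cost a factor 1/\<rho>.\<close>

definition tent :: "real^2 => real => real^2 => real" where
 "tent p \<rho> x = max 0 (1 - \<bar>x $ 1 - p $ 1\<bar> / \<rho>) * max 0 (1 - \<bar>x $ 2 - p $ 2\<bar> / \<rho>)"

lemma vec_nth_measurable_2 [measurable]: "(%x::real^2. x $ i) \<in> borel_measurable borel"
 by (intro borel_measurable_continuous_onI continuous_intros)

lemma tent_measurable [measurable]: "tent p \<rho> \<in> borel_measurable borel"
 unfolding tent_def[abs_def] by measurable

lemma tent_bounds: "\<rho> > 0 ==> 0 <= tent p \<rho> x" "\<rho> > 0 ==> tent p \<rho> x <= 1"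
 unfolding tent_def by (auto intro!: mult_le_one)

lemma tent_eq_0:
 assumes "\<rho> > 0" "\<bar>x $ 1 - p $ 1\<bar> >= \<rho> \<or> \<bar>x $ 2 - p $ 2\<bar> >= \<rho>"
 shows "tent p \<rho> x = 0"
 using assms unfolding tent_def by (auto simp: max_def field_simps)

lemma clamp_Lipschitz:
 fixes s t :: real assumes "\<rho> > 0"
 shows "\<bar>max 0 (1 - \<bar>s\<bar> / \<rho>) - max 0 (1 - \<bar>t\<bar> / \<rho>)\<bar> <= \<bar>s - t\<bar> / \<rho>"
proof -
 have "\<bar>max 0 (1 - \<bar>s\<bar> / \<rho>) - max 0 (1 - \<bar>t\<bar> / \<rho>)\<bar> <= \<bar>\<bar>s\<bar> / \<rho> - \<bar>t\<bar> / \<rho>\<bar>"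
  by (auto simp: max_def abs_if)
 also have "\<dots> = \<bar>\<bar>s\<bar> - \<bar>t\<bar>\<bar> / \<rho>"
  using assms by (simp add: diff_divide_distrib[symmetric])
 also have "\<dots> <= \<bar>s - t\<bar> / \<rho>"
  using assms by (intro divide_right_mono) auto
 finally show ?thesis .
qed

lemma tent_Lipschitz_axis:
 assumes "\<rho> > 0" and i: "i = 1 \<or> i = 2"
 shows "\<bar>tent p \<rho> (x + c *\<^sub>R axis i 1) - tent p \<rho> x\<bar> <= \<bar>c\<bar> / \<rho>"
proof -
 define m where "m s = max 0 (1 - \<bar>s\<bar> / \<rho>)" for s :: real
 have m: "0 <= m s" "m s <= 1" "\<bar>m s - m t\<bar> <= \<bar>s - t\<bar> / \<rho>" for s t
  using assms clamp_Lipschitz unfolding m_def by auto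
 have t: "tent p \<rho> x = m (x $ 1 - p $ 1) * m (x $ 2 - p $ 2)" for x by (simp add: tent_def m_def)
 from i show ?thesis
 proof
  assume i: "i = 1"
  have "\<bar>tent p \<rho> (x + c *\<^sub>R axis i 1) - tent p \<rho> x\<bar> = \<bar>m (x $ 1 + c - p $ 1) - m (x $ 1 - p $ 1)\<bar> * m (x $ 2 - p $ 2)"
   using m(1)[of "x $ 2 - p $ 2"] by (simp add: t i axis_def left_diff_distrib[symmetric] abs_mult)
  also have "\<dots> <= \<bar>c\<bar> / \<rho> * 1"
   using m(3)[of "x $ 1 + c - p $ 1" "x $ 1 - p $ 1"] m assms by (intro mult_mono) auto
  finally show ?thesis by simp
 next
  assume i: "i = 2"
  have "\<bar>tent p \<rho> (x + c *\<^sub>R axis i 1) - tent p \<rho> x\<bar> = m (x $ 1 - p $ 1) * \<bar>m (x $ 2 + c - p $ 2) - m (x $ 2 - p $ 2)\<bar>"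
   using m(1)[of "x $ 1 - p $ 1"] by (simp add: t i axis_def right_diff_distrib[symmetric] abs_mult)
  also have "\<dots> <= 1 * (\<bar>c\<bar> / \<rho>)"
   using m(3)[of "x $ 2 + c - p $ 2" "x $ 2 - p $ 2"] m assms by (intro mult_mono) auto
  finally show ?thesis by simp
 qed
qed

lemma indicator_Ico_partition:
 fixes t c \<tau> :: real assumes "\<tau> > 0"
 shows "(\<Sum>j<K. indicator {c..<c + \<tau>} (t - real j * \<tau>)) = (indicator {c..<c + real K * \<tau>} t :: real)"
proof (induction K)
 case (Suc K)
 define s where "s = real K * \<tau>"
 have "s >= 0" "real (Suc K) * \<tau> = s + \<tau>" using assms by (auto simp: s_def algebra_simps)
 then show ?case
  unfolding sum.lessThan_Suc Suc s_def[symmetric]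
  using assms by (auto simp: indicator_def)
qed simp

lemma abs_le_Young: "\<bar>t\<bar> <= \<kappa> / 2 + t\<^sup>2 / (2 * \<kappa>)" if "\<kappa> > 0" for t \<kappa> :: real
proof -
 have "0 <= (\<bar>t\<bar> - \<kappa>)\<^sup>2" by simp
 then have "2 * \<kappa> * \<bar>t\<bar> <= \<kappa> * \<kappa> + t\<^sup>2" by (simp add: power2_diff power2_eq_square algebra_simps)
 then show ?thesis using that by (simp add: field_simps)
qed

lemma mult_le_Young: "\<bar>s * t\<bar> <= (s\<^sup>2 / \<kappa> + \<kappa> * t\<^sup>2) / 2" if "\<kappa> > 0" for s t \<kappa> :: real
proof -
 have "0 <= (\<bar>s\<bar> - \<kappa> * \<bar>t\<bar>)\<^sup>2" by simp
 then have "2 * \<kappa> * \<bar>s * t\<bar> <= s\<^sup>2 + \<kappa> * \<kappa> * t\<^sup>2"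
  by (simp add: power2_diff power2_eq_square algebra_simps abs_mult)
 then show ?thesis using that by (simp add: field_simps power2_eq_square)
qed

text \<open>The column over \<open>x\<close> in the strip \<open>S\<close> consists of the
  \<open>N + 1\<close> points \<open>sh j x\<close>. Together the columns tile the slab of height
  4\<rho> around \<open>p\<close>, twice the height of the support of the tent, so the weight
  vanishes at both ends of each column and summation by parts has no boundary terms.
  \<open>N >= 3\<close> gives \<tau> at most \<rho>, which keeps one-step shifts within these
  margins. Columns are labelled by their base point: \<open>y j x\<close> and \<open>h j x\<close>
  belong to the lattice point \<open>sh j x\<close>.\<close>

locale column_lattice =
 fixes p :: "real^2" and \<rho> \<tau> :: real and N :: nat and r v :: "real^2 => real"
 assumes \<rho>: "\<rho> > 0" and \<tau>: "\<tau> = 4 * \<rho> / real (Suc N)" and N: "N >= 3"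
  and r_meas [measurable]: "r \<in> borel_measurable borel" and r2: "integrable lborel (%x. (r x)\<^sup>2)"
  and v_meas [measurable]: "v \<in> borel_measurable borel" and v2: "integrable lborel (%x. (v x)\<^sup>2)"
begin

abbreviation "e1 \<equiv> axis 1 1 :: real^2"
abbreviation "e2 \<equiv> axis 2 1 :: real^2"
abbreviation "\<eta> \<equiv> tent p \<rho>"

definition c where "c = p $ 2 - 2 * \<rho>"
definition S :: "(real^2) set" where "S = {x. x $ 2 \<in> {c..<c + \<tau>}}"
definition sh :: "nat => real^2 => real^2" where "sh j x = x + (real j * \<tau>) *\<^sub>R e2"
definition y :: "nat => real^2 => real" where "y j x = isotonic N (%i. v (sh i x)) j"
definition h :: "nat => real^2 => real" where "h j x = (y (Suc j) x - y j x) / \<tau>"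
definition bx :: "(real^2) set" where "bx = cbox (p - vec (3 * \<rho>)) (p + vec (3 * \<rho>))"

lemma tau_pos: "\<tau> > 0" and tau_le: "\<tau> <= \<rho>" and N_tau: "real (Suc N) * \<tau> = 4 * \<rho>"
proof -
 show "\<tau> > 0" using \<rho> by (simp add: \<tau>)
 show "\<tau> <= \<rho>" using \<rho> N by (simp add: \<tau> pos_divide_le_eq)
 show "real (Suc N) * \<tau> = 4 * \<rho>" by (simp add: \<tau>)
qed

lemma mem_bx: "x \<in> bx \<longleftrightarrow> \<bar>x $ 1 - p $ 1\<bar> <= 3 * \<rho> \<and> \<bar>x $ 2 - p $ 2\<bar> <= 3 * \<rho>"
 unfolding bx_def mem_cbox_2 by (auto simp: abs_le_iff)

lemma sh_nth: "sh j x $ 1 = x $ 1" "sh j x $ 2 = x $ 2 + real j * \<tau>"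
 by (simp_all add: sh_def axis_def)

lemma sh_Suc: "sh (Suc j) x = sh j x + \<tau> *\<^sub>R e2"
 by (simp add: sh_def algebra_simps)

lemma sh_add: "sh j (x + a) = sh j x + a"
 by (simp add: sh_def)

lemma sh_diff: "sh j (x - a) = sh j x - a"
 by (simp add: sh_def)

lemma S_meas [measurable]: "S \<in> sets borel"
 unfolding S_def by measurable

lemma bx_meas [measurable]: "bx \<in> sets borel"
 by (simp add: bx_def)

lemma sh_meas [measurable]: "sh j \<in> borel_measurable borel"
 unfolding sh_def[abs_def] by measurable

lemma y_meas: "j <= N ==> y j \<in> borel_measurable borel"
 unfolding y_def[abs_def] by (intro borel_measurable_isotonic) measurable

lemma S_shift: "indicator S (x + t *\<^sub>R e1) = indicator S x" "indicator S (x - t *\<^sub>R e1) = indicator S x"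
 by (auto simp: S_def indicator_def axis_def)

lemma integrable_shift:
 "integrable lborel F ==> integrable lborel (%x. F (sh j x))" for F :: "real^2 => real"
 unfolding sh_def by (rule integrable_translate)

text \<open>The translates of the strip \<open>S\<close> by multiples of \<tau> tile the slab, so
  column sums integrated over \<open>S\<close> are integrals over the slab. This transfers
  inequalities proved column by column to plane integrals.\<close>

lemma column_integral:
 fixes F :: "real^2 => real"
 assumes F: "integrable lborel F"
 shows "integrable lborel (%x. indicator S x * (\<Sum>j\<le>N. F (sh j x)))"
  and "(\<integral>x. indicator S x * (\<Sum>j\<le>N. F (sh j x)) \<partial>lborel)
   = (\<integral>x. indicator {x. x $ 2 \<in> {c..<c + 4 * \<rho>}} x * F x \<partial>lborel)"
proof -
 have [measurable]: "F \<in> borel_measurable borel" using F by auto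
 have i: "integrable lborel (%x. indicator S x * F (sh j x))" for j
  using integrable_real_mult_indicator[OF _ integrable_shift[OF F], of S j] by (simp add: mult.commute)
 then have "integrable lborel (%x. \<Sum>j\<le>N. indicator S x * F (sh j x))"
  by (intro Bochner_Integration.integrable_sum)
 then show "integrable lborel (%x. indicator S x * (\<Sum>j\<le>N. F (sh j x)))"
  by (simp add: sum_distrib_left)
 have i': "integrable lborel (%x. indicator S (x - (real j * \<tau>) *\<^sub>R e2) * F x)" for j
  using integrable_translate[OF i[of j], of "- ((real j * \<tau>) *\<^sub>R e2)"] by (simp add: sh_def)
 have "(\<integral>x. indicator S x * (\<Sum>j\<le>N. F (sh j x)) \<partial>lborel) = (\<Sum>j\<le>N. \<integral>x. indicator S x * F (sh j x) \<partial>lborel)"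
  unfolding sum_distrib_left by (rule Bochner_Integration.integral_sum) (rule i)
 also have "\<dots> = (\<Sum>j\<le>N. \<integral>x. indicator S (x - (real j * \<tau>) *\<^sub>R e2) * F x \<partial>lborel)"
 proof (rule sum.cong[OF refl])
  fix j
  show "(\<integral>x. indicator S x * F (sh j x) \<partial>lborel) = (\<integral>x. indicator S (x - (real j * \<tau>) *\<^sub>R e2) * F x \<partial>lborel)"
   using integral_translate[of "%x. indicator S x * F (sh j x)" "- ((real j * \<tau>) *\<^sub>R e2)"]
   by (simp add: sh_def)
 qed
 also have "\<dots> = (\<integral>x. (\<Sum>j\<le>N. indicator S (x - (real j * \<tau>) *\<^sub>R e2) * F x) \<partial>lborel)"
  by (rule Bochner_Integration.integral_sum[symmetric]) (rule i')
 also have "\<dots> = (\<integral>x. indicator {x. x $ 2 \<in> {c..<c + 4 * \<rho>}} x * F x \<partial>lborel)"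
 proof (rule Bochner_Integration.integral_cong[OF refl])
  fix x :: "real^2"
  have "(\<Sum>j\<le>N. indicator S (x - (real j * \<tau>) *\<^sub>R e2)) = (\<Sum>j<Suc N. indicator {c..<c + \<tau>} (x $ 2 - real j * \<tau>) :: real)"
   unfolding lessThan_Suc_atMost by (intro sum.cong) (auto simp: S_def indicator_def axis_def)
  also have "\<dots> = indicator {c..<c + 4 * \<rho>} (x $ 2)"
   unfolding indicator_Ico_partition[OF tau_pos] N_tau ..
  finally show "(\<Sum>j\<le>N. indicator S (x - (real j * \<tau>) *\<^sub>R e2) * F x) = indicator {x. x $ 2 \<in> {c..<c + 4 * \<rho>}} x * F x"
   by (simp add: sum_distrib_right[symmetric] indicator_def)
 qed
 finally show "(\<integral>x. indicator S x * (\<Sum>j\<le>N. F (sh j x)) \<partial>lborel)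
   = (\<integral>x. indicator {x. x $ 2 \<in> {c..<c + 4 * \<rho>}} x * F x \<partial>lborel)" .
qed

text \<open>The slab is unbounded in the first coordinate; the vanishing of \<open>F\<close> far
  from \<open>p\<close> in that direction cuts it down to the square \<open>bx\<close>.\<close>

lemma column_integral_le:
 fixes F G :: "real^2 => real"
 assumes F: "integrable lborel F" and G: "integrable lborel (%x. indicator bx x * G x)"
  and le: "!!x. x \<in> bx ==> F x <= G x" and F0: "!!x. \<bar>x $ 1 - p $ 1\<bar> > 3 * \<rho> ==> F x = 0"
  and G0: "!!x. x \<in> bx ==> 0 <= G x"
 shows "(\<integral>x. indicator S x * (\<Sum>j\<le>N. F (sh j x)) \<partial>lborel) <= (\<integral>x. indicator bx x * G x \<partial>lborel)"
 unfolding column_integral[OF F]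
proof (rule integral_mono[OF _ G])
 show "integrable lborel (%x. indicator {x. x $ 2 \<in> {c..<c + 4 * \<rho>}} x * F x)"
 proof -
  have "{x::real^2. x $ 2 \<in> {c..<c + 4 * \<rho>}} \<in> sets lborel" by measurable
  from integrable_real_mult_indicator[OF this F] show ?thesis by (simp add: mult.commute)
 qed
 show "indicator {x. x $ 2 \<in> {c..<c + 4 * \<rho>}} x * F x <= indicator bx x * G x" for x
 proof (cases "x \<in> bx")
  case True
  then show ?thesis using le[of x] G0[of x] by (auto simp: indicator_def)
 next
  case False
  then have "\<bar>x $ 1 - p $ 1\<bar> > 3 * \<rho> \<or> x $ 2 \<notin> {c..<c + 4 * \<rho>}"
   using \<rho> by (auto simp: mem_bx c_def abs_le_iff)
  then show ?thesis using False F0[of x] by (auto simp: indicator_def)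
 qed
qed

lemma tent_sh_ends:
 assumes "x \<in> S" shows "\<eta> (sh 0 x) = 0" "\<eta> (sh N x) = 0"
proof -
 have *: "c <= x $ 2" "x $ 2 < c + \<tau>" using assms by (auto simp: S_def)
 show "\<eta> (sh 0 x) = 0"
  by (rule tent_eq_0[OF \<rho>]) (use * tau_le \<rho> in \<open>auto simp: sh_nth c_def\<close>)
 have "real N * \<tau> = 4 * \<rho> - \<tau>" using N_tau by (simp add: algebra_simps)
 then have "\<bar>sh N x $ 2 - p $ 2\<bar> >= \<rho>"
  using * tau_le \<rho> by (simp add: sh_nth c_def)
 then show "\<eta> (sh N x) = 0"
  by (intro tent_eq_0[OF \<rho>]) simp
qed

lemma h_bounds:
 assumes "j < N"
 shows "0 <= h j x" "h j x <= max 0 (diff_quot \<tau> e2 v (sh j x))"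
proof -
 show "0 <= h j x"
  using isotonic_mono[OF assms] tau_pos by (simp add: h_def y_def)
 have "h j x <= max 0 (v (sh (Suc j) x) - v (sh j x)) / \<tau>"
  unfolding h_def y_def using isotonic_step_le[OF assms] tau_pos by (intro divide_right_mono) auto
 also have "\<dots> = max 0 (diff_quot \<tau> e2 v (sh j x))"
  using tau_pos by (simp add: diff_quot_def sh_Suc max_def divide_le_0_iff zero_le_divide_iff)
 finally show "h j x <= max 0 (diff_quot \<tau> e2 v (sh j x))" .
qed

lemma h_square_le: "j < N ==> (h j x)\<^sup>2 <= (diff_quot \<tau> e2 v (sh j x))\<^sup>2"
 using h_bounds[of j x] by (auto simp: abs_le_square_iff[symmetric] max_def split: if_splits)

text \<open>In a weak sense the regression has at least the slope \<beta>. Summation by parts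
  compares it with the affine profile \<open>L\<close>, at the price of their difference times the
  increments of the weight. Increasing sequences are their own regressions, so by contraction that
  difference is no larger in l2 than the difference of \<open>v\<close> and \<open>L\<close>. The
  parameter \<kappa> trades the l1 sum for an l2 sum.\<close>

lemma h_sum_lower:
 fixes \<beta> \<gamma> \<kappa> :: real
 assumes x: "x \<in> S" and \<beta>: "\<beta> >= 0" and \<kappa>: "\<kappa> > 0"
 defines "L \<equiv> %x::real^2. \<beta> * x $ 2 + \<gamma>"
 shows "\<beta> * (\<Sum>j<N. \<eta> (sh j x)) - 1 / \<rho> * indicator {x. \<bar>x $ 1 - p $ 1\<bar> <= \<rho>} x *
   (\<Sum>j\<le>N. \<kappa> / 2 + (v (sh j x) - L (sh j x))\<^sup>2 / (2 * \<kappa>)) <= (\<Sum>j<N. \<eta> (sh j x) * h j x)"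
proof -
 define Z :: real where "Z = indicator {x. \<bar>x $ 1 - p $ 1\<bar> <= \<rho>} x"
 have Z0: "Z >= 0" by (simp add: Z_def)
 have ends: "\<eta> (sh 0 x) = 0" "\<eta> (sh N x) = 0" using tent_sh_ends[OF x] by auto
 have monoL: "mono_upto N (%j. L (sh j x))"
  using \<beta> tau_pos by (auto simp: mono_upto_def L_def sh_nth algebra_simps)
 have dL: "L (sh (Suc j) x) - L (sh j x) = \<beta> * \<tau>" for j
  by (simp add: L_def sh_nth algebra_simps)
 define D where "D j = \<eta> (sh (Suc j) x) - \<eta> (sh j x)" for j
 have D: "\<bar>D j\<bar> <= \<tau> / \<rho> * Z" for j
 proof (cases "\<bar>x $ 1 - p $ 1\<bar> <= \<rho>")
  case True
  then show ?thesis
   using tent_Lipschitz_axis[OF \<rho>, of 2 p "sh j x" \<tau>] tau_pos by (simp add: D_def Z_def sh_Suc)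
 next
  case False
  then show ?thesis
   using tent_eq_0[OF \<rho>, of "sh (Suc j) x" p] tent_eq_0[OF \<rho>, of "sh j x" p] by (simp add: D_def Z_def sh_nth)
 qed
 have 1: "(\<Sum>j<N. \<eta> (sh j x) * (y (Suc j) x - y j x)) = - (\<Sum>j<N. D j * y (Suc j) x)"
  unfolding D_def by (rule summation_by_parts) (rule ends)+
 have 2: "(\<Sum>j<N. \<eta> (sh j x) * (L (sh (Suc j) x) - L (sh j x))) = - (\<Sum>j<N. D j * L (sh (Suc j) x))"
  unfolding D_def by (rule summation_by_parts[where z = "%j. L (sh j x)"]) (rule ends)+
 \<comment> \<open>\<open>L\<close> increases along the column because \<beta> is nonnegative, hence
   it is fixed by the regression.\<close>
 have contr: "(\<Sum>j\<le>N. (y j x - L (sh j x))\<^sup>2) <= (\<Sum>j\<le>N. (v (sh j x) - L (sh j x))\<^sup>2)"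
 proof -
  have "(\<Sum>j\<le>N. (y j x - L (sh j x))\<^sup>2) = (\<Sum>j\<le>N. (isotonic N (%i. v (sh i x)) j - isotonic N (%i. L (sh i x)) j)\<^sup>2)"
   by (intro sum.cong) (auto simp: y_def isotonic_of_mono[OF monoL])
  also have "\<dots> <= (\<Sum>j\<le>N. (v (sh j x) - L (sh j x))\<^sup>2)" by (rule isotonic_contraction)
  finally show ?thesis .
 qed
 have "(\<Sum>j<N. D j * (y (Suc j) x - L (sh (Suc j) x))) <= (\<Sum>j<N. \<tau> / \<rho> * Z * (\<kappa> / 2 + (y (Suc j) x - L (sh (Suc j) x))\<^sup>2 / (2 * \<kappa>)))"
 proof (rule sum_mono)
  fix j
  let ?t = "y (Suc j) x - L (sh (Suc j) x)"
  have "D j * ?t <= \<bar>D j\<bar> * \<bar>?t\<bar>" by (metis abs_ge_self abs_mult)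
  also have "\<dots> <= (\<tau> / \<rho> * Z) * (\<kappa> / 2 + ?t\<^sup>2 / (2 * \<kappa>))"
   using D[of j] abs_le_Young[OF \<kappa>, of ?t] by (intro mult_mono) (use order_trans[OF abs_ge_zero D] in auto)
  finally show "D j * ?t <= \<tau> / \<rho> * Z * (\<kappa> / 2 + ?t\<^sup>2 / (2 * \<kappa>))" .
 qed
 also have "\<dots> = \<tau> / \<rho> * Z * (\<Sum>j<N. \<kappa> / 2 + (y (Suc j) x - L (sh (Suc j) x))\<^sup>2 / (2 * \<kappa>))"
  by (simp add: sum_distrib_left)
 also have "\<dots> <= \<tau> / \<rho> * Z * (\<Sum>j\<le>N. \<kappa> / 2 + (y j x - L (sh j x))\<^sup>2 / (2 * \<kappa>))"
 proof (rule mult_left_mono)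
  have "(\<Sum>j\<le>N. \<kappa> / 2 + (y j x - L (sh j x))\<^sup>2 / (2 * \<kappa>)) = (\<kappa> / 2 + (y 0 x - L (sh 0 x))\<^sup>2 / (2 * \<kappa>)) + (\<Sum>j<N. \<kappa> / 2 + (y (Suc j) x - L (sh (Suc j) x))\<^sup>2 / (2 * \<kappa>))"
   unfolding lessThan_Suc_atMost[symmetric] by (rule sum.lessThan_Suc_shift)
  then show "(\<Sum>j<N. \<kappa> / 2 + (y (Suc j) x - L (sh (Suc j) x))\<^sup>2 / (2 * \<kappa>)) <= (\<Sum>j\<le>N. \<kappa> / 2 + (y j x - L (sh j x))\<^sup>2 / (2 * \<kappa>))"
   using \<kappa> by simp
 qed (use tau_pos \<rho> Z0 in auto)
 also have "\<dots> <= \<tau> / \<rho> * Z * (\<Sum>j\<le>N. \<kappa> / 2 + (v (sh j x) - L (sh j x))\<^sup>2 / (2 * \<kappa>))"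
 proof (rule mult_left_mono)
  show "(\<Sum>j\<le>N. \<kappa> / 2 + (y j x - L (sh j x))\<^sup>2 / (2 * \<kappa>)) <= (\<Sum>j\<le>N. \<kappa> / 2 + (v (sh j x) - L (sh j x))\<^sup>2 / (2 * \<kappa>))"
   unfolding sum.distrib sum_divide_distrib[symmetric]
   using contr \<kappa> by (intro add_left_mono divide_right_mono) auto
 qed (use tau_pos \<rho> Z0 in auto)
 finally have 3: "(\<Sum>j<N. D j * (y (Suc j) x - L (sh (Suc j) x))) <= \<tau> * (1 / \<rho> * Z * (\<Sum>j\<le>N. \<kappa> / 2 + (v (sh j x) - L (sh j x))\<^sup>2 / (2 * \<kappa>)))"
  by simp
 have 4: "(\<Sum>j<N. \<eta> (sh j x) * (y (Suc j) x - y j x)) = \<tau> * (\<Sum>j<N. \<eta> (sh j x) * h j x)"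
  using tau_pos by (simp add: h_def sum_distrib_left)
 have 5: "(\<Sum>j<N. \<eta> (sh j x) * (L (sh (Suc j) x) - L (sh j x))) = \<tau> * (\<beta> * (\<Sum>j<N. \<eta> (sh j x)))"
  unfolding dL by (simp add: sum_distrib_left mult_ac)
 have "(\<Sum>j<N. D j * (y (Suc j) x - L (sh (Suc j) x))) = \<tau> * (\<beta> * (\<Sum>j<N. \<eta> (sh j x))) - \<tau> * (\<Sum>j<N. \<eta> (sh j x) * h j x)"
  using 1 2 4 5 by (simp add: right_diff_distrib sum_subtractf)
 with 3 have "\<tau> * (\<beta> * (\<Sum>j<N. \<eta> (sh j x)) - 1 / \<rho> * Z * (\<Sum>j\<le>N. \<kappa> / 2 + (v (sh j x) - L (sh j x))\<^sup>2 / (2 * \<kappa>))) <= \<tau> * (\<Sum>j<N. \<eta> (sh j x) * h j x)"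
  by (simp add: right_diff_distrib)
 then show ?thesis
  using tau_pos unfolding Z_def by (simp only: mult_le_cancel_left_pos)
qed

end

lemma diff_quot_measurable [measurable]:
 assumes [measurable]: "f \<in> borel_measurable borel"
 shows "diff_quot \<tau> e f \<in> borel_measurable borel"
 unfolding diff_quot_def[abs_def] by measurable

lemma diff_quot_square_integrable:
 assumes [measurable]: "f \<in> borel_measurable borel" and f2: "integrable lborel (%x. (f x)\<^sup>2)"
 shows "integrable lborel (%x. (diff_quot \<tau> e f x)\<^sup>2)"
proof -
 have "integrable lborel (%x. (f (x + \<tau> *\<^sub>R e))\<^sup>2)" by (rule integrable_translate[OF f2])
 then have "integrable lborel (%x. (f (x + \<tau> *\<^sub>R e) - f x)\<^sup>2)"
  by (intro integrable_add_squares(2) f2) auto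
 then show ?thesis by (simp add: diff_quot_def power_divide)
qed

lemma integrable_mult_bounded:
 fixes f b :: "'a => real"
 assumes f: "integrable M f" and [measurable]: "b \<in> borel_measurable M" and b: "!!x. \<bar>b x\<bar> <= 1"
 shows "integrable M (%x. b x * f x)"
proof (rule Bochner_Integration.integrable_bound[OF f])
 have [measurable]: "f \<in> borel_measurable M" using f by auto
 show "(%x. b x * f x) \<in> borel_measurable M" by measurable
 show "AE x in M. norm (b x * f x) <= norm (f x)"
  using b by (auto simp: abs_mult intro!: mult_left_le_one_le)
qed

context column_lattice
begin

text \<open>\<open>Ka\<close> collects the errors in \<open>r\<close> at a lattice point,
  \<open>Kb\<close> those in \<open>v\<close> at its left neighbour. The weight \<kappa> belongs to
  the one product with a factor that is bounded but not small, the vertical slope of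
  \<open>v\<close>; all other terms are small by themselves.\<close>

definition Ka :: "real => real^2 => real" where
 "Ka \<kappa> x = 1 / (2 * \<rho>) * ((r x)\<^sup>2 / \<kappa>) + 1/2 * (diff_quot \<tau> e2 r x)\<^sup>2 + 1 / (2 * \<rho>) * (r x)\<^sup>2"

definition Kb :: "real => real^2 => real" where
 "Kb \<kappa> x = 1 / (2 * \<rho>) * (\<kappa> * (diff_quot \<tau> e2 v x)\<^sup>2) + (1/2 + 1 / (2 * \<rho>)) * (diff_quot \<tau> e1 v x)\<^sup>2"

text \<open>The half-width 2\<rho> covers the support of the tent and its horizontal shift by
  \<tau>.\<close>

definition Z2 :: "real^2 => real" where
 "Z2 x = indicator {x. \<bar>x $ 1 - p $ 1\<bar> <= 2 * \<rho>} x"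

text \<open>The discrete form of the two integrations by parts. The horizontal difference of weight
  times \<open>h\<close> splits by the product rule. One part has the increment of the weight
  against \<open>r\<close>. In the other, the horizontal difference of \<open>h\<close> is a
  vertical difference of \<open>z\<close>, and summation by parts along the column moves it onto
  \<open>r\<close>. What remains are products of the small vertical slope of \<open>r\<close>, or of
  \<open>r\<close> itself, with \<open>z\<close>.\<close>

lemma shift_term_pointwise:
 assumes x: "x \<in> S" and \<kappa>: "\<kappa> > 0"
 shows "- (\<Sum>j\<le>N. Z2 (sh j x) * (Ka \<kappa> (sh j x) + Kb \<kappa> (sh j x - \<tau> *\<^sub>R e1)))
  <= (\<Sum>j<N. r (sh j x) * ((\<eta> (sh j (x - \<tau> *\<^sub>R e1)) * h j (x - \<tau> *\<^sub>R e1) - \<eta> (sh j x) * h j x) / \<tau>))"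
proof (cases "\<bar>x $ 1 - p $ 1\<bar> <= 2 * \<rho>")
 case False
 have "\<eta> (sh j x) = 0" "\<eta> (sh j (x - \<tau> *\<^sub>R e1)) = 0" for j
  using False tau_pos tau_le \<rho> by (auto intro!: tent_eq_0[OF \<rho>] simp: sh_nth axis_def)
 moreover have "Z2 (sh j x) = 0" for j using False by (simp add: Z2_def sh_nth)
 ultimately show ?thesis by simp
next
 case True
 then have Z: "Z2 (sh j x) = 1" for j by (simp add: Z2_def sh_nth)
 define xm where "xm = x - \<tau> *\<^sub>R e1"
 have xm: "xm + \<tau> *\<^sub>R e1 = x" "sh j xm + \<tau> *\<^sub>R e1 = sh j x" "sh j xm = sh j x - \<tau> *\<^sub>R e1" for j
  by (auto simp: xm_def sh_def)
 \<comment> \<open>The horizontal difference quotient of the regression, from the column over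
   \<open>x\<close> to its left neighbour. Horizontal and vertical differences commute, which yields
   \<open>hz\<close>.\<close>
 define z where "z j = (y j xm - y j x) / \<tau>" for j
 define R where "R j = r (sh j x)" for j
 define H where "H j = \<eta> (sh j x)" for j
 define D2v where "D2v j = diff_quot \<tau> e2 v (sh j xm)" for j
 define D1v where "D1v j = diff_quot \<tau> e1 v (sh j xm)" for j
 define D2r where "D2r j = diff_quot \<tau> e2 r (sh j x)" for j
 have H: "0 <= H j" "H j <= 1" for j using tent_bounds[OF \<rho>] by (auto simp: H_def)
 have dH: "\<bar>H (Suc j) - H j\<bar> <= \<tau> / \<rho>" for j
  using tent_Lipschitz_axis[OF \<rho>, of 2 p "sh j x" \<tau>] tau_pos by (simp add: H_def sh_Suc)
 have dHm: "\<bar>\<eta> (sh j xm) - H j\<bar> <= \<tau> / \<rho>" for j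
  using tent_Lipschitz_axis[OF \<rho>, of 1 p "sh j xm" \<tau>] tau_pos by (simp add: H_def xm(2) abs_minus_commute)
 have hz: "h j xm - h j x = z (Suc j) - z j" for j
  by (simp add: h_def z_def diff_divide_distrib)
 \<comment> \<open>Contraction for two neighbouring columns: this is where the regression inherits a
   small horizontal slope from \<open>v\<close>.\<close>
 have z2: "(\<Sum>j\<le>N. (z j)\<^sup>2) <= (\<Sum>j\<le>N. (D1v j)\<^sup>2)"
 proof -
  have "(\<Sum>j\<le>N. (z j)\<^sup>2) = (\<Sum>j\<le>N. (y j xm - y j x)\<^sup>2) / \<tau>\<^sup>2"
   by (simp add: z_def power_divide sum_divide_distrib)
  also have "\<dots> <= (\<Sum>j\<le>N. (v (sh j xm) - v (sh j x))\<^sup>2) / \<tau>\<^sup>2"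
   unfolding y_def by (intro divide_right_mono isotonic_contraction) auto
  also have "\<dots> = (\<Sum>j\<le>N. (D1v j)\<^sup>2)"
   by (simp add: D1v_def diff_quot_def power_divide sum_divide_distrib xm(2) power2_commute)
  finally show ?thesis .
 qed
 \<comment> \<open>The increment of the weight costs 1/\<rho>, and \<open>h\<close> is replaced by
   the vertical quotient of \<open>v\<close>. That quotient does not tend to 0, so Young's
   inequality carries the weight \<kappa>.\<close>
 have A: "R j * ((\<eta> (sh j xm) - H j) / \<tau>) * h j xm >= - (1 / (2 * \<rho>) * ((R j)\<^sup>2 / \<kappa> + \<kappa> * (D2v j)\<^sup>2))" if "j < N" for j
 proof -
  have "\<bar>R j * ((\<eta> (sh j xm) - H j) / \<tau>) * h j xm\<bar> = \<bar>\<eta> (sh j xm) - H j\<bar> / \<tau> * \<bar>R j * h j xm\<bar>"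
   using tau_pos by (simp add: abs_mult)
  also have "\<dots> <= 1 / \<rho> * (((R j)\<^sup>2 / \<kappa> + \<kappa> * (h j xm)\<^sup>2) / 2)"
  proof (rule mult_mono)
   show "\<bar>\<eta> (sh j xm) - H j\<bar> / \<tau> <= 1 / \<rho>"
    using dHm[of j] tau_pos \<rho> by (simp add: field_simps)
  qed (use mult_le_Young[OF \<kappa>] \<rho> in auto)
  also have "\<dots> <= 1 / \<rho> * (((R j)\<^sup>2 / \<kappa> + \<kappa> * (D2v j)\<^sup>2) / 2)"
   using h_square_le[OF that, of xm] \<kappa> \<rho>
   by (intro mult_left_mono divide_right_mono add_left_mono) (auto simp: D2v_def)
  also have "\<dots> = 1 / (2 * \<rho>) * ((R j)\<^sup>2 / \<kappa> + \<kappa> * (D2v j)\<^sup>2)" by simp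
  finally show ?thesis by (subst minus_le_iff) (rule abs_le_D2)
 qed
 have B: "(\<Sum>j<N. (R j * H j) * (z (Suc j) - z j)) = - (\<Sum>j<N. (R (Suc j) * H (Suc j) - R j * H j) * z (Suc j))"
  by (rule summation_by_parts) (use tent_sh_ends[OF x] in \<open>auto simp: H_def\<close>)
 have C: "(R (Suc j) * H (Suc j) - R j * H j) * z (Suc j)
   <= \<tau> * (1/2 * (D2r j)\<^sup>2 + 1 / (2 * \<rho>) * (R j)\<^sup>2 + (1/2 + 1 / (2 * \<rho>)) * (z (Suc j))\<^sup>2)" for j
 proof -
  have D2r: "R (Suc j) - R j = \<tau> * D2r j"
   using tau_pos by (simp add: R_def D2r_def diff_quot_def sh_Suc)
  have "(R (Suc j) * H (Suc j) - R j * H j) * z (Suc j)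
   = H (Suc j) * ((R (Suc j) - R j) * z (Suc j)) + (H (Suc j) - H j) * (R j * z (Suc j))"
   by (simp add: algebra_simps)
  also have "\<dots> <= 1 * (\<tau> * \<bar>D2r j * z (Suc j)\<bar>) + \<tau> / \<rho> * \<bar>R j * z (Suc j)\<bar>"
  proof (rule add_mono)
   have "H (Suc j) * ((R (Suc j) - R j) * z (Suc j)) <= H (Suc j) * (\<tau> * \<bar>D2r j * z (Suc j)\<bar>)"
    unfolding D2r using H tau_pos by (intro mult_left_mono) (auto simp: mult.assoc)
   also have "\<dots> <= 1 * (\<tau> * \<bar>D2r j * z (Suc j)\<bar>)"
    using H tau_pos by (intro mult_right_mono) auto
   finally show "H (Suc j) * ((R (Suc j) - R j) * z (Suc j)) <= 1 * (\<tau> * \<bar>D2r j * z (Suc j)\<bar>)" .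
   have "(H (Suc j) - H j) * (R j * z (Suc j)) <= \<bar>H (Suc j) - H j\<bar> * \<bar>R j * z (Suc j)\<bar>"
    by (metis abs_ge_self abs_mult)
   also have "\<dots> <= \<tau> / \<rho> * \<bar>R j * z (Suc j)\<bar>"
    using dH by (intro mult_right_mono) auto
   finally show "(H (Suc j) - H j) * (R j * z (Suc j)) <= \<tau> / \<rho> * \<bar>R j * z (Suc j)\<bar>" .
  qed
  \<comment> \<open>Young's inequality with weight 1: here both factors of each product are
    small.\<close>
  also have "\<dots> <= 1 * (\<tau> * (((D2r j)\<^sup>2 / 1 + 1 * (z (Suc j))\<^sup>2) / 2)) + \<tau> / \<rho> * (((R j)\<^sup>2 / 1 + 1 * (z (Suc j))\<^sup>2) / 2)"
   using tau_pos \<rho> by (intro add_mono mult_left_mono mult_le_Young) auto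
  also have "\<dots> = \<tau> * (1/2 * (D2r j)\<^sup>2 + 1 / (2 * \<rho>) * (R j)\<^sup>2 + (1/2 + 1 / (2 * \<rho>)) * (z (Suc j))\<^sup>2)"
   using \<rho> by (simp add: field_simps)
  finally show ?thesis .
 qed
 have zS: "(\<Sum>j<N. (z (Suc j))\<^sup>2) <= (\<Sum>j\<le>N. (z j)\<^sup>2)"
 proof -
  have "(\<Sum>j\<le>N. (z j)\<^sup>2) = (z 0)\<^sup>2 + (\<Sum>j<N. (z (Suc j))\<^sup>2)"
   unfolding lessThan_Suc_atMost[symmetric] by (rule sum.lessThan_Suc_shift)
  then show ?thesis by simp
 qed
 have le: "(\<Sum>j<N. f j) <= (\<Sum>j\<le>N. f j)" if "!!j. 0 <= f j" for f :: "nat => real"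
  by (intro sum_mono2) (auto simp: that)
 have second: "(\<Sum>j<N. (R j * H j) * (z (Suc j) - z j)) / \<tau>
  >= - (\<Sum>j\<le>N. 1/2 * (D2r j)\<^sup>2 + 1 / (2 * \<rho>) * (R j)\<^sup>2 + (1/2 + 1 / (2 * \<rho>)) * (D1v j)\<^sup>2)"
 proof -
  have "(\<Sum>j<N. (R (Suc j) * H (Suc j) - R j * H j) * z (Suc j))
   <= (\<Sum>j<N. \<tau> * (1/2 * (D2r j)\<^sup>2 + 1 / (2 * \<rho>) * (R j)\<^sup>2 + (1/2 + 1 / (2 * \<rho>)) * (z (Suc j))\<^sup>2))"
   by (intro sum_mono C)
  also have "\<dots> = \<tau> * ((\<Sum>j<N. 1/2 * (D2r j)\<^sup>2 + 1 / (2 * \<rho>) * (R j)\<^sup>2) + (1/2 + 1 / (2 * \<rho>)) * (\<Sum>j<N. (z (Suc j))\<^sup>2))"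
   by (simp add: sum_distrib_left sum.distrib distrib_left)
  also have "\<dots> <= \<tau> * ((\<Sum>j\<le>N. 1/2 * (D2r j)\<^sup>2 + 1 / (2 * \<rho>) * (R j)\<^sup>2) + (1/2 + 1 / (2 * \<rho>)) * (\<Sum>j\<le>N. (D1v j)\<^sup>2))"
   using tau_pos \<rho> zS z2 by (intro mult_left_mono add_mono le order_trans[OF zS z2]) auto
  also have "\<dots> = \<tau> * (\<Sum>j\<le>N. 1/2 * (D2r j)\<^sup>2 + 1 / (2 * \<rho>) * (R j)\<^sup>2 + (1/2 + 1 / (2 * \<rho>)) * (D1v j)\<^sup>2)"
   by (simp add: sum_distrib_left sum.distrib)
  finally show ?thesis
   unfolding B using tau_pos by (simp add: pos_divide_le_eq mult.commute)
 qed
 have first: "(\<Sum>j<N. R j * ((\<eta> (sh j xm) - H j) / \<tau>) * h j xm) >= - (\<Sum>j\<le>N. 1 / (2 * \<rho>) * ((R j)\<^sup>2 / \<kappa> + \<kappa> * (D2v j)\<^sup>2))"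
 proof -
  have "- (\<Sum>j\<le>N. 1 / (2 * \<rho>) * ((R j)\<^sup>2 / \<kappa> + \<kappa> * (D2v j)\<^sup>2)) <= - (\<Sum>j<N. 1 / (2 * \<rho>) * ((R j)\<^sup>2 / \<kappa> + \<kappa> * (D2v j)\<^sup>2))"
   using \<rho> \<kappa> le by simp
  also have "\<dots> <= (\<Sum>j<N. R j * ((\<eta> (sh j xm) - H j) / \<tau>) * h j xm)"
   unfolding sum_negf[symmetric] using A by (intro sum_mono) auto
  finally show ?thesis .
 qed
 have "(\<Sum>j\<le>N. Z2 (sh j x) * (Ka \<kappa> (sh j x) + Kb \<kappa> (sh j x - \<tau> *\<^sub>R e1)))
  = (\<Sum>j\<le>N. 1 / (2 * \<rho>) * ((R j)\<^sup>2 / \<kappa> + \<kappa> * (D2v j)\<^sup>2))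
   + (\<Sum>j\<le>N. 1/2 * (D2r j)\<^sup>2 + 1 / (2 * \<rho>) * (R j)\<^sup>2 + (1/2 + 1 / (2 * \<rho>)) * (D1v j)\<^sup>2)"
  unfolding sum.distrib[symmetric] Z Ka_def Kb_def R_def D2v_def D1v_def D2r_def xm(3)
  by (intro sum.cong) (auto simp: algebra_simps)
 moreover have "(\<Sum>j<N. r (sh j x) * ((\<eta> (sh j xm) * h j xm - \<eta> (sh j x) * h j x) / \<tau>))
  = (\<Sum>j<N. R j * ((\<eta> (sh j xm) - H j) / \<tau>) * h j xm) + (\<Sum>j<N. (R j * H j) * (z (Suc j) - z j)) / \<tau>"
  unfolding sum_divide_distrib sum.distrib[symmetric] hz[symmetric] R_def[symmetric] H_def[symmetric]
  using tau_pos by (intro sum.cong) (auto simp: field_simps)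
 ultimately show ?thesis
  using first second unfolding xm_def[symmetric] by linarith
qed

lemma h_meas:
 assumes "j < N" shows "h j \<in> borel_measurable borel"
proof -
 have [measurable]: "y j \<in> borel_measurable borel" "y (Suc j) \<in> borel_measurable borel"
  using assms by (auto intro: y_meas)
 show ?thesis unfolding h_def[abs_def] by measurable
qed

lemma Z2_meas [measurable]: "Z2 \<in> borel_measurable borel"
 unfolding Z2_def[abs_def] by measurable

lemma Z2_abs: "\<bar>Z2 x\<bar> <= 1" "0 <= Z2 x" by (auto simp: Z2_def)

lemma Ka_integrable: "integrable lborel (Ka \<kappa>)" and Kb_integrable: "integrable lborel (Kb \<kappa>)"
 unfolding Ka_def[abs_def] Kb_def[abs_def]
 by (intro Bochner_Integration.integrable_add integrable_mult_right integrable_divide r2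
   diff_quot_square_integrable[OF r_meas r2] diff_quot_square_integrable[OF v_meas v2])+

lemma K_nonneg: "\<kappa> > 0 ==> 0 <= Ka \<kappa> x" "\<kappa> > 0 ==> 0 <= Kb \<kappa> x"
 unfolding Ka_def Kb_def using \<rho> by auto

lemma h_square_integrable: "j < N ==> integrable lborel (%x. (h j x)\<^sup>2)"
proof (rule Bochner_Integration.integrable_bound[OF integrable_shift[OF diff_quot_square_integrable[OF v_meas v2]]])
 assume j: "j < N"
 have [measurable]: "h j \<in> borel_measurable borel" using h_meas[OF j] .
 show "(%x. (h j x)\<^sup>2) \<in> borel_measurable lborel" by measurable
 show "AE x in lborel. norm ((h j x)\<^sup>2) <= norm ((diff_quot \<tau> e2 v (sh j x))\<^sup>2)"
  using h_square_le[OF j] by simp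
qed

lemma indicator_S_integrable: "integrable lborel f ==> integrable lborel (%x. indicator S x * f x)"
 for f :: "real^2 => real"
 by (rule integrable_mult_bounded) (auto simp: indicator_def)

lemma bx_integrable: "integrable lborel f ==> integrable lborel (%x. indicator bx x * f x)"
 for f :: "real^2 => real"
 by (rule integrable_mult_bounded) (auto simp: indicator_def)

text \<open>\<open>S\<close> is invariant under horizontal shifts, so translating the integral moves
  the difference quotient from \<open>r\<close> onto weight times \<open>h\<close>; the pointwise
  estimate then applies column by column.\<close>

lemma shift_term_integral:
 assumes \<kappa>: "\<kappa> > 0"
 shows "integrable lborel (%x. indicator S x * (\<Sum>j<N. \<eta> (sh j x) * diff_quot \<tau> e1 r (sh j x) * h j x))" (is "integrable _ ?f")
  and "- ((\<integral>x. indicator bx x * Ka \<kappa> x \<partial>lborel) + (\<integral>x. indicator bx x * Kb \<kappa> x \<partial>lborel)) <= (\<integral>x. indicator S x * (\<Sum>j<N. \<eta> (sh j x) * diff_quot \<tau> e1 r (sh j x) * h j x) \<partial>lborel)"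
proof -
 define q where "q j x = \<eta> (sh j x) * h j x" for j x
 have qm: "q j \<in> borel_measurable borel" if "j < N" for j
 proof -
  have [measurable]: "h j \<in> borel_measurable borel" using h_meas[OF that] .
  show ?thesis unfolding q_def[abs_def] by measurable
 qed
 have q2: "integrable lborel (%x. (q j x)\<^sup>2)" if "j < N" for j
 proof -
  have "integrable lborel (%x. (\<eta> (sh j x))\<^sup>2 * (h j x)\<^sup>2)"
   by (rule integrable_mult_bounded[OF h_square_integrable[OF that]])
    (use tent_bounds[OF \<rho>] in \<open>auto simp: abs_square_le_1\<close>)
  then show ?thesis by (simp add: q_def power_mult_distrib)
 qed
 have rs2: "integrable lborel (%x. (r (sh j x))\<^sup>2)" for j by (rule integrable_shift[OF r2])
 have rs2': "integrable lborel (%x. (r (sh j x + \<tau> *\<^sub>R e1))\<^sup>2)" for j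
  using integrable_translate[OF rs2[of j], of "\<tau> *\<^sub>R e1"] by (simp add: sh_add)
 have i1: "integrable lborel (%x. indicator S x * (r (sh j x) * q j x))" if "j < N" for j
  by (intro indicator_S_integrable integrable_mult_squares rs2 q2 that) (use qm[OF that] in auto)
 have i2: "integrable lborel (%x. indicator S x * (r (sh j x + \<tau> *\<^sub>R e1) * q j x))" if "j < N" for j
  by (intro indicator_S_integrable integrable_mult_squares rs2' q2 that) (use qm[OF that] in auto)
 have eq2: "indicator S (x + - (\<tau> *\<^sub>R e1)) * (r (sh j (x + - (\<tau> *\<^sub>R e1)) + \<tau> *\<^sub>R e1) * q j (x + - (\<tau> *\<^sub>R e1)))
  = indicator S x * (r (sh j x) * q j (x - \<tau> *\<^sub>R e1))" for j x
  by (simp add: S_shift sh_diff)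
 have i3: "integrable lborel (%x. indicator S x * (r (sh j x) * q j (x - \<tau> *\<^sub>R e1)))" if "j < N" for j
  using integrable_translate[OF i2[OF that], of "- (\<tau> *\<^sub>R e1)"] unfolding eq2 .
 have e3: "(\<integral>x. indicator S x * (r (sh j x + \<tau> *\<^sub>R e1) * q j x) \<partial>lborel) = (\<integral>x. indicator S x * (r (sh j x) * q j (x - \<tau> *\<^sub>R e1)) \<partial>lborel)" if "j < N" for j
  using integral_translate[of "%x. indicator S x * (r (sh j x + \<tau> *\<^sub>R e1) * q j x)" "- (\<tau> *\<^sub>R e1)"] qm[OF that] unfolding eq2 by simp
 have f: "?f x = (\<Sum>j<N. (indicator S x * (r (sh j x + \<tau> *\<^sub>R e1) * q j x) - indicator S x * (r (sh j x) * q j x)) / \<tau>)" for x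
  unfolding sum_distrib_left by (intro sum.cong) (auto simp: diff_quot_def q_def field_simps)
 show "integrable lborel ?f"
  unfolding f by (intro Bochner_Integration.integrable_sum integrable_divide Bochner_Integration.integrable_diff i1 i2) auto
 define g where "g x = indicator S x * (\<Sum>j<N. r (sh j x) * ((q j (x - \<tau> *\<^sub>R e1) - q j x) / \<tau>))" for x
 have g: "g x = (\<Sum>j<N. (indicator S x * (r (sh j x) * q j (x - \<tau> *\<^sub>R e1)) - indicator S x * (r (sh j x) * q j x)) / \<tau>)" for x
  unfolding g_def sum_distrib_left by (intro sum.cong) (auto simp: field_simps)
 have gi: "integrable lborel g"
  unfolding g by (intro Bochner_Integration.integrable_sum integrable_divide Bochner_Integration.integrable_diff i1 i3) auto
 have "(\<integral>x. ?f x \<partial>lborel) = (\<Sum>j<N. ((\<integral>x. indicator S x * (r (sh j x + \<tau> *\<^sub>R e1) * q j x) \<partial>lborel) - (\<integral>x. indicator S x * (r (sh j x) * q j x) \<partial>lborel)) / \<tau>)"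
  unfolding f using i1 i2 by (subst Bochner_Integration.integral_sum) auto
 also have "\<dots> = (\<integral>x. g x \<partial>lborel)"
  unfolding g using i1 i3 e3 by (subst Bochner_Integration.integral_sum) auto
 finally have fg: "(\<integral>x. ?f x \<partial>lborel) = (\<integral>x. g x \<partial>lborel)" .
 define A where "A x = Z2 x * Ka \<kappa> x" for x
 \<comment> \<open>\<open>Kb\<close> enters at the left neighbour while the cutoff sits at the point
   itself. Attaching the shift to the cutoff makes the term a translate of \<open>B\<close>, with
   the same integral.\<close>
 define B where "B x = Z2 (x + \<tau> *\<^sub>R e1) * Kb \<kappa> x" for x
 have Ai: "integrable lborel A"
  unfolding A_def by (rule integrable_mult_bounded[OF Ka_integrable]) (auto intro: Z2_abs)
 have Bi: "integrable lborel B"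
  unfolding B_def by (rule integrable_mult_bounded[OF Kb_integrable]) (auto intro: Z2_abs)
 have Bi': "integrable lborel (%x. B (x - \<tau> *\<^sub>R e1))"
  using integrable_translate[OF Bi, of "- (\<tau> *\<^sub>R e1)"] by simp
 have ciA: "(\<integral>x. indicator S x * (\<Sum>j\<le>N. A (sh j x)) \<partial>lborel) <= (\<integral>x. indicator bx x * Ka \<kappa> x \<partial>lborel)"
 proof (rule column_integral_le[OF Ai bx_integrable[OF Ka_integrable]])
  show "A x <= Ka \<kappa> x" for x
   unfolding A_def by (rule mult_left_le_one_le) (use K_nonneg \<kappa> Z2_abs in \<open>auto simp: Z2_def\<close>)
 qed (use \<rho> K_nonneg \<kappa> in \<open>auto simp: A_def Z2_def\<close>)
 have ciB: "(\<integral>x. indicator S x * (\<Sum>j\<le>N. B (sh j x)) \<partial>lborel) <= (\<integral>x. indicator bx x * Kb \<kappa> x \<partial>lborel)"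
 proof (rule column_integral_le[OF Bi bx_integrable[OF Kb_integrable]])
  show "B x <= Kb \<kappa> x" for x
   unfolding B_def by (rule mult_left_le_one_le) (use K_nonneg \<kappa> Z2_abs in \<open>auto simp: Z2_def\<close>)
  show "B x = 0" if "3 * \<rho> < \<bar>x $ 1 - p $ 1\<bar>" for x
  proof -
   have "(x + \<tau> *\<^sub>R e1) $ 1 = x $ 1 + \<tau>" by (simp add: axis_def)
   then have "\<not> \<bar>(x + \<tau> *\<^sub>R e1) $ 1 - p $ 1\<bar> <= 2 * \<rho>"
    using that tau_pos tau_le by linarith
   then show ?thesis by (simp add: B_def Z2_def)
  qed
 qed (use K_nonneg \<kappa> in auto)
 have shB: "(\<integral>x. indicator S x * (\<Sum>j\<le>N. B (sh j x - \<tau> *\<^sub>R e1)) \<partial>lborel) = (\<integral>x. indicator S x * (\<Sum>j\<le>N. B (sh j x)) \<partial>lborel)"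
 proof -
  have [measurable]: "B \<in> borel_measurable borel" using Bi by auto
  have eq: "indicator S (x + - (\<tau> *\<^sub>R e1)) * (\<Sum>j\<le>N. B (sh j (x + - (\<tau> *\<^sub>R e1)))) = indicator S x * (\<Sum>j\<le>N. B (sh j x - \<tau> *\<^sub>R e1))" for x
   by (simp add: S_shift sh_diff)
  show ?thesis
   using integral_translate[of "%x. indicator S x * (\<Sum>j\<le>N. B (sh j x))" "- (\<tau> *\<^sub>R e1)"] unfolding eq by simp
 qed
 have pw: "- (indicator S x * (\<Sum>j\<le>N. A (sh j x)) + indicator S x * (\<Sum>j\<le>N. B (sh j x - \<tau> *\<^sub>R e1))) <= g x" for x
 proof (cases "x \<in> S")
  case True
  have "(\<Sum>j\<le>N. A (sh j x)) + (\<Sum>j\<le>N. B (sh j x - \<tau> *\<^sub>R e1)) = (\<Sum>j\<le>N. Z2 (sh j x) * (Ka \<kappa> (sh j x) + Kb \<kappa> (sh j x - \<tau> *\<^sub>R e1)))"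
   unfolding sum.distrib[symmetric] by (intro sum.cong) (auto simp: A_def B_def algebra_simps)
  then show ?thesis
   using shift_term_pointwise[OF True \<kappa>] True by (simp add: g_def q_def)
 qed (simp add: g_def)
 have "- ((\<integral>x. indicator S x * (\<Sum>j\<le>N. A (sh j x)) \<partial>lborel) + (\<integral>x. indicator S x * (\<Sum>j\<le>N. B (sh j x - \<tau> *\<^sub>R e1)) \<partial>lborel))
  = (\<integral>x. - (indicator S x * (\<Sum>j\<le>N. A (sh j x)) + indicator S x * (\<Sum>j\<le>N. B (sh j x - \<tau> *\<^sub>R e1))) \<partial>lborel)"
  using column_integral(1)[OF Ai] column_integral(1)[OF Bi'] by simp
 also have "\<dots> <= (\<integral>x. g x \<partial>lborel)"
  using column_integral(1)[OF Ai] column_integral(1)[OF Bi'] pw gi by (intro integral_mono) auto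
 finally show "- ((\<integral>x. indicator bx x * Ka \<kappa> x \<partial>lborel) + (\<integral>x. indicator bx x * Kb \<kappa> x \<partial>lborel)) <= (\<integral>x. indicator S x * (\<Sum>j<N. \<eta> (sh j x) * diff_quot \<tau> e1 r (sh j x) * h j x) \<partial>lborel)"
  using ciA ciB shB unfolding fg by linarith
qed

lemma tent_integrable: "integrable lborel \<eta>"
proof (rule Bochner_Integration.integrable_bound)
 show "integrable lborel (indicat_real bx)"
  unfolding bx_def by (intro integrable_real_indicator) (auto simp: emeasure_lborel_cbox_eq)
 show "AE x in lborel. norm (\<eta> x) <= norm (indicat_real bx x)"
 proof (rule AE_I2)
  fix x
  have "\<eta> x = 0" if "x \<notin> bx"
   by (rule tent_eq_0[OF \<rho>]) (use that \<rho> in \<open>auto simp: mem_bx\<close>)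
  then show "norm (\<eta> x) <= norm (indicat_real bx x)"
   using tent_bounds[OF \<rho>, of p x] by (auto simp: indicator_def)
 qed
qed simp

lemma tent_slab:
 "indicator {x. x $ 2 \<in> {c..<c + 4 * \<rho>}} x * (\<eta> x * a) = \<eta> x * (a::real)"
proof (cases "x $ 2 \<in> {c..<c + 4 * \<rho>}")
 case False
 have "\<eta> x = 0" by (rule tent_eq_0[OF \<rho>]) (use False \<rho> in \<open>auto simp: c_def\<close>)
 then show ?thesis by simp
qed simp

text \<open>Both sides estimate the sum of weight times (\<alpha> + horizontal quotient of
  \<open>r\<close>) times \<open>h\<close>. From above, \<open>h\<close> is at most the positive
  part of the vertical quotient of \<open>v\<close>. From below, the \<alpha>-part is handled by
  \<open>h_sum_lower\<close> and the rest by \<open>shift_term_integral\<close>. The regression has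
  disappeared from the final inequality.\<close>

theorem lattice_inequality:
 assumes \<alpha>: "\<alpha> >= 0" and \<beta>: "\<beta> >= 0" and \<kappa>: "\<kappa> > 0"
 shows "\<alpha> * \<beta> * (\<integral>x. \<eta> x \<partial>lborel) \<le>
  (\<integral>x. \<eta> x * (\<bar>\<alpha> + diff_quot \<tau> e1 r x\<bar> * max 0 (diff_quot \<tau> e2 v x)) \<partial>lborel)
  + \<alpha> / \<rho> * (\<integral>x. indicator bx x * (\<kappa> / 2 + (v x - (\<beta> * x $ 2 + \<gamma>))\<^sup>2 / (2 * \<kappa>)) \<partial>lborel)
  + ((\<integral>x. indicator bx x * Ka \<kappa> x \<partial>lborel) + (\<integral>x. indicator bx x * Kb \<kappa> x \<partial>lborel))"
proof -
 define L where "L x = \<beta> * x $ 2 + \<gamma>" for x :: "real^2"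
 have [measurable]: "L \<in> borel_measurable borel" unfolding L_def[abs_def] by measurable
 define P where "P x = \<eta> x * (\<bar>\<alpha> + diff_quot \<tau> e1 r x\<bar> * max 0 (diff_quot \<tau> e2 v x))" for x
 define Y where "Y x = indicator {x. \<bar>x $ 1 - p $ 1\<bar> <= \<rho>} x * (indicator bx x * (\<kappa> / 2 + (v x - L x)\<^sup>2 / (2 * \<kappa>)))" for x
 have bxi: "integrable lborel (indicat_real bx)"
  unfolding bx_def by (intro integrable_real_indicator) (auto simp: emeasure_lborel_cbox_eq)
 have Li: "integrable lborel (%x. (indicator bx x * L x)\<^sup>2)"
 proof (rule Bochner_Integration.integrable_bound)
  define C where "C = \<beta> * (\<bar>p $ 2\<bar> + 3 * \<rho>) + \<bar>\<gamma>\<bar>"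
  show "integrable lborel (%x. indicat_real bx x * C\<^sup>2)" using bxi by simp
  show "AE x in lborel. norm ((indicator bx x * L x)\<^sup>2) <= norm (indicat_real bx x * C\<^sup>2)"
  proof (rule AE_I2)
   fix x :: "real^2"
   have "\<bar>L x\<bar> <= C" if "x \<in> bx"
   proof -
    have "\<bar>x $ 2\<bar> <= \<bar>p $ 2\<bar> + 3 * \<rho>" using that by (auto simp: mem_bx)
    then have "\<bar>\<beta> * x $ 2\<bar> <= \<beta> * (\<bar>p $ 2\<bar> + 3 * \<rho>)" using \<beta> by (simp add: abs_mult mult_left_mono)
    then show ?thesis unfolding L_def C_def by linarith
   qed
   then show "norm ((indicator bx x * L x)\<^sup>2) <= norm (indicat_real bx x * C\<^sup>2)"
    using power_mono[of "\<bar>L x\<bar>" C 2] by (auto simp: indicator_def)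
  qed
 qed simp
 have vLi: "integrable lborel (%x. indicator bx x * (v x - L x)\<^sup>2)"
 proof -
  have "integrable lborel (%x. indicator bx x * (v x)\<^sup>2)" by (rule bx_integrable[OF v2])
  moreover have "(indicator bx x * v x)\<^sup>2 = indicator bx x * (v x)\<^sup>2" for x by (simp add: indicator_def)
  ultimately have "integrable lborel (%x. (indicator bx x * v x - indicator bx x * L x)\<^sup>2)"
   using Li by (intro integrable_add_squares(2)) auto
  moreover have "(indicator bx x * v x - indicator bx x * L x)\<^sup>2 = indicator bx x * (v x - L x)\<^sup>2" for x
   by (simp add: indicator_def)
  ultimately show ?thesis by simp
 qed
 have Gi: "integrable lborel (%x. indicator bx x * (\<kappa> / 2 + (v x - L x)\<^sup>2 / (2 * \<kappa>)))"
 proof -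
  have "integrable lborel (%x. indicator bx x * (\<kappa> / 2) + indicator bx x * (v x - L x)\<^sup>2 / (2 * \<kappa>))"
   using bxi vLi by (intro Bochner_Integration.integrable_add integrable_divide integrable_mult_left) auto
  then show ?thesis by (simp add: distrib_left)
 qed
 have Yi: "integrable lborel Y"
  unfolding Y_def by (rule integrable_mult_bounded[OF Gi]) (auto simp: indicator_def)
 have Pi: "integrable lborel P"
 proof -
  have 1: "integrable lborel (%x. (\<eta> x * \<bar>\<alpha> + diff_quot \<tau> e1 r x\<bar>)\<^sup>2)"
  proof -
   have "integrable lborel (%x. \<eta> x * \<eta> x)"
    by (rule integrable_mult_bounded[OF tent_integrable]) (use tent_bounds[OF \<rho>] in auto)
   then have "integrable lborel (%x. (\<eta> x * \<alpha>)\<^sup>2)" by (simp add: power_mult_distrib power2_eq_square[of "\<eta> _"])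
   moreover have "integrable lborel (%x. (\<eta> x)\<^sup>2 * (diff_quot \<tau> e1 r x)\<^sup>2)"
    by (rule integrable_mult_bounded[OF diff_quot_square_integrable[OF r_meas r2]])
     (use tent_bounds[OF \<rho>] in \<open>auto simp: abs_square_le_1\<close>)
   ultimately have "integrable lborel (%x. (\<eta> x * \<alpha> + \<eta> x * diff_quot \<tau> e1 r x)\<^sup>2)"
    by (intro integrable_add_squares(1)) (auto simp: power_mult_distrib)
   moreover have "(\<eta> x * \<alpha> + \<eta> x * diff_quot \<tau> e1 r x)\<^sup>2 = (\<eta> x * \<bar>\<alpha> + diff_quot \<tau> e1 r x\<bar>)\<^sup>2" for x
    by (simp add: power_mult_distrib distrib_left[symmetric])
   ultimately show ?thesis by simp
  qed
  have 2: "integrable lborel (%x. (max 0 (diff_quot \<tau> e2 v x))\<^sup>2)"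
   by (rule Bochner_Integration.integrable_bound[OF diff_quot_square_integrable[OF v_meas v2, of \<tau> e2]])
    (auto simp: max_def)
  have "integrable lborel (%x. (\<eta> x * \<bar>\<alpha> + diff_quot \<tau> e1 r x\<bar>) * max 0 (diff_quot \<tau> e2 v x))"
   by (rule integrable_mult_squares[OF _ _ 1 2]) auto
  then show ?thesis unfolding P_def by (simp add: mult.assoc)
 qed
 define f where "f x = indicator S x * (\<Sum>j<N. \<eta> (sh j x) * diff_quot \<tau> e1 r (sh j x) * h j x)" for x
 have fi: "integrable lborel f" and fl: "- ((\<integral>x. indicator bx x * Ka \<kappa> x \<partial>lborel) + (\<integral>x. indicator bx x * Kb \<kappa> x \<partial>lborel)) <= (\<integral>x. f x \<partial>lborel)"
  using shift_term_integral[OF \<kappa>] unfolding f_def by auto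
 have pw: "\<alpha> * \<beta> * (indicator S x * (\<Sum>j\<le>N. \<eta> (sh j x))) - \<alpha> / \<rho> * (indicator S x * (\<Sum>j\<le>N. Y (sh j x))) + f x
  <= indicator S x * (\<Sum>j\<le>N. P (sh j x))" for x
 proof (cases "x \<in> S")
  case True
  define Z :: real where "Z = indicator {x. \<bar>x $ 1 - p $ 1\<bar> <= \<rho>} x"
  have tN: "\<eta> (sh N x) = 0" using tent_sh_ends[OF True] by auto
  have tN': "(\<Sum>j\<le>N. \<eta> (sh j x)) = (\<Sum>j<N. \<eta> (sh j x))"
   unfolding lessThan_Suc_atMost[symmetric] using tN by simp
  have PN: "(\<Sum>j\<le>N. P (sh j x)) = (\<Sum>j<N. P (sh j x))"
   unfolding lessThan_Suc_atMost[symmetric] using tN by (simp add: P_def)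
  have slab: "sh j x \<in> bx" if "j <= N" "\<bar>x $ 1 - p $ 1\<bar> <= \<rho>" for j
  proof -
   have "c <= x $ 2" "x $ 2 < c + \<tau>" using True by (auto simp: S_def)
   moreover have "0 <= real j * \<tau>" "real j * \<tau> <= real N * \<tau>" using that tau_pos by (auto intro: mult_right_mono)
   moreover have "real N * \<tau> + \<tau> = 4 * \<rho>" using N_tau by (simp add: algebra_simps)
   ultimately have "\<bar>x $ 2 + real j * \<tau> - p $ 2\<bar> <= 3 * \<rho>"
    using \<rho> unfolding c_def abs_le_iff by linarith
   then show ?thesis
    using that \<rho> unfolding mem_bx sh_nth by simp
  qed
  have Ysum: "(\<Sum>j\<le>N. Y (sh j x)) = Z * (\<Sum>j\<le>N. \<kappa> / 2 + (v (sh j x) - L (sh j x))\<^sup>2 / (2 * \<kappa>))"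
  proof (cases "\<bar>x $ 1 - p $ 1\<bar> <= \<rho>")
   case True
   have "(\<Sum>j\<le>N. Y (sh j x)) = (\<Sum>j\<le>N. \<kappa> / 2 + (v (sh j x) - L (sh j x))\<^sup>2 / (2 * \<kappa>))"
    by (intro sum.cong) (use True slab in \<open>auto simp: Y_def sh_nth\<close>)
   then show ?thesis using True by (simp add: Z_def)
  qed (simp add: Y_def Z_def sh_nth)
  \<comment> \<open>Nonnegativity of \<open>h\<close> permits passing to the absolute value of the
    first factor.\<close>
  have "(\<Sum>j<N. \<eta> (sh j x) * (\<alpha> + diff_quot \<tau> e1 r (sh j x)) * h j x) <= (\<Sum>j<N. P (sh j x))"
  proof (rule sum_mono)
   fix j assume "j \<in> {..<N}"
   then have j: "j < N" by simp
   have "(\<alpha> + diff_quot \<tau> e1 r (sh j x)) * h j x <= \<bar>\<alpha> + diff_quot \<tau> e1 r (sh j x)\<bar> * max 0 (diff_quot \<tau> e2 v (sh j x))"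
    using h_bounds[OF j, of x] by (intro mult_mono) auto
   then show "\<eta> (sh j x) * (\<alpha> + diff_quot \<tau> e1 r (sh j x)) * h j x <= P (sh j x)"
    unfolding P_def mult.assoc using tent_bounds[OF \<rho>] by (intro mult_left_mono) auto
  qed
  moreover have "(\<Sum>j<N. \<eta> (sh j x) * (\<alpha> + diff_quot \<tau> e1 r (sh j x)) * h j x) = \<alpha> * (\<Sum>j<N. \<eta> (sh j x) * h j x) + f x"
   using True unfolding f_def by (simp add: sum_distrib_left sum.distrib[symmetric] algebra_simps)
  moreover have "\<alpha> * (\<beta> * (\<Sum>j<N. \<eta> (sh j x)) - 1 / \<rho> * Z * (\<Sum>j\<le>N. \<kappa> / 2 + (v (sh j x) - L (sh j x))\<^sup>2 / (2 * \<kappa>))) <= \<alpha> * (\<Sum>j<N. \<eta> (sh j x) * h j x)"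
   using h_sum_lower[OF True \<beta> \<kappa>, of \<gamma>] \<alpha> unfolding Z_def L_def by (intro mult_left_mono) auto
  moreover have "\<alpha> * (\<beta> * (\<Sum>j<N. \<eta> (sh j x)) - 1 / \<rho> * Z * (\<Sum>j\<le>N. \<kappa> / 2 + (v (sh j x) - L (sh j x))\<^sup>2 / (2 * \<kappa>)))
   = \<alpha> * \<beta> * (\<Sum>j<N. \<eta> (sh j x)) - \<alpha> / \<rho> * (\<Sum>j\<le>N. Y (sh j x))"
   unfolding Ysum by (simp add: right_diff_distrib mult.assoc)
  ultimately show ?thesis
   using True unfolding tN' PN by simp
 qed (simp add: f_def)
 have "\<alpha> * \<beta> * (\<integral>x. indicator S x * (\<Sum>j\<le>N. \<eta> (sh j x)) \<partial>lborel) - \<alpha> / \<rho> * (\<integral>x. indicator S x * (\<Sum>j\<le>N. Y (sh j x)) \<partial>lborel) + (\<integral>x. f x \<partial>lborel)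
  = (\<integral>x. \<alpha> * \<beta> * (indicator S x * (\<Sum>j\<le>N. \<eta> (sh j x))) - \<alpha> / \<rho> * (indicator S x * (\<Sum>j\<le>N. Y (sh j x))) + f x \<partial>lborel)"
  using column_integral(1)[OF tent_integrable] column_integral(1)[OF Yi] fi by simp
 also have "\<dots> <= (\<integral>x. indicator S x * (\<Sum>j\<le>N. P (sh j x)) \<partial>lborel)"
  using column_integral(1)[OF tent_integrable] column_integral(1)[OF Yi] fi column_integral(1)[OF Pi] pw
  by (intro integral_mono) auto
 also have "\<dots> = (\<integral>x. P x \<partial>lborel)"
  using column_integral(2)[OF Pi] by (simp only: P_def tent_slab)
 finally have main: "\<alpha> * \<beta> * (\<integral>x. indicator S x * (\<Sum>j\<le>N. \<eta> (sh j x)) \<partial>lborel) - \<alpha> / \<rho> * (\<integral>x. indicator S x * (\<Sum>j\<le>N. Y (sh j x)) \<partial>lborel) + (\<integral>x. f x \<partial>lborel) <= (\<integral>x. P x \<partial>lborel)" .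
 have "indicator {x. x $ 2 \<in> {c..<c + 4 * \<rho>}} x * \<eta> x = \<eta> x" for x
  using tent_slab[of x 1] by (simp only: mult_1_right)
 then have eta: "(\<integral>x. indicator S x * (\<Sum>j\<le>N. \<eta> (sh j x)) \<partial>lborel) = (\<integral>x. \<eta> x \<partial>lborel)"
  using column_integral(2)[OF tent_integrable] by (simp only:)
 have Yle: "\<alpha> / \<rho> * (\<integral>x. indicator S x * (\<Sum>j\<le>N. Y (sh j x)) \<partial>lborel) <= \<alpha> / \<rho> * (\<integral>x. indicator bx x * (\<kappa> / 2 + (v x - L x)\<^sup>2 / (2 * \<kappa>)) \<partial>lborel)"
 proof (rule mult_left_mono[OF column_integral_le[OF Yi Gi]])
  have K0: "0 <= \<kappa> / 2 + (v x - L x)\<^sup>2 / (2 * \<kappa>)" for x using \<kappa> by simp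
  show "Y x <= \<kappa> / 2 + (v x - L x)\<^sup>2 / (2 * \<kappa>)" for x
   using K0[of x] by (auto simp: Y_def indicator_def)
  show "0 <= \<kappa> / 2 + (v x - L x)\<^sup>2 / (2 * \<kappa>)" for x by (rule K0)
  show "Y x = 0" if "3 * \<rho> < \<bar>x $ 1 - p $ 1\<bar>" for x using that \<rho> by (simp add: Y_def)
  show "0 <= \<alpha> / \<rho>" using \<alpha> \<rho> by simp
 qed
 have gen: "A - D + F <= Q ==> - K <= F ==> D <= D' ==> A <= Q + D' + K" for A D F Q K D' :: real
  by linarith
 show ?thesis
  using gen[OF main[unfolded eta] fl Yle] unfolding P_def L_def .
qed

end

section \<open>Letting the lattice spacing tend to zero\<close>

section \<open>Passing to weak derivatives\<close>

lemma indicator_mult_square: "(indicator B x * t)\<^sup>2 = indicator B x * (t::real)\<^sup>2"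
 by (simp add: indicator_def)

lemma tent_eq_0_outside:
 assumes "\<rho> > 0" "\<rho> <= s" "x \<notin> cbox (p - vec s) (p + vec s)"
 shows "tent p \<rho> x = 0"
proof (rule tent_eq_0[OF assms(1)], rule ccontr)
 assume "\<not> (\<rho> <= \<bar>x $ 1 - p $ 1\<bar> \<or> \<rho> <= \<bar>x $ 2 - p $ 2\<bar>)"
 then have "\<bar>x $ 1 - p $ 1\<bar> < s" "\<bar>x $ 2 - p $ 2\<bar> < s" using assms by auto
 then have "x \<in> cbox (p - vec s) (p + vec s)" by (auto simp: mem_cbox_2 abs_less_iff)
 then show False using assms by simp
qed

lemma L2_limit_mult:
 fixes f g :: "nat => 'a => real"
 assumes [measurable]: "!!n. f n \<in> borel_measurable M" "!!n. g n \<in> borel_measurable M"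
   "f' \<in> borel_measurable M" "g' \<in> borel_measurable M"
  and f2: "!!n. integrable M (%x. (f n x)\<^sup>2)" "integrable M (%x. (f' x)\<^sup>2)"
  and g2: "!!n. integrable M (%x. (g n x)\<^sup>2)" "integrable M (%x. (g' x)\<^sup>2)"
  and lf: "(%n. \<integral>x. (f n x - f' x)\<^sup>2 \<partial>M) \<longlonglongrightarrow> 0"
  and lg: "(%n. \<integral>x. (g n x - g' x)\<^sup>2 \<partial>M) \<longlonglongrightarrow> 0"
 shows "(%n. \<integral>x. f n x * g n x \<partial>M) \<longlonglongrightarrow> (\<integral>x. f' x * g' x \<partial>M)"
proof -
 have df: "integrable M (%x. (f n x - f' x)\<^sup>2)" and dg: "integrable M (%x. (g n x - g' x)\<^sup>2)" for n
  by (intro integrable_add_squares(2) f2 g2; simp)+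
 define a b where "a n = sqrt (\<integral>x. (f n x - f' x)\<^sup>2 \<partial>M)" and "b n = sqrt (\<integral>x. (g n x - g' x)\<^sup>2 \<partial>M)" for n
 define A B where "A = sqrt (\<integral>x. (f' x)\<^sup>2 \<partial>M)" and "B = sqrt (\<integral>x. (g' x)\<^sup>2 \<partial>M)"
 have a0: "a \<longlonglongrightarrow> 0" and b0: "b \<longlonglongrightarrow> 0"
  unfolding a_def[abs_def] b_def[abs_def] using tendsto_real_sqrt[OF lf] tendsto_real_sqrt[OF lg] by auto
 have bound: "norm ((\<integral>x. f n x * g n x \<partial>M) - (\<integral>x. f' x * g' x \<partial>M)) <= a n * b n + a n * B + A * b n" for n
 proof -
  have eq: "f n x * g n x = f' x * g' x + ((f n x - f' x) * (g n x - g' x) + (f n x - f' x) * g' x + f' x * (g n x - g' x))" for x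
   by (simp add: algebra_simps)
  have "(\<integral>x. f n x * g n x \<partial>M) = (\<integral>x. f' x * g' x \<partial>M) + ((\<integral>x. (f n x - f' x) * (g n x - g' x) \<partial>M) + (\<integral>x. (f n x - f' x) * g' x \<partial>M) + (\<integral>x. f' x * (g n x - g' x) \<partial>M))"
   unfolding eq using df dg f2 g2 by (simp add: integrable_mult_squares)
  then have "norm ((\<integral>x. f n x * g n x \<partial>M) - (\<integral>x. f' x * g' x \<partial>M)) <= \<bar>\<integral>x. (f n x - f' x) * (g n x - g' x) \<partial>M\<bar> + \<bar>\<integral>x. (f n x - f' x) * g' x \<partial>M\<bar> + \<bar>\<integral>x. f' x * (g n x - g' x) \<partial>M\<bar>"
   by simp
  also have "\<dots> <= a n * b n + a n * B + A * b n"
   unfolding a_def b_def A_def B_def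
   by (intro add_mono Cauchy_Schwarz_integral df dg f2 g2) auto
  finally show ?thesis .
 qed
 have "(%n. a n * b n + a n * B + A * b n) \<longlonglongrightarrow> 0 * 0 + 0 * B + A * 0"
  by (rule tendsto_add[OF tendsto_add[OF tendsto_mult[OF a0 b0] tendsto_mult[OF a0 tendsto_const]] tendsto_mult[OF tendsto_const b0]])
 then have lim: "(%n. a n * b n + a n * B + A * b n) \<longlonglongrightarrow> 0" by simp
 have "(%n. (\<integral>x. f n x * g n x \<partial>M) - (\<integral>x. f' x * g' x \<partial>M)) \<longlonglongrightarrow> 0"
  by (rule Lim_null_comparison[OF eventuallyI lim]) (rule bound)
 then show ?thesis by (simp add: LIM_zero_iff)
qed

text \<open>The error of the difference quotient is bounded by the L2 modulus of continuity of
  \<open>g\<close>, which tends to 0 with the step.\<close>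

lemma diff_quot_tendsto_L2:
 fixes u g :: "real^2 => real"
 assumes \<rho>: "\<rho> > 0" and i: "i = 1 \<or> i = 2"
  and u: "integrable lborel u" and g: "integrable lborel g" and g2: "integrable lborel (%x. (g x)\<^sup>2)"
  and u2: "integrable lborel (%x. (u x)\<^sup>2)"
  and W: "weak_deriv_on (p - vec (4 * \<rho>)) (p + vec (4 * \<rho>)) (axis i 1) u g"
  and \<tau>: "!!n. \<tau> n > 0" "!!n. \<tau> n <= \<rho> / 2" "\<tau> \<longlonglongrightarrow> 0"
 defines "B \<equiv> cbox (p - vec (3 * \<rho>)) (p + vec (3 * \<rho>))"
 shows "(%n. \<integral>x. (indicator B x * diff_quot (\<tau> n) (axis i 1) u x - indicator B x * g x)\<^sup>2 \<partial>lborel) \<longlonglongrightarrow> 0"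
proof (rule LIMSEQ_I)
 fix e :: real assume e: "e > 0"
 have [measurable]: "u \<in> borel_measurable borel" "g \<in> borel_measurable borel" using u g by auto
 have [measurable]: "B \<in> sets borel" by (simp add: B_def)
 obtain \<delta> where \<delta>: "\<delta> > 0" "!!c. norm c < \<delta> ==> (\<integral>x. (g (x + c) - g x)\<^sup>2 \<partial>lborel) < e / 2"
  using L2_translation_continuous[of g "e/2"] g2 e by auto
 \<comment> \<open>The half-width 7/2 \<rho> lies between 3\<rho> and 4\<rho>: steps up to \<rho>/2
   stay in the box where the weak derivative is known.\<close>
 define Bo where "Bo = box (p - vec (7 / 2 * \<rho>)) (p + vec (7 / 2 * \<rho>))"
 have BBo: "x \<in> Bo" if "x \<in> B" for x
  using that \<rho> by (auto simp: Bo_def B_def mem_box_2 mem_cbox_2)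
 obtain n0 where n0: "!!n. n >= n0 ==> \<bar>\<tau> n\<bar> < \<delta>"
  using LIMSEQ_D[OF \<tau>(3) \<delta>(1)] by auto
 have "norm ((\<integral>x. (indicator B x * diff_quot (\<tau> n) (axis i 1) u x - indicator B x * g x)\<^sup>2 \<partial>lborel) - 0) < e" if n: "n >= n0" for n
 proof -
  let ?D = "%x. ((u (x + \<tau> n *\<^sub>R axis i 1) - u x) / \<tau> n - g x)\<^sup>2"
  have "(\<integral>\<^sup>+x. ennreal (?D x) * indicator Bo x \<partial>lborel) <= ennreal ((sqrt (e / 2))\<^sup>2)"
   unfolding Bo_def
  proof (rule weak_deriv_difference_quotient[OF u g g2 W \<tau>(1)])
   show "sqrt (e/2) >= 0" using e by simp
   fix s assume s: "0 <= s" "s <= \<tau> n"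
   show "x + s *\<^sub>R axis i 1 \<in> box (p - vec (4 * \<rho>)) (p + vec (4 * \<rho>))"
    if "x \<in> box (p - vec (7 / 2 * \<rho>)) (p + vec (7 / 2 * \<rho>))" for x
    using that s \<tau>(2)[of n] i \<rho> by (auto simp: mem_box_2 axis_def)
   have "norm (s *\<^sub>R (axis i 1 :: real^2)) < \<delta>"
    using s n0[OF n] by (simp add: norm_axis_1)
   from \<delta>(2)[OF this] show "(\<integral>x. (g (x + s *\<^sub>R axis i 1) - g x)\<^sup>2 \<partial>lborel) <= (sqrt (e / 2))\<^sup>2"
    using e by simp
  qed
  then have 1: "(\<integral>\<^sup>+x. ennreal (?D x) * indicator Bo x \<partial>lborel) <= ennreal (e / 2)" using e by simp
  have int: "integrable lborel (%x. (indicator B x * diff_quot (\<tau> n) (axis i 1) u x - indicator B x * g x)\<^sup>2)"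
  proof (intro integrable_add_squares(2))
   show "integrable lborel (%x. (indicator B x * diff_quot (\<tau> n) (axis i 1) u x)\<^sup>2)"
    "integrable lborel (%x. (indicator B x * g x)\<^sup>2)"
    unfolding indicator_mult_square
    by (rule integrable_mult_bounded; simp add: u2 g2 diff_quot_square_integrable; simp add: indicator_def)+
  qed auto
  have "ennreal (\<integral>x. (indicator B x * diff_quot (\<tau> n) (axis i 1) u x - indicator B x * g x)\<^sup>2 \<partial>lborel)
   = (\<integral>\<^sup>+x. ennreal ((indicator B x * diff_quot (\<tau> n) (axis i 1) u x - indicator B x * g x)\<^sup>2) \<partial>lborel)"
   by (rule nn_integral_eq_integral[symmetric, OF int]) auto
  also have "\<dots> <= (\<integral>\<^sup>+x. ennreal (?D x) * indicator Bo x \<partial>lborel)"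
   by (intro nn_integral_mono) (use BBo in \<open>auto simp: indicator_def diff_quot_def\<close>)
  also have "\<dots> <= ennreal (e / 2)" by (rule 1)
  finally have "(\<integral>x. (indicator B x * diff_quot (\<tau> n) (axis i 1) u x - indicator B x * g x)\<^sup>2 \<partial>lborel) <= e / 2"
   using e by (simp add: ennreal_le_iff)
  then show ?thesis using e by simp
 qed
 then show "\<exists>no. \<forall>n\<ge>no. norm ((\<integral>x. (indicator B x * diff_quot (\<tau> n) (axis i 1) u x - indicator B x * g x)\<^sup>2 \<partial>lborel) - 0) < e"
  by blast
qed

text \<open>Only the inequality is passed to the limit, not the regression, whose convergence as
  \<tau> tends to 0 is never asked for. For fixed \<open>r\<close> and \<open>v\<close> the
  quotients converge strongly in L2 on \<open>B\<close>, so the product term and the squares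
  converge.\<close>

theorem weak_derivative_inequality:
 fixes r v r1 r2 v1 v2 :: "real^2 => real"
 assumes \<rho>: "\<rho> > 0" and \<alpha>: "\<alpha> >= 0" and \<beta>: "\<beta> >= 0" and \<kappa>: "\<kappa> > 0"
  and L1: "integrable lborel r" "integrable lborel v" "integrable lborel r1" "integrable lborel r2"
   "integrable lborel v1" "integrable lborel v2"
  and L2: "integrable lborel (%x. (r x)\<^sup>2)" "integrable lborel (%x. (v x)\<^sup>2)" "integrable lborel (%x. (r1 x)\<^sup>2)"
   "integrable lborel (%x. (r2 x)\<^sup>2)" "integrable lborel (%x. (v1 x)\<^sup>2)" "integrable lborel (%x. (v2 x)\<^sup>2)"
  and W: "weak_deriv_on (p - vec (4 * \<rho>)) (p + vec (4 * \<rho>)) (axis 1 1) r r1"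
   "weak_deriv_on (p - vec (4 * \<rho>)) (p + vec (4 * \<rho>)) (axis 2 1) r r2"
   "weak_deriv_on (p - vec (4 * \<rho>)) (p + vec (4 * \<rho>)) (axis 1 1) v v1"
   "weak_deriv_on (p - vec (4 * \<rho>)) (p + vec (4 * \<rho>)) (axis 2 1) v v2"
 defines "B \<equiv> cbox (p - vec (3 * \<rho>)) (p + vec (3 * \<rho>))"
 shows "\<alpha> * \<beta> * (\<integral>x. tent p \<rho> x \<partial>lborel) \<le>
  (\<integral>x. tent p \<rho> x * (\<bar>\<alpha> + r1 x\<bar> * max 0 (v2 x)) \<partial>lborel)
  + \<alpha> / \<rho> * (\<integral>x. indicator B x * (\<kappa> / 2 + (v x - (\<beta> * x $ 2 + \<gamma>))\<^sup>2 / (2 * \<kappa>)) \<partial>lborel)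
  + ((1 / (2 * \<rho> * \<kappa>) + 1 / (2 * \<rho>)) * (\<integral>x. indicator B x * (r x)\<^sup>2 \<partial>lborel) + 1/2 * (\<integral>x. indicator B x * (r2 x)\<^sup>2 \<partial>lborel)
   + \<kappa> / (2 * \<rho>) * (\<integral>x. indicator B x * (v2 x)\<^sup>2 \<partial>lborel) + (1/2 + 1 / (2 * \<rho>)) * (\<integral>x. indicator B x * (v1 x)\<^sup>2 \<partial>lborel))"
proof (rule LIMSEQ_le_const)
 have [measurable]: "r \<in> borel_measurable borel" "v \<in> borel_measurable borel" "r1 \<in> borel_measurable borel"
  "r2 \<in> borel_measurable borel" "v1 \<in> borel_measurable borel" "v2 \<in> borel_measurable borel"
  using L1 by auto
 have [measurable]: "B \<in> sets borel" by (simp add: B_def)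
 \<comment> \<open>The spacing for \<open>N = n + 7\<close>; with at least eight points it is at
   most \<rho>/2, as \<open>diff_quot_tendsto_L2\<close> requires.\<close>
 define \<tau> where "\<tau> n = 4 * \<rho> / real (Suc (n + 7))" for n
 have \<tau>pos: "\<tau> n > 0" "\<tau> n <= \<rho> / 2" for n using \<rho> by (auto simp: \<tau>_def field_simps)
 have "(%n. 4 * \<rho> * inverse (real (Suc (n + 7)))) \<longlonglongrightarrow> 4 * \<rho> * 0"
  by (intro tendsto_mult tendsto_const LIMSEQ_ignore_initial_segment[OF LIMSEQ_inverse_real_of_nat])
 then have \<tau>lim: "\<tau> \<longlonglongrightarrow> 0" by (simp add: \<tau>_def[abs_def] divide_inverse)
 have lat: "column_lattice \<rho> (\<tau> n) (n + 7) r v" for n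
  by unfold_locales (use \<rho> L2 in \<open>auto simp: \<tau>_def\<close>)
 let ?D = "%n e f x. indicator B x * diff_quot (\<tau> n) e f x"
 have D2: "integrable lborel (%x. (?D n e f x)\<^sup>2)" if "f \<in> borel_measurable borel" "integrable lborel (%x. (f x)\<^sup>2)" for n e f
  unfolding indicator_mult_square
  by (rule integrable_mult_bounded[OF diff_quot_square_integrable[OF that]]) (auto simp: indicator_def)
 have I2: "integrable lborel (%x. (indicator B x * f x)\<^sup>2)" if "f \<in> borel_measurable borel" "integrable lborel (%x. (f x)\<^sup>2)" for f :: "real^2 => real"
  unfolding indicator_mult_square
  by (rule integrable_mult_bounded[OF that(2)]) (auto simp: indicator_def)
 have sqlim: "(%n. \<integral>x. indicator B x * (diff_quot (\<tau> n) (axis i 1) f x)\<^sup>2 \<partial>lborel) \<longlonglongrightarrow> (\<integral>x. indicator B x * (g x)\<^sup>2 \<partial>lborel)"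
  if "i = 1 \<or> i = 2" and f: "integrable lborel f" "integrable lborel (%x. (f x)\<^sup>2)"
   and g: "integrable lborel g" "integrable lborel (%x. (g x)\<^sup>2)"
   and W: "weak_deriv_on (p - vec (4 * \<rho>)) (p + vec (4 * \<rho>)) (axis i 1) f g" for i f g
 proof -
  have [measurable]: "f \<in> borel_measurable borel" "g \<in> borel_measurable borel" using f g by auto
  have l: "(%n. \<integral>x. (?D n (axis i 1) f x - indicator B x * g x)\<^sup>2 \<partial>lborel) \<longlonglongrightarrow> 0"
   unfolding B_def by (rule diff_quot_tendsto_L2[OF \<rho> that(1) f(1) g f(2) W \<tau>pos \<tau>lim])
  have "(%n. \<integral>x. ?D n (axis i 1) f x * ?D n (axis i 1) f x \<partial>lborel) \<longlonglongrightarrow> (\<integral>x. (indicator B x * g x) * (indicator B x * g x) \<partial>lborel)"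
   by (intro L2_limit_mult l D2 I2 f g) auto
  moreover have "?D n (axis i 1) f x * ?D n (axis i 1) f x = indicator B x * (diff_quot (\<tau> n) (axis i 1) f x)\<^sup>2"
   "(indicator B x * g x) * (indicator B x * g x) = indicator B x * (g x)\<^sup>2" for n x
   by (auto simp: indicator_def power2_eq_square)
  ultimately show ?thesis by simp
 qed
 define P where "P n = (\<integral>x. tent p \<rho> x * (\<bar>\<alpha> + diff_quot (\<tau> n) (axis 1 1) r x\<bar> * max 0 (diff_quot (\<tau> n) (axis 2 1) v x)) \<partial>lborel)" for n
 define X where "X = \<alpha> / \<rho> * (\<integral>x. indicator B x * (\<kappa> / 2 + (v x - (\<beta> * x $ 2 + \<gamma>))\<^sup>2 / (2 * \<kappa>)) \<partial>lborel)"
 define R where "R = (\<integral>x. indicator B x * (r x)\<^sup>2 \<partial>lborel)"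
 define E where "E n i f = (\<integral>x. indicator B x * (diff_quot (\<tau> n) (axis i 1) f x)\<^sup>2 \<partial>lborel)" for n i f
 have tB: "tent p \<rho> x = indicator B x * tent p \<rho> x" for x
  using tent_eq_0_outside[OF \<rho>, of "3 * \<rho>" x p] \<rho> by (cases "x \<in> B") (simp_all add: B_def)
 have Bi: "integrable lborel (%x. indicator B x * k)" for k :: real
  unfolding B_def by (intro integrable_mult_left integrable_real_indicator) (auto simp: emeasure_lborel_cbox_eq)
 have Plim: "P \<longlonglongrightarrow> (\<integral>x. tent p \<rho> x * (\<bar>\<alpha> + r1 x\<bar> * max 0 (v2 x)) \<partial>lborel)"
 proof -
  have lr: "(%n. \<integral>x. (?D n (axis 1 1) r x - indicator B x * r1 x)\<^sup>2 \<partial>lborel) \<longlonglongrightarrow> 0"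
   unfolding B_def by (rule diff_quot_tendsto_L2[OF \<rho> _ L1(1) L1(3) L2(3) L2(1) W(1) \<tau>pos \<tau>lim]) simp
  have lv: "(%n. \<integral>x. (?D n (axis 2 1) v x - indicator B x * v2 x)\<^sup>2 \<partial>lborel) \<longlonglongrightarrow> 0"
   unfolding B_def by (rule diff_quot_tendsto_L2[OF \<rho> _ L1(2) L1(6) L2(6) L2(2) W(4) \<tau>pos \<tau>lim]) simp
  \<comment> \<open>Absolute value and positive part are 1-Lipschitz, so \<open>F\<close> and
    \<open>G\<close> inherit the L2 convergence of the quotients.\<close>
  define F where "F d x = tent p \<rho> x * \<bar>indicator B x * \<alpha> + indicator B x * d x\<bar>" for d :: "real^2 => real" and x
  define G where "G d x = max 0 (indicator B x * d x)" for d :: "real^2 => real" and x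
  have FG: "tent p \<rho> x * (\<bar>\<alpha> + d x\<bar> * max 0 (d' x)) = F d x * G d' x" for d d' x
   using tB[of x] by (cases "x \<in> B") (auto simp: F_def G_def)
  have Fm: "F d \<in> borel_measurable borel" "G d \<in> borel_measurable borel" if [measurable]: "d \<in> borel_measurable borel" for d
   unfolding F_def[abs_def] G_def[abs_def] by measurable
  have F2: "integrable lborel (%x. (F d x)\<^sup>2)" if [measurable]: "d \<in> borel_measurable borel" and d: "integrable lborel (%x. (indicator B x * d x)\<^sup>2)" for d
  proof -
   have "integrable lborel (%x. (indicator B x * \<alpha>)\<^sup>2)"
    using Bi[of "\<alpha>\<^sup>2"] by (simp only: indicator_mult_square)
   then have "integrable lborel (%x. (indicator B x * \<alpha> + indicator B x * d x)\<^sup>2)"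
    by (intro integrable_add_squares(1) d) auto
   then have "integrable lborel (%x. (tent p \<rho> x)\<^sup>2 * (indicator B x * \<alpha> + indicator B x * d x)\<^sup>2)"
    by (rule integrable_mult_bounded) (use tent_bounds[OF \<rho>] in \<open>auto simp: abs_square_le_1\<close>)
   then show ?thesis by (simp add: F_def power_mult_distrib)
  qed
  have G2: "integrable lborel (%x. (G d x)\<^sup>2)" if [measurable]: "d \<in> borel_measurable borel" and d: "integrable lborel (%x. (indicator B x * d x)\<^sup>2)" for d
   by (rule Bochner_Integration.integrable_bound[OF d]) (use Fm that in \<open>auto simp: G_def max_def\<close>)
  have sq0: "(%n. \<integral>x. (a n x)\<^sup>2 \<partial>lborel) \<longlonglongrightarrow> 0"
   if a: "!!n x. \<bar>a n x\<bar> <= \<bar>b n x\<bar>" and b: "(%n. \<integral>x. (b n x)\<^sup>2 \<partial>lborel) \<longlonglongrightarrow> 0" and bi: "!!n. integrable lborel (%x. (b n x)\<^sup>2)"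
   for a b :: "nat => real^2 => real"
  proof (rule tendsto_sandwich[OF _ _ tendsto_const b])
   show "\<forall>\<^sub>F n in sequentially. 0 <= (\<integral>x. (a n x)\<^sup>2 \<partial>lborel)" by (auto intro!: always_eventually)
   show "\<forall>\<^sub>F n in sequentially. (\<integral>x. (a n x)\<^sup>2 \<partial>lborel) <= (\<integral>x. (b n x)\<^sup>2 \<partial>lborel)"
    using a by (intro always_eventually allI integral_mono_AE' bi) (auto simp: abs_le_square_iff)
  qed
  have ir: "integrable lborel (%x. (?D n (axis 1 1) r x - indicator B x * r1 x)\<^sup>2)"
   and iv: "integrable lborel (%x. (?D n (axis 2 1) v x - indicator B x * v2 x)\<^sup>2)" for n
   by (auto intro!: integrable_add_squares(2) D2 I2 L2 diff_quot_square_integrable)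
  have "(%n. \<integral>x. F (diff_quot (\<tau> n) (axis 1 1) r) x * G (diff_quot (\<tau> n) (axis 2 1) v) x \<partial>lborel) \<longlonglongrightarrow> (\<integral>x. F r1 x * G v2 x \<partial>lborel)"
  proof (rule L2_limit_mult)
   show "(%n. \<integral>x. (F (diff_quot (\<tau> n) (axis 1 1) r) x - F r1 x)\<^sup>2 \<partial>lborel) \<longlonglongrightarrow> 0"
   proof (rule sq0[OF _ lr ir])
    fix n x
    have "\<bar>F (diff_quot (\<tau> n) (axis 1 1) r) x - F r1 x\<bar>
     = tent p \<rho> x * \<bar>\<bar>indicator B x * \<alpha> + ?D n (axis 1 1) r x\<bar> - \<bar>indicator B x * \<alpha> + indicator B x * r1 x\<bar>\<bar>"
     using tent_bounds(1)[OF \<rho>, of p x] by (simp add: F_def right_diff_distrib[symmetric] abs_mult)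
    also have "\<dots> <= 1 * \<bar>?D n (axis 1 1) r x - indicator B x * r1 x\<bar>"
     using tent_bounds[OF \<rho>, of p x] by (intro mult_mono) auto
    finally show "\<bar>F (diff_quot (\<tau> n) (axis 1 1) r) x - F r1 x\<bar> <= \<bar>?D n (axis 1 1) r x - indicator B x * r1 x\<bar>" by simp
   qed
   show "(%n. \<integral>x. (G (diff_quot (\<tau> n) (axis 2 1) v) x - G v2 x)\<^sup>2 \<partial>lborel) \<longlonglongrightarrow> 0"
    by (rule sq0[OF _ lv iv]) (auto simp: G_def max_def)
  qed (auto intro!: Fm F2 G2 D2 I2 L2 diff_quot_square_integrable)
  then show ?thesis unfolding P_def[abs_def] FG .
 qed
 have E: "(%n. E n 2 r) \<longlonglongrightarrow> (\<integral>x. indicator B x * (r2 x)\<^sup>2 \<partial>lborel)"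
  "(%n. E n 2 v) \<longlonglongrightarrow> (\<integral>x. indicator B x * (v2 x)\<^sup>2 \<partial>lborel)"
  "(%n. E n 1 v) \<longlonglongrightarrow> (\<integral>x. indicator B x * (v1 x)\<^sup>2 \<partial>lborel)"
  unfolding E_def by (intro sqlim L1 L2 W; simp)+
 show "(%n. P n + X + ((1 / (2 * \<rho> * \<kappa>) + 1 / (2 * \<rho>)) * R + 1/2 * E n 2 r + \<kappa> / (2 * \<rho>) * E n 2 v + (1/2 + 1 / (2 * \<rho>)) * E n 1 v))
  \<longlonglongrightarrow> (\<integral>x. tent p \<rho> x * (\<bar>\<alpha> + r1 x\<bar> * max 0 (v2 x)) \<partial>lborel)
  + \<alpha> / \<rho> * (\<integral>x. indicator B x * (\<kappa> / 2 + (v x - (\<beta> * x $ 2 + \<gamma>))\<^sup>2 / (2 * \<kappa>)) \<partial>lborel)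
  + ((1 / (2 * \<rho> * \<kappa>) + 1 / (2 * \<rho>)) * (\<integral>x. indicator B x * (r x)\<^sup>2 \<partial>lborel) + 1/2 * (\<integral>x. indicator B x * (r2 x)\<^sup>2 \<partial>lborel)
   + \<kappa> / (2 * \<rho>) * (\<integral>x. indicator B x * (v2 x)\<^sup>2 \<partial>lborel) + (1/2 + 1 / (2 * \<rho>)) * (\<integral>x. indicator B x * (v1 x)\<^sup>2 \<partial>lborel))"
  unfolding X_def[symmetric] R_def[symmetric]
  by (intro tendsto_add tendsto_mult tendsto_const Plim E)
 have "\<alpha> * \<beta> * (\<integral>x. tent p \<rho> x \<partial>lborel) <= P n + X + ((1 / (2 * \<rho> * \<kappa>) + 1 / (2 * \<rho>)) * R + 1/2 * E n 2 r + \<kappa> / (2 * \<rho>) * E n 2 v + (1/2 + 1 / (2 * \<rho>)) * E n 1 v)" for n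
 proof -
  interpret column_lattice p \<rho> "\<tau> n" "n + 7" r v by (rule lat)
  have bB: "bx = B" by (simp add: bx_def B_def)
  have iI: "integrable lborel (%x. indicator B x * f x)" if "integrable lborel f" for f :: "real^2 => real"
   by (rule integrable_mult_bounded[OF that]) (auto simp: indicator_def)
  have Ka: "(\<integral>x. indicator B x * Ka \<kappa> x \<partial>lborel) = (1 / (2 * \<rho> * \<kappa>) + 1 / (2 * \<rho>)) * R + 1/2 * E n 2 r"
  proof -
   have "indicator B x * Ka \<kappa> x = (1 / (2 * \<rho> * \<kappa>) + 1 / (2 * \<rho>)) * (indicator B x * (r x)\<^sup>2) + 1/2 * (indicator B x * (diff_quot (\<tau> n) (axis 2 1) r x)\<^sup>2)" for x
    by (simp add: Ka_def indicator_def algebra_simps)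
   then show ?thesis
    unfolding R_def E_def using iI[OF L2(1)] iI[OF diff_quot_square_integrable[OF _ L2(1)], of "\<tau> n" "axis 2 1"] by simp
  qed
  have Kb: "(\<integral>x. indicator B x * Kb \<kappa> x \<partial>lborel) = \<kappa> / (2 * \<rho>) * E n 2 v + (1/2 + 1 / (2 * \<rho>)) * E n 1 v"
  proof -
   have "indicator B x * Kb \<kappa> x = \<kappa> / (2 * \<rho>) * (indicator B x * (diff_quot (\<tau> n) (axis 2 1) v x)\<^sup>2) + (1/2 + 1 / (2 * \<rho>)) * (indicator B x * (diff_quot (\<tau> n) (axis 1 1) v x)\<^sup>2)" for x
    by (simp add: Kb_def indicator_def algebra_simps)
   then show ?thesis
    unfolding E_def using iI[OF diff_quot_square_integrable[OF _ L2(2)], of "\<tau> n" "axis 1 1"] iI[OF diff_quot_square_integrable[OF _ L2(2)], of "\<tau> n" "axis 2 1"] by simp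
  qed
  show ?thesis
   using lattice_inequality[OF \<alpha> \<beta> \<kappa>, of \<gamma>] unfolding bB Ka Kb P_def[symmetric] X_def[symmetric] by simp
 qed
 then show "\<exists>N. \<forall>n\<ge>N. \<alpha> * \<beta> * (\<integral>x. tent p \<rho> x \<partial>lborel) <= P n + X + ((1 / (2 * \<rho> * \<kappa>) + 1 / (2 * \<rho>)) * R + 1/2 * E n 2 r + \<kappa> / (2 * \<rho>) * E n 2 v + (1/2 + 1 / (2 * \<rho>)) * E n 1 v)"
  by blast
qed

section \<open>Periodic profiles with two slopes\<close>

section \<open>Sawtooth functions\<close>

definition tri :: "real => real" where
 "tri t = \<bar>t - of_int (round t)\<bar>"

text \<open>The half-open convention at 1/2 agrees with that of \<open>P1\<close> and
  \<open>P2\<close>, so the value 1 marks the first phase exactly and not just up to null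
  sets.\<close>

definition square_wave :: "real => real" where
 "square_wave t = (if frac t < 1/2 then 1 else -1)"

text \<open>Slope \<open>b + a\<close> in the first phase and \<open>b - a\<close> in the second,
  mean slope \<open>b\<close>, and distance at most |a| \<epsilon>/2 from the line of slope
  \<open>b\<close>.\<close>

definition saw :: "real => real => real => real => real" where
 "saw b a \<epsilon> t = b * t + a * (\<epsilon> * tri (t / \<epsilon>))"

lemma tri_Lipschitz: "\<bar>tri s - tri t\<bar> <= \<bar>s - t\<bar>"
proof -
 have *: "tri s <= \<bar>s - t\<bar> + tri t" for s t
 proof -
  have "tri s <= \<bar>s - of_int (round t)\<bar>" unfolding tri_def by (rule round_diff_minimal)
  also have "\<dots> <= \<bar>s - t\<bar> + tri t" unfolding tri_def by linarith
  finally show ?thesis .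
 qed
 show ?thesis using *[of s t] *[of t s] by linarith
qed

lemma tri_bounds: "0 <= tri t" "tri t <= 1/2"
 using of_int_round_abs_le[of t] by (auto simp: tri_def abs_minus_commute)

lemma tri_has_derivative:
 assumes "2 * t \<notin> \<int>"
 shows "(tri has_real_derivative square_wave t) (at t)"
proof -
 define m where "m = \<lfloor>t\<rfloor>"
 have fr: "t = of_int m + frac t" by (simp add: m_def frac_def)
 have ne: "frac t ~= 0" "frac t ~= 1/2"
 proof -
  show "frac t ~= 0" using fr assms by (metis Ints_add Ints_of_int add.right_neutral mult_2)
  show "frac t ~= 1/2"
  proof
   assume "frac t = 1/2"
   then have "2 * t = of_int (2 * m + 1)" using fr by simp
   then show False using assms by (metis Ints_of_int)
  qed
 qed
 have f01: "0 < frac t" "frac t < 1" using ne frac_ge_0[of t] frac_lt_1[of t] by linarith+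
 show ?thesis
 proof (cases "frac t < 1/2")
  case True
  have "((%s. s - of_int m) has_real_derivative 1) (at t)" by (auto intro!: derivative_eq_intros)
  then have "(tri has_real_derivative 1) (at t)"
  proof (rule has_field_derivative_transform_within_open[where S = "{of_int m<..<of_int m + 1/2}"])
   have "of_int m < t" "t < of_int m + 1/2" using fr f01 True by linarith+
   then show "t \<in> {of_int m<..<of_int m + 1/2}" by simp
   show "s - of_int m = tri s" if "s \<in> {of_int m<..<of_int m + 1/2}" for s
   proof -
    have "round s = m" unfolding round_def using that by (intro floor_unique) auto
    then show ?thesis using that by (simp add: tri_def)
   qed
  qed auto
  then show ?thesis using True by (simp add: square_wave_def)
 next
  case False
  have "((%s. of_int m + 1 - s) has_real_derivative -1) (at t)" by (auto intro!: derivative_eq_intros)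
  then have "(tri has_real_derivative -1) (at t)"
  proof (rule has_field_derivative_transform_within_open[where S = "{of_int m + 1/2<..<of_int m + 1}"])
   have "of_int m + 1/2 < t" "t < of_int m + 1" using fr f01 False ne by linarith+
   then show "t \<in> {of_int m + 1/2<..<of_int m + 1}" by simp
   show "of_int m + 1 - s = tri s" if "s \<in> {of_int m + 1/2<..<of_int m + 1}" for s
   proof -
    have "round s = m + 1" unfolding round_def using that by (intro floor_unique) auto
    then show ?thesis using that by (simp add: tri_def)
   qed
  qed auto
  then show ?thesis using False by (simp add: square_wave_def)
 qed
qed

lemma square_wave_meas [measurable]: "square_wave \<in> borel_measurable borel"
 unfolding square_wave_def[abs_def] frac_def by measurable

lemma square_wave_cases: "square_wave t = 1 \<or> square_wave t = -1"
 by (simp add: square_wave_def)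

lemma saw_Lipschitz:
 assumes "\<epsilon> > 0"
 shows "\<bar>saw b a \<epsilon> s - saw b a \<epsilon> t\<bar> <= (\<bar>b\<bar> + \<bar>a\<bar>) * \<bar>s - t\<bar>"
proof -
 have "\<bar>\<epsilon> * (tri (s / \<epsilon>) - tri (t / \<epsilon>))\<bar> <= \<epsilon> * \<bar>s / \<epsilon> - t / \<epsilon>\<bar>"
  using assms tri_Lipschitz[of "s / \<epsilon>" "t / \<epsilon>"] by (simp add: abs_mult)
 also have "\<dots> = \<bar>s - t\<bar>" using assms by (simp add: diff_divide_distrib[symmetric])
 finally have *: "\<bar>\<epsilon> * (tri (s / \<epsilon>) - tri (t / \<epsilon>))\<bar> <= \<bar>s - t\<bar>" .
 have "saw b a \<epsilon> s - saw b a \<epsilon> t = b * (s - t) + a * (\<epsilon> * (tri (s / \<epsilon>) - tri (t / \<epsilon>)))"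
  by (simp add: saw_def algebra_simps)
 then have "\<bar>saw b a \<epsilon> s - saw b a \<epsilon> t\<bar> <= \<bar>b\<bar> * \<bar>s - t\<bar> + \<bar>a\<bar> * \<bar>\<epsilon> * (tri (s / \<epsilon>) - tri (t / \<epsilon>))\<bar>"
  by (metis abs_mult abs_triangle_ineq)
 also have "\<dots> <= \<bar>b\<bar> * \<bar>s - t\<bar> + \<bar>a\<bar> * \<bar>s - t\<bar>"
  using * by (intro add_left_mono mult_left_mono) auto
 finally show ?thesis by (simp add: distrib_right)
qed

lemma saw_meas [measurable]:
 assumes "\<epsilon> > 0" shows "saw b a \<epsilon> \<in> borel_measurable borel"
 unfolding saw_def[abs_def] tri_def[abs_def] round_def by measurable

lemma saw_has_derivative:
 assumes "\<epsilon> > 0" "2 * (t / \<epsilon>) \<notin> \<int>"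
 shows "(saw b a \<epsilon> has_real_derivative (b + a * square_wave (t / \<epsilon>))) (at t)"
proof -
 have "((%t. tri (t / \<epsilon>)) has_real_derivative square_wave (t / \<epsilon>) * (1 / \<epsilon>)) (at t)"
  by (rule DERIV_chain2[where f = tri and g = "%t. t / \<epsilon>"], rule tri_has_derivative[OF assms(2)])
   (use assms in \<open>auto intro!: derivative_eq_intros\<close>)
 then have "((%t. b * t + a * (\<epsilon> * tri (t / \<epsilon>))) has_real_derivative
   (b * 1 + a * (\<epsilon> * (square_wave (t / \<epsilon>) * (1 / \<epsilon>))))) (at t)"
  by (intro DERIV_add DERIV_cmult DERIV_ident)
 then show ?thesis
  unfolding saw_def[abs_def] using assms(1) by simp
qed

lemma AE_not_half_integer:
 assumes "\<epsilon> > 0"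
 shows "AE x in lborel. 2 * ((x::real^2) $ i / \<epsilon>) \<notin> \<int>"
proof -
 have "negligible (\<Union>k::int. {x::real^2. x $ i = of_int k * \<epsilon> / 2})"
 proof (rule negligible_countable_Union)
  fix T assume "T \<in> range (%k::int. {x::real^2. x $ i = of_int k * \<epsilon> / 2})"
  then obtain k :: int where T: "T = {x::real^2. x $ i = of_int k * \<epsilon> / 2}" by auto
  have "negligible {x::real^2. x \<bullet> axis i 1 = of_int k * \<epsilon> / 2}"
   by (rule negligible_standard_hyperplane) (auto simp: Basis_vec_def)
  then show "negligible T" unfolding T by (simp add: inner_axis)
 qed auto
 then have "AE x in lebesgue. x \<notin> (\<Union>k::int. {x::real^2. x $ i = of_int k * \<epsilon> / 2})"
  by (intro AE_not_in) (simp add: negligible_iff_null_sets)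
 then have "AE x in lborel. x \<notin> (\<Union>k::int. {x::real^2. x $ i = of_int k * \<epsilon> / 2})"
  by (simp add: AE_completion_iff)
 then show ?thesis
 proof eventually_elim
  case (elim x)
  show ?case
  proof
   assume "2 * (x $ i / \<epsilon>) \<in> \<int>"
   then obtain k where "2 * (x $ i / \<epsilon>) = of_int k" by (elim Ints_cases)
   then have "x $ i = of_int k * \<epsilon> / 2" using assms by (simp add: field_simps)
   then show False using elim by blast
  qed
 qed
qed

text \<open>In the direction of the other coordinate all difference quotients vanish identically; in
  the own direction they converge wherever the profile is differentiable.\<close>

lemma coordinate_weak_derivative:
 fixes F G :: "real => real" and \<phi> :: "real^2 => real"
 assumes lip: "!!s t. \<bar>F s - F t\<bar> <= L * \<bar>s - t\<bar>"
  and ae: "AE x in lborel. (F has_real_derivative G ((x::real^2) $ i)) (at (x $ i))"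
  and [measurable]: "G \<in> borel_measurable borel"
  and C: "C_k (Suc 0) \<phi>" and K: "compact K" "!!x. x \<notin> K ==> \<phi> x = 0"
 shows "(\<integral>x. F (x $ i) * frechet_derivative \<phi> (at x) (axis j 1) \<partial>lborel)
  = - (\<integral>x. (if i = j then G (x $ i) else 0) * \<phi> x \<partial>lborel)"
proof (rule Lipschitz_weak_derivative[OF _ _ _ C K])
 show "\<bar>F (x $ i) - F (y $ i)\<bar> <= L * norm (x - y)" for x y :: "real^2"
 proof -
  have L0: "0 <= L" using lip[of 1 0] by simp
  have "\<bar>F (x $ i) - F (y $ i)\<bar> <= L * \<bar>(x - y) $ i\<bar>" using lip[of "x $ i" "y $ i"] by simp
  also have "\<dots> <= L * norm (x - y)" using L0 component_le_norm_cart[of "x - y" i] by (intro mult_left_mono)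
  finally show ?thesis .
 qed
 show "(%x::real^2. if i = j then G (x $ i) else 0) \<in> borel_measurable borel" by measurable
 show "AE x in lborel. (%n. (F ((x + inverse (real (Suc n)) *\<^sub>R axis j 1) $ i) - F (x $ i)) / inverse (real (Suc n)))
   \<longlonglongrightarrow> (if i = j then G (x $ i) else 0)"
  using ae
 proof eventually_elim
  case (elim x)
  show ?case
  proof (cases "i = j")
   case True
   have "((%t. (F (x $ i + t) - F (x $ i)) / t) \<longlongrightarrow> G (x $ i)) (at 0)"
    using elim by (simp add: DERIV_def)
   moreover have "filterlim (%n. inverse (real (Suc n))) (at 0) sequentially"
    using LIMSEQ_inverse_real_of_nat by (simp add: filterlim_at)
   ultimately have "(%n. (F (x $ i + inverse (real (Suc n))) - F (x $ i)) / inverse (real (Suc n))) \<longlonglongrightarrow> G (x $ i)"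
    by (rule filterlim_compose)
   then show ?thesis using True by (simp add: axis_def)
  next
   case False
   then show ?thesis by (simp add: axis_def)
  qed
 qed
qed

lemma saw_weak_derivative:
 assumes \<epsilon>: "\<epsilon> > 0" and C: "C_k (Suc 0) \<phi>" and K: "compact K" "!!x. x \<notin> K ==> \<phi> x = 0"
 shows "(\<integral>x. saw b a \<epsilon> (x $ i) * frechet_derivative \<phi> (at x) (axis j 1) \<partial>lborel)
  = - (\<integral>x. (if i = j then b + a * square_wave (x $ i / \<epsilon>) else 0) * \<phi> x \<partial>lborel)"
proof (rule coordinate_weak_derivative[OF _ _ _ C K, where G = "%t. b + a * square_wave (t / \<epsilon>)"])
 show "\<bar>saw b a \<epsilon> s - saw b a \<epsilon> t\<bar> <= (\<bar>b\<bar> + \<bar>a\<bar>) * \<bar>s - t\<bar>" for s t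
  by (rule saw_Lipschitz[OF \<epsilon>])
 show "AE x in lborel. (saw b a \<epsilon> has_real_derivative (b + a * square_wave ((x::real^2) $ i / \<epsilon>))) (at (x $ i))"
  using AE_not_half_integer[OF \<epsilon>, of i] by eventually_elim (rule saw_has_derivative[OF \<epsilon>])
qed measurable

lemma saw_linear: "saw b 0 \<epsilon> t = b * t"
 by (simp add: saw_def)

section \<open>Quantitative rigidity for nearly admissible gradients\<close>

section \<open>Rigidity\<close>

text \<open>The cutoff to the closed box keeps the functions integrable over the plane and is
  invisible to tests vanishing off the box. With \<open>a = 0\<close> the same statement subtracts a
  linear function, so it treats both components.\<close>

lemma weak_deriv_on_minus_saw:
 fixes u g :: "real^2 => real"
 assumes W: "weak_deriv_on a' b' (axis j 1) u g" and u: "integrable lborel u" and g: "integrable lborel g" and \<epsilon>: "\<epsilon> > 0"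
 shows "weak_deriv_on a' b' (axis j 1) (%x. u x - indicator (cbox a' b') x * saw b a \<epsilon> (x $ i))
  (%x. g x - indicator (cbox a' b') x * (if i = j then b + a * square_wave (x $ i / \<epsilon>) else 0))"
 unfolding weak_deriv_on_def
proof (intro allI impI)
 fix \<phi> :: "real^2 => real" assume C: "\<forall>k. C_k k \<phi>" and s: "\<forall>x. x \<notin> box a' b' --> \<phi> x = 0"
 have s': "\<phi> x = 0" if "x \<notin> cbox a' b'" for x using s that box_subset_cbox by blast
 obtain B where B: "B >= 0" "!!x. \<bar>frechet_derivative \<phi> (at x) (axis j 1)\<bar> <= B" "!!x. \<bar>\<phi> x\<bar> <= B"
  using smooth_bounded_derivative[OF C[rule_format] compact_cbox s'] by metis
 obtain \<psi> where \<psi>: "!!x. \<psi> x = frechet_derivative \<phi> (at x) (axis j 1)" "continuous_on UNIV \<psi>"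
  using C_k_1_directional[OF C[rule_format]] by metis
 have \<psi>': "frechet_derivative \<phi> (at x) (axis j 1) = \<psi> x" for x by (simp add: \<psi>(1))
 have \<psi>0: "\<psi> x = 0" if "x \<notin> cbox a' b'" for x
  unfolding \<psi>(1) by (rule frechet_derivative_eq_0_outside[OF closed_cbox s' that])
 have [measurable]: "\<psi> \<in> borel_measurable borel" "\<phi> \<in> borel_measurable borel"
  using \<psi>(2) C_k_imp_continuous_on[OF C[rule_format]] by (auto intro: borel_measurable_continuous_onI)
 let ?S = "%x. saw b a \<epsilon> (x $ i)" and ?G = "%x::real^2. if i = j then b + a * square_wave (x $ i / \<epsilon>) else 0"
 have [measurable]: "?S \<in> borel_measurable borel"
  using measurable_compose[OF vec_nth_measurable_2 saw_meas[OF \<epsilon>]] .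
 have [measurable]: "?G \<in> borel_measurable borel" by measurable
 have bd: "integrable lborel (%x. f x * k x)" if "integrable lborel f" "k \<in> borel_measurable borel" "!!x. \<bar>k x\<bar> <= B" for f k :: "real^2 => real"
 proof (rule Bochner_Integration.integrable_bound)
  show "integrable lborel (%x. B * f x)" using that by simp
  show "(%x. f x * k x) \<in> borel_measurable lborel" using that by auto
  show "AE x in lborel. norm (f x * k x) <= norm (B * f x)"
   using that(3) B(1) by (auto simp: abs_mult mult.commute[of "\<bar>f _\<bar>"] intro!: mult_right_mono)
 qed
 have Mex: "\<exists>M. \<forall>x\<in>cbox a' b'. \<bar>?S x\<bar> <= M"
 proof -
  have lin: "\<bar>?S x\<bar> <= (\<bar>b\<bar> + \<bar>a\<bar>) * norm x + \<bar>saw b a \<epsilon> 0\<bar>" for x :: "real^2"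
  proof -
   have "\<bar>?S x - saw b a \<epsilon> 0\<bar> <= (\<bar>b\<bar> + \<bar>a\<bar>) * \<bar>x $ i\<bar>" using saw_Lipschitz[OF \<epsilon>, of b a "x $ i" 0] by simp
   also have "\<dots> <= (\<bar>b\<bar> + \<bar>a\<bar>) * norm x" by (intro mult_left_mono component_le_norm_cart) auto
   finally show ?thesis by linarith
  qed
  obtain R where R: "!!x. x \<in> cbox a' b' ==> norm x <= R"
   using bounded_cbox[of a' b'] unfolding bounded_iff by blast
  have "\<bar>?S x\<bar> <= (\<bar>b\<bar> + \<bar>a\<bar>) * R + \<bar>saw b a \<epsilon> 0\<bar>" if "x \<in> cbox a' b'" for x
   using lin[of x] mult_left_mono[OF R[OF that], of "\<bar>b\<bar> + \<bar>a\<bar>"] by linarith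
  then show ?thesis by blast
 qed
 have boxi: "integrable lborel (%x. indicator (cbox a' b') x * F x)" if "F \<in> borel_measurable borel" "\<forall>x\<in>cbox a' b'. \<bar>F x\<bar> <= M" for F :: "real^2 => real" and M
 proof (rule Bochner_Integration.integrable_bound)
  show "integrable lborel (%x. indicator (cbox a' b') x * M :: real)"
   by (intro integrable_mult_left integrable_real_indicator) (auto simp: emeasure_lborel_cbox_eq)
  show "(%x. indicator (cbox a' b') x * F x) \<in> borel_measurable lborel" using that(1) by measurable
  show "AE x in lborel. norm (indicator (cbox a' b') x * F x) <= norm (indicator (cbox a' b') x * M)"
   using that(2) by (force simp: indicator_def)
 qed
 obtain M where M: "\<forall>x\<in>cbox a' b'. \<bar>?S x\<bar> <= M" using Mex by blast
 have iS: "integrable lborel (%x. indicator (cbox a' b') x * ?S x)" by (rule boxi[OF _ M]) measurable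
 have iG: "integrable lborel (%x. indicator (cbox a' b') x * ?G x)"
 proof (rule boxi)
  show "\<forall>x\<in>cbox a' b'. \<bar>?G x\<bar> <= \<bar>b\<bar> + \<bar>a\<bar>"
  proof
   fix x :: "real^2"
   show "\<bar>?G x\<bar> <= \<bar>b\<bar> + \<bar>a\<bar>"
    using square_wave_cases[of "x $ i / \<epsilon>"] by auto
  qed
 qed measurable
 have "(\<integral>x. (u x - indicator (cbox a' b') x * ?S x) * \<psi> x \<partial>lborel) = (\<integral>x. u x * \<psi> x \<partial>lborel) - (\<integral>x. indicator (cbox a' b') x * ?S x * \<psi> x \<partial>lborel)"
  unfolding left_diff_distrib
  by (rule Bochner_Integration.integral_diff; intro bd u iS) (use B \<psi>' in auto)
 also have "(\<integral>x. indicator (cbox a' b') x * ?S x * \<psi> x \<partial>lborel) = (\<integral>x. ?S x * \<psi> x \<partial>lborel)"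
  by (intro Bochner_Integration.integral_cong) (use \<psi>0 in \<open>auto simp: indicator_def\<close>)
 also have "\<dots> = - (\<integral>x. ?G x * \<phi> x \<partial>lborel)"
  unfolding \<psi>(1) by (rule saw_weak_derivative[OF \<epsilon> C[rule_format] compact_cbox s'])
 also have "(\<integral>x. ?G x * \<phi> x \<partial>lborel) = (\<integral>x. indicator (cbox a' b') x * ?G x * \<phi> x \<partial>lborel)"
  by (intro Bochner_Integration.integral_cong) (use s' in \<open>auto simp: indicator_def\<close>)
 also have "(\<integral>x. u x * \<psi> x \<partial>lborel) = - (\<integral>x. g x * \<phi> x \<partial>lborel)"
  unfolding \<psi>(1) using W C s by (auto simp: weak_deriv_on_def)
 also have "- (\<integral>x. g x * \<phi> x \<partial>lborel) - - (\<integral>x. indicator (cbox a' b') x * ?G x * \<phi> x \<partial>lborel)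
  = - (\<integral>x. (g x - indicator (cbox a' b') x * ?G x) * \<phi> x \<partial>lborel)"
  unfolding left_diff_distrib
  by (subst Bochner_Integration.integral_diff) (auto intro!: bd g iG B)
 finally show "(\<integral>x. (u x - indicator (cbox a' b') x * ?S x) * frechet_derivative \<phi> (at x) (axis j 1) \<partial>lborel)
   = - (\<integral>x. (g x - indicator (cbox a' b') x * ?G x) * \<phi> x \<partial>lborel)"
  unfolding \<psi>' .
qed

lemma tent_integral_pos:
 assumes \<rho>: "\<rho> > 0" and i: "integrable lborel (tent p \<rho>)"
 shows "(\<integral>x. tent p \<rho> x \<partial>lborel) > 0"
proof -
 let ?C = "cbox (p - vec (\<rho> / 2)) (p + vec (\<rho> / 2))"
 have "0 < measure lborel ?C * (1/4)"
 proof -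
  have "0 < measure lborel (box (p - vec (\<rho> / 2)) (p + vec (\<rho> / 2)))"
   by (subst measure_lborel_box_eq) (use \<rho> in \<open>auto simp: inner_axis Basis_vec_def intro!: prod_pos\<close>)
  also have "\<dots> <= measure lborel ?C"
   using box_subset_cbox by (intro measure_mono_fmeasurable) (auto simp: fmeasurable_def emeasure_lborel_cbox_eq)
  finally show ?thesis by simp
 qed
 also have "\<dots> = (\<integral>x. indicator ?C x * (1/4) \<partial>lborel)" by simp
 also have "\<dots> <= (\<integral>x. tent p \<rho> x \<partial>lborel)"
 proof (rule integral_mono[OF _ i])
  show "integrable lborel (%x. indicator ?C x * (1/4) :: real)"
   by (intro integrable_mult_left integrable_real_indicator) (auto simp: emeasure_lborel_cbox_eq)
  show "indicator ?C x * (1/4) <= tent p \<rho> x" for x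
  proof (cases "x \<in> ?C")
   case True
   then have "p $ 1 - \<rho> / 2 <= x $ 1" "x $ 1 <= p $ 1 + \<rho> / 2" "p $ 2 - \<rho> / 2 <= x $ 2" "x $ 2 <= p $ 2 + \<rho> / 2"
    by (simp_all add: mem_cbox_2)
   then have "\<bar>x $ 1 - p $ 1\<bar> <= \<rho> / 2" "\<bar>x $ 2 - p $ 2\<bar> <= \<rho> / 2"
    by linarith+
   then have "1/2 <= 1 - \<bar>x $ 1 - p $ 1\<bar> / \<rho>" "1/2 <= 1 - \<bar>x $ 2 - p $ 2\<bar> / \<rho>"
    using \<rho> by (auto simp: field_simps)
   then have f: "1/2 <= max 0 (1 - \<bar>x $ 1 - p $ 1\<bar> / \<rho>)" "1/2 <= max 0 (1 - \<bar>x $ 2 - p $ 2\<bar> / \<rho>)"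
    by (blast intro: order_trans[OF _ max.cobounded2])+
   have "(1/2) * (1/2) <= tent p \<rho> x"
    unfolding tent_def by (intro mult_mono) (rule f | simp)+
   then show ?thesis using True by simp
  qed (use tent_bounds[OF \<rho>] in auto)
 qed
 finally show ?thesis .
qed

text \<open>The pairs \<open>(\<partial>\<^sub>1u\<^sub>1, \<partial>\<^sub>2u\<^sub>2)\<close> admitted at \<open>x\<close>.  The pairs with second entry \<open>2\<close> have first entry \<open>-2\<close>
 where the square wave is \<open>1\<close>, and \<open>3\<close> where it is \<open>-1\<close>.\<close>

definition phase_pairs :: "real => (real \<times> real) set" where
 "phase_pairs s = (if s = 1 then {(0,0), (-1/2,1), (-2,2)} else {(0,0), (5/2,1), (3,2)})"

text \<open>For an exact pair one of the two factors is zero: the second is positive only when b =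
  2, and there \<open>a\<close> equals the subtracted slope. A pair known up to \<open>d\<close>
  then gives a product of order d + d^2, and Young's inequality replaces \<open>d\<close> by its
  square plus a multiple of \<kappa>.\<close>

lemma phase_pairs_product_bound:
 assumes ab: "(a, b) \<in> phase_pairs s" and s: "s = 1 \<or> s = -1" and d: "\<bar>f - a\<bar> <= d" "\<bar>g - b\<bar> <= d" and \<kappa>: "\<kappa> > 0"
 shows "\<bar>1/6 + (f - (2/3 - 5/2 * s))\<bar> * max 0 (g - 1) <= 3 * \<kappa> + (3 / \<kappa> + 1) * d\<^sup>2"
  and "(g - 1)\<^sup>2 <= 2 + 2 * d\<^sup>2"
proof -
 have d0: "0 <= d" using d by linarith
 \<comment> \<open>\<open>2/3 - 1/6 = 1/2\<close>, so the subtracted slope is -2 for s = 1 and 3 for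
   s = -1. The values of \<open>A\<close> are 2, 3/2, 0 and 3, 1/2, 0; those of \<open>b - 1\<close>
   are -1, 0, 1.\<close>
 define A where "A = \<bar>a - (1/2 - 5/2 * s)\<bar>"
 define B where "B = max 0 (b - 1)"
 have AB: "A * B = 0" "0 <= A" "A <= 3" "0 <= B" "B <= 1" "\<bar>b - 1\<bar> <= 1"
  using ab s by (auto simp: phase_pairs_def A_def B_def split: if_splits)
 have "\<bar>1/6 + (f - (2/3 - 5/2 * s))\<bar> <= A + d" using d unfolding A_def by linarith
 moreover have "max 0 (g - 1) <= B + d" using d unfolding B_def by linarith
 ultimately have "\<bar>1/6 + (f - (2/3 - 5/2 * s))\<bar> * max 0 (g - 1) <= (A + d) * (B + d)"
  using AB d0 by (intro mult_mono) auto
 also have "\<dots> = (A + B) * d + d\<^sup>2" using AB by (simp add: algebra_simps power2_eq_square)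
 also have "\<dots> <= 6 * d + d\<^sup>2" using AB d0 by (intro add_right_mono mult_right_mono) auto
 also have "6 * d <= 3 * \<kappa> + 3 / \<kappa> * d\<^sup>2"
 proof -
  have "\<bar>1 * d\<bar> <= (1\<^sup>2 / (1/\<kappa>) + (1/\<kappa>) * d\<^sup>2) / 2" using \<kappa> by (intro mult_le_Young) auto
  then show ?thesis using d0 by simp
 qed
 finally show "\<bar>1/6 + (f - (2/3 - 5/2 * s))\<bar> * max 0 (g - 1) <= 3 * \<kappa> + (3 / \<kappa> + 1) * d\<^sup>2"
  by (simp add: distrib_right)
 have "\<bar>g - 1\<bar> <= 1 + d" using d AB(6) by linarith
 then have "(g - 1)\<^sup>2 <= (1 + d)\<^sup>2" using d0 by (simp add: abs_le_square_iff[symmetric])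
 also have "\<dots> <= 2 + 2 * d\<^sup>2" using zero_le_power2[of "1 - d"] by (simp add: power2_sum power2_diff)
 finally show "(g - 1)\<^sup>2 <= 2 + 2 * d\<^sup>2" .
qed

text \<open>\<open>weak_derivative_inequality\<close> with \<alpha> = 1/6, \<beta> = 1/3, \<gamma> =
  0. Along a recovery sequence the integrals of \<open>D\<close> squared and of \<open>E\<close> and
  the scale \<epsilon> tend to 0; the terms left over all carry the factor \<kappa>, while the left
  side is a fixed positive number.\<close>

lemma rigidity_step:
 fixes u1 u2 g11 g12 g21 g22 D E :: "real^2 => real" and p :: "real^2"
 assumes \<rho>: "\<rho> > 0" and \<epsilon>: "\<epsilon> > 0" and \<kappa>: "\<kappa> > 0"
 defines "K \<equiv> cbox (p - vec (4 * \<rho>)) (p + vec (4 * \<rho>))"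
 assumes L1: "integrable lborel u1" "integrable lborel u2" "integrable lborel g11" "integrable lborel g12"
   "integrable lborel g21" "integrable lborel g22"
  and L2: "integrable lborel (%x. (u1 x)\<^sup>2)" "integrable lborel (%x. (u2 x)\<^sup>2)" "integrable lborel (%x. (g11 x)\<^sup>2)"
   "integrable lborel (%x. (g12 x)\<^sup>2)" "integrable lborel (%x. (g21 x)\<^sup>2)" "integrable lborel (%x. (g22 x)\<^sup>2)"
  and W: "weak_deriv_on (p - vec (4 * \<rho>)) (p + vec (4 * \<rho>)) (axis 1 1) u1 g11"
   "weak_deriv_on (p - vec (4 * \<rho>)) (p + vec (4 * \<rho>)) (axis 2 1) u1 g12"
   "weak_deriv_on (p - vec (4 * \<rho>)) (p + vec (4 * \<rho>)) (axis 1 1) u2 g21"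
   "weak_deriv_on (p - vec (4 * \<rho>)) (p + vec (4 * \<rho>)) (axis 2 1) u2 g22"
  and D: "integrable lborel (%x. (D x)\<^sup>2)" and E: "integrable lborel E" "!!x. 0 <= E x"
  and close: "AE x in lborel. x \<in> K --> (u1 x - 2/3 * x $ 1)\<^sup>2 + (u2 x - 4/3 * x $ 2)\<^sup>2 <= E x"
  and pairs: "AE x in lborel. x \<in> K --> (\<exists>a b. (a, b) \<in> phase_pairs (square_wave (x $ 1 / \<epsilon>)) \<and>
    \<bar>g11 x - a\<bar> <= D x \<and> \<bar>g22 x - b\<bar> <= D x \<and> \<bar>g12 x\<bar> <= D x \<and> \<bar>g21 x\<bar> <= D x)"
 shows "1/18 * (\<integral>x. tent p \<rho> x \<partial>lborel) \<le>
   (3 * \<kappa> * measure lborel K + (3 / \<kappa> + 1) * (\<integral>x. (D x)\<^sup>2 \<partial>lborel))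
  + 1 / (6 * \<rho>) * (\<kappa> / 2 * measure lborel K + 1 / (2 * \<kappa>) * (\<integral>x. E x \<partial>lborel))
  + ((1 / (2 * \<rho> * \<kappa>) + 1 / (2 * \<rho>)) * (2 * (\<integral>x. E x \<partial>lborel) + 4 * \<epsilon>\<^sup>2 * measure lborel K) + 1/2 * (\<integral>x. (D x)\<^sup>2 \<partial>lborel)
   + \<kappa> / (2 * \<rho>) * (2 * measure lborel K + 2 * (\<integral>x. (D x)\<^sup>2 \<partial>lborel)) + (1/2 + 1 / (2 * \<rho>)) * (\<integral>x. (D x)\<^sup>2 \<partial>lborel))"
proof -
 have [measurable]: "u1 \<in> borel_measurable borel" "u2 \<in> borel_measurable borel" "g11 \<in> borel_measurable borel"
  "g12 \<in> borel_measurable borel" "g21 \<in> borel_measurable borel" "g22 \<in> borel_measurable borel" "E \<in> borel_measurable borel"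
  using L1 E by auto
 define B where "B = cbox (p - vec (3 * \<rho>)) (p + vec (3 * \<rho>))"
 have [measurable]: "K \<in> sets borel" "B \<in> sets borel" by (auto simp: K_def B_def)
 have BK: "x \<in> B ==> x \<in> K" for x using \<rho> by (auto simp: B_def K_def mem_cbox_2)
 \<comment> \<open>The phase slopes -2 and 3 increased by 1/6: the mean slope becomes 2/3, so that
   \<open>r\<close> tends to 0.\<close>
 define S where "S x = saw (2/3) (-5/2) \<epsilon> (x $ 1)" for x :: "real^2"
 define r where "r x = u1 x - indicator K x * S x" for x
 define r1 where "r1 x = g11 x - indicator K x * (2/3 + (-5/2) * square_wave (x $ 1 / \<epsilon>))" for x
 define v where "v x = u2 x - indicator K x * (1 * x $ 2)" for x
 define v2 where "v2 x = g22 x - indicator K x * 1" for x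
 have [measurable]: "S \<in> borel_measurable borel"
  unfolding S_def[abs_def] by (rule measurable_compose[OF vec_nth_measurable_2 saw_meas[OF \<epsilon>]])
 have [measurable]: "r \<in> borel_measurable borel" "r1 \<in> borel_measurable borel" "v \<in> borel_measurable borel" "v2 \<in> borel_measurable borel"
  unfolding r_def[abs_def] r1_def[abs_def] v_def[abs_def] v2_def[abs_def] by measurable
 have Ki: "integrable lborel (%x. indicator K x * k)" for k :: real
  unfolding K_def by (intro integrable_mult_left integrable_real_indicator) (auto simp: emeasure_lborel_cbox_eq)
 have bK: "integrable lborel (%x. indicator K x * F x)" "integrable lborel (%x. (indicator K x * F x)\<^sup>2)"
  if [measurable]: "F \<in> borel_measurable borel" and F: "!!x. x \<in> K ==> \<bar>F x\<bar> <= M" for F :: "real^2 => real" and M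
 proof -
  show "integrable lborel (%x. indicator K x * F x)"
   by (rule Bochner_Integration.integrable_bound[OF Ki[of M]]) (use F in \<open>force simp: indicator_def\<close>)+
  show "integrable lborel (%x. (indicator K x * F x)\<^sup>2)"
  proof (rule Bochner_Integration.integrable_bound[OF Ki[of "M\<^sup>2"]])
   have "(F x)\<^sup>2 <= M\<^sup>2" if "x \<in> K" for x
    using power_mono[OF F[OF that], of 2] by simp
   then show "AE x in lborel. norm ((indicator K x * F x)\<^sup>2) <= norm (indicator K x * M\<^sup>2)"
    by (auto simp: indicator_def)
  qed simp
 qed
 obtain R where R: "!!x. x \<in> K ==> norm x <= R"
  using bounded_cbox[of "p - vec (4 * \<rho>)" "p + vec (4 * \<rho>)"] unfolding K_def bounded_iff by blast
 have Kc: "\<bar>x $ i\<bar> <= R" if "x \<in> K" for x i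
  using R[OF that] component_le_norm_cart[of x i] by linarith
 have SM: "\<bar>S x\<bar> <= 19/6 * R + \<bar>saw (2/3) (-5/2) \<epsilon> 0\<bar>" if "x \<in> K" for x
 proof -
  have "\<bar>S x - saw (2/3) (-5/2) \<epsilon> 0\<bar> <= 19/6 * \<bar>x $ 1\<bar>"
   using saw_Lipschitz[OF \<epsilon>, of "2/3" "-5/2" "x $ 1" 0] unfolding S_def by simp
  then show ?thesis using Kc[OF that, of 1] by linarith
 qed
 note bS = bK[of S, OF _ SM]
 have bx2: "integrable lborel (%x. indicator K x * (1 * x $ 2))" "integrable lborel (%x. (indicator K x * (1 * x $ 2))\<^sup>2)"
  by (rule bK[where M = R]; use Kc in simp)+
 have bs: "integrable lborel (%x. indicator K x * (2/3 + (-5/2) * square_wave (x $ 1 / \<epsilon>)))"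
  "integrable lborel (%x. (indicator K x * (2/3 + (-5/2) * square_wave (x $ 1 / \<epsilon>)))\<^sup>2)"
 proof -
  have sw: "\<bar>2/3 + (-5/2) * square_wave (x $ 1 / \<epsilon>)\<bar> <= 4" for x :: "real^2"
   using square_wave_cases[of "x $ 1 / \<epsilon>"] by auto
  show "integrable lborel (%x. indicator K x * (2/3 + (-5/2) * square_wave (x $ 1 / \<epsilon>)))"
  "integrable lborel (%x. (indicator K x * (2/3 + (-5/2) * square_wave (x $ 1 / \<epsilon>)))\<^sup>2)"
   by (rule bK[OF _ sw]; measurable)+
 qed
 have b1: "integrable lborel (%x. indicator K x * 1 :: real)" "integrable lborel (%x. (indicator K x * 1 :: real)\<^sup>2)"
  by (rule bK[where M = 1]; simp)+
 have i1: "integrable lborel r" "integrable lborel r1" "integrable lborel v" "integrable lborel v2"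
  unfolding r_def[abs_def] r1_def[abs_def] v_def[abs_def] v2_def[abs_def]
  by (intro Bochner_Integration.integrable_diff L1 bS bx2 bs b1; simp)+
 have i2: "integrable lborel (%x. (r x)\<^sup>2)" "integrable lborel (%x. (r1 x)\<^sup>2)" "integrable lborel (%x. (v x)\<^sup>2)" "integrable lborel (%x. (v2 x)\<^sup>2)"
  unfolding r_def[abs_def] r1_def[abs_def] v_def[abs_def] v2_def[abs_def]
  by (intro integrable_add_squares(2) L2 bS bx2 bs b1; measurable)+
 note ms = weak_deriv_on_minus_saw[where a' = "p - vec (4 * \<rho>)" and b' = "p + vec (4 * \<rho>)" and \<epsilon> = \<epsilon>, OF _ _ _ \<epsilon>, folded K_def]
 have W': "weak_deriv_on (p - vec (4 * \<rho>)) (p + vec (4 * \<rho>)) (axis 1 1) r r1"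
   "weak_deriv_on (p - vec (4 * \<rho>)) (p + vec (4 * \<rho>)) (axis 2 1) r g12"
   "weak_deriv_on (p - vec (4 * \<rho>)) (p + vec (4 * \<rho>)) (axis 1 1) v g21"
   "weak_deriv_on (p - vec (4 * \<rho>)) (p + vec (4 * \<rho>)) (axis 2 1) v v2"
  using ms[OF W(1) L1(1,3), of "2/3" "-5/2" 1] ms[OF W(2) L1(1,4), of "2/3" "-5/2" 1]
   ms[OF W(3) L1(2,5), of 1 0 2] ms[OF W(4) L1(2,6), of 1 0 2]
  unfolding r_def[abs_def] r1_def[abs_def] v_def[abs_def] v2_def[abs_def] S_def saw_linear by simp_all
 define d e m where "d = (\<integral>x. (D x)\<^sup>2 \<partial>lborel)" and "e = (\<integral>x. E x \<partial>lborel)" and "m = measure lborel K"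
 have le: "(\<integral>x. F x \<partial>lborel) <= a * m + b * d + c * e"
  if ae: "AE x in lborel. F x <= indicator K x * a + b * (D x)\<^sup>2 + c * E x" and nn: "0 <= a" "0 <= b" "0 <= c" for F a b c
 proof -
  have "(\<integral>x. F x \<partial>lborel) <= (\<integral>x. indicator K x * a + b * (D x)\<^sup>2 + c * E x \<partial>lborel)"
   using ae Ki[of a] D E nn by (intro integral_mono_AE') (auto intro!: AE_I2)
  also have "\<dots> = a * m + b * d + c * e"
   using Ki[of a] D E unfolding d_def e_def m_def by simp
  finally show ?thesis .
 qed
 have tB: "tent p \<rho> x = 0" if "x \<notin> K" for x
  by (rule tent_eq_0_outside[OF \<rho>, of "4 * \<rho>"]) (use that \<rho> in \<open>auto simp: K_def\<close>)
 have D0: "0 <= b * (D x)\<^sup>2 + c * E x" if "0 <= b" "0 <= c" for b c x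
  using that E(2) by simp
 have I1: "(\<integral>x. tent p \<rho> x * (\<bar>1/6 + r1 x\<bar> * max 0 (v2 x)) \<partial>lborel) <= 3 * \<kappa> * m + (3 / \<kappa> + 1) * d + 0 * e"
 proof (rule le)
  show "AE x in lborel. tent p \<rho> x * (\<bar>1/6 + r1 x\<bar> * max 0 (v2 x)) <= indicator K x * (3 * \<kappa>) + (3 / \<kappa> + 1) * (D x)\<^sup>2 + 0 * E x"
   using pairs
  proof eventually_elim
   case (elim x)
   show ?case
   proof (cases "x \<in> K")
    case True
    then obtain a b where ab: "(a, b) \<in> phase_pairs (square_wave (x $ 1 / \<epsilon>))" "\<bar>g11 x - a\<bar> <= D x" "\<bar>g22 x - b\<bar> <= D x"
     using elim by blast
    have "\<bar>1/6 + r1 x\<bar> * max 0 (v2 x) <= 3 * \<kappa> + (3 / \<kappa> + 1) * (D x)\<^sup>2"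
     using phase_pairs_product_bound(1)[OF ab(1) square_wave_cases ab(2,3) \<kappa>] True by (simp add: r1_def v2_def)
    moreover have "tent p \<rho> x * (\<bar>1/6 + r1 x\<bar> * max 0 (v2 x)) <= 1 * (\<bar>1/6 + r1 x\<bar> * max 0 (v2 x))"
     using tent_bounds[OF \<rho>, of p x] by (intro mult_right_mono) auto
    ultimately show ?thesis using True by simp
   next
    case False
    then show ?thesis using tB[OF False] \<kappa> by simp
   qed
  qed
 qed (use \<kappa> in auto)
 have I2: "(\<integral>x. indicator B x * (\<kappa> / 2 + (v x - (1/3 * x $ 2 + 0))\<^sup>2 / (2 * \<kappa>)) \<partial>lborel) <= \<kappa> / 2 * m + 0 * d + 1 / (2 * \<kappa>) * e"
 proof (rule le)
  show "AE x in lborel. indicator B x * (\<kappa> / 2 + (v x - (1/3 * x $ 2 + 0))\<^sup>2 / (2 * \<kappa>)) <= indicator K x * (\<kappa> / 2) + 0 * (D x)\<^sup>2 + 1 / (2 * \<kappa>) * E x"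
   using close
  proof eventually_elim
   case (elim x)
   show ?case
   proof (cases "x \<in> B")
    case True
    then have K: "x \<in> K" by (rule BK)
    have "v x - (1/3 * x $ 2 + 0) = u2 x - 4/3 * x $ 2" using K by (simp add: v_def)
    moreover have "(u2 x - 4/3 * x $ 2)\<^sup>2 <= E x" using elim K zero_le_power2[of "u1 x - 2/3 * x $ 1"] by linarith
    ultimately show ?thesis using True K \<kappa> by (simp add: divide_right_mono)
   next
    case False
    then show ?thesis using E(2)[of x] \<kappa> by (simp add: indicator_def)
   qed
  qed
 qed (use \<kappa> in auto)
 \<comment> \<open>The sawtooth is within 5/4 \<epsilon> of its mean line. Squaring the sum doubles
   both squares, and 2 (5/4)^2 is at most 4.\<close>
 have I3: "(\<integral>x. indicator B x * (r x)\<^sup>2 \<partial>lborel) <= 4 * \<epsilon>\<^sup>2 * m + 0 * d + 2 * e"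
 proof (rule le)
  show "AE x in lborel. indicator B x * (r x)\<^sup>2 <= indicator K x * (4 * \<epsilon>\<^sup>2) + 0 * (D x)\<^sup>2 + 2 * E x"
   using close
  proof eventually_elim
   case (elim x)
   show ?case
   proof (cases "x \<in> B")
    case True
    then have K: "x \<in> K" by (rule BK)
    define q where "q = 5/2 * (\<epsilon> * tri (x $ 1 / \<epsilon>))"
    have "r x = (u1 x - 2/3 * x $ 1) + q" using K by (simp add: r_def S_def saw_def q_def)
    then have "(r x)\<^sup>2 <= 2 * (u1 x - 2/3 * x $ 1)\<^sup>2 + 2 * q\<^sup>2"
     using zero_le_power2[of "(u1 x - 2/3 * x $ 1) - q"] by (simp add: power2_sum power2_diff)
    moreover have "q\<^sup>2 <= (5/4 * \<epsilon>)\<^sup>2"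
    proof (rule power_mono)
     show "0 <= q" using tri_bounds(1) \<epsilon> by (simp add: q_def)
     have "\<epsilon> * tri (x $ 1 / \<epsilon>) <= \<epsilon> * (1/2)" using tri_bounds(2) \<epsilon> by (intro mult_left_mono) auto
     then show "q <= 5/4 * \<epsilon>" by (simp add: q_def)
    qed
    moreover have "(5/4 * \<epsilon>)\<^sup>2 <= 2 * \<epsilon>\<^sup>2" by (simp add: power2_eq_square)
    moreover have "(u1 x - 2/3 * x $ 1)\<^sup>2 <= E x" using elim K zero_le_power2[of "u2 x - 4/3 * x $ 2"] by linarith
    ultimately show ?thesis using True K by simp
   next
    case False
    then show ?thesis using E(2)[of x] by (simp add: indicator_def)
   qed
  qed
 qed auto
 have aeD: "AE x in lborel. x \<in> K --> (g12 x)\<^sup>2 <= (D x)\<^sup>2 \<and> (g21 x)\<^sup>2 <= (D x)\<^sup>2 \<and> (g22 x - 1)\<^sup>2 <= 2 + 2 * (D x)\<^sup>2"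
  using pairs
 proof eventually_elim
  case (elim x)
  show ?case
  proof
   assume "x \<in> K"
   then obtain a b where ab: "(a, b) \<in> phase_pairs (square_wave (x $ 1 / \<epsilon>))" "\<bar>g11 x - a\<bar> <= D x" "\<bar>g22 x - b\<bar> <= D x"
    "\<bar>g12 x\<bar> <= D x" "\<bar>g21 x\<bar> <= D x"
    using elim by blast
   have "(g12 x)\<^sup>2 <= (D x)\<^sup>2" "(g21 x)\<^sup>2 <= (D x)\<^sup>2"
    using power_mono[OF ab(4), of 2] power_mono[OF ab(5), of 2] by auto
   then show "(g12 x)\<^sup>2 <= (D x)\<^sup>2 \<and> (g21 x)\<^sup>2 <= (D x)\<^sup>2 \<and> (g22 x - 1)\<^sup>2 <= 2 + 2 * (D x)\<^sup>2"
    using phase_pairs_product_bound(2)[OF ab(1) square_wave_cases ab(2,3) \<kappa>] by blast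
  qed
 qed
 have I4: "(\<integral>x. indicator B x * (g12 x)\<^sup>2 \<partial>lborel) <= 0 * m + 1 * d + 0 * e"
  and I5: "(\<integral>x. indicator B x * (v2 x)\<^sup>2 \<partial>lborel) <= 2 * m + 2 * d + 0 * e"
  and I6: "(\<integral>x. indicator B x * (g21 x)\<^sup>2 \<partial>lborel) <= 0 * m + 1 * d + 0 * e"
 proof -
  show "(\<integral>x. indicator B x * (g12 x)\<^sup>2 \<partial>lborel) <= 0 * m + 1 * d + 0 * e"
   by (rule le, use aeD in eventually_elim) (use BK in \<open>auto simp: indicator_def\<close>)
  show "(\<integral>x. indicator B x * (v2 x)\<^sup>2 \<partial>lborel) <= 2 * m + 2 * d + 0 * e"
   by (rule le, use aeD in eventually_elim) (use BK in \<open>auto simp: indicator_def v2_def\<close>)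
  show "(\<integral>x. indicator B x * (g21 x)\<^sup>2 \<partial>lborel) <= 0 * m + 1 * d + 0 * e"
   by (rule le, use aeD in eventually_elim) (use BK in \<open>auto simp: indicator_def\<close>)
 qed
 have main: "1/6 * (1/3) * (\<integral>x. tent p \<rho> x \<partial>lborel) \<le>
  (\<integral>x. tent p \<rho> x * (\<bar>1/6 + r1 x\<bar> * max 0 (v2 x)) \<partial>lborel)
  + (1/6) / \<rho> * (\<integral>x. indicator B x * (\<kappa> / 2 + (v x - (1/3 * x $ 2 + 0))\<^sup>2 / (2 * \<kappa>)) \<partial>lborel)
  + ((1 / (2 * \<rho> * \<kappa>) + 1 / (2 * \<rho>)) * (\<integral>x. indicator B x * (r x)\<^sup>2 \<partial>lborel) + 1/2 * (\<integral>x. indicator B x * (g12 x)\<^sup>2 \<partial>lborel)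
   + \<kappa> / (2 * \<rho>) * (\<integral>x. indicator B x * (v2 x)\<^sup>2 \<partial>lborel) + (1/2 + 1 / (2 * \<rho>)) * (\<integral>x. indicator B x * (g21 x)\<^sup>2 \<partial>lborel))"
  unfolding B_def
  by (rule weak_derivative_inequality[OF \<rho> _ _ \<kappa> i1(1,3,2) L1(4,5) i1(4) i2(1,3,2) L2(4,5) i2(4) W']) auto
 also have "\<dots> <= (3 * \<kappa> * m + (3 / \<kappa> + 1) * d + 0 * e)
  + (1/6) / \<rho> * (\<kappa> / 2 * m + 0 * d + 1 / (2 * \<kappa>) * e)
  + ((1 / (2 * \<rho> * \<kappa>) + 1 / (2 * \<rho>)) * (4 * \<epsilon>\<^sup>2 * m + 0 * d + 2 * e) + 1/2 * (0 * m + 1 * d + 0 * e)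
   + \<kappa> / (2 * \<rho>) * (2 * m + 2 * d + 0 * e) + (1/2 + 1 / (2 * \<rho>)) * (0 * m + 1 * d + 0 * e))"
  using \<rho> \<kappa> by (intro add_mono mult_left_mono I1 I2 I3 I4 I5 I6) auto
 finally show ?thesis
  unfolding d_def[symmetric] e_def[symmetric] m_def[symmetric] by (simp add: add.commute)
qed

section \<open>Passage from classes on a subset to Borel functions on the plane\<close>

lemma integrable_lebesgue_on_iff:
 fixes F F' :: "real^2 => real"
 assumes [measurable]: "K \<in> sets borel" "F' \<in> borel_measurable borel" and F: "F \<in> borel_measurable (lebesgue_on K)"
  and ae: "AE x in lborel. x \<in> K --> F x = F' x"
 shows "integrable (lebesgue_on K) F \<longleftrightarrow> integrable lborel (%x. indicator K x * F' x)"
  and "integral\<^sup>L (lebesgue_on K) F = (\<integral>x. indicator K x * F' x \<partial>lborel)"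
proof -
 have K: "K \<inter> space lebesgue \<in> sets lebesgue" by auto
 have F'm: "F' \<in> borel_measurable (lebesgue_on K)"
  by (intro measurable_restrict_space1 measurable_completion) auto
 have ae': "AE x in lebesgue_on K. F x = F' x"
  using ae by (subst AE_restrict_space_iff[OF K]) (simp add: AE_completion_iff)
 have im: "(%x. indicator K x * F' x) \<in> borel_measurable lborel" by measurable
 have "integrable (lebesgue_on K) F \<longleftrightarrow> integrable (lebesgue_on K) F'"
  by (rule integrable_cong_AE[OF F F'm ae'])
 also have "\<dots> \<longleftrightarrow> integrable lebesgue (%x. indicator K x * F' x)"
  by (subst integrable_restrict_space[OF K]) simp
 also have "\<dots> \<longleftrightarrow> integrable lborel (%x. indicator K x * F' x)"
  by (rule integrable_completion[OF im])
 finally show "integrable (lebesgue_on K) F \<longleftrightarrow> integrable lborel (%x. indicator K x * F' x)" .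
 have "integral\<^sup>L (lebesgue_on K) F = integral\<^sup>L (lebesgue_on K) F'"
  by (rule integral_cong_AE[OF F F'm ae'])
 also have "\<dots> = integral\<^sup>L lebesgue (%x. indicator K x * F' x)"
  by (subst integral_restrict_space[OF K]) simp
 also have "\<dots> = (\<integral>x. indicator K x * F' x \<partial>lborel)"
  by (rule integral_completion[OF im])
 finally show "integral\<^sup>L (lebesgue_on K) F = (\<integral>x. indicator K x * F' x \<partial>lborel)" .
qed

text \<open>Extension by zero off \<open>K\<close> turns integrals over \<open>K\<close> into
  integrals over the plane, where translations are available.\<close>

lemma borel_representative:
 fixes F :: "real^2 => real"
 assumes K [measurable]: "K \<in> sets borel" and F: "F \<in> borel_measurable (lebesgue_on K)"
 obtains F' where "F' \<in> borel_measurable borel" "AE x in lborel. x \<in> K --> F x = F' x" "!!x. x \<notin> K ==> F' x = 0"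
proof -
 have K': "K \<in> sets lebesgue" using K by auto
 have "(%x. indicator K x * F x) \<in> borel_measurable lebesgue"
  using F K' by (subst (asm) borel_measurable_restrict_space_iff) auto
 then obtain g where g: "g \<in> borel_measurable lborel" "AE x in lborel. indicator K x * F x = g x"
  using completion_ex_borel_measurable_real by blast
 show ?thesis
 proof (rule that[of "%x. indicator K x * g x"])
  show "(%x. indicator K x * g x) \<in> borel_measurable borel" using g(1) by simp
  show "AE x in lborel. x \<in> K --> F x = indicator K x * g x"
   using g(2) by eventually_elim auto
 qed auto
qed

lemma integrable_vec_nth: "integrable M f ==> integrable M (%x. f x $ i)"
 for f :: "'a => 'b::euclidean_space ^ 'n"
 using integrable_bounded_linear[OF bounded_linear_vec_nth] by blast

lemma borel_measurable_vec_nth_comp: "f \<in> borel_measurable M ==> (%x. f x $ i) \<in> borel_measurable M"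
 for f :: "'a => 'b::euclidean_space ^ 'n"
 by (rule measurable_compose[of f M borel "%y. y $ i" borel]) (auto intro!: borel_measurable_continuous_onI continuous_intros)

text \<open>A smooth function vanishing off the open box is a test function on \<Omega>, with the
  closed box as its compact set, so the scalar notion on the box follows entry by entry.\<close>

lemma weak_gradient_imp_weak_deriv_on:
 fixes u :: "real^2 => real^2" and G :: "real^2 => real^2^2"
 assumes WG: "has_weak_gradient \<Omega> u G" and K: "cbox a b \<subseteq> \<Omega>" and \<Omega>: "open \<Omega>"
  and [measurable]: "u' \<in> borel_measurable borel" "g' \<in> borel_measurable borel"
  and u': "AE x in lborel. x \<in> cbox a b --> u x $ i = u' x"
  and g': "AE x in lborel. x \<in> cbox a b --> G x $ i $ j = g' x"
 shows "weak_deriv_on a b (axis j 1) u' g'"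
 unfolding weak_deriv_on_def
proof (intro allI impI)
 fix \<phi> :: "real^2 => real" assume C: "\<forall>k. C_k k \<phi>" and s: "\<forall>x. x \<notin> box a b --> \<phi> x = 0"
 have s': "\<phi> x = 0" if "x \<notin> cbox a b" for x using s that box_subset_cbox by blast
 have test: "test_fun \<Omega> \<phi>"
  unfolding test_fun_def using C s' K by (intro conjI exI[of _ "cbox a b"]) auto
 obtain \<psi> where \<psi>: "!!x. \<psi> x = frechet_derivative \<phi> (at x) (axis j 1)" "continuous_on UNIV \<psi>"
  using C_k_1_directional[OF C[rule_format]] by metis
 have \<psi>0: "\<psi> x = 0" if "x \<notin> cbox a b" for x
  unfolding \<psi>(1) by (rule frechet_derivative_eq_0_outside[OF closed_cbox s' that])
 have [measurable]: "\<psi> \<in> borel_measurable borel" "\<phi> \<in> borel_measurable borel"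
  using \<psi>(2) C_k_imp_continuous_on[OF C[rule_format]] by (auto intro: borel_measurable_continuous_onI)
 have \<Omega>s: "\<Omega> \<inter> space lebesgue \<in> sets lebesgue" using \<Omega> by auto
 have Ks: "cbox a b \<inter> space lebesgue \<in> sets lebesgue" by auto
 have red: "integral\<^sup>L (lebesgue_on \<Omega>) (%x. f x * k x) = (\<integral>x. f' x * k x \<partial>lborel)"
  if k: "!!x. x \<notin> cbox a b ==> k x = 0" and [measurable]: "k \<in> borel_measurable borel" "f' \<in> borel_measurable borel"
   and fm: "f \<in> borel_measurable (lebesgue_on (cbox a b))" and ff': "AE x in lborel. x \<in> cbox a b --> f x = f' x"
  for f f' k :: "real^2 => real"
 proof -
  have "integral\<^sup>L (lebesgue_on \<Omega>) (%x. f x * k x) = integral\<^sup>L lebesgue (%x. indicator \<Omega> x *\<^sub>R (f x * k x))"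
   by (rule integral_restrict_space[OF \<Omega>s])
  also have "\<dots> = integral\<^sup>L lebesgue (%x. indicator (cbox a b) x *\<^sub>R (f x * k x))"
   by (intro Bochner_Integration.integral_cong) (use k K in \<open>auto simp: indicator_def\<close>)
  also have "\<dots> = integral\<^sup>L (lebesgue_on (cbox a b)) (%x. f x * k x)"
   by (rule integral_restrict_space[OF Ks, symmetric])
  also have "\<dots> = (\<integral>x. indicator (cbox a b) x * (f' x * k x) \<partial>lborel)"
  proof (rule integrable_lebesgue_on_iff(2))
   have "k \<in> borel_measurable (lebesgue_on (cbox a b))"
    by (intro measurable_restrict_space1 measurable_completion) auto
   then show "(%x. f x * k x) \<in> borel_measurable (lebesgue_on (cbox a b))" using fm by measurable
   show "AE x in lborel. x \<in> cbox a b --> f x * k x = f' x * k x" using ff' by eventually_elim auto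
  qed measurable
  also have "\<dots> = (\<integral>x. f' x * k x \<partial>lborel)"
   by (intro Bochner_Integration.integral_cong) (use k in \<open>auto simp: indicator_def\<close>)
  finally show ?thesis .
 qed
 have "integrable (lebesgue_on (cbox a b)) u" "integrable (lebesgue_on (cbox a b)) G"
  using WG K by (auto simp: has_weak_gradient_def locally_integrable_def)
 then have um: "(%x. u x $ i) \<in> borel_measurable (lebesgue_on (cbox a b))"
  and gm: "(%x. G x $ i $ j) \<in> borel_measurable (lebesgue_on (cbox a b))"
  by (auto intro!: borel_measurable_vec_nth_comp)
 have "(\<integral>x. u' x * \<psi> x \<partial>lborel) = integral\<^sup>L (lebesgue_on \<Omega>) (%x. u x $ i * \<psi> x)"
  by (rule red[symmetric, OF \<psi>0 _ _ um u']) auto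
 also have "\<dots> = - integral\<^sup>L (lebesgue_on \<Omega>) (%x. G x $ i $ j * \<phi> x)"
  unfolding \<psi>(1) using WG test by (auto simp: has_weak_gradient_def)
 also have "integral\<^sup>L (lebesgue_on \<Omega>) (%x. G x $ i $ j * \<phi> x) = (\<integral>x. g' x * \<phi> x \<partial>lborel)"
  by (rule red[OF s' _ _ gm g']) auto
 finally show "(\<integral>x. u' x * frechet_derivative \<phi> (at x) (axis j 1) \<partial>lborel) = - (\<integral>x. g' x * \<phi> x \<partial>lborel)"
  unfolding \<psi>(1) .
qed

lemma diag2_nth: "diag2 a b $ 1 $ 1 = a" "diag2 a b $ 1 $ 2 = 0" "diag2 a b $ 2 $ 1 = 0" "diag2 a b $ 2 $ 2 = b"
 by (simp_all add: diag2_def)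

lemma diag2_mult_vec: "(diag2 a b *v x) $ 1 = a * x $ 1" "(diag2 a b *v x) $ 2 = b * x $ 2"
 by (simp_all add: matrix_vector_mult_def sum_2 diag2_nth)

lemma abs_entry_le_norm: "\<bar>A $ i $ j\<bar> <= norm A" for A :: "real^2^2"
 using component_le_norm_cart[of "A $ i" j] Finite_Cartesian_Product.norm_nth_le[of A i] by linarith

text \<open>The common core of the two negative results. Only L2 information enters, so it applies
  both to weakly* convergent sequences and to sequences of small energy converging in Lp with
  \<open>p >= 2\<close>. \<open>D\<close> may be any measurable upper bound, tending to 0 in L2, for
  the distance to some admissible diagonal matrix.\<close>

theorem no_recovery_sequence:
 fixes u :: "nat => real^2 => real^2" and G :: "nat => real^2 => real^2^2" and D :: "nat => real^2 => real" and p :: "real^2"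
 assumes \<Omega>: "open \<Omega>" and \<rho>: "\<rho> > 0"
 defines "K \<equiv> cbox (p - vec (4 * \<rho>)) (p + vec (4 * \<rho>))"
 assumes K: "K \<subseteq> \<Omega>" and \<epsilon>: "!!h. \<epsilon> h > 0" "\<epsilon> \<longlonglongrightarrow> 0"
  and WG: "!!h. has_weak_gradient \<Omega> (u h) (G h)"
  and u2: "!!h. integrable (lebesgue_on K) (%x. (norm (u h x))\<^sup>2)"
  and G2: "!!h. integrable (lebesgue_on K) (%x. (norm (G h x))\<^sup>2)"
  and conv: "(%h. \<integral>x. (norm (u h x - diag2 (2/3) (4/3) *v x))\<^sup>2 \<partial>lebesgue_on K) \<longlonglongrightarrow> 0"
  and Dm: "!!h. D h \<in> borel_measurable (lebesgue_on K)" and D2: "!!h. integrable (lebesgue_on K) (%x. (D h x)\<^sup>2)"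
  and Dconv: "(%h. \<integral>x. (D h x)\<^sup>2 \<partial>lebesgue_on K) \<longlonglongrightarrow> 0"
  and pairs: "!!h. AE x in lebesgue_on K. \<exists>a b. (a, b) \<in> phase_pairs (square_wave (x $ 1 / \<epsilon> h)) \<and> norm (G h x - diag2 a b) <= D h x"
 shows False
proof -
 have [measurable]: "K \<in> sets borel" by (simp add: K_def)
 have Kb: "K \<in> sets borel" by simp
 have Ks: "K \<inter> space lebesgue \<in> sets lebesgue" by auto
 note unorm = u2
 define I where "I = (\<integral>x. tent p \<rho> x \<partial>lborel)"
 define m where "m = measure lborel K"
 define d where "d h = (\<integral>x. (D h x)\<^sup>2 \<partial>lebesgue_on K)" for h
 define e where "e h = (\<integral>x. (norm (u h x - diag2 (2/3) (4/3) *v x))\<^sup>2 \<partial>lebesgue_on K)" for h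
 have step: "1/18 * I \<le>
   (3 * \<kappa> * m + (3 / \<kappa> + 1) * d h)
  + 1 / (6 * \<rho>) * (\<kappa> / 2 * m + 1 / (2 * \<kappa>) * e h)
  + ((1 / (2 * \<rho> * \<kappa>) + 1 / (2 * \<rho>)) * (2 * e h + 4 * (\<epsilon> h)\<^sup>2 * m) + 1/2 * d h
   + \<kappa> / (2 * \<rho>) * (2 * m + 2 * d h) + (1/2 + 1 / (2 * \<rho>)) * d h)" if \<kappa>: "\<kappa> > 0" for \<kappa> h
 proof -
  have uG: "integrable (lebesgue_on K) (u h)" "integrable (lebesgue_on K) (G h)"
   using WG[of h] K by (auto simp: has_weak_gradient_def locally_integrable_def K_def)
  then have m1: "(%x. u h x $ i) \<in> borel_measurable (lebesgue_on K)" "(%x. G h x $ i $ j) \<in> borel_measurable (lebesgue_on K)" for i j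
   by (auto intro!: borel_measurable_vec_nth_comp)
  have um: "u h \<in> borel_measurable (lebesgue_on K)" using uG by auto
  have rep: "\<exists>F'. F' \<in> borel_measurable borel \<and> (AE x in lborel. x \<in> K --> F x = F' x) \<and> integrable lborel F' \<and> integrable lborel (%x. (F' x)\<^sup>2)"
   if F: "integrable (lebesgue_on K) F" "integrable (lebesgue_on K) (%x. (F x)\<^sup>2)" for F :: "real^2 => real"
  proof -
   have Fm: "F \<in> borel_measurable (lebesgue_on K)" using F by auto
   obtain F' where F': "F' \<in> borel_measurable borel" "AE x in lborel. x \<in> K --> F x = F' x" "!!x. x \<notin> K ==> F' x = 0"
    using borel_representative[OF Kb Fm] by blast
   have i: "(%x. indicator K x * F' x) = F'" "(%x. indicator K x * (F' x)\<^sup>2) = (%x. (F' x)\<^sup>2)"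
    using F'(3) by (auto simp: indicator_def fun_eq_iff)
   have "integrable lborel F'" using F(1) integrable_lebesgue_on_iff(1)[OF Kb F'(1) Fm F'(2)] unfolding i by simp
   moreover have "integrable lborel (%x. (F' x)\<^sup>2)"
   proof -
    have "AE x in lborel. x \<in> K --> (F x)\<^sup>2 = (F' x)\<^sup>2" using F'(2) by eventually_elim auto
    moreover have "(%x. (F' x)\<^sup>2) \<in> borel_measurable borel" using F'(1) by simp
    ultimately show ?thesis
     using F(2) Fm integrable_lebesgue_on_iff(1)[OF Kb, of "%x. (F' x)\<^sup>2" "%x. (F x)\<^sup>2"] unfolding i by simp
   qed
   ultimately show ?thesis using F' by blast
  qed
  have usq: "integrable (lebesgue_on K) (%x. (u h x $ i)\<^sup>2)" for i
   by (rule Bochner_Integration.integrable_bound[OF u2[of h]])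
    (use m1 component_le_norm_cart in \<open>auto simp: abs_le_square_iff[symmetric] intro!: AE_I2\<close>)
  have Gsq: "integrable (lebesgue_on K) (%x. (G h x $ i $ j)\<^sup>2)" for i j
   by (rule Bochner_Integration.integrable_bound[OF G2[of h]])
    (use m1 abs_entry_le_norm in \<open>auto simp: abs_le_square_iff[symmetric] intro!: AE_I2\<close>)
  have ui: "integrable (lebesgue_on K) (%x. u h x $ i)" and Gi: "integrable (lebesgue_on K) (%x. G h x $ i $ j)" for i j
   using uG by (auto intro!: integrable_vec_nth)
  obtain u1 where u1: "u1 \<in> borel_measurable borel" "AE x in lborel. x \<in> K --> u h x $ 1 = u1 x" "integrable lborel u1" "integrable lborel (%x. (u1 x)\<^sup>2)"
   using rep[OF ui usq, of 1] by blast
  obtain u2 where u2: "u2 \<in> borel_measurable borel" "AE x in lborel. x \<in> K --> u h x $ 2 = u2 x" "integrable lborel u2" "integrable lborel (%x. (u2 x)\<^sup>2)"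
   using rep[OF ui usq, of 2] by blast
  define Pg where "Pg i j F' \<longleftrightarrow> F' \<in> borel_measurable borel \<and> (AE x in lborel. x \<in> K --> G h x $ i $ j = F' x)
    \<and> integrable lborel F' \<and> integrable lborel (%x. (F' x)\<^sup>2)" for i j and F' :: "real^2 => real"
  define g where "g i j = (SOME F'. Pg i j F')" for i j
  have "Pg i j (g i j)" for i j
  proof -
   have "\<exists>F'. Pg i j F'" unfolding Pg_def by (rule rep[OF Gi Gsq])
   then show ?thesis unfolding g_def by (rule someI_ex[of "Pg i j"])
  qed
  then have g: "!!i j. g i j \<in> borel_measurable borel" "!!i j. AE x in lborel. x \<in> K --> G h x $ i $ j = g i j x"
   "!!i j. integrable lborel (g i j)" "!!i j. integrable lborel (%x. (g i j x)\<^sup>2)"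
   unfolding Pg_def by blast+
  obtain D' where D': "D' \<in> borel_measurable borel" "AE x in lborel. x \<in> K --> D h x = D' x" "!!x. x \<notin> K ==> D' x = 0"
   using borel_representative[OF Kb Dm] by blast
  have D'2: "integrable lborel (%x. (D' x)\<^sup>2)" "(\<integral>x. (D' x)\<^sup>2 \<partial>lborel) = d h"
  proof -
   have i: "(%x. indicator K x * (D' x)\<^sup>2) = (%x. (D' x)\<^sup>2)"
    using D'(3) by (auto simp: indicator_def fun_eq_iff)
   have a: "AE x in lborel. x \<in> K --> (D h x)\<^sup>2 = (D' x)\<^sup>2" using D'(2) by eventually_elim auto
   have b: "(%x. (D' x)\<^sup>2) \<in> borel_measurable borel" "(%x. (D h x)\<^sup>2) \<in> borel_measurable (lebesgue_on K)"
    using D'(1) Dm by auto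
   show "integrable lborel (%x. (D' x)\<^sup>2)" "(\<integral>x. (D' x)\<^sup>2 \<partial>lborel) = d h"
    using integrable_lebesgue_on_iff[OF Kb b a] D2[of h] unfolding i d_def by auto
  qed
  define C :: "real^2 => real^2" where "C x = diag2 (2/3) (4/3) *v x" for x
  have Cm: "C \<in> borel_measurable (lebesgue_on K)"
  proof -
   have "continuous_on UNIV C"
    unfolding C_def[abs_def] by (rule linear_continuous_on) (rule matrix_vector_mul_bounded_linear)
   then have "C \<in> borel_measurable borel" by (rule borel_measurable_continuous_onI)
   then show ?thesis by (intro measurable_restrict_space1 measurable_completion) auto
  qed
  have Em: "(%x. (norm (u h x - C x))\<^sup>2) \<in> borel_measurable (lebesgue_on K)"
   using um Cm by measurable
  obtain E0 where E0: "E0 \<in> borel_measurable borel" "AE x in lborel. x \<in> K --> (norm (u h x - C x))\<^sup>2 = E0 x" "!!x. x \<notin> K ==> E0 x = 0"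
   using borel_representative[OF Kb Em] by blast
  have Ei: "integrable (lebesgue_on K) (%x. (norm (u h x - C x))\<^sup>2)"
  proof -
   obtain R where R: "!!x. x \<in> K ==> norm (C x) <= R"
   proof -
    have "bounded (C ` K)"
     unfolding C_def K_def
     by (intro compact_imp_bounded compact_continuous_image linear_continuous_on matrix_vector_mul_bounded_linear compact_cbox)
    then have "\<exists>a. \<forall>x\<in>K. norm (C x) <= a" unfolding bounded_iff by simp
    then show ?thesis using that by blast
   qed
   have fm: "finite_measure (lebesgue_on K)"
    unfolding K_def by (intro finite_measureI) (simp add: emeasure_restrict_space emeasure_lborel_cbox_eq)
   have "integrable (lebesgue_on K) (%x. 2 * (norm (u h x))\<^sup>2 + 2 * R\<^sup>2)"
    by (intro Bochner_Integration.integrable_add integrable_mult_right unorm finite_measure.integrable_const[OF fm])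
   then show ?thesis
   proof (rule Bochner_Integration.integrable_bound[OF _ Em])
    show "AE x in lebesgue_on K. norm ((norm (u h x - C x))\<^sup>2) <= norm (2 * (norm (u h x))\<^sup>2 + 2 * R\<^sup>2)"
    proof (rule AE_I2)
     fix x assume "x \<in> space (lebesgue_on K)"
     then have x: "x \<in> K" by simp
     have "norm (u h x - C x) <= norm (u h x) + R" using norm_triangle_ineq4[of "u h x" "C x"] R[OF x] by linarith
     then have "(norm (u h x - C x))\<^sup>2 <= (norm (u h x) + R)\<^sup>2" by (intro power_mono) auto
     also have "\<dots> <= 2 * (norm (u h x))\<^sup>2 + 2 * R\<^sup>2"
      using zero_le_power2[of "norm (u h x) - R"] by (simp add: power2_sum power2_diff)
     finally show "norm ((norm (u h x - C x))\<^sup>2) <= norm (2 * (norm (u h x))\<^sup>2 + 2 * R\<^sup>2)" by simp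
    qed
   qed
  qed
  \<comment> \<open>The Borel representative may be negative on a null set, while
    \<open>rigidity_step\<close> asks for nonnegativity everywhere.\<close>
  define E where "E x = \<bar>E0 x\<bar>" for x
  have E: "AE x in lborel. x \<in> K --> (norm (u h x - C x))\<^sup>2 = E x"
   using E0(2)
  proof eventually_elim
   case (elim x)
   then show ?case unfolding E_def by (metis abs_of_nonneg zero_le_power2)
  qed
  have E2: "integrable lborel E" "(\<integral>x. E x \<partial>lborel) = e h"
  proof -
   have i: "(%x. indicator K x * E x) = E"
    using E0(3) by (auto simp: indicator_def fun_eq_iff E_def)
   have "E \<in> borel_measurable borel" using E0(1) by (simp add: E_def[abs_def])
   from integrable_lebesgue_on_iff[OF Kb this Em E] show "integrable lborel E" "(\<integral>x. E x \<partial>lborel) = e h"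
    using Ei unfolding i e_def C_def by auto
  qed
  have W: "weak_deriv_on (p - vec (4 * \<rho>)) (p + vec (4 * \<rho>)) (axis j 1) u1 (g 1 j)"
   "weak_deriv_on (p - vec (4 * \<rho>)) (p + vec (4 * \<rho>)) (axis j 1) u2 (g 2 j)" for j
   by (rule weak_gradient_imp_weak_deriv_on[OF WG[of h] K[unfolded K_def] \<Omega> u1(1) g(1) u1(2)[unfolded K_def] g(2)[unfolded K_def]])
    (rule weak_gradient_imp_weak_deriv_on[OF WG[of h] K[unfolded K_def] \<Omega> u2(1) g(1) u2(2)[unfolded K_def] g(2)[unfolded K_def]])
  have close: "AE x in lborel. x \<in> K --> (u1 x - 2/3 * x $ 1)\<^sup>2 + (u2 x - 4/3 * x $ 2)\<^sup>2 <= E x"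
   using u1(2) u2(2) E
  proof eventually_elim
   case (elim x)
   show ?case
   proof
    assume x: "x \<in> K"
    have "E x = (norm (u h x - C x))\<^sup>2" using elim x by simp
    also have "\<dots> = ((u h x - C x) $ 1)\<^sup>2 + ((u h x - C x) $ 2)\<^sup>2"
     unfolding power2_norm_eq_inner inner_vec_def sum_2 by (simp add: power2_eq_square)
    finally show "(u1 x - 2/3 * x $ 1)\<^sup>2 + (u2 x - 4/3 * x $ 2)\<^sup>2 <= E x"
     using elim x by (simp add: C_def diag2_mult_vec)
   qed
  qed
  have "AE x in lebesgue. x \<in> K --> (\<exists>a b. (a, b) \<in> phase_pairs (square_wave (x $ 1 / \<epsilon> h)) \<and> norm (G h x - diag2 a b) <= D h x)"
   using pairs[of h] AE_restrict_space_iff[OF Ks] by simp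
  then have "AE x in lborel. x \<in> K --> (\<exists>a b. (a, b) \<in> phase_pairs (square_wave (x $ 1 / \<epsilon> h)) \<and> norm (G h x - diag2 a b) <= D h x)"
   by (simp add: AE_completion_iff)
  then have pp: "AE x in lborel. x \<in> K --> (\<exists>a b. (a, b) \<in> phase_pairs (square_wave (x $ 1 / \<epsilon> h)) \<and>
    \<bar>g 1 1 x - a\<bar> <= D' x \<and> \<bar>g 2 2 x - b\<bar> <= D' x \<and> \<bar>g 1 2 x\<bar> <= D' x \<and> \<bar>g 2 1 x\<bar> <= D' x)"
   using g(2)[of 1 1] g(2)[of 1 2] g(2)[of 2 1] g(2)[of 2 2] D'(2)
  proof eventually_elim
   case (elim x)
   show ?case
   proof
    assume x: "x \<in> K"
    then obtain a b where ab: "(a, b) \<in> phase_pairs (square_wave (x $ 1 / \<epsilon> h))" "norm (G h x - diag2 a b) <= D h x"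
     using elim by blast
    have "\<bar>(G h x - diag2 a b) $ i $ j\<bar> <= D' x" for i j
     using abs_entry_le_norm[of "G h x - diag2 a b" i j] ab(2) elim x by simp
    from this[of 1 1] this[of 1 2] this[of 2 1] this[of 2 2]
    show "\<exists>a b. (a, b) \<in> phase_pairs (square_wave (x $ 1 / \<epsilon> h)) \<and>
     \<bar>g 1 1 x - a\<bar> <= D' x \<and> \<bar>g 2 2 x - b\<bar> <= D' x \<and> \<bar>g 1 2 x\<bar> <= D' x \<and> \<bar>g 2 1 x\<bar> <= D' x"
     using ab(1) elim x by (intro exI[of _ a] exI[of _ b]) (auto simp: diag2_nth)
   qed
  qed
  show ?thesis
   using rigidity_step[OF \<rho> \<epsilon>(1) \<kappa> u1(3) u2(3) g(3) g(3) g(3) g(3) u1(4) u2(4) g(4) g(4) g(4) g(4) W(1) W(1) W(2) W(2)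
     D'2(1) E2(1) _ close[unfolded K_def] pp[unfolded K_def]]
   unfolding D'2(2) E2(2) I_def m_def K_def by (simp add: E_def)
 qed
 have dl: "d \<longlonglongrightarrow> 0" and el: "e \<longlonglongrightarrow> 0"
  using Dconv conv unfolding d_def[abs_def] e_def[abs_def] by auto
 \<comment> \<open>The coefficient of \<kappa> that remains after \<open>d\<close>, \<open>e\<close>
   and \<epsilon> have tended to 0.\<close>
 define Q where "Q = 3 * m + 1 / (6 * \<rho>) * (m / 2) + 1 / (2 * \<rho>) * (2 * m)"
 have lim: "1/18 * I <= \<kappa> * Q" if \<kappa>: "\<kappa> > 0" for \<kappa>
 proof (rule LIMSEQ_le_const)
  show "(%h. (3 * \<kappa> * m + (3 / \<kappa> + 1) * d h)
  + 1 / (6 * \<rho>) * (\<kappa> / 2 * m + 1 / (2 * \<kappa>) * e h)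
  + ((1 / (2 * \<rho> * \<kappa>) + 1 / (2 * \<rho>)) * (2 * e h + 4 * (\<epsilon> h)\<^sup>2 * m) + 1/2 * d h
   + \<kappa> / (2 * \<rho>) * (2 * m + 2 * d h) + (1/2 + 1 / (2 * \<rho>)) * d h)) \<longlonglongrightarrow> \<kappa> * Q"
  proof -
   have "(%h. (3 * \<kappa> * m + (3 / \<kappa> + 1) * d h)
   + 1 / (6 * \<rho>) * (\<kappa> / 2 * m + 1 / (2 * \<kappa>) * e h)
   + ((1 / (2 * \<rho> * \<kappa>) + 1 / (2 * \<rho>)) * (2 * e h + 4 * (\<epsilon> h)\<^sup>2 * m) + 1/2 * d h
    + \<kappa> / (2 * \<rho>) * (2 * m + 2 * d h) + (1/2 + 1 / (2 * \<rho>)) * d h)) \<longlonglongrightarrow>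
    (3 * \<kappa> * m + (3 / \<kappa> + 1) * 0)
   + 1 / (6 * \<rho>) * (\<kappa> / 2 * m + 1 / (2 * \<kappa>) * 0)
   + ((1 / (2 * \<rho> * \<kappa>) + 1 / (2 * \<rho>)) * (2 * 0 + 4 * 0\<^sup>2 * m) + 1/2 * 0
    + \<kappa> / (2 * \<rho>) * (2 * m + 2 * 0) + (1/2 + 1 / (2 * \<rho>)) * 0)"
    by (intro tendsto_add tendsto_mult tendsto_power tendsto_const dl el \<epsilon>(2))
   then show ?thesis by (simp add: Q_def algebra_simps)
  qed
  show "\<exists>N. \<forall>h\<ge>N. 1/18 * I <= (3 * \<kappa> * m + (3 / \<kappa> + 1) * d h)
  + 1 / (6 * \<rho>) * (\<kappa> / 2 * m + 1 / (2 * \<kappa>) * e h)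
  + ((1 / (2 * \<rho> * \<kappa>) + 1 / (2 * \<rho>)) * (2 * e h + 4 * (\<epsilon> h)\<^sup>2 * m) + 1/2 * d h
   + \<kappa> / (2 * \<rho>) * (2 * m + 2 * d h) + (1/2 + 1 / (2 * \<rho>)) * d h)"
   using step[OF \<kappa>] by blast
 qed
 have ti: "integrable lborel (tent p \<rho>)"
 proof (rule Bochner_Integration.integrable_bound)
  show "integrable lborel (indicat_real K)"
   unfolding K_def by (intro integrable_real_indicator) (auto simp: emeasure_lborel_cbox_eq)
  show "AE x in lborel. norm (tent p \<rho> x) <= norm (indicat_real K x)"
   using tent_bounds[OF \<rho>] tent_eq_0_outside[OF \<rho>, of "4 * \<rho>" _ p] \<rho> by (auto simp: indicator_def K_def)
 qed simp
 have I: "I > 0" unfolding I_def by (rule tent_integral_pos[OF \<rho> ti])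
 have Q: "Q >= 0" using \<rho> by (simp add: Q_def m_def)
 \<comment> \<open>This choice of \<kappa> makes the right side at most I/36, half of the left side;
   adding 1 to \<open>Q\<close> avoids a separate case Q = 0.\<close>
 have "1/18 * I <= I / (36 * (Q + 1)) * Q" using I Q by (intro lim) auto
 also have "\<dots> <= I / 36"
 proof -
  have "I / (36 * (Q + 1)) * Q = I / 36 * (Q / (Q + 1))" by simp
  also have "\<dots> <= I / 36 * 1" using I Q by (intro mult_left_mono) (auto simp: field_simps)
  finally show ?thesis by simp
 qed
 finally show False using I by simp
qed

section \<open>Uniqueness of weak gradients, and laminates as explicit competitors\<close>

section \<open>Weak gradients of laminates\<close>

lemma AE_cbox_imp_box: "AE x in lborel. x \<in> cbox a b --> x \<in> box a (b::real^2)"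
proof -
 have "AE x in lebesgue. x \<notin> cbox a b - box a b"
  using negligible_frontier_interval[of a b] by (intro AE_not_in) (simp add: negligible_iff_null_sets)
 then have "AE x in lborel. x \<notin> cbox a b - box a b" by (simp add: AE_completion_iff)
 then show ?thesis by eventually_elim auto
qed

text \<open>Makes the chosen \<open>weak_grad\<close> usable: it agrees almost everywhere with any
  weak gradient computed by hand. On each box of a countable cover of \<Omega> the difference pairs
  to 0 with every test, and \<open>test_duality_bound\<close> with bound 0 applies.\<close>

lemma weak_gradient_unique:
 assumes G: "has_weak_gradient \<Omega> u G" and G': "has_weak_gradient \<Omega> u G'" and \<Omega>: "open \<Omega>"
 shows "AE x in lebesgue_on \<Omega>. G x = G' x"
proof -
 obtain \<D> where \<D>: "countable \<D>" "!!X. X \<in> \<D> ==> X \<subseteq> \<Omega>" "!!X. X \<in> \<D> ==> \<exists>a b. X = cbox a b" "\<Union>\<D> = \<Omega>"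
  using open_countable_Union_open_cbox[OF \<Omega>] by (metis Pow_iff subsetD)
 have one: "AE x in lborel. x \<in> cbox a b --> G x = G' x" if sub: "cbox a b \<subseteq> \<Omega>" for a b
 proof -
  have int: "integrable (lebesgue_on (cbox a b)) G" "integrable (lebesgue_on (cbox a b)) G'"
   using G G' sub by (auto simp: has_weak_gradient_def locally_integrable_def)
  have entry: "AE x in lborel. x \<in> cbox a b --> G x $ i $ j = G' x $ i $ j" for i j
  proof -
   have rep: "\<exists>F'. F' \<in> borel_measurable borel \<and> (AE x in lborel. x \<in> cbox a b --> F x = F' x) \<and> integrable lborel F'"
    if F: "integrable (lebesgue_on (cbox a b)) F" for F :: "real^2 => real"
   proof -
    have Fm: "F \<in> borel_measurable (lebesgue_on (cbox a b))" using F by auto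
    obtain F' where F': "F' \<in> borel_measurable borel" "AE x in lborel. x \<in> cbox a b --> F x = F' x" "!!x. x \<notin> cbox a b ==> F' x = 0"
     using borel_representative[OF _ Fm] by auto
    have "(%x. indicator (cbox a b) x * F' x) = F'" using F'(3) by (auto simp: indicator_def fun_eq_iff)
    then have "integrable lborel F'"
     using integrable_lebesgue_on_iff(1)[OF _ F'(1) Fm F'(2)] F by simp
    then show ?thesis using F' by blast
   qed
   have Gi: "integrable (lebesgue_on (cbox a b)) (%x. G x $ i $ j)" "integrable (lebesgue_on (cbox a b)) (%x. G' x $ i $ j)"
    by (intro integrable_vec_nth int)+
   obtain g where g: "g \<in> borel_measurable borel" "AE x in lborel. x \<in> cbox a b --> G x $ i $ j = g x" "integrable lborel g"
    using rep[OF Gi(1)] by blast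
   obtain g' where g': "g' \<in> borel_measurable borel" "AE x in lborel. x \<in> cbox a b --> G' x $ i $ j = g' x" "integrable lborel g'"
    using rep[OF Gi(2)] by blast
   have ui: "integrable (lebesgue_on (cbox a b)) (%x. u x $ i)"
    using G sub by (intro integrable_vec_nth) (auto simp: has_weak_gradient_def locally_integrable_def)
   obtain v where v: "v \<in> borel_measurable borel" "AE x in lborel. x \<in> cbox a b --> u x $ i = v x"
    using rep[OF ui] by blast
   have W: "weak_deriv_on a b (axis j 1) v g" "weak_deriv_on a b (axis j 1) v g'"
    using weak_gradient_imp_weak_deriv_on[OF G sub \<Omega> v(1) g(1) v(2) g(2)]
     weak_gradient_imp_weak_deriv_on[OF G' sub \<Omega> v(1) g'(1) v(2) g'(2)] by auto
   have [measurable]: "g \<in> borel_measurable borel" "g' \<in> borel_measurable borel" using g g' by auto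
   have "(\<integral>\<^sup>+x. ennreal ((g x - g' x)\<^sup>2) * indicator (box a b) x \<partial>lborel) <= ennreal (0\<^sup>2)"
   proof (rule test_duality_bound)
    show "integrable lborel (%x. g x - g' x)" using g g' by simp
    fix \<phi> :: "real^2 => real" assume C: "!!k. C_k k \<phi>" and s: "!!x. x \<notin> box a b ==> \<phi> x = 0"
    have s': "\<phi> x = 0" if "x \<notin> cbox a b" for x using s that box_subset_cbox by blast
    obtain B where B: "B >= 0" "!!x. \<bar>\<phi> x\<bar> <= B"
     using smooth_bounded_derivative[OF C compact_cbox s'] by metis
    have [measurable]: "\<phi> \<in> borel_measurable borel" using C_k_imp_borel_measurable[OF C[of 0]] .
    have bd: "integrable lborel (%x. f x * \<phi> x)" if "integrable lborel f" for f :: "real^2 => real"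
    proof (rule Bochner_Integration.integrable_bound)
     show "integrable lborel (%x. B * f x)" using that by simp
     show "(%x. f x * \<phi> x) \<in> borel_measurable lborel" using that by auto
     show "AE x in lborel. norm (f x * \<phi> x) <= norm (B * f x)"
      using B by (auto simp: abs_mult mult.commute[of "\<bar>f _\<bar>"] intro!: mult_right_mono)
    qed
    have "(\<integral>x. g x * \<phi> x \<partial>lborel) = (\<integral>x. g' x * \<phi> x \<partial>lborel)"
     using W C s unfolding weak_deriv_on_def by fastforce
    then have "(\<integral>x. (g x - g' x) * \<phi> x \<partial>lborel) = 0"
     unfolding left_diff_distrib using bd g(3) g'(3) by simp
    then show "\<bar>\<integral>x. (g x - g' x) * \<phi> x \<partial>lborel\<bar> <= 0 * sqrt (\<integral>x. (\<phi> x)\<^sup>2 \<partial>lborel)" by simp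
   qed simp
   then have "(\<integral>\<^sup>+x. ennreal ((g x - g' x)\<^sup>2) * indicator (box a b) x \<partial>lborel) = 0" by simp
   then have "AE x in lborel. ennreal ((g x - g' x)\<^sup>2) * indicator (box a b) x = 0"
    by (subst (asm) nn_integral_0_iff_AE) auto
   then show ?thesis
    using g(2) g'(2) AE_cbox_imp_box[of a b]
    by eventually_elim (auto simp: indicator_def split: if_splits)
  qed
  have "AE x in lborel. x \<in> cbox a b --> (\<forall>i j. G x $ i $ j = G' x $ i $ j)"
   using entry[of 1 1] entry[of 1 2] entry[of 2 1] entry[of 2 2]
   by eventually_elim (auto simp: forall_2)
  then show ?thesis by eventually_elim (simp add: vec_eq_iff)
 qed
 have "AE x in lborel. \<forall>X\<in>\<D>. x \<in> X --> G x = G' x"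
 proof (subst AE_ball_countable[OF \<D>(1)], rule ballI)
  fix X assume X: "X \<in> \<D>"
  then obtain a b where "X = cbox a b" using \<D>(3) by blast
  then show "AE x in lborel. x \<in> X --> G x = G' x" using one[of a b] \<D>(2)[OF X] by simp
 qed
 then have "AE x in lborel. x \<in> \<Omega> --> G x = G' x"
  by eventually_elim (use \<D>(4) in auto)
 then show ?thesis
  using \<Omega> by (subst AE_restrict_space_iff) (auto simp: AE_completion_iff)
qed

lemma weak_grad_AE_eq:
 assumes "has_weak_gradient \<Omega> u G" "open \<Omega>"
 shows "AE x in lebesgue_on \<Omega>. weak_grad \<Omega> u x = G x"
 using weak_gradient_unique[OF someI[of "has_weak_gradient \<Omega> u", OF assms(1)] assms]
 unfolding weak_grad_def .

lemma has_weak_gradient_weak_grad: "has_weak_gradient \<Omega> u G ==> has_weak_gradient \<Omega> u (weak_grad \<Omega> u)"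
 unfolding weak_grad_def by (rule someI[of "has_weak_gradient \<Omega> u"])

text \<open>A layered deformation whose gradient takes one diagonal value in each phase and has mean
  \<open>diag2 b g\<close>; only the entry (1,1) jumps, in its own direction, so the layers fit
  together.\<close>

definition laminate :: "real => real => real => real => real^2 => real^2" where
 "laminate b a g \<epsilon> x = vector [saw b a \<epsilon> (x $ 1), g * x $ 2]"

definition laminate_grad :: "real => real => real => real => real^2 => real^2^2" where
 "laminate_grad b a g \<epsilon> x = diag2 (b + a * square_wave (x $ 1 / \<epsilon>)) g"

lemma laminate_nth: "laminate b a g \<epsilon> x $ 1 = saw b a \<epsilon> (x $ 1)" "laminate b a g \<epsilon> x $ 2 = g * x $ 2"
 by (simp_all add: laminate_def)

lemma borel_measurable_vec2:
 fixes f :: "'a => 'b::euclidean_space^2"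
 assumes "(%x. f x $ 1) \<in> borel_measurable M" "(%x. f x $ 2) \<in> borel_measurable M"
 shows "f \<in> borel_measurable M"
proof -
 have bl: "bounded_linear (axis i :: 'b => 'b^2)" for i
  unfolding linear_conv_bounded_linear[symmetric] by (rule linearI) (auto simp: axis_def vec_eq_iff)
 have "(%x. axis i (f x $ i) :: 'b^2) \<in> borel_measurable M" if "(%x. f x $ i) \<in> borel_measurable M" for i
  by (rule measurable_compose[OF that borel_measurable_continuous_onI[OF linear_continuous_on[OF bl]]])
 then have "(%x. (axis 1 (f x $ 1) :: 'b^2) + axis 2 (f x $ 2)) \<in> borel_measurable M"
  using assms by (intro borel_measurable_add) auto
 moreover have "(axis 1 (f x $ 1) :: 'b^2) + axis 2 (f x $ 2) = f x" for x
  by (simp add: vec_eq_iff axis_def forall_2)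
 ultimately show ?thesis by simp
qed

lemma laminate_meas:
 assumes "\<epsilon> > 0" shows "laminate b a g \<epsilon> \<in> borel_measurable borel"
proof (rule borel_measurable_vec2)
 show "(%x. laminate b a g \<epsilon> x $ 1) \<in> borel_measurable borel"
  unfolding laminate_nth by (rule measurable_compose[OF vec_nth_measurable_2 saw_meas[OF assms]])
 show "(%x. laminate b a g \<epsilon> x $ 2) \<in> borel_measurable borel"
  unfolding laminate_nth by measurable
qed

lemma laminate_grad_meas: "laminate_grad b a g \<epsilon> \<in> borel_measurable borel"
proof (rule borel_measurable_vec2)
 have [measurable]: "(%x::real^2. b + a * square_wave (x $ 1 / \<epsilon>)) \<in> borel_measurable borel" by measurable
 show "(%x. laminate_grad b a g \<epsilon> x $ 1) \<in> borel_measurable borel"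
  by (rule borel_measurable_vec2) (simp_all add: laminate_grad_def diag2_nth)
 show "(%x. laminate_grad b a g \<epsilon> x $ 2) \<in> borel_measurable borel"
  by (rule borel_measurable_vec2) (simp_all add: laminate_grad_def diag2_nth)
qed

lemma norm_vec2_le: "norm x <= \<bar>x $ 1\<bar> + \<bar>x $ 2\<bar>" for x :: "real^2"
 using norm_le_l1_cart[of x] by (simp add: sum_2)

lemma norm_diag2_le: "norm (diag2 a b) <= \<bar>a\<bar> + \<bar>b\<bar>"
proof -
 have "norm (diag2 a b) <= norm (diag2 a b $ 1) + norm (diag2 a b $ 2)"
  using L2_set_le_sum[of UNIV "%i. norm (diag2 a b $ i)"] by (simp add: norm_vec_def sum_2)
 also have "\<dots> <= \<bar>a\<bar> + \<bar>b\<bar>"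
  using norm_vec2_le[of "diag2 a b $ 1"] norm_vec2_le[of "diag2 a b $ 2"] by (simp add: diag2_nth)
 finally show ?thesis .
qed

lemma laminate_bounded:
 assumes \<epsilon>: "\<epsilon> > 0" shows "norm (laminate b a g \<epsilon> x) <= (\<bar>b\<bar> + \<bar>g\<bar>) * norm x + \<bar>a\<bar> * \<epsilon> / 2"
  and "norm (laminate b a g \<epsilon> x - diag2 b g *v x) <= \<bar>a\<bar> * \<epsilon> / 2"
proof -
 have t: "\<bar>a * (\<epsilon> * tri (x $ 1 / \<epsilon>))\<bar> <= \<bar>a\<bar> * (\<epsilon> * (1/2))"
  unfolding abs_mult using tri_bounds[of "x $ 1 / \<epsilon>"] \<epsilon> by (intro mult_left_mono) auto
 have "norm (laminate b a g \<epsilon> x - diag2 b g *v x) <= \<bar>a * (\<epsilon> * tri (x $ 1 / \<epsilon>))\<bar>"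
  using norm_vec2_le[of "laminate b a g \<epsilon> x - diag2 b g *v x"] by (simp add: laminate_nth diag2_mult_vec saw_def)
 then show 1: "norm (laminate b a g \<epsilon> x - diag2 b g *v x) <= \<bar>a\<bar> * \<epsilon> / 2" using t by simp
 have "norm (diag2 b g *v x) <= \<bar>b\<bar> * \<bar>x $ 1\<bar> + \<bar>g\<bar> * \<bar>x $ 2\<bar>"
  using norm_vec2_le[of "diag2 b g *v x"] by (simp add: diag2_mult_vec abs_mult)
 also have "\<dots> <= \<bar>b\<bar> * norm x + \<bar>g\<bar> * norm x"
  by (intro add_mono mult_left_mono component_le_norm_cart) auto
 finally show "norm (laminate b a g \<epsilon> x) <= (\<bar>b\<bar> + \<bar>g\<bar>) * norm x + \<bar>a\<bar> * \<epsilon> / 2"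
  using 1 norm_triangle_ineq2[of "laminate b a g \<epsilon> x" "diag2 b g *v x"] by (simp add: distrib_right)
qed

lemma laminate_grad_bounded: "norm (laminate_grad b a g \<epsilon> x) <= \<bar>b\<bar> + \<bar>a\<bar> + \<bar>g\<bar>"
proof -
 have "\<bar>b + a * square_wave (x $ 1 / \<epsilon>)\<bar> <= \<bar>b\<bar> + \<bar>a\<bar>"
  using square_wave_cases[of "x $ 1 / \<epsilon>"] by auto
 then show ?thesis
  unfolding laminate_grad_def using norm_diag2_le[of "b + a * square_wave (x $ 1 / \<epsilon>)" g] by linarith
qed

lemma finite_measure_lebesgue_on:
 assumes "bounded S" "S \<in> sets lebesgue" shows "finite_measure (lebesgue_on S)"
proof (rule finite_measureI)
 obtain a b where "S \<subseteq> cbox a b" using bounded_subset_cbox_symmetric[OF assms(1)] by blast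
 then have "emeasure lebesgue S <= emeasure lebesgue (cbox a b)" by (intro emeasure_mono) auto
 also have "\<dots> < \<infinity>" by (simp add: emeasure_lborel_cbox_eq)
 finally show "emeasure (lebesgue_on S) (space (lebesgue_on S)) ~= \<infinity>"
  using assms(2) by (simp add: emeasure_restrict_space)
qed

lemma borel_measurable_lebesgue_on:
 assumes "f \<in> borel_measurable borel" shows "f \<in> borel_measurable (lebesgue_on S)"
proof -
 have "f \<in> borel_measurable lborel" using assms by simp
 then show ?thesis by (rule measurable_restrict_space1[OF measurable_completion])
qed

lemma integrable_lebesgue_on_bounded:
 fixes f :: "real^2 => 'b::euclidean_space"
 assumes "bounded S" "S \<in> sets lebesgue" "f \<in> borel_measurable (lebesgue_on S)" "!!x. x \<in> S ==> norm (f x) <= M"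
 shows "integrable (lebesgue_on S) f"
proof (rule finite_measure.integrable_const_bound[OF finite_measure_lebesgue_on[OF assms(1,2)]])
 show "AE x in lebesgue_on S. norm (f x) <= M" by (rule AE_I2) (simp add: assms(4))
qed (rule assms(3))

text \<open>Both components are instances of \<open>saw\<close>: the second is linear, which is the
  case of amplitude 0.\<close>

lemma laminate_has_weak_gradient:
 assumes \<epsilon>: "\<epsilon> > 0" and \<Omega>: "open \<Omega>"
 shows "has_weak_gradient \<Omega> (laminate b a g \<epsilon>) (laminate_grad b a g \<epsilon>)"
 unfolding has_weak_gradient_def
proof (intro conjI allI impI)
 show "locally_integrable \<Omega> (laminate b a g \<epsilon>)"
  unfolding locally_integrable_def
 proof (intro allI impI)
  fix K assume K: "compact K \<and> K \<subseteq> \<Omega>"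
  then have "bounded K" "K \<in> sets lebesgue" by (simp_all add: compact_imp_bounded fmeasurableD[OF lmeasurable_compact])
  from \<open>bounded K\<close> obtain R where R: "!!x. x \<in> K ==> norm x <= R" unfolding bounded_iff by blast
  show "integrable (lebesgue_on K) (laminate b a g \<epsilon>)"
  proof (rule integrable_lebesgue_on_bounded[where M = "(\<bar>b\<bar> + \<bar>g\<bar>) * R + \<bar>a\<bar> * \<epsilon> / 2"])
   show "norm (laminate b a g \<epsilon> x) <= (\<bar>b\<bar> + \<bar>g\<bar>) * R + \<bar>a\<bar> * \<epsilon> / 2" if "x \<in> K" for x
    using laminate_bounded(1)[OF \<epsilon>, of b a g x] mult_left_mono[OF R[OF that], of "\<bar>b\<bar> + \<bar>g\<bar>"] by linarith
  qed (use \<open>bounded K\<close> \<open>K \<in> sets lebesgue\<close> laminate_meas[OF \<epsilon>] in \<open>auto intro: borel_measurable_lebesgue_on\<close>)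
 qed
 show "locally_integrable \<Omega> (laminate_grad b a g \<epsilon>)"
  unfolding locally_integrable_def
  by (intro allI impI integrable_lebesgue_on_bounded[OF _ _ _ laminate_grad_bounded])
   (auto intro: compact_imp_bounded borel_measurable_lebesgue_on laminate_grad_meas fmeasurableD[OF lmeasurable_compact])
 fix \<phi> i j assume "test_fun \<Omega> \<phi>"
 then obtain K where C: "!!k. C_k k \<phi>" and K: "compact K" "K \<subseteq> \<Omega>" "!!x. x \<notin> K ==> \<phi> x = 0"
  by (auto simp: test_fun_def)
 obtain \<psi> where \<psi>: "!!x. \<psi> x = frechet_derivative \<phi> (at x) (axis j 1)" "continuous_on UNIV \<psi>"
  using C_k_1_directional[OF C] by metis
 have \<psi>0: "\<psi> x = 0" if "x \<notin> K" for x
  unfolding \<psi>(1) by (rule frechet_derivative_eq_0_outside[OF compact_imp_closed[OF K(1)] K(3) that])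
 have m: "\<psi> \<in> borel_measurable borel" "\<phi> \<in> borel_measurable borel"
  using \<psi>(2) C_k_imp_continuous_on[OF C] by (auto intro: borel_measurable_continuous_onI)
 have red: "integral\<^sup>L (lebesgue_on \<Omega>) (%x. f x * k x) = (\<integral>x. f x * k x \<partial>lborel)"
  if k: "!!x. x \<notin> K ==> k x = 0" and fk: "(%x. f x * k x) \<in> borel_measurable borel" for f k :: "real^2 => real"
 proof -
  have "integral\<^sup>L (lebesgue_on \<Omega>) (%x. f x * k x) = integral\<^sup>L lebesgue (%x. indicator \<Omega> x *\<^sub>R (f x * k x))"
   by (rule integral_restrict_space) (use \<Omega> in auto)
  also have "\<dots> = integral\<^sup>L lebesgue (%x. f x * k x)"
   by (intro Bochner_Integration.integral_cong) (use k K in \<open>auto simp: indicator_def\<close>)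
  also have "\<dots> = (\<integral>x. f x * k x \<partial>lborel)" by (rule integral_completion) (use fk in simp)
  finally show ?thesis .
 qed
 have lm: "(%x. laminate b a g \<epsilon> x $ i) \<in> borel_measurable borel" "(%x. laminate_grad b a g \<epsilon> x $ i $ j) \<in> borel_measurable borel"
  by (intro borel_measurable_vec_nth_comp laminate_meas laminate_grad_meas \<epsilon>)+
 have "integral\<^sup>L (lebesgue_on \<Omega>) (%x. laminate b a g \<epsilon> x $ i * \<psi> x) = (\<integral>x. laminate b a g \<epsilon> x $ i * \<psi> x \<partial>lborel)"
  by (rule red[OF \<psi>0]) (use lm m in auto)
 also have "\<dots> = - (\<integral>x. laminate_grad b a g \<epsilon> x $ i $ j * \<phi> x \<partial>lborel)"
 proof (cases "i = 1")
  case True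
  have "laminate_grad b a g \<epsilon> x $ i $ j = (if 1 = j then b + a * square_wave (x $ 1 / \<epsilon>) else 0)" for x
   using True exhaust_2[of j] by (auto simp: laminate_grad_def diag2_nth)
  then show ?thesis
   using saw_weak_derivative[OF \<epsilon> C K(1,3), of b a 1 j] True unfolding \<psi>(1) by (simp add: laminate_nth)
 next
  case False
  then have i: "i = 2" using exhaust_2[of i] by auto
  have "laminate_grad b a g \<epsilon> x $ i $ j = (if 2 = j then g + 0 * square_wave (x $ 2 / \<epsilon>) else 0)" for x
   using i exhaust_2[of j] by (auto simp: laminate_grad_def diag2_nth)
  then show ?thesis
   using saw_weak_derivative[OF \<epsilon> C K(1,3), of g 0 2 j] i unfolding \<psi>(1) by (simp add: laminate_nth saw_linear)
 qed
 also have "(\<integral>x. laminate_grad b a g \<epsilon> x $ i $ j * \<phi> x \<partial>lborel) = integral\<^sup>L (lebesgue_on \<Omega>) (%x. laminate_grad b a g \<epsilon> x $ i $ j * \<phi> x)"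
  by (rule red[OF K(3), symmetric]) (use lm m in auto)
 finally show "integral\<^sup>L (lebesgue_on \<Omega>) (%x. laminate b a g \<epsilon> x $ i * frechet_derivative \<phi> (at x) (axis j 1)) =
    - integral\<^sup>L (lebesgue_on \<Omega>) (%x. laminate_grad b a g \<epsilon> x $ i $ j * \<phi> x)"
  unfolding \<psi>(1) .
qed

lemma laminate_linear: "laminate b 0 g \<epsilon> = (*v) (diag2 b g)"
 by (rule ext) (simp add: vec_eq_iff forall_2 laminate_nth diag2_mult_vec saw_linear)

lemma linear_has_weak_gradient: "open \<Omega> ==> has_weak_gradient \<Omega> ((*v) (diag2 b g)) (%x. diag2 b g)"
 using laminate_has_weak_gradient[of 1 \<Omega> b 0 g] by (simp add: laminate_linear laminate_grad_def[abs_def])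

lemma square_wave_add_half: "square_wave (t + 1/2) = - square_wave t"
proof -
 have "frac (1/2::real) = 1/2" by (simp add: frac_eq)
 moreover have "\<not> frac t < 0" using frac_ge_0[of t] by linarith
 ultimately show ?thesis
  using frac_lt_1[of t] by (auto simp: square_wave_def frac_add)
qed

text \<open>A special case of the Riemann--Lebesgue lemma: the square wave changes sign under a shift by
 half a period, and shifts are continuous in \<open>L\<^sup>1\<close>.\<close>

lemma square_wave_weakly_null:
 fixes f :: "real^2 => real"
 assumes f: "integrable lborel f" and \<epsilon>: "!!h. \<epsilon> h > 0" "\<epsilon> \<longlonglongrightarrow> 0"
 shows "(%h. \<integral>x. square_wave (x $ 1 / \<epsilon> h) * f x \<partial>lborel) \<longlonglongrightarrow> 0"
proof (rule LIMSEQ_I)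
 fix r :: real assume r: "r > 0"
 obtain \<delta> where \<delta>: "\<delta> > 0" "!!c. norm c < \<delta> ==> (\<integral>x. \<bar>f (x + c) - f x\<bar> \<partial>lborel) < r"
  using L1_translation_continuous[OF f r] by blast
 obtain n where n: "!!h. h >= n ==> \<bar>\<epsilon> h\<bar> < \<delta>" using LIMSEQ_D[OF \<epsilon>(2) \<delta>(1)] by auto
 have [measurable]: "f \<in> borel_measurable borel" using f by auto
 have "norm ((\<integral>x. square_wave (x $ 1 / \<epsilon> h) * f x \<partial>lborel) - 0) < r" if "h >= n" for h
 proof -
  let ?s = "%x::real^2. square_wave (x $ 1 / \<epsilon> h)"
  define c where "c = (\<epsilon> h / 2) *\<^sub>R (axis 1 1 :: real^2)"
  have sb: "\<bar>?s x\<bar> <= 1" for x using square_wave_cases[of "x $ 1 / \<epsilon> h"] by auto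
  have i: "integrable lborel (%x. ?s x * F x)" if "integrable lborel F" for F
   by (rule integrable_mult_bounded[OF that]) (use sb in auto)
  have sc: "?s (x + c) = - ?s x" for x
  proof -
   have "(x + c) $ 1 / \<epsilon> h = x $ 1 / \<epsilon> h + 1/2" using \<epsilon>(1)[of h] by (simp add: c_def axis_def field_simps)
   then show ?thesis by (simp add: square_wave_add_half)
  qed
  have fi: "integrable lborel (%x. f (x + c))" by (rule integrable_translate[OF f])
  have "(\<integral>x. ?s x * f x \<partial>lborel) = (\<integral>x. ?s (x + c) * f (x + c) \<partial>lborel)"
   by (rule integral_translate[symmetric]) measurable
  also have "\<dots> = - (\<integral>x. ?s x * f (x + c) \<partial>lborel)" unfolding sc by simp
  finally have "2 * (\<integral>x. ?s x * f x \<partial>lborel) = - (\<integral>x. ?s x * (f (x + c) - f x) \<partial>lborel)"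
   unfolding right_diff_distrib using i[OF f] i[OF fi] by simp
  then have "2 * \<bar>\<integral>x. ?s x * f x \<partial>lborel\<bar> = \<bar>\<integral>x. ?s x * (f (x + c) - f x) \<partial>lborel\<bar>" by linarith
  also have "\<dots> <= (\<integral>x. \<bar>?s x * (f (x + c) - f x)\<bar> \<partial>lborel)" by (rule integral_abs_bound)
  also have "\<dots> <= (\<integral>x. \<bar>f (x + c) - f x\<bar> \<partial>lborel)"
   by (intro integral_mono_AE' AE_I2)
    (use f fi sb in \<open>auto simp: abs_mult intro!: mult_left_le_one_le\<close>)
  also have "\<dots> < r"
   using n[OF that] \<epsilon>(1)[of h] by (intro \<delta>(2)) (simp add: c_def norm_axis_1)
  finally show ?thesis by simp
 qed
 then show "\<exists>no. \<forall>h\<ge>no. norm ((\<integral>x. square_wave (x $ 1 / \<epsilon> h) * f x \<partial>lborel) - 0) < r" by blast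
qed

section \<open>Three-point sets in the space of minors, and potentials vanishing on them\<close>

section \<open>Polyconvex sets and potentials\<close>

lemma minors_diag2: "minors (diag2 a b) = (diag2 a b, a * b)"
 by (simp add: minors_def det_2 diag2_nth)

lemma diag2_combination: "s *\<^sub>R diag2 a b + t *\<^sub>R diag2 c d = diag2 (s * a + t * c) (s * b + t * d)"
 by (simp add: vec_eq_iff forall_2 diag2_nth)

lemma diag2_zero: "diag2 0 0 = 0"
 by (simp add: vec_eq_iff forall_2 diag2_nth)

definition triple_set :: "real => real => real => real => (real^2^2) set" where
 "triple_set a b c d = {diag2 0 0, diag2 a b, diag2 c d}"

lemma minors_hull_triple:
 assumes "minors \<Lambda> \<in> convex hull (minors ` triple_set a b c d)"
 obtains w s t where "0 <= w" "0 <= s" "0 <= t" "w + s + t = 1" "\<Lambda> = diag2 (s * a + t * c) (s * b + t * d)"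
  "(s * a + t * c) * (s * b + t * d) = s * (a * b) + t * (c * d)"
proof -
 obtain w s t where wst: "0 <= w" "0 <= s" "0 <= t" "w + s + t = 1"
  "minors \<Lambda> = w *\<^sub>R minors (diag2 0 0) + s *\<^sub>R minors (diag2 a b) + t *\<^sub>R minors (diag2 c d)"
  using assms by (auto simp: triple_set_def convex_hull_3)
 have e: "(\<Lambda>, det \<Lambda>) = w *\<^sub>R (diag2 0 0, 0 * 0) + s *\<^sub>R (diag2 a b, a * b) + t *\<^sub>R (diag2 c d, c * d)"
  using wst(5) unfolding minors_diag2 unfolding minors_def .
 have \<Lambda>: "\<Lambda> = diag2 (s * a + t * c) (s * b + t * d)"
  using e by (simp add: diag2_zero diag2_combination)
 have d: "det \<Lambda> = s * (a * b) + t * (c * d)"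
  using arg_cong[OF e, of snd] by simp
 show ?thesis
  by (rule that[OF wst(1-4) \<Lambda>]) (use d in \<open>simp add: \<Lambda> det_2 diag2_nth\<close>)
qed

text \<open>If the determinant condition forces all products of barycentric coordinates to vanish, only
 the vertices of the triangle remain.\<close>

definition minors_rigid :: "(real^2^2) set => bool" where
 "minors_rigid A \<longleftrightarrow> (\<forall>\<Lambda>. minors \<Lambda> \<in> convex hull (minors ` A) --> \<Lambda> \<in> A)"

lemma minors_rigid_triple:
 assumes "!!w s t. 0 <= w ==> 0 <= s ==> 0 <= t ==> w + s + t = 1 ==>
   (s * a + t * c) * (s * b + t * d) = s * (a * b) + t * (c * d) ==> s * w = 0 \<and> t * w = 0 \<and> s * t = 0"
 shows "minors_rigid (triple_set a b c d)"
 unfolding minors_rigid_def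
proof (intro allI impI)
 fix \<Lambda> assume "minors \<Lambda> \<in> convex hull (minors ` triple_set a b c d)"
 then obtain w s t where *: "0 <= w" "0 <= s" "0 <= t" "w + s + t = 1" "\<Lambda> = diag2 (s * a + t * c) (s * b + t * d)"
  "(s * a + t * c) * (s * b + t * d) = s * (a * b) + t * (c * d)"
  by (rule minors_hull_triple)
 have "s * w = 0 \<and> t * w = 0 \<and> s * t = 0" using assms[OF *(1-4,6)] .
 then have "(s = 0 \<and> t = 0) \<or> (s = 1 \<and> t = 0) \<or> (s = 0 \<and> t = 1)" using *(4) by auto
 then show "\<Lambda> \<in> triple_set a b c d" by (auto simp: triple_set_def *(5))
qed

text \<open>The determinant of a convex combination equals the combination of the determinants minus
  the sum, over pairs, of the product of the two weights with the determinant of the difference of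
  the two matrices. Here these determinants are -1/2, -4 and -3/2; having one sign, they force each
  product of weights to vanish.\<close>

lemma minors_rigid_A1: "minors_rigid (triple_set (-1/2) 1 (-2) 2)"
proof (rule minors_rigid_triple)
 fix w s t :: real
 assume nn: "0 <= w" "0 <= s" "0 <= t" and 1: "w + s + t = 1"
  and eq: "(s * (-1/2) + t * (-2)) * (s * 1 + t * 2) = s * ((-1/2) * 1) + t * ((-2) * 2)"
 have w: "w = 1 - s - t" using 1 by simp
 have "s * w / 2 + 4 * (t * w) + 3/2 * (s * t) = 0"
  using eq unfolding w by (simp add: algebra_simps add_divide_distrib diff_divide_distrib)
 moreover have "0 <= s * w" "0 <= t * w" "0 <= s * t" using nn by auto
 ultimately show "s * w = 0 \<and> t * w = 0 \<and> s * t = 0" by linarith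
qed

text \<open>The determinants of the pairwise differences are 5/2, 6 and 1/2, again of one
  sign.\<close>

lemma minors_rigid_A2: "minors_rigid (triple_set (5/2) 1 3 2)"
proof (rule minors_rigid_triple)
 fix w s t :: real
 assume nn: "0 <= w" "0 <= s" "0 <= t" and 1: "w + s + t = 1"
  and eq: "(s * (5/2) + t * 3) * (s * 1 + t * 2) = s * ((5/2) * 1) + t * (3 * 2)"
 have w: "w = 1 - s - t" using 1 by simp
 have "5/2 * (s * w) + 6 * (t * w) + 1/2 * (s * t) = 0"
  using eq unfolding w by (simp add: algebra_simps add_divide_distrib diff_divide_distrib)
 moreover have "0 <= s * w" "0 <= t * w" "0 <= s * t" using nn by auto
 ultimately show "s * w = 0 \<and> t * w = 0 \<and> s * t = 0" by linarith
qed

lemma minors_rigid_imp_polyconvex_set: "minors_rigid A ==> polyconvex_set A"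
 unfolding polyconvex_set_def minors_rigid_def
 by (intro exI[of _ "convex hull (minors ` A)"]) (auto intro: hull_inc)

text \<open>Nearest points of the two arguments exist, and their convex combination is a competitor
  for the combined point.\<close>

lemma convex_on_infdist:
 fixes H :: "'a::euclidean_space set"
 assumes "closed H" "convex H" "H ~= {}"
 shows "convex_on UNIV (%x. infdist x H)"
proof (rule convex_onI)
 fix t :: real and x y :: 'a assume t: "0 < t" "t < 1"
 obtain a where a: "a \<in> H" "infdist x H = dist x a" using infdist_attains_inf[OF assms(1,3)] by blast
 obtain b where b: "b \<in> H" "infdist y H = dist y b" using infdist_attains_inf[OF assms(1,3)] by blast
 have "(1 - t) *\<^sub>R a + t *\<^sub>R b \<in> H" using assms(2) a b t by (auto simp: convex_alt)
 then have "infdist ((1 - t) *\<^sub>R x + t *\<^sub>R y) H <= dist ((1 - t) *\<^sub>R x + t *\<^sub>R y) ((1 - t) *\<^sub>R a + t *\<^sub>R b)"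
  by (rule infdist_le)
 also have "\<dots> = norm ((1 - t) *\<^sub>R (x - a) + t *\<^sub>R (y - b))"
  by (simp add: dist_norm algebra_simps)
 also have "\<dots> <= (1 - t) * norm (x - a) + t * norm (y - b)"
  using norm_triangle_ineq[of "(1 - t) *\<^sub>R (x - a)" "t *\<^sub>R (y - b)"] t by simp
 finally show "infdist ((1 - t) *\<^sub>R x + t *\<^sub>R y) H <= (1 - t) * infdist x H + t * infdist y H"
  by (simp add: a b dist_norm)
qed simp

lemma powr_convex_nonneg:
 assumes p: "p >= 1" and t: "0 < t" "t < 1" and xy: "0 <= x" "0 <= (y::real)"
 shows "((1 - t) * x + t * y) powr p <= (1 - t) * x powr p + t * y powr p"
proof -
 \<comment> \<open>Settles the cases with a zero argument, where convexity reduces to comparing a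
   power of a weight in (0,1) with the weight.\<close>
 have scale: "(s * z) powr p <= s * z powr p" if "0 < s" "s < 1" "0 <= z" for s z
 proof -
  have "s powr p <= s powr 1" using that p by (intro powr_mono') auto
  then show ?thesis using that by (simp add: powr_mult mult_right_mono)
 qed
 consider "x = 0" | "y = 0" | "x > 0" "y > 0" using xy by linarith
 then show ?thesis
 proof cases
  case 1
  then show ?thesis using scale[of t y] t xy p by simp
 next
  case 2
  then show ?thesis using scale[of "1 - t" x] t xy p by simp
 next
  case 3
  then show ?thesis using convex_onD[OF powr_convex[OF p], of t x y] t by simp
 qed
qed

lemma det_bound: "\<bar>det \<Lambda>\<bar> <= 2 * (norm \<Lambda>)\<^sup>2" for \<Lambda> :: "real^2^2"
proof -
 have "\<bar>det \<Lambda>\<bar> <= \<bar>\<Lambda> $ 1 $ 1\<bar> * \<bar>\<Lambda> $ 2 $ 2\<bar> + \<bar>\<Lambda> $ 1 $ 2\<bar> * \<bar>\<Lambda> $ 2 $ 1\<bar>"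
  unfolding det_2 abs_mult[symmetric] by (rule abs_triangle_ineq4)
 also have "\<dots> <= norm \<Lambda> * norm \<Lambda> + norm \<Lambda> * norm \<Lambda>"
  by (intro add_mono mult_mono abs_entry_le_norm) auto
 finally show ?thesis by (simp add: power2_eq_square)
qed

text \<open>\<open>W\<close> is the distance of the minors to the convex hull of the minors of
  \<open>A\<close>, plus the excess of the p-th power of the norm over its value on a ball
  containing \<open>A\<close>. The first term is convex in the minors and vanishes just on
  \<open>A\<close> by rigidity; it grows at most quadratically, whence \<open>p >= 2\<close>. The
  second is convex, vanishes on \<open>A\<close> and gives coercivity.\<close>

lemma polyconvex_potential_exists:
 assumes A: "finite A" "diag2 0 0 \<in> A" "minors_rigid A" and p: "p >= 2"
 shows "\<exists>W. polyconvex_potential p A W"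
proof -
 define H where "H = convex hull (minors ` A)"
 have H: "closed H" "convex H" "H ~= {}"
  using A by (auto simp: H_def intro!: compact_imp_closed finite_imp_compact_convex_hull)
 obtain R where R: "R >= 0" "!!\<Lambda>. \<Lambda> \<in> A ==> norm \<Lambda> <= R"
  using finite_imp_bounded[OF A(1)] by (metis bounded_pos less_imp_le)
 define W where "W \<Lambda> = infdist (minors \<Lambda>) H + max 0 (norm \<Lambda> powr p - R powr p)" for \<Lambda>
 define V where "V z = infdist z H + max 0 (norm (fst z) powr p - R powr p)" for z :: "(real^2^2) \<times> real"
 have mH: "minors \<Lambda> \<in> H" if "\<Lambda> \<in> A" for \<Lambda> using that by (auto simp: H_def intro: hull_inc)
 have "polyconvex_fun W"
  unfolding polyconvex_fun_def
 proof (intro exI[of _ V] conjI allI)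
  show "W \<Lambda> = V (minors \<Lambda>)" for \<Lambda> by (simp add: W_def V_def minors_def)
  show "convex_on UNIV V"
   unfolding V_def
  proof (intro convex_on_add convex_on_infdist H convex_onI)
   fix t :: real and x y :: "(real^2^2) \<times> real" assume t: "0 < t" "t < 1"
   have "norm (fst ((1 - t) *\<^sub>R x + t *\<^sub>R y)) <= (1 - t) * norm (fst x) + t * norm (fst y)"
    using norm_triangle_ineq[of "(1 - t) *\<^sub>R fst x" "t *\<^sub>R fst y"] t by simp
   then have "norm (fst ((1 - t) *\<^sub>R x + t *\<^sub>R y)) powr p <= ((1 - t) * norm (fst x) + t * norm (fst y)) powr p"
    using p by (intro powr_mono2) auto
   also have "\<dots> <= (1 - t) * norm (fst x) powr p + t * norm (fst y) powr p"
    using p t by (intro powr_convex_nonneg) auto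
   also have "\<dots> <= (1 - t) * (R powr p + max 0 (norm (fst x) powr p - R powr p)) + t * (R powr p + max 0 (norm (fst y) powr p - R powr p))"
    using t by (intro add_mono mult_left_mono) auto
   also have "\<dots> = R powr p + ((1 - t) * max 0 (norm (fst x) powr p - R powr p) + t * max 0 (norm (fst y) powr p - R powr p))"
    by (simp add: algebra_simps)
   finally have "norm (fst ((1 - t) *\<^sub>R x + t *\<^sub>R y)) powr p - R powr p <= (1 - t) * max 0 (norm (fst x) powr p - R powr p) + t * max 0 (norm (fst y) powr p - R powr p)"
    by simp
   moreover have "0 <= (1 - t) * max 0 (norm (fst x) powr p - R powr p) + t * max 0 (norm (fst y) powr p - R powr p)"
    using t by simp
   ultimately show "max 0 (norm (fst ((1 - t) *\<^sub>R x + t *\<^sub>R y)) powr p - R powr p) <= (1 - t) * max 0 (norm (fst x) powr p - R powr p) + t * max 0 (norm (fst y) powr p - R powr p)"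
    by (rule max.boundedI[rotated])
  qed simp
 qed
 moreover have "coercive_growth p W"
  unfolding coercive_growth_def
 proof (rule exI[of _ "1::real"], rule conjI[OF zero_less_one], rule exI[of _ "R powr p + 1"], rule conjI[rotated],
   rule exI[of _ 4], rule conjI[rotated], intro allI conjI)
  show "0 < R powr p + 1" by (simp add: add_nonneg_pos)
  fix \<Lambda> :: "real^2^2"
  define X where "X = norm \<Lambda> powr p"
  show "1 * norm \<Lambda> powr p - (R powr p + 1) <= W \<Lambda>"
   using infdist_nonneg[of "minors \<Lambda>" H] max.cobounded2[of "norm \<Lambda> powr p - R powr p" 0] unfolding W_def by linarith
  have X0: "X >= 0" by (simp add: X_def)
  have pw: "norm \<Lambda> powr q <= 1 + X" if "0 <= q" "q <= p" for q
  proof (cases "norm \<Lambda> <= 1")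
   case True
   then have "norm \<Lambda> powr q <= 1" using that by (intro powr_le1) auto
   then show ?thesis using X0 by linarith
  next
   case False
   then have "norm \<Lambda> powr q <= norm \<Lambda> powr p" using that by (intro powr_mono) auto
   then show ?thesis by (simp add: X_def)
  qed
  have n1: "norm \<Lambda> <= 1 + X" using pw[of 1] p by simp
  have n2: "(norm \<Lambda>)\<^sup>2 <= 1 + X" using pw[of 2] p by (cases "norm \<Lambda> = 0") (auto simp: powr_numeral)
  \<comment> \<open>The zero matrix lies in \<open>A\<close> and its minors vanish, so the distance
    to \<open>H\<close> is at most the norm of the minors.\<close>
  have "0 \<in> H" using mH[OF A(2)] unfolding minors_diag2 by (simp add: diag2_zero zero_prod_def)
  then have "infdist (minors \<Lambda>) H <= dist (minors \<Lambda>) 0" by (rule infdist_le)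
  also have "\<dots> <= norm \<Lambda> + \<bar>det \<Lambda>\<bar>"
   using norm_Pair_le[of \<Lambda> "det \<Lambda>"] by (simp add: minors_def)
  also have "\<dots> <= (1 + X) + 2 * (1 + X)" using n1 order_trans[OF det_bound[of \<Lambda>] mult_left_mono[OF n2]] by (intro add_mono) auto
  finally have "infdist (minors \<Lambda>) H <= (1 + X) + 2 * (1 + X)" .
  moreover have "max 0 (norm \<Lambda> powr p - R powr p) <= X" by (simp add: X_def)
  ultimately have "W \<Lambda> <= ((1 + X) + 2 * (1 + X)) + X" unfolding W_def by (rule add_mono)
  then show "W \<Lambda> <= 4 * (1 + norm \<Lambda> powr p)" unfolding X_def[symmetric] by (simp add: algebra_simps)
 qed auto
 moreover have "0 <= W \<Lambda>" for \<Lambda> by (simp add: W_def infdist_nonneg)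
 moreover have "A = W -` {0}"
 proof (intro set_eqI iffI)
  fix \<Lambda> assume a: "\<Lambda> \<in> A"
  have "norm \<Lambda> powr p <= R powr p" using R(2)[OF a] p by (intro powr_mono2) auto
  then show "\<Lambda> \<in> W -` {0}" using mH[OF a] by (simp add: W_def)
 next
  fix \<Lambda> assume "\<Lambda> \<in> W -` {0}"
  then have "infdist (minors \<Lambda>) H + max 0 (norm \<Lambda> powr p - R powr p) = 0" by (simp add: W_def)
  then have "infdist (minors \<Lambda>) H = 0"
   using infdist_nonneg[of "minors \<Lambda>" H] max.cobounded1[of 0 "norm \<Lambda> powr p - R powr p"] by linarith
  then have "minors \<Lambda> \<in> H" using in_closed_iff_infdist_zero[OF H(1,3)] by blast
  then show "\<Lambda> \<in> A" using A(3) by (auto simp: minors_rigid_def H_def)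
 qed
 ultimately show ?thesis unfolding polyconvex_potential_def by blast
qed

lemma polyconvex_fun_continuous:
 assumes "polyconvex_fun W" shows "continuous_on UNIV W"
proof -
 obtain V where V: "convex_on UNIV V" "!!\<Lambda>. W \<Lambda> = V (minors \<Lambda>)" using assms by (auto simp: polyconvex_fun_def)
 have "continuous_on UNIV V" using V(1) by (intro convex_on_continuous) auto
 moreover have "continuous_on UNIV minors"
  unfolding minors_def[abs_def] det_2 by (intro continuous_intros)
 ultimately have "continuous_on UNIV (%\<Lambda>. V (minors \<Lambda>))"
  by (auto intro: continuous_on_compose2[of UNIV V])
 then show ?thesis using V(2) by (simp cong: continuous_on_cong)
qed

text \<open>For \<BB> the determinants of the pairwise differences are 1, 1 and -1/2, so weights w,
  s, t are compatible with the determinant when w s + w t = s t / 2. With s = t this gives s = 4 w,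
  hence 1/9, 4/9, 4/9.\<close>

lemma minors_C_combination:
 "minors (diag2 (2/3) (4/3)) = (1/9) *\<^sub>R minors (diag2 0 0) + (4/9) *\<^sub>R minors (diag2 1 1) + (4/9) *\<^sub>R minors (diag2 (1/2) 2)"
 unfolding minors_diag2 by (simp add: diag2_zero diag2_combination)

lemma C_in_polyconvex_hull: "diag2 (2/3) (4/3) \<in> polyconvex_set hull (triple_set 1 1 (1/2) 2)"
 unfolding hull_def
proof (rule InterI)
 fix S assume "S \<in> {t. polyconvex_set t \<and> triple_set 1 1 (1/2) 2 \<subseteq> t}"
 then have S: "polyconvex_set S" "triple_set 1 1 (1/2) 2 \<subseteq> S" by auto
 obtain C where C: "convex C" "S = {\<Lambda>. minors \<Lambda> \<in> C}" using S(1) by (auto simp: polyconvex_set_def)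
 have "minors ` triple_set 1 1 (1/2) 2 \<subseteq> C" using S(2) C(2) by auto
 then have "convex hull (minors ` triple_set 1 1 (1/2) 2) \<subseteq> C" using C(1) by (rule hull_minimal)
 moreover have "minors (diag2 (2/3) (4/3)) \<in> convex hull (minors ` triple_set 1 1 (1/2) 2)"
  unfolding triple_set_def minors_C_combination image_insert image_empty convex_hull_3
  by (intro CollectI exI conjI refl) auto
 ultimately show "diag2 (2/3) (4/3) \<in> S" using C(2) by blast
qed

section \<open>Uniform boundedness, and compactness from weak* to strong L2 convergence\<close>

section \<open>Weakly* convergent sequences\<close>

text \<open>The test function is the sign of \<open>f\<close> on the set where |f| exceeds
  \<open>C\<close>, scaled to L1 norm \<open>a\<close>. That set has positive measure because the
  bound by \<open>C\<close> fails.\<close>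

lemma large_test_function:
 fixes f :: "'a => real"
 assumes M: "finite_measure M" and [measurable]: "f \<in> borel_measurable M"
  and f: "AE x in M. \<bar>f x\<bar> <= N" and not_bd: "\<not> (AE x in M. \<bar>f x\<bar> <= C)" and C: "C >= 0" and a: "a > 0"
 obtains \<psi> where "integrable M \<psi>" "(\<integral>x. \<bar>\<psi> x\<bar> \<partial>M) <= a" "a * C <= (\<integral>x. f x * \<psi> x \<partial>M)"
proof -
 interpret finite_measure M by fact
 define E where "E = {x \<in> space M. \<bar>f x\<bar> > C}"
 have [measurable]: "E \<in> sets M" unfolding E_def by measurable
 define m where "m = measure M E"
 have "emeasure M E ~= 0"
 proof
  assume "emeasure M E = 0"
  then have "AE x in M. \<bar>f x\<bar> <= C"
   by (intro AE_I[of _ _ E]) (auto simp: E_def)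
  then show False using not_bd by blast
 qed
 then have m: "m > 0" unfolding m_def by (simp add: emeasure_eq_measure zero_less_measure_iff)
 define \<psi> where "\<psi> x = a / m * (indicator E x * sgn (f x))" for x
 have \<psi>b: "\<bar>\<psi> x\<bar> <= a / m * indicator E x" for x
  using a m by (auto simp: \<psi>_def abs_mult abs_sgn_eq indicator_def)
 have iE: "integrable M (%x. a / m * indicator E x)"
  by (intro integrable_mult_right integrable_real_indicator) (auto simp: emeasure_eq_measure)
 have \<psi>i: "integrable M \<psi>"
  by (rule Bochner_Integration.integrable_bound[OF iE]) (use \<psi>b a m in \<open>auto simp: \<psi>_def[abs_def]\<close>)
 have fi: "integrable M (%x. f x * \<psi> x)"
 proof (rule Bochner_Integration.integrable_bound[where f = "%x. N * \<psi> x"])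
  show "integrable M (%x. N * \<psi> x)" using \<psi>i by simp
  show "(%x. f x * \<psi> x) \<in> borel_measurable M" using \<psi>i by measurable
  show "AE x in M. norm (f x * \<psi> x) <= norm (N * \<psi> x)"
   using f by eventually_elim (auto simp: abs_mult intro!: mult_right_mono)
 qed
 show ?thesis
 proof (rule that[OF \<psi>i])
  have "(\<integral>x. \<bar>\<psi> x\<bar> \<partial>M) <= (\<integral>x. a / m * indicator E x \<partial>M)"
   using \<psi>i iE \<psi>b by (intro integral_mono) auto
  also have "\<dots> = a" using m by (simp add: m_def)
  finally show "(\<integral>x. \<bar>\<psi> x\<bar> \<partial>M) <= a" .
  have "a * C = (\<integral>x. C * (a / m * indicator E x) \<partial>M)" using m by (simp add: m_def)
  also have "\<dots> <= (\<integral>x. f x * \<psi> x \<partial>M)"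
  proof (rule integral_mono)
   show "integrable M (%x. C * (a / m * indicator E x))" by (rule integrable_mult_right[OF iE])
   fix x assume "x \<in> space M"
   have "f x * \<psi> x = a / m * indicator E x * \<bar>f x\<bar>"
    unfolding \<psi>_def abs_sgn[of "f x"] by (simp only: mult_ac)
   moreover have "C * (a / m * indicator E x) <= a / m * indicator E x * \<bar>f x\<bar>"
    using a m mult_left_mono[of C "\<bar>f x\<bar>" "a / m * indicator E x"] \<open>x \<in> space M\<close>
    by (cases "x \<in> E") (simp_all add: E_def mult.commute)
   ultimately show "C * (a / m * indicator E x) <= f x * \<psi> x" by simp
  qed (rule fi)
  finally show "a * C <= (\<integral>x. f x * \<psi> x \<partial>M)" .
 qed
qed

text \<open>Completeness of L1 in the form used for gliding humps: a summable bound on the norms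
  makes the series converge almost everywhere and bounds the norm of its sum.\<close>

lemma L1_series:
 fixes \<psi> :: "nat => 'a => real"
 assumes i: "!!j. integrable M (\<psi> j)" and le: "!!j. (\<integral>x. \<bar>\<psi> j x\<bar> \<partial>M) <= c j" and c: "summable c"
 shows "AE x in M. summable (%j. \<psi> j x)" "integrable M (%x. \<Sum>j. \<psi> j x)" "(\<integral>x. \<bar>\<Sum>j. \<psi> j x\<bar> \<partial>M) <= suminf c"
proof -
 have [measurable]: "\<psi> j \<in> borel_measurable M" for j using i[of j] by auto
 have c0: "0 <= c j" for j by (rule order_trans[OF _ le[of j]]) simp
 have sm: "summable (%j. \<integral>x. \<bar>\<psi> j x\<bar> \<partial>M)"
  by (rule summable_comparison_test'[OF c, of 0]) (use le in auto)
 have "(\<integral>\<^sup>+x. (\<Sum>j. ennreal \<bar>\<psi> j x\<bar>) \<partial>M) = (\<Sum>j. \<integral>\<^sup>+x. ennreal \<bar>\<psi> j x\<bar> \<partial>M)"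
  by (rule nn_integral_suminf) auto
 also have "\<dots> = (\<Sum>j. ennreal (\<integral>x. \<bar>\<psi> j x\<bar> \<partial>M))"
  using i by (intro arg_cong[where f = suminf] ext nn_integral_eq_integral) auto
 also have "\<dots> ~= \<infinity>"
  using sm by (simp add: ennreal_suminf_neq_top)
 finally have "AE x in M. (\<Sum>j. ennreal \<bar>\<psi> j x\<bar>) ~= \<infinity>"
  by (intro nn_integral_PInf_AE) auto
 then have sa: "AE x in M. summable (%j. norm (\<psi> j x))"
  by eventually_elim (auto intro: summable_suminf_not_top)
 then show "AE x in M. summable (%j. \<psi> j x)"
  by eventually_elim (rule summable_norm_cancel)
 have sm': "summable (%j. \<integral>x. norm (\<psi> j x) \<partial>M)" using sm by simp
 show int: "integrable M (%x. \<Sum>j. \<psi> j x)" by (rule integrable_suminf[where f = \<psi>]) (fact i sa sm')+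
 have sa': "AE x in M. summable (%j. norm \<bar>\<psi> j x\<bar>)" using sa by simp
 have sm'': "summable (%j. \<integral>x. norm \<bar>\<psi> j x\<bar> \<partial>M)" using sm by simp
 have ia: "integrable M (%x. \<bar>\<psi> j x\<bar>)" for j using i by simp
 have "(\<integral>x. \<bar>\<Sum>j. \<psi> j x\<bar> \<partial>M) <= (\<integral>x. (\<Sum>j. \<bar>\<psi> j x\<bar>) \<partial>M)"
 proof (rule integral_mono_AE)
  show "integrable M (%x. \<bar>\<Sum>j. \<psi> j x\<bar>)" using int by simp
  show "integrable M (%x. \<Sum>j. \<bar>\<psi> j x\<bar>)" by (rule integrable_suminf[where f = "%j x. \<bar>\<psi> j x\<bar>"]) (fact ia sa' sm'')+
  show "AE x in M. \<bar>\<Sum>j. \<psi> j x\<bar> <= (\<Sum>j. \<bar>\<psi> j x\<bar>)"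
   using sa unfolding real_norm_def by eventually_elim (rule summable_rabs)
 qed
 also have "\<dots> = (\<Sum>j. \<integral>x. \<bar>\<psi> j x\<bar> \<partial>M)" by (rule integral_suminf[where f = "%j x. \<bar>\<psi> j x\<bar>"]) (fact ia sa' sm'')+
 also have "\<dots> <= suminf c" by (rule suminf_le[OF le sm c])
 finally show "(\<integral>x. \<bar>\<Sum>j. \<psi> j x\<bar> \<partial>M) <= suminf c" .
qed

text \<open>The uniform boundedness principle for \<open>L\<^sup>\<infinity>\<close> as the dual of \<open>L\<^sup>1\<close>, by a gliding hump: a test function
 \<open>\<Psi>\<close> is built as a rapidly converging series whose \<open>k\<close>-th term makes \<open>\<integral> f\<^sub>h \<Psi>\<close> larger than \<open>k\<close> for some \<open>h\<close>.\<close>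

lemma weakly_bounded_imp_bounded:
 fixes f :: "nat => 'a => real"
 assumes M: "finite_measure M" and m: "!!h. f h \<in> borel_measurable M"
  and each: "!!h. \<exists>N. AE x in M. \<bar>f h x\<bar> <= N"
  and weak: "!!\<psi>. integrable M \<psi> ==> \<exists>B. \<forall>h. \<bar>\<integral>x. f h x * \<psi> x \<partial>M\<bar> <= B"
 obtains C where "!!h. AE x in M. \<bar>f h x\<bar> <= C"
proof (rule ccontr)
 assume "\<not> thesis"
 then have unb: "\<exists>h. \<not> (AE x in M. \<bar>f h x\<bar> <= C)" for C using that by blast
 have mult: "integrable M (%x. f h x * \<psi> x)" if "integrable M \<psi>" for h \<psi>
 proof -
  obtain N where N: "AE x in M. \<bar>f h x\<bar> <= N" using each by blast
  show ?thesis
  proof (rule Bochner_Integration.integrable_bound[where f = "%x. N * \<psi> x"])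
   show "integrable M (%x. N * \<psi> x)" using that by simp
   show "(%x. f h x * \<psi> x) \<in> borel_measurable M" using that m[of h] by measurable
   show "AE x in M. norm (f h x * \<psi> x) <= norm (N * \<psi> x)"
    using N by eventually_elim (auto simp: abs_mult intro!: mult_right_mono)
  qed
 qed
 \<comment> \<open>A state holds the partial sum \<open>S\<close> of the earlier humps, the L1
   budget \<open>b\<close> of the present hump, and the hump \<psi> with the index \<open>h\<close>
   at which it acts. It must outweigh the contribution of \<open>S\<close> for every index, which is
   possible because weak boundedness makes that contribution uniformly bounded.\<close>
 define P where "P n X = (case X of (S, b, h, \<psi>) => integrable M S \<and> 0 < b \<and> integrable M \<psi> \<and> (\<integral>x. \<bar>\<psi> x\<bar> \<partial>M) <= b
   \<and> (\<forall>h'. \<bar>\<integral>x. f h' x * S x \<partial>M\<bar> + real n + 1 <= (\<integral>x. f h x * \<psi> x \<partial>M)))"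
  for n :: nat and X :: "('a => real) \<times> real \<times> nat \<times> ('a => real)"
 \<comment> \<open>Budgets at least halve, so the total of all later humps is at most twice the next
   budget. The condition with \<open>N\<close> keeps their effect on the present \<open>f h\<close>
   below 1.\<close>
 define Q where "Q n X Y = (case X of (S, b, h, \<psi>) => case Y of (S', b', h', \<psi>') =>
   S' = (%x. S x + \<psi> x) \<and> b' <= b / 2 \<and> (\<exists>N\<ge>0. (AE x in M. \<bar>f h x\<bar> <= N) \<and> 2 * N * b' <= 1))"
  for n :: nat and X Y :: "('a => real) \<times> real \<times> nat \<times> ('a => real)"
 have ex: "\<exists>h \<psi>. P n (S, b, h, \<psi>)" if S: "integrable M S" and b: "b > 0" for n S b
 proof -
  obtain B where B: "!!h. \<bar>\<integral>x. f h x * S x \<partial>M\<bar> <= B" using weak[OF S] by blast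
  have B0: "B >= 0" using B[of 0] by linarith
  define C where "C = (B + real n + 1) / b"
  have C: "C >= 0" using B0 b by (simp add: C_def)
  obtain h where h: "\<not> (AE x in M. \<bar>f h x\<bar> <= C)" using unb by blast
  obtain N where N: "AE x in M. \<bar>f h x\<bar> <= N" using each by blast
  obtain \<psi> where \<psi>: "integrable M \<psi>" "(\<integral>x. \<bar>\<psi> x\<bar> \<partial>M) <= b" "b * C <= (\<integral>x. f h x * \<psi> x \<partial>M)"
   using large_test_function[OF M m N h C b] by blast
  have "b * C = B + real n + 1" using b by (simp add: C_def)
  then have "\<bar>\<integral>x. f h' x * S x \<partial>M\<bar> + real n + 1 <= (\<integral>x. f h x * \<psi> x \<partial>M)" for h'
   using \<psi>(3) B[of h'] by linarith
  then show ?thesis using \<psi> S b unfolding P_def by auto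
 qed
 have "\<exists>X. \<forall>n. P n (X n) \<and> Q n (X n) (X (Suc n))"
 proof (rule dependent_nat_choice)
  show "\<exists>X. P 0 X" using ex[of "%x. 0" 1 0] by auto
  fix X n assume PX: "P n X"
  obtain S b h \<psi> where X: "X = (S, b, h, \<psi>)" by (cases X) auto
  have X': "integrable M S" "0 < b" "integrable M \<psi>" using PX by (auto simp: P_def X)
  obtain N where N: "AE x in M. \<bar>f h x\<bar> <= N" using each by blast
  define N' where "N' = max 0 N"
  have N': "N' >= 0" "AE x in M. \<bar>f h x\<bar> <= N'" using N by (auto simp: N'_def elim: eventually_mono)
  define b' where "b' = min (b / 2) (1 / (2 * (N' + 1)))"
  have b': "b' > 0" "b' <= b / 2" using X'(2) N' by (auto simp: b'_def)
  have "2 * N' * b' <= 2 * N' * (1 / (2 * (N' + 1)))" using N' by (intro mult_left_mono) (auto simp: b'_def)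
  also have "\<dots> <= 1" using N' by (simp add: field_simps)
  finally have Nb: "2 * N' * b' <= 1" .
  obtain h' \<psi>' where "P (Suc n) (%x. S x + \<psi> x, b', h', \<psi>')"
   using ex[of "%x. S x + \<psi> x" b' "Suc n"] X' b' by auto
  moreover have "Q n X (%x. S x + \<psi> x, b', h', \<psi>')"
   unfolding Q_def X using b' N' Nb by auto
  ultimately show "\<exists>Y. P (Suc n) Y \<and> Q n X Y" by blast
 qed
 then obtain X where X: "!!n. P n (X n)" "!!n. Q n (X n) (X (Suc n))" by blast
 define S b h \<psi> where "S n = fst (X n)" and "b n = fst (snd (X n))" and "h n = fst (snd (snd (X n)))" and "\<psi> n = snd (snd (snd (X n)))" for n
 have Xn: "X n = (S n, b n, h n, \<psi> n)" for n by (simp add: S_def b_def h_def \<psi>_def)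
 have Pn: "integrable M (S n)" "0 < b n" "integrable M (\<psi> n)" "(\<integral>x. \<bar>\<psi> n x\<bar> \<partial>M) <= b n"
  "!!h'. \<bar>\<integral>x. f h' x * S n x \<partial>M\<bar> + real n + 1 <= (\<integral>x. f (h n) x * \<psi> n x \<partial>M)" for n
  using X(1)[of n] unfolding Xn P_def by auto
 have Qn: "S (Suc n) = (%x. S n x + \<psi> n x)" "b (Suc n) <= b n / 2" "\<exists>N\<ge>0. (AE x in M. \<bar>f (h n) x\<bar> <= N) \<and> 2 * N * b (Suc n) <= 1" for n
  using X(2)[of n] unfolding Xn Q_def by auto
 have bj: "b (k + j) <= b k * (1/2) ^ j" for k j
 proof (induction j)
  case (Suc j)
  then show ?case using Qn(2)[of "k + j"] by simp
 qed simp
 have geo: "summable (%j. b k * (1/2) ^ j)" "(\<Sum>j. b k * (1/2) ^ j) = 2 * b k" for k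
  by (auto intro!: summable_mult summable_geometric simp: suminf_mult suminf_geometric)
 have tail_i: "integrable M (\<psi> (k + j))" "(\<integral>x. \<bar>\<psi> (k + j) x\<bar> \<partial>M) <= b k * (1/2) ^ j" for k j
  using Pn(3,4)[of "k + j"] bj[of k j] by auto
 note series = L1_series[of M "%j. \<psi> (_ + j)", OF tail_i geo(1)]
 define \<Psi> where "\<Psi> x = S 0 x + (\<Sum>j. \<psi> j x)" for x
 have \<Psi>i: "integrable M \<Psi>" unfolding \<Psi>_def using Pn(1)[of 0] series(2)[of 0] by simp
 obtain B where B: "!!h. \<bar>\<integral>x. f h x * \<Psi> x \<partial>M\<bar> <= B" using weak[OF \<Psi>i] by blast
 have Sk: "S k x = S 0 x + (\<Sum>j<k. \<psi> j x)" for k x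
  by (induction k) (auto simp: Qn(1))
 \<comment> \<open>Split the limit into the partial sum, the k-th hump and the tail: the first two
   contribute at least k + 1 by \<open>P\<close>, the tail at least -1 by \<open>Q\<close>.\<close>
 have low: "real k <= (\<integral>x. f (h k) x * \<Psi> x \<partial>M)" for k
 proof -
  define T where "T x = (\<Sum>j. \<psi> (Suc k + j) x)" for x
  have Ti: "integrable M T" unfolding T_def by (rule series(2))
  have dec: "AE x in M. f (h k) x * \<Psi> x = f (h k) x * S k x + f (h k) x * \<psi> k x + f (h k) x * T x"
   using series(1)[of 0]
  proof eventually_elim
   case (elim x)
   have "(\<Sum>j. \<psi> j x) = (\<Sum>j. \<psi> (j + Suc k) x) + (\<Sum>j<Suc k. \<psi> j x)"
    by (rule suminf_split_initial_segment) (use elim in simp)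
   moreover have "T x = (\<Sum>j. \<psi> (j + Suc k) x)" by (simp only: T_def add.commute)
   ultimately have "\<Psi> x = S k x + \<psi> k x + T x"
    unfolding \<Psi>_def Sk[of k x] by (simp only: sum.lessThan_Suc)
   then show ?case by (simp add: distrib_left)
  qed
  have fS: "integrable M (%x. f (h k) x * S k x)" "integrable M (%x. f (h k) x * \<psi> k x)" "integrable M (%x. f (h k) x * T x)"
   using Pn Ti mult by auto
  have "(\<integral>x. f (h k) x * \<Psi> x \<partial>M) = (\<integral>x. f (h k) x * S k x + f (h k) x * \<psi> k x + f (h k) x * T x \<partial>M)"
   using dec fS mult[OF \<Psi>i] by (intro integral_cong_AE) auto
  also have "\<dots> = (\<integral>x. f (h k) x * S k x \<partial>M) + (\<integral>x. f (h k) x * \<psi> k x \<partial>M) + (\<integral>x. f (h k) x * T x \<partial>M)"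
   using fS by simp
  finally have eq: "(\<integral>x. f (h k) x * \<Psi> x \<partial>M) = (\<integral>x. f (h k) x * S k x \<partial>M) + (\<integral>x. f (h k) x * \<psi> k x \<partial>M) + (\<integral>x. f (h k) x * T x \<partial>M)" .
  obtain N where N: "N >= 0" "AE x in M. \<bar>f (h k) x\<bar> <= N" "2 * N * b (Suc k) <= 1" using Qn(3) by blast
  have "\<bar>\<integral>x. f (h k) x * T x \<partial>M\<bar> <= (\<integral>x. \<bar>f (h k) x * T x\<bar> \<partial>M)" by (rule integral_abs_bound)
  also have "\<dots> <= (\<integral>x. N * \<bar>T x\<bar> \<partial>M)"
  proof (rule integral_mono_AE)
   show "AE x in M. \<bar>f (h k) x * T x\<bar> <= N * \<bar>T x\<bar>"
    using N(2) by eventually_elim (auto simp: abs_mult intro!: mult_right_mono)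
  qed (use fS Ti in auto)
  also have "\<dots> = N * (\<integral>x. \<bar>T x\<bar> \<partial>M)" by simp
  also have "\<dots> <= N * (2 * b (Suc k))"
   using series(3)[of "Suc k"] N(1) unfolding geo T_def by (intro mult_left_mono) auto
  also have "\<dots> <= 1" using N(3) by simp
  finally have "\<bar>\<integral>x. f (h k) x * T x \<partial>M\<bar> <= 1" .
  then show ?thesis
   unfolding eq using Pn(5)[of "h k" k] by linarith
 qed
 obtain k :: nat where "real k > B" using reals_Archimedean2 by blast
 then show False using low[of k] B[of "h k"] by linarith
qed

lemma square_sum_le: "(a + b)\<^sup>2 <= 2 * a\<^sup>2 + 2 * (b::real)\<^sup>2"
 using zero_le_power2[of "a - b"] by (simp add: power2_sum power2_diff)

text \<open>A bound without any modulus of continuity: shifts of \<open>g\<close> differ from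
  \<open>g\<close> by at most 4 G in squared norm, so the quotient is that close to
  \<open>g\<close>. Undoing the division gives 2 (4 G) + 2 G = 10 G times \<tau>^2. It is uniform
  over sequences with bounded gradients.\<close>

lemma shift_estimate:
 fixes u g :: "real^2 => real"
 assumes u: "integrable lborel u" and g: "integrable lborel g" and g2: "integrable lborel (%x. (g x)\<^sup>2)"
  and G: "(\<integral>x. (g x)\<^sup>2 \<partial>lborel) <= G"
  and W: "weak_deriv_on a b e u g" and \<tau>: "\<tau> >= 0"
  and inner: "!!x s. x \<in> box a' b' ==> 0 <= s ==> s <= \<tau> ==> x + s *\<^sub>R e \<in> box a b"
 shows "(\<integral>\<^sup>+x. ennreal ((u (x + \<tau> *\<^sub>R e) - u x)\<^sup>2) * indicator (box a' b') x \<partial>lborel) <= ennreal (10 * \<tau>\<^sup>2 * G)"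
proof (cases "\<tau> = 0")
 case False
 then have \<tau>': "\<tau> > 0" using \<tau> by simp
 have [measurable]: "u \<in> borel_measurable borel" "g \<in> borel_measurable borel" using u g by auto
 have G0: "G >= 0" by (rule order_trans[OF _ G]) simp
 let ?q = "%x. (u (x + \<tau> *\<^sub>R e) - u x) / \<tau>"
 have "(\<integral>\<^sup>+x. ennreal ((?q x - g x)\<^sup>2) * indicator (box a' b') x \<partial>lborel) <= ennreal ((sqrt (4 * G))\<^sup>2)"
 proof (rule weak_deriv_difference_quotient[OF u g g2 W \<tau>'])
  show "x + s *\<^sub>R e \<in> box a b" if "x \<in> box a' b'" "0 <= s" "s <= \<tau>" for x s using inner that .
  fix s assume "0 <= s" "s <= \<tau>"
  have gi: "integrable lborel (%x. (g (x + s *\<^sub>R e))\<^sup>2)" by (rule integrable_translate[OF g2])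
  have "(\<integral>x. (g (x + s *\<^sub>R e) - g x)\<^sup>2 \<partial>lborel) <= (\<integral>x. 2 * (g (x + s *\<^sub>R e))\<^sup>2 + 2 * (g x)\<^sup>2 \<partial>lborel)"
  proof (rule integral_mono)
   show "integrable lborel (%x. (g (x + s *\<^sub>R e) - g x)\<^sup>2)"
    by (rule integrable_add_squares(2)[OF _ _ gi g2]) auto
   show "(g (x + s *\<^sub>R e) - g x)\<^sup>2 <= 2 * (g (x + s *\<^sub>R e))\<^sup>2 + 2 * (g x)\<^sup>2" for x
    using square_sum_le[of "g (x + s *\<^sub>R e)" "- g x"] by simp
  qed (use gi g2 in auto)
  also have "\<dots> = 4 * (\<integral>x. (g x)\<^sup>2 \<partial>lborel)"
   using gi g2 integral_translate[of "%x. (g x)\<^sup>2" "s *\<^sub>R e"] by simp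
  finally show "(\<integral>x. (g (x + s *\<^sub>R e) - g x)\<^sup>2 \<partial>lborel) <= (sqrt (4 * G))\<^sup>2"
   using G G0 by simp
 qed (use G0 in auto)
 then have 1: "(\<integral>\<^sup>+x. ennreal ((?q x - g x)\<^sup>2) * indicator (box a' b') x \<partial>lborel) <= ennreal (4 * G)" using G0 by simp
 have "(\<integral>\<^sup>+x. ennreal ((u (x + \<tau> *\<^sub>R e) - u x)\<^sup>2) * indicator (box a' b') x \<partial>lborel)
  <= (\<integral>\<^sup>+x. ennreal (2 * \<tau>\<^sup>2) * (ennreal ((?q x - g x)\<^sup>2) * indicator (box a' b') x) + ennreal (2 * \<tau>\<^sup>2) * ennreal ((g x)\<^sup>2) \<partial>lborel)"
 proof (rule nn_integral_mono)
  fix x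
  have "u (x + \<tau> *\<^sub>R e) - u x = \<tau> * ((?q x - g x) + g x)" using False by simp
  then have "(u (x + \<tau> *\<^sub>R e) - u x)\<^sup>2 = \<tau>\<^sup>2 * ((?q x - g x) + g x)\<^sup>2" by (metis power_mult_distrib)
  also have "\<dots> <= \<tau>\<^sup>2 * (2 * (?q x - g x)\<^sup>2 + 2 * (g x)\<^sup>2)" by (intro mult_left_mono square_sum_le) auto
  finally have le: "(u (x + \<tau> *\<^sub>R e) - u x)\<^sup>2 <= 2 * \<tau>\<^sup>2 * (?q x - g x)\<^sup>2 + 2 * \<tau>\<^sup>2 * (g x)\<^sup>2"
   by (simp add: algebra_simps)
  show "ennreal ((u (x + \<tau> *\<^sub>R e) - u x)\<^sup>2) * indicator (box a' b') x
   <= ennreal (2 * \<tau>\<^sup>2) * (ennreal ((?q x - g x)\<^sup>2) * indicator (box a' b') x) + ennreal (2 * \<tau>\<^sup>2) * ennreal ((g x)\<^sup>2)"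
  proof (cases "x \<in> box a' b'")
   case True
   have "ennreal ((u (x + \<tau> *\<^sub>R e) - u x)\<^sup>2) <= ennreal (2 * \<tau>\<^sup>2 * (?q x - g x)\<^sup>2 + 2 * \<tau>\<^sup>2 * (g x)\<^sup>2)"
    using le by (rule ennreal_leI)
   also have "\<dots> = ennreal (2 * \<tau>\<^sup>2) * ennreal ((?q x - g x)\<^sup>2) + ennreal (2 * \<tau>\<^sup>2) * ennreal ((g x)\<^sup>2)"
    by (subst ennreal_plus) (auto simp: ennreal_mult)
   finally show ?thesis using True by simp
  qed simp
 qed
 also have "\<dots> = ennreal (2 * \<tau>\<^sup>2) * (\<integral>\<^sup>+x. ennreal ((?q x - g x)\<^sup>2) * indicator (box a' b') x \<partial>lborel) + ennreal (2 * \<tau>\<^sup>2) * (\<integral>\<^sup>+x. ennreal ((g x)\<^sup>2) \<partial>lborel)"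
  by (subst nn_integral_add; (subst nn_integral_cmult)?; measurable?) (simp add: nn_integral_cmult)
 also have "\<dots> <= ennreal (2 * \<tau>\<^sup>2) * ennreal (4 * G) + ennreal (2 * \<tau>\<^sup>2) * ennreal G"
 proof (intro add_mono mult_left_mono 1)
  have "(\<integral>\<^sup>+x. ennreal ((g x)\<^sup>2) \<partial>lborel) = ennreal (\<integral>x. (g x)\<^sup>2 \<partial>lborel)"
   by (rule nn_integral_eq_integral[OF g2]) auto
  then show "(\<integral>\<^sup>+x. ennreal ((g x)\<^sup>2) \<partial>lborel) <= ennreal G" using G by (simp add: ennreal_leI)
 qed auto
 also have "\<dots> = ennreal (10 * \<tau>\<^sup>2 * G)"
  using G0 by (simp add: ennreal_mult[symmetric] ennreal_plus[symmetric] del: ennreal_plus)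
 finally show ?thesis .
qed simp

lemma measure_small_box_pos: "\<delta> > 0 ==> 0 < measure lborel (cbox 0 (vec \<delta> :: real^2))"
proof -
 assume \<delta>: "\<delta> > 0"
 have "0 < measure lborel (box 0 (vec \<delta> :: real^2))"
  by (subst measure_lborel_box_eq) (use \<delta> in \<open>auto simp: inner_axis Basis_vec_def intro!: prod_pos\<close>)
 also have "\<dots> <= measure lborel (cbox 0 (vec \<delta> :: real^2))"
  using box_subset_cbox by (intro measure_mono_fmeasurable) (auto simp: fmeasurable_def emeasure_lborel_cbox_eq)
 finally show ?thesis .
qed

text \<open>Averages over a small square converge pointwise by weak convergence, and they are close to the
 function itself in \<open>L\<^sup>2\<close>, uniformly in \<open>h\<close>, by the bound on the gradients.\<close>

lemma weak_imp_strong_L2: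
 fixes w g1 g2 :: "nat => real^2 => real" and p :: "real^2"
 assumes \<rho>: "\<rho> > 0" and wi: "!!h. integrable lborel (w h)" and wb: "!!h x. \<bar>w h x\<bar> <= M"
  and g1: "!!h. integrable lborel (g1 h)" "!!h. integrable lborel (%x. (g1 h x)\<^sup>2)" "!!h. (\<integral>x. (g1 h x)\<^sup>2 \<partial>lborel) <= G"
  and g2: "!!h. integrable lborel (g2 h)" "!!h. integrable lborel (%x. (g2 h x)\<^sup>2)" "!!h. (\<integral>x. (g2 h x)\<^sup>2 \<partial>lborel) <= G"
  and W1: "!!h. weak_deriv_on (p - vec (6 * \<rho>)) (p + vec (6 * \<rho>)) (axis 1 1) (w h) (g1 h)"
  and W2: "!!h. weak_deriv_on (p - vec (6 * \<rho>)) (p + vec (6 * \<rho>)) (axis 2 1) (w h) (g2 h)"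
  and weak: "!!x y. (%h. \<integral>z. indicator (cbox x y) z * w h z \<partial>lborel) \<longlonglongrightarrow> 0"
 defines "K \<equiv> cbox (p - vec (4 * \<rho>)) (p + vec (4 * \<rho>))"
 shows "(%h. \<integral>x. indicator K x * (w h x)\<^sup>2 \<partial>lborel) \<longlonglongrightarrow> 0"
proof (rule LIMSEQ_I)
 fix e :: real assume e: "e > 0"
 have wm [measurable]: "w h \<in> borel_measurable borel" for h using wi[of h] by auto
 have [measurable]: "K \<in> sets borel" by (simp add: K_def)
 have G0: "G >= 0" by (rule order_trans[OF _ g1(3)[of 0]]) simp
 have M0: "M >= 0" using wb[of 0 0] by linarith
 \<comment> \<open>With at most \<rho>/2 a horizontal and then a vertical shift lead from half-width
   9/2 \<rho> through 11/2 \<rho> to at most 6\<rho>. The second bound makes 80 \<delta>^2 G at most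
   2/5 e.\<close>
 define \<delta> where "\<delta> = min (\<rho> / 2) (sqrt (e / (200 * (G + 1))))"
 have \<delta>: "\<delta> > 0" "2 * \<delta> <= \<rho>" using \<rho> e G0 by (auto simp: \<delta>_def)
 have \<delta>e: "80 * \<delta>\<^sup>2 * G < e / 2"
 proof -
  have "\<delta>\<^sup>2 <= (sqrt (e / (200 * (G + 1))))\<^sup>2" using \<delta>(1) by (intro power_mono) (auto simp: \<delta>_def)
  then have "\<delta>\<^sup>2 <= e / (200 * (G + 1))" using e G0 by simp
  then have "80 * \<delta>\<^sup>2 * G <= 80 * (e / (200 * (G + 1))) * G" using G0 by (intro mult_right_mono mult_left_mono) auto
  also have "\<dots> = 2/5 * e * (G / (G + 1))" using G0 by (simp add: field_simps)
  also have "\<dots> <= 2/5 * e * 1" using e G0 by (intro mult_left_mono) auto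
  finally show ?thesis using e by linarith
 qed
 define Q where "Q = cbox 0 (vec \<delta> :: real^2)"
 have [measurable]: "Q \<in> sets borel" by (simp add: Q_def)
 define q where "q = measure lborel Q"
 have q: "q > 0" unfolding q_def Q_def by (rule measure_small_box_pos[OF \<delta>(1)])
 have Qi: "integrable lborel (%s. indicator Q s * k)" for k :: real
  unfolding Q_def by (intro integrable_mult_left integrable_real_indicator) (auto simp: emeasure_lborel_cbox_eq)
 have Ki: "integrable lborel (%s. indicator K s * k)" for k :: real
  unfolding K_def by (intro integrable_mult_left integrable_real_indicator) (auto simp: emeasure_lborel_cbox_eq)
 define Bo where "Bo = box (p - vec (9/2 * \<rho>)) (p + vec (9/2 * \<rho>))"
 define Bo' where "Bo' = box (p - vec (11/2 * \<rho>)) (p + vec (11/2 * \<rho>))"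
 have [measurable]: "Bo \<in> sets borel" "Bo' \<in> sets borel" by (auto simp: Bo_def Bo'_def)
 have KBo: "x \<in> K ==> x \<in> Bo" for x using \<rho> by (auto simp: K_def Bo_def mem_cbox_2 mem_box_2)
 \<comment> \<open>A diagonal shift is a horizontal one followed by a vertical one, each costing 10
   \<delta>^2 G; squaring the sum doubles both, in total 40.\<close>
 have shift: "(\<integral>\<^sup>+x. ennreal ((w h (x + s) - w h x)\<^sup>2) * indicator Bo x \<partial>lborel) <= ennreal (40 * \<delta>\<^sup>2 * G)" if s: "s \<in> Q" for h s
 proof -
  define a b where "a = s $ 1" and "b = s $ 2"
  have ab: "0 <= a" "a <= \<delta>" "0 <= b" "b <= \<delta>" using s by (auto simp: Q_def mem_cbox_2 a_def b_def)
  have s': "s = a *\<^sub>R axis 1 1 + b *\<^sub>R axis 2 1" by (simp add: vec_eq_iff forall_2 axis_def a_def b_def)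
  have sq: "10 * t\<^sup>2 * G <= 10 * \<delta>\<^sup>2 * G" if "0 <= t" "t <= \<delta>" for t
   using that G0 by (intro mult_right_mono mult_left_mono power_mono) auto
  have 1: "(\<integral>\<^sup>+x. ennreal ((w h (x + a *\<^sub>R axis 1 1) - w h x)\<^sup>2) * indicator Bo x \<partial>lborel) <= ennreal (10 * \<delta>\<^sup>2 * G)"
  proof -
   have "(\<integral>\<^sup>+x. ennreal ((w h (x + a *\<^sub>R axis 1 1) - w h x)\<^sup>2) * indicator Bo x \<partial>lborel) <= ennreal (10 * a\<^sup>2 * G)"
    unfolding Bo_def
   proof (rule shift_estimate[OF wi g1 W1 ab(1)])
    fix x and t :: real assume "x \<in> box (p - vec (9/2 * \<rho>)) (p + vec (9/2 * \<rho>))" "0 <= t" "t <= a"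
    then show "x + t *\<^sub>R axis 1 1 \<in> box (p - vec (6 * \<rho>)) (p + vec (6 * \<rho>))"
     using ab \<delta> \<rho> by (auto simp: mem_box_2 axis_def)
   qed
   also have "\<dots> <= ennreal (10 * \<delta>\<^sup>2 * G)" by (rule ennreal_leI[OF sq[OF ab(1,2)]])
   finally show ?thesis .
  qed
  have 2: "(\<integral>\<^sup>+y. ennreal ((w h (y + b *\<^sub>R axis 2 1) - w h y)\<^sup>2) * indicator Bo' y \<partial>lborel) <= ennreal (10 * \<delta>\<^sup>2 * G)"
  proof -
   have "(\<integral>\<^sup>+x. ennreal ((w h (x + b *\<^sub>R axis 2 1) - w h x)\<^sup>2) * indicator Bo' x \<partial>lborel) <= ennreal (10 * b\<^sup>2 * G)"
    unfolding Bo'_def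
   proof (rule shift_estimate[OF wi g2 W2 ab(3)])
    fix x and t :: real assume "x \<in> box (p - vec (11/2 * \<rho>)) (p + vec (11/2 * \<rho>))" "0 <= t" "t <= b"
    then show "x + t *\<^sub>R axis 2 1 \<in> box (p - vec (6 * \<rho>)) (p + vec (6 * \<rho>))"
     using ab \<delta> \<rho> by (auto simp: mem_box_2 axis_def)
   qed
   also have "\<dots> <= ennreal (10 * \<delta>\<^sup>2 * G)" by (rule ennreal_leI[OF sq[OF ab(3,4)]])
   finally show ?thesis .
  qed
  define F where "F y = ennreal ((w h (y + b *\<^sub>R axis 2 1) - w h y)\<^sup>2) * indicator Bo' y" for y
  have Fm: "F \<in> borel_measurable borel" unfolding F_def by measurable
  have 3: "(\<integral>\<^sup>+x. F (x + a *\<^sub>R axis 1 1) \<partial>lborel) <= ennreal (10 * \<delta>\<^sup>2 * G)"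
   using 2 unfolding nn_integral_translate[OF Fm] by (simp only: F_def[abs_def])
  have "(\<integral>\<^sup>+x. ennreal ((w h (x + s) - w h x)\<^sup>2) * indicator Bo x \<partial>lborel)
   <= (\<integral>\<^sup>+x. 2 * F (x + a *\<^sub>R axis 1 1) + 2 * (ennreal ((w h (x + a *\<^sub>R axis 1 1) - w h x)\<^sup>2) * indicator Bo x) \<partial>lborel)"
  proof (rule nn_integral_mono)
   fix x
   show "ennreal ((w h (x + s) - w h x)\<^sup>2) * indicator Bo x
    <= 2 * F (x + a *\<^sub>R axis 1 1) + 2 * (ennreal ((w h (x + a *\<^sub>R axis 1 1) - w h x)\<^sup>2) * indicator Bo x)"
   proof (cases "x \<in> Bo")
    case True
    have x': "x + a *\<^sub>R axis 1 1 \<in> Bo'" using True ab \<delta> \<rho> by (auto simp: Bo_def Bo'_def mem_box_2 axis_def)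
    define A B where "A = w h (x + s) - w h (x + a *\<^sub>R axis 1 1)" and "B = w h (x + a *\<^sub>R axis 1 1) - w h x"
    have "ennreal ((w h (x + s) - w h x)\<^sup>2) = ennreal ((A + B)\<^sup>2)" by (simp add: A_def B_def)
    also have "\<dots> <= ennreal (2 * A\<^sup>2 + 2 * B\<^sup>2)" by (rule ennreal_leI[OF square_sum_le])
    also have "\<dots> = 2 * ennreal (A\<^sup>2) + 2 * ennreal (B\<^sup>2)"
     by (subst ennreal_plus) (auto simp: ennreal_mult)
    finally show ?thesis
     using True x' by (simp add: F_def A_def B_def s' add.assoc)
   qed simp
  qed
  also have "\<dots> = 2 * (\<integral>\<^sup>+x. F (x + a *\<^sub>R axis 1 1) \<partial>lborel) + 2 * (\<integral>\<^sup>+x. ennreal ((w h (x + a *\<^sub>R axis 1 1) - w h x)\<^sup>2) * indicator Bo x \<partial>lborel)"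
  proof -
   have [measurable]: "(%x. F (x + a *\<^sub>R axis 1 1)) \<in> borel_measurable borel" using Fm by measurable
   show ?thesis by (subst nn_integral_add) (auto simp: nn_integral_cmult)
  qed
  also have "\<dots> <= 2 * ennreal (10 * \<delta>\<^sup>2 * G) + 2 * ennreal (10 * \<delta>\<^sup>2 * G)"
   by (intro add_mono mult_left_mono 1 3) auto
  also have "\<dots> = ennreal (40 * \<delta>\<^sup>2 * G)"
  proof -
   have "2 * ennreal Y + 2 * ennreal Y = ennreal (4 * Y)" if "Y >= 0" for Y
   proof -
    have "ennreal (4 * Y) = ennreal (2 * Y + 2 * Y)" by simp
    also have "\<dots> = ennreal (2 * Y) + ennreal (2 * Y)" using that by (intro ennreal_plus) auto
    also have "ennreal (2 * Y) = 2 * ennreal Y" using that by (simp add: ennreal_mult)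
    finally show ?thesis by simp
   qed
   from this[of "10 * \<delta>\<^sup>2 * G"] show ?thesis using G0 by (simp add: mult.assoc)
  qed
  finally show ?thesis .
 qed
 \<comment> \<open>The average of \<open>w h\<close> over the small square with lower left corner
   \<open>x\<close>. It is a pairing with the indicator of a fixed square, so weak convergence sends
   it to 0 at each point, with the bound \<open>M\<close> as domination.\<close>
 define A where "A h x = (\<integral>s. indicator Q s * w h (x + s) \<partial>lborel) / q" for h x
 have Am [measurable]: "A h \<in> borel_measurable borel" for h
 proof -
  have "(%x. \<integral>s. indicator Q s * w h (x + s) \<partial>lborel) \<in> borel_measurable borel"
   by (rule lborel.borel_measurable_lebesgue_integral) measurable
  then show ?thesis unfolding A_def[abs_def] by measurable
 qed
 have Qw: "integrable lborel (%s. indicator Q s * f s)" "integrable lborel (%s. (indicator Q s * f s)\<^sup>2)"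
  if "f \<in> borel_measurable borel" "!!s. \<bar>f s\<bar> <= C" for f :: "real^2 => real" and C
 proof -
  have [measurable]: "f \<in> borel_measurable borel" by fact
  show "integrable lborel (%s. indicator Q s * f s)"
  proof (rule Bochner_Integration.integrable_bound[OF Qi[of C]])
   have "\<bar>f s\<bar> <= \<bar>C\<bar>" for s using that(2)[of s] by linarith
   then show "AE s in lborel. norm (indicator Q s * f s) <= norm (indicator Q s * C)"
    by (auto simp: indicator_def)
  qed measurable
  show "integrable lborel (%s. (indicator Q s * f s)\<^sup>2)"
  proof (rule Bochner_Integration.integrable_bound[OF Qi[of "C\<^sup>2"]])
   have "(f s)\<^sup>2 <= C\<^sup>2" for s using power_mono[OF that(2)[of s], of 2] by simp
   then show "AE s in lborel. norm ((indicator Q s * f s)\<^sup>2) <= norm (indicator Q s * C\<^sup>2)"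
    by (auto simp: indicator_def)
  qed simp
 qed
 have wxm: "(%s. w h (x + s)) \<in> borel_measurable borel" for h x by measurable
 have Ab: "\<bar>A h x\<bar> <= M" for h x
 proof -
  have "\<bar>\<integral>s. indicator Q s * w h (x + s) \<partial>lborel\<bar> <= (\<integral>s. \<bar>indicator Q s * w h (x + s)\<bar> \<partial>lborel)"
   by (rule integral_abs_bound)
  also have "\<dots> <= (\<integral>s. indicator Q s * M \<partial>lborel)"
  proof (rule integral_mono)
   show "integrable lborel (%s. \<bar>indicator Q s * w h (x + s)\<bar>)"
    by (rule integrable_abs[OF Qw(1)[OF wxm wb]])
   show "\<bar>indicator Q s * w h (x + s)\<bar> <= indicator Q s * M" for s
    using wb[of h "x + s"] by (simp add: indicator_def)
  qed (rule Qi)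
  also have "\<dots> = q * M" by (simp add: q_def)
  finally show ?thesis using q by (simp add: A_def pos_divide_le_eq mult.commute)
 qed
 have Alim: "(%h. A h x) \<longlonglongrightarrow> 0" for x
 proof -
  have "(\<integral>s. indicator Q s * w h (x + s) \<partial>lborel) = (\<integral>z. indicator (cbox x (x + vec \<delta>)) z * w h z \<partial>lborel)" for h
  proof -
   have "indicator (cbox x (x + vec \<delta>)) (s + x) = (indicator Q s :: real)" for s
    by (simp add: indicator_def Q_def mem_cbox_2)
   then show ?thesis
    using integral_translate[of "%z. indicator (cbox x (x + vec \<delta>)) z * w h z" x] by (simp add: add.commute)
  qed
  then show ?thesis
   unfolding A_def using tendsto_divide[OF weak[of x "x + vec \<delta>"] tendsto_const[of q]] q by simp
 qed
 \<comment> \<open>Jensen's inequality for the average, obtained from Cauchy-Schwarz with the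
   indicator of the square as second factor.\<close>
 have jensen: "(w h x - A h x)\<^sup>2 <= 1 / q * (\<integral>s. (indicator Q s * (w h (x + s) - w h x))\<^sup>2 \<partial>lborel)" for h x
 proof -
  define f where "f s = w h (x + s) - w h x" for s
  have fm: "f \<in> borel_measurable borel" unfolding f_def by measurable
  have fb: "\<bar>f s\<bar> <= 2 * M" for s using wb[of h "x + s"] wb[of h x] unfolding f_def by linarith
  have "(\<integral>s. indicator Q s * f s \<partial>lborel) = (\<integral>s. indicator Q s * w h (x + s) \<partial>lborel) - (\<integral>s. indicator Q s * w h x \<partial>lborel)"
   unfolding f_def right_diff_distrib
   by (rule Bochner_Integration.integral_diff[OF Qw(1)[OF wxm wb] Qi])
  also have "\<dots> = q * (A h x - w h x)" using q by (simp add: A_def q_def right_diff_distrib)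
  finally have eq: "(\<integral>s. indicator Q s * f s \<partial>lborel) = q * (A h x - w h x)" .
  have i1: "integrable lborel (%s. (indicator Q s :: real)\<^sup>2)"
  proof -
   have "(%s. (indicator Q s :: real)\<^sup>2) = (%s. indicator Q s * 1)" by (auto simp: fun_eq_iff indicator_def)
   then show ?thesis using Qi[of 1] by simp
  qed
  have "\<bar>\<integral>s. indicator Q s * (indicator Q s * f s) \<partial>lborel\<bar> <= sqrt (\<integral>s. (indicator Q s)\<^sup>2 \<partial>lborel) * sqrt (\<integral>s. (indicator Q s * f s)\<^sup>2 \<partial>lborel)"
   by (rule Cauchy_Schwarz_integral[OF _ _ i1 Qw(2)[OF fm fb]]) (use fm in measurable)
  moreover have "indicator Q s * (indicator Q s * f s) = indicator Q s * f s" "(indicator Q s :: real)\<^sup>2 = indicator Q s" for s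
   by (auto simp: indicator_def)
  ultimately have "\<bar>q * (A h x - w h x)\<bar> <= sqrt q * sqrt (\<integral>s. (indicator Q s * f s)\<^sup>2 \<partial>lborel)"
   by (simp add: eq q_def)
  then have "\<bar>q * (A h x - w h x)\<bar>\<^sup>2 <= (sqrt q * sqrt (\<integral>s. (indicator Q s * f s)\<^sup>2 \<partial>lborel))\<^sup>2"
   by (intro power_mono) auto
  then have "q * (q * (w h x - A h x)\<^sup>2) <= q * (\<integral>s. (indicator Q s * f s)\<^sup>2 \<partial>lborel)"
   using q by (simp add: power_mult_distrib power2_commute[of "A h x"] power2_eq_square[of q] mult.assoc)
  then have "q * (w h x - A h x)\<^sup>2 <= (\<integral>s. (indicator Q s * f s)\<^sup>2 \<partial>lborel)"
   using q by (simp only: mult_le_cancel_left_pos)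
  then show ?thesis using q unfolding f_def by (simp add: field_simps)
 qed
 \<comment> \<open>Fubini exchanges the average over shifts with the integral over \<open>x\<close>;
   then \<open>shift\<close> applies for each fixed shift.\<close>
 have near: "(\<integral>x. indicator K x * (w h x - A h x)\<^sup>2 \<partial>lborel) <= 40 * \<delta>\<^sup>2 * G" for h
 proof -
  have int: "integrable lborel (%x. indicator K x * (w h x - A h x)\<^sup>2)"
  proof (rule Bochner_Integration.integrable_bound[OF Ki[of "(2 * M)\<^sup>2"]])
   have "(w h x - A h x)\<^sup>2 <= (2 * M)\<^sup>2" for x
   proof -
    have "\<bar>w h x - A h x\<bar> <= 2 * M" using wb[of h x] Ab[of h x] by linarith
    from power_mono[OF this, of 2] show ?thesis by simp
   qed
   then show "AE x in lborel. norm (indicator K x * (w h x - A h x)\<^sup>2) <= norm (indicator K x * (2 * M)\<^sup>2)"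
    by (auto simp: indicator_def)
  qed measurable
  have "ennreal (\<integral>x. indicator K x * (w h x - A h x)\<^sup>2 \<partial>lborel) = (\<integral>\<^sup>+x. ennreal (indicator K x * (w h x - A h x)\<^sup>2) \<partial>lborel)"
   by (rule nn_integral_eq_integral[OF int, symmetric]) auto
  also have "\<dots> <= (\<integral>\<^sup>+x. ennreal (1 / q) * (\<integral>\<^sup>+s. indicator Q s * (ennreal ((w h (x + s) - w h x)\<^sup>2) * indicator Bo x) \<partial>lborel) \<partial>lborel)"
  proof (rule nn_integral_mono)
   fix x
   show "ennreal (indicator K x * (w h x - A h x)\<^sup>2) <= ennreal (1 / q) * (\<integral>\<^sup>+s. indicator Q s * (ennreal ((w h (x + s) - w h x)\<^sup>2) * indicator Bo x) \<partial>lborel)"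
   proof (cases "x \<in> K")
    case True
    have fm: "(%s. w h (x + s) - w h x) \<in> borel_measurable borel" by measurable
    have fb: "\<bar>w h (x + s) - w h x\<bar> <= 2 * M" for s using wb[of h "x + s"] wb[of h x] by linarith
    have "ennreal ((w h x - A h x)\<^sup>2) <= ennreal (1 / q * (\<integral>s. (indicator Q s * (w h (x + s) - w h x))\<^sup>2 \<partial>lborel))"
     by (rule ennreal_leI[OF jensen])
    also have "\<dots> = ennreal (1 / q) * ennreal (\<integral>s. (indicator Q s * (w h (x + s) - w h x))\<^sup>2 \<partial>lborel)"
     using q by (intro ennreal_mult) auto
    also have "ennreal (\<integral>s. (indicator Q s * (w h (x + s) - w h x))\<^sup>2 \<partial>lborel) = (\<integral>\<^sup>+s. ennreal ((indicator Q s * (w h (x + s) - w h x))\<^sup>2) \<partial>lborel)"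
     by (rule nn_integral_eq_integral[OF Qw(2)[OF fm fb], symmetric]) auto
    also have "\<dots> = (\<integral>\<^sup>+s. indicator Q s * (ennreal ((w h (x + s) - w h x)\<^sup>2) * indicator Bo x) \<partial>lborel)"
     using KBo[OF True] by (intro nn_integral_cong) (auto simp: indicator_def)
    finally show ?thesis using True by simp
   qed simp
  qed
  also have "\<dots> = ennreal (1 / q) * (\<integral>\<^sup>+x. \<integral>\<^sup>+s. indicator Q s * (ennreal ((w h (x + s) - w h x)\<^sup>2) * indicator Bo x) \<partial>lborel \<partial>lborel)"
   by (rule nn_integral_cmult) measurable
  also have "(\<integral>\<^sup>+x. \<integral>\<^sup>+s. indicator Q s * (ennreal ((w h (x + s) - w h x)\<^sup>2) * indicator Bo x) \<partial>lborel \<partial>lborel)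
   = (\<integral>\<^sup>+s. \<integral>\<^sup>+x. indicator Q s * (ennreal ((w h (x + s) - w h x)\<^sup>2) * indicator Bo x) \<partial>lborel \<partial>lborel)"
   by (rule lborel_pair.Fubini') measurable
  also have "\<dots> = (\<integral>\<^sup>+s. indicator Q s * (\<integral>\<^sup>+x. ennreal ((w h (x + s) - w h x)\<^sup>2) * indicator Bo x \<partial>lborel) \<partial>lborel)"
   by (intro nn_integral_cong nn_integral_cmult) measurable
  also have "\<dots> <= (\<integral>\<^sup>+s. indicator Q s * ennreal (40 * \<delta>\<^sup>2 * G) \<partial>lborel)"
   by (intro nn_integral_mono) (use shift in \<open>auto simp: indicator_def\<close>)
  also have "\<dots> = emeasure lborel Q * ennreal (40 * \<delta>\<^sup>2 * G)"
   by (subst nn_integral_multc) auto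
  also have "emeasure lborel Q = ennreal q"
   unfolding q_def by (rule emeasure_eq_ennreal_measure) (simp add: Q_def emeasure_lborel_cbox_eq)
  finally have "ennreal (\<integral>x. indicator K x * (w h x - A h x)\<^sup>2 \<partial>lborel) <= ennreal (1 / q) * (ennreal q * ennreal (40 * \<delta>\<^sup>2 * G))"
   by (rule meta_mp) (auto intro: mult_left_mono)
  also have "\<dots> = ennreal (1 / q) * ennreal (q * (40 * \<delta>\<^sup>2 * G))"
   using q G0 by (subst ennreal_mult[of q]) auto
  also have "\<dots> = ennreal (1 / q * (q * (40 * \<delta>\<^sup>2 * G)))"
   using q G0 by (intro ennreal_mult[symmetric]) auto
  also have "1 / q * (q * (40 * \<delta>\<^sup>2 * G)) = 40 * \<delta>\<^sup>2 * G" using q by simp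
  finally show ?thesis using G0 by (simp add: ennreal_le_iff)
 qed
 have "(%h. \<integral>x. indicator K x * (A h x)\<^sup>2 \<partial>lborel) \<longlonglongrightarrow> (\<integral>x. 0 \<partial>(lborel :: (real^2) measure))"
 proof (rule integral_dominated_convergence[where w = "%x. indicator K x * M\<^sup>2"])
  show "AE x in lborel. (%h. indicator K x * (A h x)\<^sup>2) \<longlonglongrightarrow> 0"
  proof (rule AE_I2)
   fix x
   have "(%h. indicator K x * (A h x)\<^sup>2) \<longlonglongrightarrow> indicator K x * 0\<^sup>2"
    by (intro tendsto_mult tendsto_power tendsto_const Alim)
   then show "(%h. indicator K x * (A h x)\<^sup>2) \<longlonglongrightarrow> 0" by simp
  qed
  have "(A h x)\<^sup>2 <= M\<^sup>2" for h x using power_mono[OF Ab[of h x], of 2] by simp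
  then show "AE x in lborel. norm (indicator K x * (A h x)\<^sup>2) <= indicator K x * M\<^sup>2" for h
   by (auto simp: indicator_def)
 qed (use Ki in auto)
 then have "\<forall>\<^sub>F h in sequentially. (\<integral>x. indicator K x * (A h x)\<^sup>2 \<partial>lborel) < e / 4"
  using e by (intro order_tendstoD) auto
 then obtain n where n: "!!h. h >= n ==> (\<integral>x. indicator K x * (A h x)\<^sup>2 \<partial>lborel) < e / 4"
  by (auto simp: eventually_sequentially)
 have "norm ((\<integral>x. indicator K x * (w h x)\<^sup>2 \<partial>lborel) - 0) < e" if h: "h >= n" for h
 proof -
  have ib: "integrable lborel (%x. indicator K x * (f x)\<^sup>2)" if [measurable]: "f \<in> borel_measurable borel" and "!!x. \<bar>f x\<bar> <= 2 * M" for f :: "real^2 => real"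
  proof (rule Bochner_Integration.integrable_bound[OF Ki[of "(2 * M)\<^sup>2"]])
   have "(f x)\<^sup>2 <= (2 * M)\<^sup>2" for x using power_mono[OF that(2)[of x], of 2] by simp
   then show "AE x in lborel. norm (indicator K x * (f x)\<^sup>2) <= norm (indicator K x * (2 * M)\<^sup>2)"
    by (auto simp: indicator_def)
  qed measurable
  have i1: "integrable lborel (%x. indicator K x * (w h x)\<^sup>2)"
   by (rule ib) (measurable, rule order_trans[OF wb], use M0 in simp)
  have i2: "integrable lborel (%x. indicator K x * (A h x)\<^sup>2)"
   by (rule ib) (measurable, rule order_trans[OF Ab], use M0 in simp)
  have i3: "integrable lborel (%x. indicator K x * (w h x - A h x)\<^sup>2)"
  proof (rule ib)
   show "\<bar>w h x - A h x\<bar> <= 2 * M" for x using wb[of h x] Ab[of h x] by linarith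
  qed measurable
  have "(\<integral>x. indicator K x * (w h x)\<^sup>2 \<partial>lborel) <= (\<integral>x. 2 * (indicator K x * (w h x - A h x)\<^sup>2) + 2 * (indicator K x * (A h x)\<^sup>2) \<partial>lborel)"
  proof (rule integral_mono[OF i1])
   show "integrable lborel (%x. 2 * (indicator K x * (w h x - A h x)\<^sup>2) + 2 * (indicator K x * (A h x)\<^sup>2))" using i2 i3 by simp
   show "indicator K x * (w h x)\<^sup>2 <= 2 * (indicator K x * (w h x - A h x)\<^sup>2) + 2 * (indicator K x * (A h x)\<^sup>2)" for x
    using square_sum_le[of "w h x - A h x" "A h x"] by (simp add: indicator_def)
  qed
  also have "\<dots> = 2 * (\<integral>x. indicator K x * (w h x - A h x)\<^sup>2 \<partial>lborel) + 2 * (\<integral>x. indicator K x * (A h x)\<^sup>2 \<partial>lborel)"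
   using i2 i3 by simp
  also have "\<dots> < e" using near[of h] n[OF h] \<delta>e by linarith
  finally show ?thesis
   by simp
 qed
 then show "\<exists>no. \<forall>h\<ge>no. norm ((\<integral>x. indicator K x * (w h x)\<^sup>2 \<partial>lborel) - 0) < e" by blast
qed

section \<open>The two phases in terms of the square wave, and laminates in the homogenized
  set\<close>

section \<open>The two phases\<close>

definition phase_set :: "real => (real^2^2) set" where
 "phase_set s = (if s = 1 then triple_set (-1/2) 1 (-2) 2 else triple_set (5/2) 1 3 2)"

lemma phase_set_eq: "phase_set s = (%(a, b). diag2 a b) ` phase_pairs s"
 by (auto simp: phase_set_def phase_pairs_def triple_set_def)

lemma phase_set_props: "finite (phase_set s)" "phase_set s ~= {}" "0 \<in> phase_set s" "closed (phase_set s)"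
 by (auto simp: phase_set_def triple_set_def diag2_zero)

lemma infdist_phase_set_le: "infdist \<Lambda> (phase_set s) <= norm \<Lambda>"
 using infdist_le[OF phase_set_props(3), of \<Lambda>] by (simp add: dist_norm)

definition left_half :: "(real^2) set" where
 "left_half = {y. 0 <= y $ 1 \<and> y $ 1 < 1/2 \<and> 0 <= y $ 2 \<and> y $ 2 < 1}"

definition right_half :: "(real^2) set" where
 "right_half = {y. 1/2 <= y $ 1 \<and> y $ 1 < 1 \<and> 0 <= y $ 2 \<and> y $ 2 < 1}"

lemma frac_vec_phase:
 "frac_vec (x /\<^sub>R \<epsilon>) \<in> left_half \<longleftrightarrow> square_wave (x $ 1 / \<epsilon>) = 1"
 "frac_vec (x /\<^sub>R \<epsilon>) \<in> right_half \<longleftrightarrow> square_wave (x $ 1 / \<epsilon>) ~= 1"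
proof -
 have f: "frac_vec (x /\<^sub>R \<epsilon>) $ i = frac (x $ i / \<epsilon>)" for i
  by (simp only: frac_vec_def vec_lambda_beta vector_scaleR_component real_scaleR_def divide_inverse mult.commute)
 show "frac_vec (x /\<^sub>R \<epsilon>) \<in> left_half \<longleftrightarrow> square_wave (x $ 1 / \<epsilon>) = 1"
  unfolding left_half_def mem_Collect_eq f square_wave_def using frac_lt_1[of "x $ 1 / \<epsilon>"] frac_lt_1[of "x $ 2 / \<epsilon>"] by simp
 show "frac_vec (x /\<^sub>R \<epsilon>) \<in> right_half \<longleftrightarrow> square_wave (x $ 1 / \<epsilon>) ~= 1"
  unfolding right_half_def mem_Collect_eq f square_wave_def using frac_lt_1[of "x $ 1 / \<epsilon>"] frac_lt_1[of "x $ 2 / \<epsilon>"] by (simp add: not_less)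
qed

lemma phase_sum_infdist:
 "(\<Sum>k=1..2::nat. indicator (if k = 1 then left_half else right_half) (frac_vec (x /\<^sub>R \<epsilon>)) *
   infdist \<Lambda> (if k = 1 then triple_set (-1/2) 1 (-2) 2 else triple_set (5/2) 1 3 2))
 = infdist \<Lambda> (phase_set (square_wave (x $ 1 / \<epsilon>)))"
proof -
 have "{1..2} = {1, 2::nat}" by auto
 then show ?thesis
  using frac_vec_phase[where x = x and \<epsilon> = \<epsilon>] by (simp add: phase_set_def indicator_def)
qed

text \<open>The matrices of the two phases with equal index share the second diagonal entry
  \<open>g\<close>. The parameters \<open>b\<close> and \<open>a\<close> are the half sum and half
  difference of their first entries, for instance ((-1/2) + 5/2)/2 = 1 and ((-1/2) - 5/2)/2 =
  -3/2.\<close>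

lemma laminate_grad_in_phase_set:
 assumes "(b, a, g) \<in> {(0, 0, 0), (1, -3/2, 1), (1/2, -5/2, 2)}"
 shows "laminate_grad b a g \<epsilon> x \<in> phase_set (square_wave (x $ 1 / \<epsilon>))"
 using assms square_wave_cases[of "x $ 1 / \<epsilon>"]
 by (elim insertE emptyE Pair_inject disjE; hypsubst; simp add: laminate_grad_def phase_set_def triple_set_def)

text \<open>A weak gradient is only required to be locally integrable; measurability on \<Omega> is
  glued from countably many closed boxes. It is needed for the chosen
  \<open>weak_grad\<close>.\<close>

lemma locally_integrable_imp_measurable:
 fixes f :: "real^2 => 'b::euclidean_space"
 assumes f: "locally_integrable \<Omega> f" and \<Omega>: "open \<Omega>"
 shows "f \<in> borel_measurable (lebesgue_on \<Omega>)"
proof -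
 obtain \<D> where \<D>: "countable \<D>" "!!X. X \<in> \<D> ==> X \<subseteq> \<Omega>" "!!X. X \<in> \<D> ==> \<exists>a b. X = cbox a b" "\<Union>\<D> = \<Omega>"
  using open_countable_Union_open_cbox[OF \<Omega>] by (metis Pow_iff subsetD)
 show ?thesis
 proof (rule measurable_piecewise_restrict[OF \<D>(1)])
  fix X assume X: "X \<in> \<D>"
  then obtain a b where ab: "X = cbox a b" using \<D>(3) by blast
  have X': "X \<in> sets lebesgue" "X \<subseteq> \<Omega>" using ab \<D>(2)[OF X] by auto
  show "X \<inter> space (lebesgue_on \<Omega>) \<in> sets (lebesgue_on \<Omega>)"
   using X' \<Omega> by (auto simp: sets_restrict_space)
  have "integrable (lebesgue_on X) f" using f X' ab unfolding locally_integrable_def by auto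
  moreover have "restrict_space (lebesgue_on \<Omega>) X = lebesgue_on X"
   using X' \<Omega> by (subst restrict_restrict_space) (auto simp: Int_absorb1)
  ultimately show "f \<in> borel_measurable (restrict_space (lebesgue_on \<Omega>) X)" by auto
 qed (use \<D>(4) in auto)
qed

lemma weak_grad_measurable:
 "has_weak_gradient \<Omega> u G ==> open \<Omega> ==> weak_grad \<Omega> u \<in> borel_measurable (lebesgue_on \<Omega>)"
 using has_weak_gradient_weak_grad[of \<Omega> u G] locally_integrable_imp_measurable
 by (auto simp: has_weak_gradient_def)

lemma square_wave_coordinate_measurable: "(%x::real^2. square_wave (x $ 1 / \<epsilon>)) \<in> borel_measurable (lebesgue_on S)"
 by (rule borel_measurable_lebesgue_on) measurable

lemma phase_case_measurable:
 fixes F1 F2 :: "real^2 => real"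
 assumes [measurable]: "F1 \<in> borel_measurable (lebesgue_on S)" "F2 \<in> borel_measurable (lebesgue_on S)"
 shows "(%x. if square_wave (x $ 1 / \<epsilon>) = 1 then F1 x else F2 x) \<in> borel_measurable (lebesgue_on S)"
proof -
 have [measurable]: "(%x::real^2. square_wave (x $ 1 / \<epsilon>)) \<in> borel_measurable (lebesgue_on S)"
  by (rule square_wave_coordinate_measurable)
 show ?thesis by measurable
qed

lemma infdist_phase_measurable:
 fixes G :: "real^2 => real^2^2"
 assumes "G \<in> borel_measurable (lebesgue_on S)"
 shows "(%x. infdist (G x) (phase_set (square_wave (x $ 1 / \<epsilon>)))) \<in> borel_measurable (lebesgue_on S)"
proof -
 have i: "(%x. infdist (G x) A) \<in> borel_measurable (lebesgue_on S)" for A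
  by (rule measurable_compose[OF assms]) (intro borel_measurable_continuous_onI continuous_intros)
 \<comment> \<open>The argument 0 stands for the second phase: \<open>phase_set\<close> takes the
   second triple at every value other than 1.\<close>
 have "(%x. if square_wave (x $ 1 / \<epsilon>) = 1 then infdist (G x) (phase_set 1) else infdist (G x) (phase_set 0)) \<in> borel_measurable (lebesgue_on S)"
  by (intro phase_case_measurable i)
 moreover have "(if square_wave (x $ 1 / \<epsilon>) = 1 then infdist (G x) (phase_set 1) else infdist (G x) (phase_set 0)) = infdist (G x) (phase_set (square_wave (x $ 1 / \<epsilon>)))" for x :: "real^2"
  by (simp add: phase_set_def)
 ultimately show ?thesis by simp
qed

lemma integrable_inner_bounded:
 fixes f \<psi> :: "'a => 'b::euclidean_space"
 assumes \<psi>: "integrable M \<psi>" and [measurable]: "f \<in> borel_measurable M" and f: "AE x in M. norm (f x) <= C"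
 shows "integrable M (%x. f x \<bullet> \<psi> x)"
proof (rule Bochner_Integration.integrable_bound[where f = "%x. C *\<^sub>R \<psi> x"])
 show "integrable M (%x. C *\<^sub>R \<psi> x)" using \<psi> by simp
 show "(%x. f x \<bullet> \<psi> x) \<in> borel_measurable M" using \<psi> by measurable
 show "AE x in M. norm (f x \<bullet> \<psi> x) <= norm (C *\<^sub>R \<psi> x)"
  using f
 proof eventually_elim
  case (elim x)
  have "norm (f x \<bullet> \<psi> x) <= norm (f x) * norm (\<psi> x)" using Cauchy_Schwarz_ineq2 by simp
  also have "\<dots> <= \<bar>C\<bar> * norm (\<psi> x)" using elim by (intro mult_right_mono) auto
  finally show ?case by simp
 qed
qed

lemma laminate_W1inf:
 assumes \<epsilon>: "\<epsilon> > 0" and \<Omega>: "open \<Omega>" "bounded \<Omega>"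
 shows "W1inf \<Omega> (laminate b a g \<epsilon>)"
proof -
 obtain R where R: "!!x. x \<in> \<Omega> ==> norm x <= R" using \<Omega>(2) unfolding bounded_iff by blast
 have "norm (laminate b a g \<epsilon> x) <= (\<bar>b\<bar> + \<bar>g\<bar>) * R + \<bar>a\<bar> * \<epsilon> / 2" if "x \<in> \<Omega>" for x
  using laminate_bounded(1)[OF \<epsilon>, of b a g x] mult_left_mono[OF R[OF that], of "\<bar>b\<bar> + \<bar>g\<bar>"] by linarith
 then have "Linf \<Omega> (laminate b a g \<epsilon>)"
  unfolding Linf_def using \<epsilon> by (auto intro!: exI AE_I2 borel_measurable_lebesgue_on laminate_meas)
 moreover have "Linf \<Omega> (laminate_grad b a g \<epsilon>)"
  unfolding Linf_def by (auto intro!: exI AE_I2 borel_measurable_lebesgue_on laminate_grad_meas laminate_grad_bounded)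
 ultimately show ?thesis
  unfolding W1inf_def using laminate_has_weak_gradient[OF \<epsilon> \<Omega>(1)] by blast
qed

lemma linear_meas: "(*v) A \<in> borel_measurable borel" for A :: "real^2^2"
proof -
 have "continuous_on UNIV ((*v) A)" by (rule linear_continuous_on) (rule matrix_vector_mul_bounded_linear)
 then show ?thesis by (rule borel_measurable_continuous_onI)
qed

lemma linear_bounded_on:
 fixes A :: "real^2^2"
 assumes "bounded \<Omega>" obtains R where "!!x. x \<in> \<Omega> ==> norm (A *v x) <= R"
proof -
 obtain r where r: "!!x. x \<in> \<Omega> ==> norm x <= r" using assms unfolding bounded_iff by blast
 obtain c where c: "!!x. norm (A *v x) <= norm x * c" "c > 0"
  using bounded_linear.pos_bounded[OF matrix_vector_mul_bounded_linear] by blast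
 show ?thesis
 proof (rule that[of "r * c"])
  fix x assume "x \<in> \<Omega>"
  then show "norm (A *v x) <= r * c" using c(1)[of x] r[of x] mult_right_mono[of "norm x" r c] c(2) by linarith
 qed
qed

text \<open>The laminate of period \<epsilon> is an exact solution: its gradient lies in the set of
  the local phase almost everywhere. It converges uniformly to the linear map, and its gradient
  weakly* since the square wave oscillates to 0.\<close>

lemma laminate_in_hom_set:
 fixes b a g :: real
 assumes \<Omega>: "open \<Omega>" "bounded \<Omega>" and T: "(b, a, g) \<in> {(0, 0, 0), (1, -3/2, 1), (1/2, -5/2, 2)}"
 shows "diag2 b g \<in> hom_set \<Omega> 2 (%k. if k = 1 then triple_set (-1/2) 1 (-2) 2 else triple_set (5/2) 1 3 2)
   (%k. if k = 1 then left_half else right_half)"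
 unfolding hom_set_def phase_sum_infdist
proof (intro CollectI allI impI, elim conjE)
 fix \<epsilon> :: "nat => real" assume \<epsilon>: "\<forall>h. \<epsilon> h > 0" "\<epsilon> \<longlonglongrightarrow> 0"
 define u where "u h = laminate b a g (\<epsilon> h)" for h
 define L where "L = lebesgue_on \<Omega>"
 have WG: "has_weak_gradient \<Omega> (u h) (laminate_grad b a g (\<epsilon> h))" for h
  unfolding u_def using \<epsilon> \<Omega> by (intro laminate_has_weak_gradient) auto
 have ae: "AE x in L. weak_grad \<Omega> (u h) x = laminate_grad b a g (\<epsilon> h) x" for h
  unfolding L_def by (rule weak_grad_AE_eq[OF WG \<Omega>(1)])
 have ae0: "AE x in L. weak_grad \<Omega> ((*v) (diag2 b g)) x = diag2 b g"
  unfolding L_def by (rule weak_grad_AE_eq[OF linear_has_weak_gradient[OF \<Omega>(1)] \<Omega>(1)])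
 have Gm: "weak_grad \<Omega> (u h) \<in> borel_measurable L" "weak_grad \<Omega> ((*v) (diag2 b g)) \<in> borel_measurable L" for h
  unfolding L_def by (rule weak_grad_measurable[OF WG \<Omega>(1)], rule weak_grad_measurable[OF linear_has_weak_gradient[OF \<Omega>(1)] \<Omega>(1)])
 have um: "u h \<in> borel_measurable L" for h
  unfolding L_def u_def using \<epsilon> by (intro borel_measurable_lebesgue_on laminate_meas) auto
 obtain R where R: "!!x. x \<in> \<Omega> ==> norm (diag2 b g *v x) <= R" using linear_bounded_on[OF \<Omega>(2)] by blast
 have spL: "space L = \<Omega>" by (simp add: L_def)
 have near: "norm (u h x - diag2 b g *v x) <= \<bar>a\<bar> * \<epsilon> h / 2" for h x
  unfolding u_def using \<epsilon> by (intro laminate_bounded(2)) auto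
 have linm: "(*v) (diag2 b g) \<in> borel_measurable L" unfolding L_def by (intro borel_measurable_lebesgue_on linear_meas)
 have "weak_star_Linf \<Omega> u ((*v) (diag2 b g))"
  unfolding weak_star_Linf_def L_def[symmetric]
 proof (intro allI impI)
  fix \<psi> :: "real^2 => real^2" assume \<psi>: "integrable L \<psi>"
  have il: "integrable L (%x. (diag2 b g *v x) \<bullet> \<psi> x)"
   using R spL by (intro integrable_inner_bounded[OF \<psi> linm]) (auto intro!: AE_I2)
  have idf: "integrable L (%x. (u h x - diag2 b g *v x) \<bullet> \<psi> x)" for h
   by (intro integrable_inner_bounded[OF \<psi> _ AE_I2[OF near]] borel_measurable_diff um linm)
  have "norm ((\<integral>x. u h x \<bullet> \<psi> x \<partial>L) - (\<integral>x. (diag2 b g *v x) \<bullet> \<psi> x \<partial>L)) <= \<epsilon> h * (\<bar>a\<bar> / 2 * (\<integral>x. norm (\<psi> x) \<partial>L))" for h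
  proof -
   have "(\<integral>x. u h x \<bullet> \<psi> x \<partial>L) = (\<integral>x. (u h x - diag2 b g *v x) \<bullet> \<psi> x + (diag2 b g *v x) \<bullet> \<psi> x \<partial>L)"
    by (simp add: inner_diff_left)
   also have "\<dots> = (\<integral>x. (u h x - diag2 b g *v x) \<bullet> \<psi> x \<partial>L) + (\<integral>x. (diag2 b g *v x) \<bullet> \<psi> x \<partial>L)"
    by (rule Bochner_Integration.integral_add[OF idf il])
   finally have "norm ((\<integral>x. u h x \<bullet> \<psi> x \<partial>L) - (\<integral>x. (diag2 b g *v x) \<bullet> \<psi> x \<partial>L)) = norm (\<integral>x. (u h x - diag2 b g *v x) \<bullet> \<psi> x \<partial>L)"
    by simp
   also have "\<dots> <= (\<integral>x. norm ((u h x - diag2 b g *v x) \<bullet> \<psi> x) \<partial>L)" by (rule integral_norm_bound)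
   also have "\<dots> <= (\<integral>x. (\<bar>a\<bar> * \<epsilon> h / 2) * norm (\<psi> x) \<partial>L)"
   proof (rule integral_mono)
    show "norm ((u h x - diag2 b g *v x) \<bullet> \<psi> x) <= (\<bar>a\<bar> * \<epsilon> h / 2) * norm (\<psi> x)" for x
    proof -
     have "norm ((u h x - diag2 b g *v x) \<bullet> \<psi> x) <= norm (u h x - diag2 b g *v x) * norm (\<psi> x)"
      using Cauchy_Schwarz_ineq2 by simp
     also have "\<dots> <= (\<bar>a\<bar> * \<epsilon> h / 2) * norm (\<psi> x)" using near by (intro mult_right_mono) auto
     finally show ?thesis .
    qed
   qed (use idf[of h] \<psi> in auto)
   also have "\<dots> = \<epsilon> h * (\<bar>a\<bar> / 2 * (\<integral>x. norm (\<psi> x) \<partial>L))" by simp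
   finally show ?thesis .
  qed
  moreover have "(%h. \<epsilon> h * (\<bar>a\<bar> / 2 * (\<integral>x. norm (\<psi> x) \<partial>L))) \<longlonglongrightarrow> 0 * (\<bar>a\<bar> / 2 * (\<integral>x. norm (\<psi> x) \<partial>L))"
   by (intro tendsto_mult \<epsilon>(2) tendsto_const)
  ultimately have "(%h. (\<integral>x. u h x \<bullet> \<psi> x \<partial>L) - (\<integral>x. (diag2 b g *v x) \<bullet> \<psi> x \<partial>L)) \<longlonglongrightarrow> 0"
   using Lim_null_comparison[OF eventuallyI, of "%h. (\<integral>x. u h x \<bullet> \<psi> x \<partial>L) - (\<integral>x. (diag2 b g *v x) \<bullet> \<psi> x \<partial>L)" "%h. \<epsilon> h * (\<bar>a\<bar> / 2 * (\<integral>x. norm (\<psi> x) \<partial>L))" sequentially]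
   by simp
  then show "(%h. \<integral>x. u h x \<bullet> \<psi> x \<partial>L) \<longlonglongrightarrow> (\<integral>x. (diag2 b g *v x) \<bullet> \<psi> x \<partial>L)" by (simp add: LIM_zero_iff)
 qed
 moreover have "weak_star_Linf \<Omega> (%h. weak_grad \<Omega> (u h)) (weak_grad \<Omega> ((*v) (diag2 b g)))"
  unfolding weak_star_Linf_def L_def[symmetric]
 proof (intro allI impI)
  fix \<psi> :: "real^2 => real^2^2" assume \<psi>: "integrable L \<psi>"
  have \<psi>m: "\<psi> \<in> borel_measurable L" using \<psi> by auto
  have \<psi>11: "integrable L (%x. \<psi> x $ 1 $ 1)" by (intro integrable_vec_nth \<psi>)
  have \<Omega>b: "\<Omega> \<in> sets borel" using \<Omega> by auto
  have \<psi>11m: "(%x. \<psi> x $ 1 $ 1) \<in> borel_measurable (lebesgue_on \<Omega>)" using \<psi>11 unfolding L_def by auto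
  obtain f where f: "f \<in> borel_measurable borel" "AE x in lborel. x \<in> \<Omega> --> \<psi> x $ 1 $ 1 = f x" "!!x. x \<notin> \<Omega> ==> f x = 0"
   using borel_representative[OF \<Omega>b \<psi>11m] by blast
  have fe: "(%x. indicator \<Omega> x * f x) = f" using f(3) by (auto simp: indicator_def fun_eq_iff)
  have fi: "integrable lborel f"
   using integrable_lebesgue_on_iff(1)[OF \<Omega>b f(1) \<psi>11m f(2)] \<psi>11 unfolding fe L_def by simp
  have sq: "(\<integral>x. square_wave (x $ 1 / \<epsilon> h) * \<psi> x $ 1 $ 1 \<partial>L) = (\<integral>x. square_wave (x $ 1 / \<epsilon> h) * f x \<partial>lborel)" for h
  proof -
   have "integral\<^sup>L (lebesgue_on \<Omega>) (%x. square_wave (x $ 1 / \<epsilon> h) * \<psi> x $ 1 $ 1) = (\<integral>x. indicator \<Omega> x * (square_wave (x $ 1 / \<epsilon> h) * f x) \<partial>lborel)"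
   proof (rule integrable_lebesgue_on_iff(2)[OF \<Omega>b])
    show "(%x. square_wave (x $ 1 / \<epsilon> h) * f x) \<in> borel_measurable borel" using f(1) by measurable
    show "(%x. square_wave (x $ 1 / \<epsilon> h) * \<psi> x $ 1 $ 1) \<in> borel_measurable (lebesgue_on \<Omega>)"
     by (intro borel_measurable_times square_wave_coordinate_measurable \<psi>11m)
    show "AE x in lborel. x \<in> \<Omega> --> square_wave (x $ 1 / \<epsilon> h) * \<psi> x $ 1 $ 1 = square_wave (x $ 1 / \<epsilon> h) * f x"
     using f(2) by eventually_elim auto
   qed
   also have "\<dots> = (\<integral>x. square_wave (x $ 1 / \<epsilon> h) * f x \<partial>lborel)"
    by (intro Bochner_Integration.integral_cong) (use f(3) in \<open>auto simp: indicator_def\<close>)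
   finally show ?thesis by (simp add: L_def)
  qed
  have ib: "integrable L (%x. diag2 b g \<bullet> \<psi> x)" using \<psi> by simp
  have isq: "integrable L (%x. square_wave (x $ 1 / \<epsilon> h) * \<psi> x $ 1 $ 1)" for h
  proof (rule integrable_mult_bounded[OF \<psi>11])
   show "(%x. square_wave (x $ 1 / \<epsilon> h)) \<in> borel_measurable L"
    unfolding L_def by (rule square_wave_coordinate_measurable)
   show "\<bar>square_wave (x $ 1 / \<epsilon> h)\<bar> <= 1" for x :: "real^2" using square_wave_cases[of "x $ 1 / \<epsilon> h"] by auto
  qed
  have eq: "(\<integral>x. weak_grad \<Omega> (u h) x \<bullet> \<psi> x \<partial>L) = (\<integral>x. diag2 b g \<bullet> \<psi> x \<partial>L) + a * (\<integral>x. square_wave (x $ 1 / \<epsilon> h) * f x \<partial>lborel)" for h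
  proof -
   \<comment> \<open>Only the entry (1,1) oscillates, so the pairing with the gradient reduces to
     one scalar pairing with the square wave.\<close>
   have pw: "laminate_grad b a g (\<epsilon> h) x \<bullet> \<psi> x = diag2 b g \<bullet> \<psi> x + a * (square_wave (x $ 1 / \<epsilon> h) * \<psi> x $ 1 $ 1)" for x
    by (simp add: laminate_grad_def inner_vec_def sum_2 diag2_nth algebra_simps)
   have "(\<integral>x. weak_grad \<Omega> (u h) x \<bullet> \<psi> x \<partial>L) = (\<integral>x. laminate_grad b a g (\<epsilon> h) x \<bullet> \<psi> x \<partial>L)"
   proof (rule integral_cong_AE)
    show "(%x. weak_grad \<Omega> (u h) x \<bullet> \<psi> x) \<in> borel_measurable L" by (intro borel_measurable_inner Gm \<psi>m)
    show "(%x. laminate_grad b a g (\<epsilon> h) x \<bullet> \<psi> x) \<in> borel_measurable L"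
     unfolding L_def by (intro borel_measurable_inner borel_measurable_lebesgue_on laminate_grad_meas \<psi>m[unfolded L_def])
    show "AE x in L. weak_grad \<Omega> (u h) x \<bullet> \<psi> x = laminate_grad b a g (\<epsilon> h) x \<bullet> \<psi> x"
     using ae[of h] by eventually_elim simp
   qed
   also have "\<dots> = (\<integral>x. diag2 b g \<bullet> \<psi> x \<partial>L) + a * (\<integral>x. square_wave (x $ 1 / \<epsilon> h) * \<psi> x $ 1 $ 1 \<partial>L)"
    unfolding pw using ib isq by simp
   finally show ?thesis by (simp only: sq)
  qed
  have eq0: "(\<integral>x. weak_grad \<Omega> ((*v) (diag2 b g)) x \<bullet> \<psi> x \<partial>L) = (\<integral>x. diag2 b g \<bullet> \<psi> x \<partial>L)"
  proof (rule integral_cong_AE)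
   show "(%x. weak_grad \<Omega> ((*v) (diag2 b g)) x \<bullet> \<psi> x) \<in> borel_measurable L" by (intro borel_measurable_inner Gm \<psi>m)
   show "(%x. diag2 b g \<bullet> \<psi> x) \<in> borel_measurable L" using \<psi>m by measurable
   show "AE x in L. weak_grad \<Omega> ((*v) (diag2 b g)) x \<bullet> \<psi> x = diag2 b g \<bullet> \<psi> x"
    using ae0 by eventually_elim simp
  qed
  have "(%h. (\<integral>x. diag2 b g \<bullet> \<psi> x \<partial>L) + a * (\<integral>x. square_wave (x $ 1 / \<epsilon> h) * f x \<partial>lborel)) \<longlonglongrightarrow> (\<integral>x. diag2 b g \<bullet> \<psi> x \<partial>L) + a * 0"
   by (intro tendsto_add tendsto_mult tendsto_const square_wave_weakly_null[OF fi]) (use \<epsilon> in auto)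
  then show "(%h. \<integral>x. weak_grad \<Omega> (u h) x \<bullet> \<psi> x \<partial>L) \<longlonglongrightarrow> (\<integral>x. weak_grad \<Omega> ((*v) (diag2 b g)) x \<bullet> \<psi> x \<partial>L)"
   unfolding eq eq0 by simp
 qed
 moreover have "converges_in_measure L (%h x. infdist (weak_grad \<Omega> (u h) x) (phase_set (square_wave (x $ 1 / \<epsilon> h)))) (%x. 0)"
  unfolding converges_in_measure_def
 proof (intro conjI allI impI)
  show m: "(%x. infdist (weak_grad \<Omega> (u h) x) (phase_set (square_wave (x $ 1 / \<epsilon> h)))) \<in> borel_measurable L" for h
   using infdist_phase_measurable Gm(1) unfolding L_def by blast
  fix \<delta> :: real assume \<delta>: "\<delta> > 0"
  have "emeasure L {x \<in> space L. \<bar>infdist (weak_grad \<Omega> (u h) x) (phase_set (square_wave (x $ 1 / \<epsilon> h))) - 0\<bar> > \<delta>} = 0" for h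
  proof (rule emeasure_eq_0_AE)
   show "AE x in L. \<not> \<bar>infdist (weak_grad \<Omega> (u h) x) (phase_set (square_wave (x $ 1 / \<epsilon> h))) - 0\<bar> > \<delta>"
    using ae[of h]
   proof eventually_elim
    case (elim x)
    have "infdist (weak_grad \<Omega> (u h) x) (phase_set (square_wave (x $ 1 / \<epsilon> h))) = 0"
     unfolding elim by (rule infdist_zero) (rule laminate_grad_in_phase_set[OF T])
    then show ?case using \<delta> by simp
   qed
  qed
  then show "(%h. emeasure L {x \<in> space L. \<bar>infdist (weak_grad \<Omega> (u h) x) (phase_set (square_wave (x $ 1 / \<epsilon> h))) - 0\<bar> > \<delta>}) \<longlonglongrightarrow> 0"
   by simp
 qed simp
 moreover have "W1inf \<Omega> (u h)" for h unfolding u_def using \<epsilon> \<Omega> by (intro laminate_W1inf) auto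
 ultimately show "\<exists>u. (\<forall>h. W1inf \<Omega> (u h)) \<and> weak_star_W1inf \<Omega> u ((*v) (diag2 b g)) \<and>
  converges_in_measure (lebesgue_on \<Omega>) (%h x. infdist (weak_grad \<Omega> (u h) x) (phase_set (square_wave (x $ 1 / \<epsilon> h)))) (%x. 0)"
  unfolding weak_star_W1inf_def L_def by blast
qed

section \<open>Exclusion of the matrix \<open>C\<close> from the homogenized set\<close>

section \<open>The homogenized set\<close>

lemma AE_lebesgue_on_iff:
 "S \<in> sets lebesgue ==> (AE x in lebesgue_on S. P x) \<longleftrightarrow> (AE x in lborel. x \<in> S --> P x)"
 by (simp add: AE_restrict_space_iff AE_completion_iff)

lemma AE_lebesgue_on_subset:
 assumes "S \<in> sets lebesgue" "T \<in> sets lebesgue" "T \<subseteq> S" "AE x in lebesgue_on S. P x"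
 shows "AE x in lebesgue_on T. P x"
proof -
 have "AE x in lborel. x \<in> S --> P x" using assms(4) unfolding AE_lebesgue_on_iff[OF assms(1)] .
 then have "AE x in lborel. x \<in> T --> P x" by eventually_elim (use assms(3) in auto)
 then show ?thesis unfolding AE_lebesgue_on_iff[OF assms(2)] .
qed

lemma bounded_borel_representative:
 fixes F :: "real^2 => real"
 assumes K: "K \<in> sets borel" and F: "F \<in> borel_measurable (lebesgue_on K)" and M: "M >= 0"
  and bd: "AE x in lebesgue_on K. \<bar>F x\<bar> <= M"
 obtains F' where "F' \<in> borel_measurable borel" "AE x in lborel. x \<in> K --> F x = F' x" "!!x. x \<notin> K ==> F' x = 0"
  "!!x. \<bar>F' x\<bar> <= M"
proof -
 obtain F0 where F0: "F0 \<in> borel_measurable borel" "AE x in lborel. x \<in> K --> F x = F0 x" "!!x. x \<notin> K ==> F0 x = 0"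
  using borel_representative[OF K F] by blast
 have KL: "K \<in> sets lebesgue" using K by simp
 show ?thesis
 proof (rule that[of "%x. max (- M) (min M (F0 x))"])
  show "(%x. max (- M) (min M (F0 x))) \<in> borel_measurable borel" using F0(1) by measurable
  show "AE x in lborel. x \<in> K --> F x = max (- M) (min M (F0 x))"
   using F0(2) bd[unfolded AE_lebesgue_on_iff[OF KL]] by eventually_elim (auto simp: min_def max_def)
  show "max (- M) (min M (F0 x)) = 0" if "x \<notin> K" for x using F0(3)[OF that] M by simp
  show "\<bar>max (- M) (min M (F0 x))\<bar> <= M" for x using M by (auto simp: min_def max_def)
 qed
qed

lemma integrable_bounded_support:
 fixes f :: "real^2 => real"
 assumes m: "f \<in> borel_measurable borel" and bd: "!!x. \<bar>f x\<bar> <= B" and supp: "!!x. x \<notin> cbox a b ==> f x = 0"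
 shows "integrable lborel f" and "integrable lborel (%x. (f x)\<^sup>2)"
  and "(\<integral>x. (f x)\<^sup>2 \<partial>lborel) <= B\<^sup>2 * measure lborel (cbox a b)"
proof -
 have i: "integrable lborel (%x. k * indicator (cbox a b) x)" for k :: real
  by (intro integrable_mult_right integrable_real_indicator) (auto simp: emeasure_lborel_cbox_eq)
 have B: "0 <= B" using bd[of 0] by linarith
 have "\<bar>f x\<bar> <= B * indicator (cbox a b) x" for x using bd[of x] supp[of x] by (cases "x \<in> cbox a b") auto
 then show "integrable lborel f"
  using m B by (intro Bochner_Integration.integrable_bound[OF i[of B]]) (auto intro!: AE_I2)
 have sq: "(f x)\<^sup>2 <= B\<^sup>2 * indicator (cbox a b) x" for x
  using power_mono[OF bd[of x], of 2] supp[of x] by (cases "x \<in> cbox a b") auto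
 show s: "integrable lborel (%x. (f x)\<^sup>2)"
  using m sq by (intro Bochner_Integration.integrable_bound[OF i[of "B\<^sup>2"]]) (auto intro!: AE_I2)
 have "(\<integral>x. (f x)\<^sup>2 \<partial>lborel) <= (\<integral>x. B\<^sup>2 * indicator (cbox a b) x \<partial>lborel)"
  by (intro integral_mono s i sq)
 then show "(\<integral>x. (f x)\<^sup>2 \<partial>lborel) <= B\<^sup>2 * measure lborel (cbox a b)" by simp
qed

text \<open>A Rellich-type step: subtracting the limit leaves a bounded sequence with bounded
  gradients whose integrals over boxes tend to 0, and \<open>weak_imp_strong_L2\<close> makes it
  strongly null on the smaller square.\<close>

lemma weak_star_imp_strong_component:
 fixes u :: "nat => real^2 => real^2" and G :: "nat => real^2 => real^2^2" and p :: "real^2"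
 assumes \<Omega>: "open \<Omega>" and \<rho>: "\<rho> > 0" and M: "M >= 0"
 defines "K \<equiv> cbox (p - vec (6 * \<rho>)) (p + vec (6 * \<rho>))" and "K4 \<equiv> cbox (p - vec (4 * \<rho>)) (p + vec (4 * \<rho>))"
 assumes K: "K \<subseteq> \<Omega>" and WG: "!!h. has_weak_gradient \<Omega> (u h) (G h)"
  and ub: "!!h. AE x in lebesgue_on \<Omega>. \<bar>u h x $ i\<bar> <= M" and Gb: "!!h j. AE x in lebesgue_on \<Omega>. \<bar>G h x $ i $ j\<bar> <= M"
  and weak: "weak_star_Linf \<Omega> u ((*v) A)" and A: "!!x. (A *v x) $ i = c * x $ i"
 shows "!!h. integrable (lebesgue_on K4) (%x. (u h x $ i - c * x $ i)\<^sup>2)"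
  and "(%h. \<integral>x. (u h x $ i - c * x $ i)\<^sup>2 \<partial>lebesgue_on K4) \<longlonglongrightarrow> 0"
proof -
 have Kb [measurable]: "K \<in> sets borel" and K4b: "K4 \<in> sets borel" by (simp_all add: K_def K4_def)
 have KL: "K \<in> sets lebesgue" "\<Omega> \<in> sets lebesgue" and \<Omega>b: "\<Omega> \<in> sets borel"
  using Kb borel_open[OF \<Omega>] by simp_all
 have K4K: "x \<in> K" if "x \<in> K4" for x using that \<rho> by (auto simp: K_def K4_def mem_cbox_2)
 have uK: "integrable (lebesgue_on K) (u h)" "integrable (lebesgue_on K) (G h)" for h
  using WG[of h] K by (auto simp: has_weak_gradient_def locally_integrable_def K_def)
 then have m: "(%x. u h x $ i) \<in> borel_measurable (lebesgue_on K)" "(%x. G h x $ i $ j) \<in> borel_measurable (lebesgue_on K)" for h j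
  by (auto intro!: borel_measurable_vec_nth_comp)
 note sub = AE_lebesgue_on_subset[OF KL(2,1) K]
 have "\<forall>h. \<exists>F'. F' \<in> borel_measurable borel \<and> (AE x in lborel. x \<in> K --> u h x $ i = F' x) \<and> (\<forall>x. x \<notin> K --> F' x = 0) \<and> (\<forall>x. \<bar>F' x\<bar> <= M)"
 proof
  fix h
  show "\<exists>F'. F' \<in> borel_measurable borel \<and> (AE x in lborel. x \<in> K --> u h x $ i = F' x) \<and> (\<forall>x. x \<notin> K --> F' x = 0) \<and> (\<forall>x. \<bar>F' x\<bar> <= M)"
   by (rule bounded_borel_representative[OF Kb m(1)[of h] M sub[OF ub[of h]]]) blast
 qed
 then obtain u' where u': "!!h. u' h \<in> borel_measurable borel" "!!h. AE x in lborel. x \<in> K --> u h x $ i = u' h x"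
   "!!h x. x \<notin> K ==> u' h x = 0" "!!h x. \<bar>u' h x\<bar> <= M"
  unfolding choice_iff by blast
 have "\<forall>h j. \<exists>F'. F' \<in> borel_measurable borel \<and> (AE x in lborel. x \<in> K --> G h x $ i $ j = F' x) \<and> (\<forall>x. x \<notin> K --> F' x = 0) \<and> (\<forall>x. \<bar>F' x\<bar> <= M)"
 proof (intro allI)
  fix h j
  show "\<exists>F'. F' \<in> borel_measurable borel \<and> (AE x in lborel. x \<in> K --> G h x $ i $ j = F' x) \<and> (\<forall>x. x \<notin> K --> F' x = 0) \<and> (\<forall>x. \<bar>F' x\<bar> <= M)"
   by (rule bounded_borel_representative[OF Kb m(2)[of h j] M sub[OF Gb[of h j]]]) blast
 qed
 then obtain g' where g': "!!h j. g' h j \<in> borel_measurable borel" "!!h j. AE x in lborel. x \<in> K --> G h x $ i $ j = g' h j x"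
   "!!h j x. x \<notin> K ==> g' h j x = 0" "!!h j x. \<bar>g' h j x\<bar> <= M"
  unfolding choice_iff by blast
 have [measurable]: "u' h \<in> borel_measurable borel" "g' h j \<in> borel_measurable borel" for h j using u'(1) g'(1) by auto
 \<comment> \<open>Amplitude 0 turns the sawtooth into the linear function of slope
   \<open>c\<close>, so \<open>weak_deriv_on_minus_saw\<close> provides the weak derivatives of
   \<open>w\<close>.\<close>
 define w where "w h x = u' h x - indicator K x * saw c 0 1 (x $ i)" for h x
 define gw where "gw h j x = g' h j x - indicator K x * (if i = j then c + 0 * square_wave (x $ i / 1) else 0)" for h j x
 obtain R where R: "!!x. x \<in> K ==> norm x <= R"
 proof -
  have "bounded K" by (simp add: K_def)
  then show ?thesis using that unfolding bounded_iff by blast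
 qed
 have "p \<in> K" using \<rho> by (simp add: K_def mem_cbox_2)
 then have R0: "0 <= R" using R[of p] norm_ge_zero[of p] by linarith
 have wm [measurable]: "w h \<in> borel_measurable borel" "gw h j \<in> borel_measurable borel" for h j
  unfolding w_def[abs_def] gw_def[abs_def] saw_linear by measurable
 have wb: "\<bar>w h x\<bar> <= M + \<bar>c\<bar> * R" for h x
 proof -
  have "\<bar>indicator K x * saw c 0 1 (x $ i)\<bar> <= \<bar>c\<bar> * R"
  proof (cases "x \<in> K")
   case True
   have "\<bar>x $ i\<bar> <= R" using component_le_norm_cart[of x i] R[OF True] by linarith
   then show ?thesis using True by (simp add: saw_linear abs_mult mult_left_mono)
  qed (use R0 in simp)
  then show ?thesis using u'(4)[of h x] unfolding w_def by linarith
 qed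
 have gb: "\<bar>gw h j x\<bar> <= M + \<bar>c\<bar>" for h j x
 proof -
  have "\<bar>indicator K x * (if i = j then c + 0 * square_wave (x $ i / 1) else 0)\<bar> <= \<bar>c\<bar>"
   by (cases "x \<in> K") auto
  then show ?thesis using g'(4)[of h j x] unfolding gw_def by linarith
 qed
 have supp: "w h x = 0" "gw h j x = 0" if "x \<notin> cbox (p - vec (6 * \<rho>)) (p + vec (6 * \<rho>))" for h j x
  using that u'(3)[of x h] g'(3)[of x h j] by (auto simp: w_def gw_def K_def)
 have supp': "u' h x = 0" "g' h j x = 0" if "x \<notin> cbox (p - vec (6 * \<rho>)) (p + vec (6 * \<rho>))" for h j x
  using that u'(3)[of x h] g'(3)[of x h j] by (auto simp: K_def)
 note wi = integrable_bounded_support[OF wm(1) wb supp(1)]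
 note gi = integrable_bounded_support[OF wm(2) gb supp(2)]
 note u'i = integrable_bounded_support(1)[OF u'(1,4) supp'(1)]
 note g'i = integrable_bounded_support(1)[OF g'(1,4) supp'(2)]
 have W: "weak_deriv_on (p - vec (6 * \<rho>)) (p + vec (6 * \<rho>)) (axis j 1) (w h) (gw h j)" for h j
  unfolding w_def[abs_def] gw_def[abs_def] K_def
  by (rule weak_deriv_on_minus_saw[OF weak_gradient_imp_weak_deriv_on[OF WG K[unfolded K_def] \<Omega> u'(1) g'(1) u'(2)[unfolded K_def] g'(2)[unfolded K_def]] u'i g'i]) simp_all
 have conv: "(%h. \<integral>z. indicator (cbox x y) z * w h z \<partial>lborel) \<longlonglongrightarrow> 0" for x y
 proof -
  \<comment> \<open>The indicator of a box times a unit vector extracts from weak* convergence the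
    mean of one component over that box.\<close>
  define \<psi> :: "real^2 => real^2" where "\<psi> z = indicator (cbox x y \<inter> K) z *\<^sub>R axis i 1" for z
  have "emeasure lborel (cbox x y \<inter> K) < \<infinity>"
   unfolding K_def by (rule le_less_trans[OF emeasure_mono[OF Int_lower1]]) (auto simp: emeasure_lborel_cbox_eq)
  then have "integrable lborel (%z. indicator (cbox x y \<inter> K) z :: real)"
   by (intro integrable_real_indicator) auto
  moreover have "(%z. indicator \<Omega> z * indicator (cbox x y \<inter> K) z) = (%z. indicator (cbox x y \<inter> K) z :: real)"
   using K by (auto simp: indicator_def fun_eq_iff)
  moreover have im: "(%z. indicator (cbox x y \<inter> K) z :: real) \<in> borel_measurable borel" by measurable
  ultimately have "integrable (lebesgue_on \<Omega>) (%z. indicator (cbox x y \<inter> K) z :: real)"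
   using integrable_lebesgue_on_iff(1)[OF \<Omega>b im borel_measurable_lebesgue_on[OF im]] by simp
  then have \<psi>: "integrable (lebesgue_on \<Omega>) \<psi>" unfolding \<psi>_def by (rule integrable_scaleR_left)
  have in\<psi>: "v \<bullet> \<psi> z = indicator (cbox x y \<inter> K) z * v $ i" for v z
   by (simp add: \<psi>_def inner_axis mult.commute)
  have rep: "integral\<^sup>L (lebesgue_on \<Omega>) (%z. F z \<bullet> \<psi> z) = (\<integral>z. indicator (cbox x y) z * f z \<partial>lborel)"
   if F: "AE z in lborel. z \<in> K --> F z $ i = f z" and f: "f \<in> borel_measurable borel" "!!z. z \<notin> K ==> f z = 0"
    and Fm: "F \<in> borel_measurable (lebesgue_on \<Omega>)" for F f
  proof -
   have "integral\<^sup>L (lebesgue_on \<Omega>) (%z. F z \<bullet> \<psi> z) = (\<integral>z. indicator \<Omega> z * (indicator (cbox x y) z * f z) \<partial>lborel)"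
   proof (rule integrable_lebesgue_on_iff(2)[OF \<Omega>b])
    show "(%z. indicator (cbox x y) z * f z) \<in> borel_measurable borel" using f(1) by measurable
    show "(%z. F z \<bullet> \<psi> z) \<in> borel_measurable (lebesgue_on \<Omega>)" using Fm \<psi> by (intro borel_measurable_inner) auto
    show "AE z in lborel. z \<in> \<Omega> --> F z \<bullet> \<psi> z = indicator (cbox x y) z * f z"
     using F
    proof eventually_elim
     case (elim z)
     then show ?case using f(2)[of z] unfolding in\<psi> by (cases "z \<in> K") (auto simp: indicator_def)
    qed
   qed
   also have "\<dots> = (\<integral>z. indicator (cbox x y) z * f z \<partial>lborel)"
    using f(2) K by (intro Bochner_Integration.integral_cong refl) (auto simp: indicator_def)
   finally show ?thesis .
  qed
  define s where "s z = indicator K z * saw c 0 1 (z $ i)" for z :: "real^2"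
  have sm [measurable]: "s \<in> borel_measurable borel" unfolding s_def[abs_def] saw_linear by measurable
  have sw: "s = (%z. u' 0 z - w 0 z)" by (simp add: w_def s_def[abs_def])
  have um: "u h \<in> borel_measurable (lebesgue_on \<Omega>)" for h
   using WG[of h] \<Omega> by (auto simp: has_weak_gradient_def intro: locally_integrable_imp_measurable)
  have 1: "integral\<^sup>L (lebesgue_on \<Omega>) (%z. u h z \<bullet> \<psi> z) = (\<integral>z. indicator (cbox x y) z * u' h z \<partial>lborel)" for h
   by (rule rep[OF u'(2,1,3) um])
  have 2: "integral\<^sup>L (lebesgue_on \<Omega>) (%z. (A *v z) \<bullet> \<psi> z) = (\<integral>z. indicator (cbox x y) z * s z \<partial>lborel)"
  proof (rule rep[OF _ sm])
   show "AE z in lborel. z \<in> K --> (A *v z) $ i = s z" by (auto simp: A s_def saw_linear)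
   show "s z = 0" if "z \<notin> K" for z using that by (simp add: s_def)
   show "(*v) A \<in> borel_measurable (lebesgue_on \<Omega>)" by (intro borel_measurable_lebesgue_on linear_meas)
  qed
  have mi: "integrable lborel (%z. indicator (cbox x y) z * f z)" if "integrable lborel f" for f :: "real^2 => real"
   using integrable_mult_indicator[OF _ that, of "cbox x y"] by simp
  have si: "integrable lborel s" unfolding sw by (intro Bochner_Integration.integrable_diff u'i wi)
  have eq: "(\<integral>z. indicator (cbox x y) z * w h z \<partial>lborel) = (\<integral>z. indicator (cbox x y) z * u' h z \<partial>lborel) - (\<integral>z. indicator (cbox x y) z * s z \<partial>lborel)" for h
  proof -
   have "(\<integral>z. indicator (cbox x y) z * w h z \<partial>lborel) = (\<integral>z. indicator (cbox x y) z * u' h z - indicator (cbox x y) z * s z \<partial>lborel)"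
    by (simp add: w_def s_def right_diff_distrib)
   also have "\<dots> = (\<integral>z. indicator (cbox x y) z * u' h z \<partial>lborel) - (\<integral>z. indicator (cbox x y) z * s z \<partial>lborel)"
    by (rule Bochner_Integration.integral_diff[OF mi[OF u'i] mi[OF si]])
   finally show ?thesis .
  qed
  have "(%h. integral\<^sup>L (lebesgue_on \<Omega>) (%z. u h z \<bullet> \<psi> z)) \<longlonglongrightarrow> integral\<^sup>L (lebesgue_on \<Omega>) (%z. (A *v z) \<bullet> \<psi> z)"
   using weak \<psi> unfolding weak_star_Linf_def by blast
  then show ?thesis unfolding eq 1 2 by (rule LIM_zero)
 qed
 have lim: "(%h. \<integral>x. indicator K4 x * (w h x)\<^sup>2 \<partial>lborel) \<longlonglongrightarrow> 0"
  unfolding K4_def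
  by (rule weak_imp_strong_L2[where w = w and ?g1.0 = "%h. gw h 1" and ?g2.0 = "%h. gw h 2", OF \<rho> wi(1) wb gi gi W W conv])
 have wm2: "(%x. (w h x)\<^sup>2) \<in> borel_measurable borel" for h by measurable
 have um2: "(%x. (u h x $ i - c * x $ i)\<^sup>2) \<in> borel_measurable (lebesgue_on K4)" for h
 proof (intro borel_measurable_power borel_measurable_diff)
  show "(%x. u h x $ i) \<in> borel_measurable (lebesgue_on K4)"
   by (rule measurable_restrict_mono[OF m(1)]) (use K4K in blast)
  show "(%x. c * x $ i) \<in> borel_measurable (lebesgue_on K4)"
   by (rule borel_measurable_lebesgue_on) measurable
 qed
 have aew: "AE x in lborel. x \<in> K4 --> (u h x $ i - c * x $ i)\<^sup>2 = (w h x)\<^sup>2" for h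
  using u'(2)[of h] by eventually_elim (auto simp: w_def saw_linear K4K)
 have "integrable lborel (%x. indicator K4 x * (w h x)\<^sup>2)" for h
 proof -
  have "integrable lborel (%x. (w h x)\<^sup>2)" by (rule wi(2))
  then show ?thesis using integrable_mult_indicator[of K4 lborel "%x. (w h x)\<^sup>2"] K4b by simp
 qed
 then show "integrable (lebesgue_on K4) (%x. (u h x $ i - c * x $ i)\<^sup>2)" for h
  unfolding integrable_lebesgue_on_iff(1)[OF K4b wm2 um2 aew] .
 show "(%h. \<integral>x. (u h x $ i - c * x $ i)\<^sup>2 \<partial>lebesgue_on K4) \<longlonglongrightarrow> 0"
  using lim unfolding integrable_lebesgue_on_iff(2)[OF K4b wm2 um2 aew] .
qed

text \<open>The integral is split at a small level: below it the square is uniformly small, above it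
  the bound \<open>B\<close> meets a set of vanishing measure.\<close>

lemma bounded_converges_in_measure_imp_L2:
 fixes f :: "nat => 'a => real"
 assumes M: "finite_measure M" and conv: "converges_in_measure M f (%x. 0)" and bd: "!!h. AE x in M. \<bar>f h x\<bar> <= B"
 shows "!!h. integrable M (%x. (f h x)\<^sup>2)" and "(%h. \<integral>x. (f h x)\<^sup>2 \<partial>M) \<longlonglongrightarrow> 0"
proof -
 interpret finite_measure M by fact
 have [measurable]: "f h \<in> borel_measurable M" for h using conv by (simp add: converges_in_measure_def)
 have sq: "AE x in M. (f h x)\<^sup>2 <= B\<^sup>2" for h
  using bd[of h]
 proof eventually_elim
  case (elim x)
  then show ?case using power_mono[of "\<bar>f h x\<bar>" B 2] by simp
 qed
 show i: "integrable M (%x. (f h x)\<^sup>2)" for h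
  by (rule integrable_const_bound[of _ "B\<^sup>2"]) (use sq in auto)
 show "(%h. \<integral>x. (f h x)\<^sup>2 \<partial>M) \<longlonglongrightarrow> 0"
 proof (rule LIMSEQ_I)
  fix e :: real assume e: "e > 0"
  define m where "m = measure M (space M)"
  have m: "m >= 0" by (simp add: m_def)
  define \<delta> where "\<delta> = sqrt (e / (2 * (m + 1)))"
  have \<delta>: "\<delta> > 0" "\<delta>\<^sup>2 * m <= e / 2" using e m by (auto simp: \<delta>_def field_simps)
  define E where "E h = {x \<in> space M. \<bar>f h x - 0\<bar> > \<delta>}" for h
  have [measurable]: "E h \<in> sets M" for h unfolding E_def by measurable
  have "(%h. emeasure M (E h)) \<longlonglongrightarrow> ennreal 0"
   using conv \<delta>(1) by (simp add: converges_in_measure_def E_def)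
  then have "(%h. measure M (E h)) \<longlonglongrightarrow> 0" unfolding measure_def by (rule tendsto_enn2real) simp
  then have "(%h. B\<^sup>2 * measure M (E h)) \<longlonglongrightarrow> B\<^sup>2 * 0" by (intro tendsto_mult tendsto_const)
  then have "\<forall>\<^sub>F h in sequentially. B\<^sup>2 * measure M (E h) < e / 2"
   using e by (intro order_tendstoD) auto
  then obtain n where n: "!!h. h >= n ==> B\<^sup>2 * measure M (E h) < e / 2" by (auto simp: eventually_sequentially)
  have "norm ((\<integral>x. (f h x)\<^sup>2 \<partial>M) - 0) < e" if h: "h >= n" for h
  proof -
   have ii: "integrable M (%x. B\<^sup>2 * indicator (E h) x)"
    by (intro integrable_mult_right integrable_real_indicator) (auto simp: emeasure_eq_measure)
   have "(\<integral>x. (f h x)\<^sup>2 \<partial>M) <= (\<integral>x. \<delta>\<^sup>2 + B\<^sup>2 * indicator (E h) x \<partial>M)"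
   proof (rule integral_mono_AE[OF i])
    show "AE x in M. (f h x)\<^sup>2 <= \<delta>\<^sup>2 + B\<^sup>2 * indicator (E h) x"
     using sq[of h] AE_space
    proof eventually_elim
     case (elim x)
     show ?case
     proof (cases "x \<in> E h")
      case False
      then have "\<bar>f h x\<bar> <= \<delta>" using elim by (auto simp: E_def)
      then have "(f h x)\<^sup>2 <= \<delta>\<^sup>2" using power_mono[of "\<bar>f h x\<bar>" \<delta> 2] by simp
      then show ?thesis using False by simp
     qed (use elim in \<open>simp add: add_increasing\<close>)
    qed
   qed (use ii in simp)
   also have "\<dots> = \<delta>\<^sup>2 * m + B\<^sup>2 * measure M (E h)" using ii by (simp add: m_def mult.commute)
   also have "\<dots> < e" using \<delta>(2) n[OF h] by linarith
   finally show ?thesis by simp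
  qed
  then show "\<exists>no. \<forall>h\<ge>no. norm ((\<integral>x. (f h x)\<^sup>2 \<partial>M) - 0) < e" by blast
 qed
qed

lemma norm_matrix_le: "norm \<Lambda> <= \<bar>\<Lambda> $ 1 $ 1\<bar> + \<bar>\<Lambda> $ 1 $ 2\<bar> + \<bar>\<Lambda> $ 2 $ 1\<bar> + \<bar>\<Lambda> $ 2 $ 2\<bar>" for \<Lambda> :: "real^2^2"
proof -
 have "norm \<Lambda> <= norm (\<Lambda> $ 1) + norm (\<Lambda> $ 2)"
  unfolding norm_vec_def[of \<Lambda>] using L2_set_le_sum[of UNIV "%i. norm (\<Lambda> $ i)"] by (simp add: sum_2)
 then show ?thesis using norm_vec2_le[of "\<Lambda> $ 1"] norm_vec2_le[of "\<Lambda> $ 2"] by linarith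
qed

lemma open_contains_square:
 fixes \<Omega> :: "(real^2) set"
 assumes "open \<Omega>" "\<Omega> ~= {}"
 obtains p \<rho> where "\<rho> > 0" "cbox (p - vec (6 * \<rho>)) (p + vec (6 * \<rho>)) \<subseteq> \<Omega>"
proof -
 obtain p where "p \<in> \<Omega>" using assms(2) by blast
 then obtain r where r: "r > 0" "ball p r \<subseteq> \<Omega>" using assms(1) unfolding open_contains_ball by blast
 show ?thesis
 \<comment> \<open>The Euclidean norm is at most the sum of two coordinates, each at most 6/13 r,
   and 12/13 is below 1.\<close>
 proof (rule that[of "r / 13" p])
  show "cbox (p - vec (6 * (r / 13))) (p + vec (6 * (r / 13))) \<subseteq> \<Omega>"
  proof
   fix x assume "x \<in> cbox (p - vec (6 * (r / 13))) (p + vec (6 * (r / 13)))"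
   then have "\<bar>(x - p) $ 1\<bar> <= 6 * (r / 13)" "\<bar>(x - p) $ 2\<bar> <= 6 * (r / 13)"
    unfolding abs_le_iff by (auto simp: mem_cbox_2)
   then have "norm (x - p) < r" using norm_vec2_le[of "x - p"] r(1) by linarith
   then show "x \<in> \<Omega>" using r(2) by (auto simp: dist_norm norm_minus_commute)
  qed
 qed (use r in simp)
qed

text \<open>The definition of the homogenized set asks each function of a sequence to be bounded,
  with no common bound; the common bound comes from weak* convergence by the uniform boundedness
  principle, one scalar component at a time.\<close>

lemma weak_star_imp_uniformly_bounded:
 fixes f :: "nat => real^2 => 'b::euclidean_space"
 assumes \<Omega>: "open \<Omega>" "bounded \<Omega>" and f: "!!h. Linf \<Omega> (f h)" and weak: "weak_star_Linf \<Omega> f g"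
 obtains C where "!!h. AE x in lebesgue_on \<Omega>. \<bar>f h x \<bullet> e\<bar> <= C"
proof (rule weakly_bounded_imp_bounded[of "lebesgue_on \<Omega>" "%h x. f h x \<bullet> e"])
 show "finite_measure (lebesgue_on \<Omega>)" using \<Omega> by (intro finite_measure_lebesgue_on) auto
 show "(%x. f h x \<bullet> e) \<in> borel_measurable (lebesgue_on \<Omega>)" for h
  using f[of h] unfolding Linf_def by (intro borel_measurable_inner) auto
 show "\<exists>N. AE x in lebesgue_on \<Omega>. \<bar>f h x \<bullet> e\<bar> <= N" for h
 proof -
  obtain C where C: "AE x in lebesgue_on \<Omega>. norm (f h x) <= C" using f[of h] unfolding Linf_def by blast
  have "AE x in lebesgue_on \<Omega>. \<bar>f h x \<bullet> e\<bar> <= C * norm e"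
   using C
  proof eventually_elim
   case (elim x)
   have "\<bar>f h x \<bullet> e\<bar> <= norm (f h x) * norm e" by (rule Cauchy_Schwarz_ineq2)
   also have "\<dots> <= C * norm e" using elim by (intro mult_right_mono) auto
   finally show ?case .
  qed
  then show ?thesis by blast
 qed
 show "\<exists>B. \<forall>h. \<bar>\<integral>x. (f h x \<bullet> e) * \<psi> x \<partial>lebesgue_on \<Omega>\<bar> <= B" if \<psi>: "integrable (lebesgue_on \<Omega>) \<psi>" for \<psi>
 proof -
  have "integrable (lebesgue_on \<Omega>) (%x. \<psi> x *\<^sub>R e)" using \<psi> by (rule integrable_scaleR_left)
  then have "convergent (%h. \<integral>x. f h x \<bullet> (\<psi> x *\<^sub>R e) \<partial>lebesgue_on \<Omega>)"
   using weak unfolding weak_star_Linf_def convergent_def by blast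
  then have "Bseq (%h. \<integral>x. f h x \<bullet> (\<psi> x *\<^sub>R e) \<partial>lebesgue_on \<Omega>)" by (rule convergent_imp_Bseq)
  then show ?thesis by (auto simp: Bseq_def mult.commute)
 qed
qed (use that in blast)

lemma weak_grad_Linf:
 assumes "W1inf \<Omega> u" "open \<Omega>"
 shows "has_weak_gradient \<Omega> u (weak_grad \<Omega> u)" "Linf \<Omega> (weak_grad \<Omega> u)"
proof -
 obtain G where G: "has_weak_gradient \<Omega> u G" "Linf \<Omega> G" using assms(1) unfolding W1inf_def by blast
 show W: "has_weak_gradient \<Omega> u (weak_grad \<Omega> u)" by (rule has_weak_gradient_weak_grad[OF G(1)])
 obtain C where C: "AE x in lebesgue_on \<Omega>. norm (G x) <= C" using G(2) unfolding Linf_def by blast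
 have "AE x in lebesgue_on \<Omega>. norm (weak_grad \<Omega> u x) <= C"
  using C weak_grad_AE_eq[OF G(1) assms(2)] by eventually_elim simp
 then show "Linf \<Omega> (weak_grad \<Omega> u)"
  unfolding Linf_def using weak_grad_measurable[OF W assms(2)] by blast
qed

lemma infdist_phase_pairs:
 "\<exists>a b. (a, b) \<in> phase_pairs s \<and> norm (\<Lambda> - diag2 a b) <= infdist \<Lambda> (phase_set s)"
proof -
 obtain \<Lambda>' where "\<Lambda>' \<in> phase_set s" and d: "infdist \<Lambda> (phase_set s) = dist \<Lambda> \<Lambda>'"
  using infdist_attains_inf[OF phase_set_props(4,2)] by blast
 then obtain a b where "(a, b) \<in> phase_pairs s" "\<Lambda>' = diag2 a b" by (auto simp: phase_set_eq)
 then show ?thesis using d by (intro exI[of _ a] exI[of _ b]) (simp add: dist_norm)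
qed

lemma bounded_square_integrable:
 fixes f :: "'a => 'b::euclidean_space"
 assumes "finite_measure M" and [measurable]: "f \<in> borel_measurable M" and f: "AE x in M. norm (f x) <= C"
 shows "integrable M (%x. (norm (f x))\<^sup>2)"
proof (rule finite_measure.integrable_const_bound[OF assms(1), of _ "C\<^sup>2"])
 show "AE x in M. norm ((norm (f x))\<^sup>2) <= C\<^sup>2"
  using f by eventually_elim (simp add: power_mono)
qed measurable

text \<open>One scale sequence is enough, as membership speaks of all of them. Uniform bounds on
  values and gradients upgrade weak* convergence to L2 convergence of the functions, and convergence
  in measure to L2 convergence of the distances; \<open>no_recovery_sequence\<close> then
  applies.\<close>

lemma C_not_in_hom_set:
 assumes \<Omega>: "open \<Omega>" "bounded \<Omega>" "\<Omega> ~= {}"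
 shows "diag2 (2/3) (4/3) \<notin> hom_set \<Omega> 2 (%k. if k = 1 then triple_set (-1/2) 1 (-2) 2 else triple_set (5/2) 1 3 2)
   (%k. if k = 1 then left_half else right_half)"
proof
 assume mem: "diag2 (2/3) (4/3) \<in> hom_set \<Omega> 2 (%k. if k = 1 then triple_set (-1/2) 1 (-2) 2 else triple_set (5/2) 1 3 2)
   (%k. if k = 1 then left_half else right_half)"
 define \<epsilon> where "\<epsilon> h = inverse (real (Suc h))" for h
 have \<epsilon>: "\<epsilon> h > 0" "\<epsilon> \<longlonglongrightarrow> 0" for h using LIMSEQ_inverse_real_of_nat by (auto simp: \<epsilon>_def[abs_def])
 obtain u where u: "!!h. W1inf \<Omega> (u h)" "weak_star_W1inf \<Omega> u ((*v) (diag2 (2/3) (4/3)))"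
  "converges_in_measure (lebesgue_on \<Omega>) (%h x. infdist (weak_grad \<Omega> (u h) x) (phase_set (square_wave (x $ 1 / \<epsilon> h)))) (%x. 0)"
  using mem \<epsilon> unfolding hom_set_def phase_sum_infdist by blast
 define G where "G h = weak_grad \<Omega> (u h)" for h
 note WG = weak_grad_Linf[OF u(1) \<Omega>(1), folded G_def]
 have ws: "weak_star_Linf \<Omega> u ((*v) (diag2 (2/3) (4/3)))" "weak_star_Linf \<Omega> G (weak_grad \<Omega> ((*v) (diag2 (2/3) (4/3))))"
  using u(2) unfolding weak_star_W1inf_def G_def by auto
 have uL: "Linf \<Omega> (u h)" for h using u(1)[of h] by (simp add: W1inf_def)
 have "\<forall>i. \<exists>C. \<forall>h. AE x in lebesgue_on \<Omega>. \<bar>u h x $ i\<bar> <= C"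
 proof
  fix i
  obtain C where "!!h. AE x in lebesgue_on \<Omega>. \<bar>u h x \<bullet> axis i 1\<bar> <= C"
   using weak_star_imp_uniformly_bounded[OF \<Omega>(1,2) uL ws(1), of "axis i 1"] by blast
  then show "\<exists>C. \<forall>h. AE x in lebesgue_on \<Omega>. \<bar>u h x $ i\<bar> <= C" unfolding inner_axis inner_real_def by auto
 qed
 then obtain Cu where Cu: "!!i h. AE x in lebesgue_on \<Omega>. \<bar>u h x $ i\<bar> <= Cu i" unfolding choice_iff by blast
 have "\<forall>i j. \<exists>C. \<forall>h. AE x in lebesgue_on \<Omega>. \<bar>G h x $ i $ j\<bar> <= C"
 proof (intro allI)
  fix i j
  obtain C where "!!h. AE x in lebesgue_on \<Omega>. \<bar>G h x \<bullet> axis i (axis j 1)\<bar> <= C"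
   using weak_star_imp_uniformly_bounded[OF \<Omega>(1,2) WG(2) ws(2), of "axis i (axis j 1)"] by blast
  then show "\<exists>C. \<forall>h. AE x in lebesgue_on \<Omega>. \<bar>G h x $ i $ j\<bar> <= C" unfolding inner_axis inner_real_def by auto
 qed
 then obtain CG where CG: "!!i j h. AE x in lebesgue_on \<Omega>. \<bar>G h x $ i $ j\<bar> <= CG i j" unfolding choice_iff by blast
 \<comment> \<open>A common bound for both components and all four gradient entries.\<close>
 define M where "M = \<bar>Cu 1\<bar> + \<bar>Cu 2\<bar> + \<bar>CG 1 1\<bar> + \<bar>CG 1 2\<bar> + \<bar>CG 2 1\<bar> + \<bar>CG 2 2\<bar>"
 have Mb: "Cu i <= M" "CG i j <= M" for i j :: 2 using exhaust_2[of i] exhaust_2[of j] unfolding M_def by auto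
 have ub: "AE x in lebesgue_on \<Omega>. \<bar>u h x $ i\<bar> <= M" for h i
  by (rule eventually_mono[OF Cu]) (rule order_trans[OF _ Mb(1)])
 have Gb: "AE x in lebesgue_on \<Omega>. \<bar>G h x $ i $ j\<bar> <= M" for h i j
  by (rule eventually_mono[OF CG]) (rule order_trans[OF _ Mb(2)])
 have M: "M >= 0" by (simp add: M_def)
 obtain p \<rho> where \<rho>: "\<rho> > 0" "cbox (p - vec (6 * \<rho>)) (p + vec (6 * \<rho>)) \<subseteq> \<Omega>" by (rule open_contains_square[OF \<Omega>(1,3)])
 define K where "K = cbox (p - vec (4 * \<rho>)) (p + vec (4 * \<rho>))"
 have K\<Omega>: "K \<subseteq> \<Omega>" using \<rho> by (intro order_trans[OF _ \<rho>(2)]) (auto simp: K_def mem_cbox_2)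
 have KL: "K \<in> sets lebesgue" "\<Omega> \<in> sets lebesgue" "bounded K" using \<Omega> by (auto simp: K_def)
 note sub = AE_lebesgue_on_subset[OF KL(2,1) K\<Omega>]
 have fm: "finite_measure (lebesgue_on K)" by (rule finite_measure_lebesgue_on[OF KL(3,1)])
 have uK: "integrable (lebesgue_on K) (u h)" "integrable (lebesgue_on K) (G h)" for h
  using WG(1)[of h] K\<Omega> by (auto simp: has_weak_gradient_def locally_integrable_def K_def)
 then have m [measurable]: "u h \<in> borel_measurable (lebesgue_on K)" "G h \<in> borel_measurable (lebesgue_on K)" for h by auto
 have A: "(diag2 (2/3) (4/3) *v x) $ 1 = 2/3 * x $ 1" "(diag2 (2/3) (4/3) *v x) $ 2 = 4/3 * x $ 2" for x
  by (simp_all add: diag2_mult_vec)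
 note s1 = weak_star_imp_strong_component[OF \<Omega>(1) \<rho>(1) M \<rho>(2) WG(1) ub Gb ws(1) A(1), folded K_def]
 note s2 = weak_star_imp_strong_component[OF \<Omega>(1) \<rho>(1) M \<rho>(2) WG(1) ub Gb ws(1) A(2), folded K_def]
 have nu: "(norm (u h x - diag2 (2/3) (4/3) *v x))\<^sup>2 = (u h x $ 1 - 2/3 * x $ 1)\<^sup>2 + (u h x $ 2 - 4/3 * x $ 2)\<^sup>2" for h x
  unfolding power2_norm_eq_inner by (simp add: inner_vec_def sum_2 A power2_eq_square)
 have conv: "(%h. \<integral>x. (norm (u h x - diag2 (2/3) (4/3) *v x))\<^sup>2 \<partial>lebesgue_on K) \<longlonglongrightarrow> 0"
  unfolding nu Bochner_Integration.integral_add[OF s1(1) s2(1)] using tendsto_add[OF s1(2) s2(2)] by simp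
 \<comment> \<open>The distance is attained at a matrix of the finite phase set, which supplies the
   pair that \<open>no_recovery_sequence\<close> asks for.\<close>
 define D where "D h x = infdist (G h x) (phase_set (square_wave (x $ 1 / \<epsilon> h)))" for h x
 have Dm: "D h \<in> borel_measurable (lebesgue_on K)" for h
  unfolding D_def[abs_def] by (rule infdist_phase_measurable[OF m(2)])
 have nb: "AE x in lebesgue_on K. norm (G h x) <= 4 * M" for h
  using sub[OF Gb[of h 1 1]] sub[OF Gb[of h 1 2]] sub[OF Gb[of h 2 1]] sub[OF Gb[of h 2 2]]
 proof eventually_elim
  case (elim x)
  then show ?case using norm_matrix_le[of "G h x"] by linarith
 qed
 have Db: "AE x in lebesgue_on K. \<bar>D h x\<bar> <= 4 * M" for h
  using nb[of h]
 proof eventually_elim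
  case (elim x)
  then show ?case using infdist_phase_set_le[of "G h x"] by (auto simp: D_def infdist_nonneg intro: order_trans)
 qed
 have Dc: "converges_in_measure (lebesgue_on K) D (%x. 0)"
  unfolding converges_in_measure_def
 proof (intro conjI allI impI Dm)
  fix \<delta> :: real assume \<delta>: "\<delta> > 0"
  have lim: "(%h. emeasure (lebesgue_on \<Omega>) {x \<in> space (lebesgue_on \<Omega>). \<bar>D h x - 0\<bar> > \<delta>}) \<longlonglongrightarrow> 0"
   and mD: "!!h. D h \<in> borel_measurable (lebesgue_on \<Omega>)"
   using u(3) \<delta> unfolding converges_in_measure_def D_def[abs_def] G_def by auto
  have le: "emeasure (lebesgue_on K) {x \<in> space (lebesgue_on K). \<bar>D h x - 0\<bar> > \<delta>} <= emeasure (lebesgue_on \<Omega>) {x \<in> space (lebesgue_on \<Omega>). \<bar>D h x - 0\<bar> > \<delta>}" for h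
  proof -
   have [measurable]: "D h \<in> borel_measurable (lebesgue_on \<Omega>)" by (rule mD)
   have mm: "{x \<in> space (lebesgue_on \<Omega>). \<bar>D h x - 0\<bar> > \<delta>} \<in> sets (lebesgue_on \<Omega>)" by measurable
   have sp: "space (lebesgue_on S) = S" for S :: "(real^2) set" by simp
   have w: "K \<inter> space lebesgue \<in> sets lebesgue" "\<Omega> \<inter> space lebesgue \<in> sets lebesgue" using KL by simp_all
   have s: "{x \<in> \<Omega>. \<bar>D h x - 0\<bar> > \<delta>} \<in> sets lebesgue"
    by (rule conjunct2[OF iffD1[OF sets_restrict_space_iff[OF w(2)] mm[unfolded sp]]])
   have "emeasure (lebesgue_on K) {x \<in> space (lebesgue_on K). \<bar>D h x - 0\<bar> > \<delta>} = emeasure lebesgue {x \<in> K. \<bar>D h x - 0\<bar> > \<delta>}"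
    unfolding sp by (rule emeasure_restrict_space[OF w(1)]) blast
   also have "\<dots> <= emeasure lebesgue {x \<in> \<Omega>. \<bar>D h x - 0\<bar> > \<delta>}" using K\<Omega> by (intro emeasure_mono s) blast
   also have "\<dots> = emeasure (lebesgue_on \<Omega>) {x \<in> space (lebesgue_on \<Omega>). \<bar>D h x - 0\<bar> > \<delta>}"
    unfolding sp by (rule emeasure_restrict_space[OF w(2), symmetric]) blast
   finally show ?thesis .
  qed
  show "(%h. emeasure (lebesgue_on K) {x \<in> space (lebesgue_on K). \<bar>D h x - 0\<bar> > \<delta>}) \<longlonglongrightarrow> 0"
   by (rule tendsto_sandwich[OF eventuallyI eventuallyI tendsto_const lim]) (use le in auto)
 qed simp
 note D = bounded_converges_in_measure_imp_L2[OF fm Dc Db]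
 have nbu: "AE x in lebesgue_on K. norm (u h x) <= 2 * M" for h
  using sub[OF ub[of h 1]] sub[OF ub[of h 2]]
 proof eventually_elim
  case (elim x)
  then show ?case using norm_vec2_le[of "u h x"] by linarith
 qed
 have pairs: "AE x in lebesgue_on K. \<exists>a b. (a, b) \<in> phase_pairs (square_wave (x $ 1 / \<epsilon> h)) \<and> norm (G h x - diag2 a b) <= D h x" for h
  unfolding D_def by (intro AE_I2 infdist_phase_pairs)
 note rec = no_recovery_sequence[where \<Omega> = \<Omega> and \<rho> = \<rho> and p = p and \<epsilon> = \<epsilon> and u = u and G = G and D = D, folded K_def]
 have u2: "integrable (lebesgue_on K) (%x. (norm (u h x))\<^sup>2)" for h
  by (rule bounded_square_integrable[OF fm m(1) nbu])
 have G2: "integrable (lebesgue_on K) (%x. (norm (G h x))\<^sup>2)" for h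
  by (rule bounded_square_integrable[OF fm m(2) nb])
 show False
  by (rule rec) (fact \<Omega> \<rho> K\<Omega> \<epsilon> WG u2 G2 conv Dm D pairs)+
qed

section \<open>Transfer to Gamma-limits: zeros of the homogenized integrand\<close>

section \<open>The homogenized integrand\<close>

lemma nn_integral_lebesgue_on_mono:
 assumes "S \<in> sets lebesgue" "T \<in> sets lebesgue" "T \<subseteq> S"
 shows "(\<integral>\<^sup>+x. f x \<partial>lebesgue_on T) <= (\<integral>\<^sup>+x. f x \<partial>lebesgue_on S)"
proof -
 have "(\<integral>\<^sup>+x. f x * indicator T x \<partial>lebesgue) <= (\<integral>\<^sup>+x. f x * indicator S x \<partial>lebesgue)"
  using assms(3) by (intro nn_integral_mono) (auto simp: indicator_def)
 then show ?thesis using assms(1,2) by (simp add: nn_integral_restrict_space)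
qed

text \<open>The constant in the domination may blow up as \<delta> tends to 0: for fixed \<delta>
  the integrals of \<open>g\<close> tend to 0 first. Used to pass from p-th powers to squares and
  from energies to squared distances.\<close>

lemma dominated_imp_null:
 fixes f :: "nat => 'a => real" and g :: "nat => 'a => real"
 assumes M: "finite_measure M" and fm: "!!k. f k \<in> borel_measurable M" and gm: "!!k. g k \<in> borel_measurable M"
  and f0: "!!k x. 0 <= f k x" and g0: "!!k x. 0 <= g k x"
  and dom: "!!\<delta>. \<delta> > 0 ==> \<exists>C\<ge>0. \<forall>k. AE x in M. f k x <= \<delta> + C * g k x"
  and le: "!!k. (\<integral>\<^sup>+x. ennreal (g k x) \<partial>M) <= ennreal (B k)" and B0: "!!k. 0 <= B k" and B: "B \<longlonglongrightarrow> 0"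
 shows "!!k. integrable M (f k)" and "(%k. \<integral>x. f k x \<partial>M) \<longlonglongrightarrow> 0"
proof -
 interpret finite_measure M by fact
 have gi: "integrable M (g k)" for k
 proof (rule integrableI_bounded[OF gm])
  show "(\<integral>\<^sup>+x. ennreal (norm (g k x)) \<partial>M) < \<infinity>"
   using le_less_trans[OF le[of k] ennreal_less_top] g0 by simp
 qed
 have gB: "(\<integral>x. g k x \<partial>M) <= B k" for k
 proof -
  have eq: "ennreal (\<integral>x. g k x \<partial>M) = (\<integral>\<^sup>+x. ennreal (g k x) \<partial>M)"
   by (rule nn_integral_eq_integral[OF gi, symmetric]) (simp add: g0)
  have "ennreal (\<integral>x. g k x \<partial>M) <= ennreal (B k)" unfolding eq by (rule le)
  then show ?thesis by (simp only: ennreal_le_iff[OF B0])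
 qed
 have di: "integrable M (%x. \<delta> + C * g k x)" for \<delta> C k
  by (intro Bochner_Integration.integrable_add integrable_const integrable_mult_right gi)
 show fi: "integrable M (f k)" for k
 proof -
  obtain C where C: "AE x in M. f k x <= 1 + C * g k x" using dom[of 1] by auto
  show ?thesis
  proof (rule Bochner_Integration.integrable_bound[OF di fm])
   show "AE x in M. norm (f k x) <= norm (1 + C * g k x)"
    using C
   proof eventually_elim
    case (elim x)
    then show ?case using f0[of k x] by simp
   qed
  qed
 qed
 show "(%k. \<integral>x. f k x \<partial>M) \<longlonglongrightarrow> 0"
 proof (rule LIMSEQ_I)
  fix e :: real assume e: "e > 0"
  define m where "m = measure M (space M)"
  have m: "m >= 0" by (simp add: m_def)
  define \<delta> where "\<delta> = e / (2 * (m + 1))"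
  have \<delta>: "\<delta> > 0" "\<delta> * m <= e / 2" using e m by (auto simp: \<delta>_def field_simps)
  obtain C where C: "C >= 0" "!!k. AE x in M. f k x <= \<delta> + C * g k x" using dom[OF \<delta>(1)] by blast
  have "(%k. C * B k) \<longlonglongrightarrow> C * 0" by (intro tendsto_mult tendsto_const B)
  then have "\<forall>\<^sub>F k in sequentially. C * B k < e / 2" using e by (intro order_tendstoD) auto
  then obtain n where n: "!!k. k >= n ==> C * B k < e / 2" by (auto simp: eventually_sequentially)
  have "norm ((\<integral>x. f k x \<partial>M) - 0) < e" if "k >= n" for k
  proof -
   have "(\<integral>x. f k x \<partial>M) <= (\<integral>x. \<delta> + C * g k x \<partial>M)" by (rule integral_mono_AE[OF fi di C(2)])
   also have "\<dots> = \<delta> * m + C * (\<integral>x. g k x \<partial>M)" using gi by (simp add: m_def mult.commute)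
   also have "\<dots> <= \<delta> * m + C * B k" using gB C(1) by (intro add_left_mono mult_left_mono) auto
   also have "\<dots> < e" using n[OF that] \<delta>(2) by linarith
   finally have "(\<integral>x. f k x \<partial>M) < e" .
   moreover have "0 <= (\<integral>x. f k x \<partial>M)" by (simp add: f0)
   ultimately show ?thesis by simp
  qed
  then show "\<exists>no. \<forall>k\<ge>no. norm ((\<integral>x. f k x \<partial>M) - 0) < e" by blast
 qed
qed

text \<open>Beyond the square root of \<delta>, the factor \<open>t powr (2 - p)\<close> decreases
  in \<open>t\<close> and is at most its value there; below it the square is at most
  \<delta>.\<close>

lemma square_le_powr:
 fixes t p \<delta> :: real
 assumes p: "p >= 2" and \<delta>: "\<delta> > 0" and t: "t >= 0"
 shows "t\<^sup>2 <= \<delta> + (sqrt \<delta>) powr (2 - p) * t powr p"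
proof (cases "t <= sqrt \<delta>")
 case True
 then have "t\<^sup>2 <= (sqrt \<delta>)\<^sup>2" using t by (intro power_mono) auto
 then show ?thesis using \<delta> by (simp add: add_increasing2)
next
 case False
 have "0 < sqrt \<delta>" using \<delta> by simp
 then have s: "0 < sqrt \<delta>" "sqrt \<delta> <= t" "0 < t" using False by linarith+
 have "t\<^sup>2 = t powr (2 - p) * t powr p" using s(3) by (simp add: powr_add[symmetric])
 also have "\<dots> <= (sqrt \<delta>) powr (2 - p) * t powr p"
  using p s by (intro mult_right_mono powr_mono2') auto
 finally show ?thesis using \<delta> by linarith
qed

text \<open>For large matrices coercivity controls the square of the norm. For bounded matrices at
  squared distance at least \<delta> the continuous potential has a positive minimum by compactness.
  The remaining ones are absorbed by \<delta>.\<close>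

lemma potential_controls_distance:
 assumes W: "polyconvex_potential p A W" and p: "p >= 2" and A: "closed A" "0 \<in> A" and \<delta>: "\<delta> > 0"
 shows "\<exists>C\<ge>0. \<forall>\<Lambda>. (infdist \<Lambda> A)\<^sup>2 <= \<delta> + C * W \<Lambda>"
proof -
 have W0: "0 <= W \<Lambda>" and Wz: "W \<Lambda> = 0 \<longleftrightarrow> \<Lambda> \<in> A" for \<Lambda> using W by (auto simp: polyconvex_potential_def)
 have Wc: "continuous_on UNIV W" using W by (intro polyconvex_fun_continuous) (simp add: polyconvex_potential_def)
 obtain c1 c2 where c: "c1 > 0" "c2 > 0" "!!\<Lambda>. c1 * norm \<Lambda> powr p - c2 <= W \<Lambda>"
  using W unfolding polyconvex_potential_def coercive_growth_def by blast
 have dn: "infdist \<Lambda> A <= norm \<Lambda>" for \<Lambda> using infdist_le[OF A(2), of \<Lambda>] by (simp add: dist_norm)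
 have dn2: "(infdist \<Lambda> A)\<^sup>2 <= (norm \<Lambda>)\<^sup>2" for \<Lambda> by (intro power_mono dn infdist_nonneg)
 \<comment> \<open>Beyond \<open>R\<close> the p-th power is at least 2 c2 / c1, so the constant
   \<open>c2\<close> costs no more than half of the coercive term.\<close>
 define R where "R = max 1 (2 * c2 / c1)"
 have R: "1 <= R" "2 * c2 / c1 <= R" by (auto simp: R_def)
 have far: "(infdist \<Lambda> A)\<^sup>2 <= 2 / c1 * W \<Lambda>" if "R <= norm \<Lambda>" for \<Lambda>
 proof -
  have n1: "1 <= norm \<Lambda>" using that R by linarith
  have "norm \<Lambda> powr 1 <= norm \<Lambda> powr p" "norm \<Lambda> powr 2 <= norm \<Lambda> powr p"
   using powr_mono[of 1 p "norm \<Lambda>"] powr_mono[of 2 p "norm \<Lambda>"] n1 p by simp_all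
  moreover have "norm \<Lambda> powr 1 = norm \<Lambda>" "norm \<Lambda> powr 2 = (norm \<Lambda>)\<^sup>2" using n1 by (auto simp: powr_numeral)
  ultimately have np: "norm \<Lambda> <= norm \<Lambda> powr p" "(norm \<Lambda>)\<^sup>2 <= norm \<Lambda> powr p" by auto
  have "2 * c2 / c1 <= norm \<Lambda> powr p" using np(1) that R by linarith
  then have "2 * c2 <= c1 * norm \<Lambda> powr p" using c(1) by (simp add: divide_le_eq mult.commute)
  then have "c1 * norm \<Lambda> powr p <= 2 * W \<Lambda>" using c(3)[of \<Lambda>] by linarith
  then have "norm \<Lambda> powr p <= 2 / c1 * W \<Lambda>" using c(1) by (simp add: field_simps)
  then show ?thesis using np(2) dn2[of \<Lambda>] by linarith
 qed
 \<comment> \<open>A compact set disjoint from \<open>A\<close>, on which \<open>W\<close> is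
   therefore bounded below by a positive number.\<close>
 define S where "S = cball 0 R \<inter> {\<Lambda>. \<delta> <= (infdist \<Lambda> A)\<^sup>2}"
 have "closed {\<Lambda>. \<delta> <= (infdist \<Lambda> A)\<^sup>2}"
  by (intro closed_Collect_le continuous_intros)
 then have S: "compact S" unfolding S_def by (intro compact_Int_closed compact_cball)
 have "\<exists>m>0. \<forall>\<Lambda>\<in>S. m <= W \<Lambda>"
 proof (cases "S = {}")
  case True
  then show ?thesis by (intro exI[of _ 1]) auto
 next
  case False
  obtain \<Lambda>0 where \<Lambda>0: "\<Lambda>0 \<in> S" "!!\<Lambda>. \<Lambda> \<in> S ==> W \<Lambda>0 <= W \<Lambda>"
   using continuous_attains_inf[OF S False continuous_on_subset[OF Wc]] by auto
  have "\<Lambda>0 \<notin> A"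
  proof
   assume "\<Lambda>0 \<in> A"
   then have "infdist \<Lambda>0 A = 0" by (rule infdist_zero)
   then show False using \<Lambda>0(1) \<delta> by (simp add: S_def)
  qed
  then have "0 < W \<Lambda>0" using W0[of \<Lambda>0] Wz[of \<Lambda>0] by simp
  then show ?thesis using \<Lambda>0(2) by blast
 qed
 then obtain m where m: "m > 0" "!!\<Lambda>. \<Lambda> \<in> S ==> m <= W \<Lambda>" by blast
 define C where "C = R\<^sup>2 / m + 2 / c1"
 have C: "0 <= R\<^sup>2 / m" "0 <= 2 / c1" "C >= 0" using m(1) c(1) by (auto simp: C_def)
 have "(infdist \<Lambda> A)\<^sup>2 <= \<delta> + C * W \<Lambda>" for \<Lambda>
 proof -
  have CW: "C * W \<Lambda> = R\<^sup>2 / m * W \<Lambda> + 2 / c1 * W \<Lambda>" by (simp add: C_def distrib_right)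
  have pos: "0 <= R\<^sup>2 / m * W \<Lambda>" "0 <= 2 / c1 * W \<Lambda>" using C W0 by (intro mult_nonneg_nonneg; simp)+
  have "R <= norm \<Lambda> \<or> (infdist \<Lambda> A)\<^sup>2 <= \<delta> \<or> \<Lambda> \<in> S" by (auto simp: S_def)
  then consider "R <= norm \<Lambda>" | "(infdist \<Lambda> A)\<^sup>2 <= \<delta>" | "\<Lambda> \<in> S" by blast
  then show ?thesis
  proof cases
   case 1
   show ?thesis using far[OF 1] pos \<delta> CW by linarith
  next
   case 2
   then show ?thesis using pos CW by linarith
  next
   case 3
   have "(infdist \<Lambda> A)\<^sup>2 <= (norm \<Lambda>)\<^sup>2" by (rule dn2)
   also have "\<dots> <= R\<^sup>2" using 3 by (intro power_mono) (auto simp: S_def)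
   also have "\<dots> = R\<^sup>2 / m * m" using m(1) by simp
   also have "\<dots> <= R\<^sup>2 / m * W \<Lambda>" using m(2)[OF 3] C by (intro mult_left_mono) auto
   finally show ?thesis using pos CW \<delta> by linarith
  qed
 qed
 then show ?thesis using C(3) by blast
qed

lemma Linf_imp_Lp:
 assumes "Linf \<Omega> f" and \<Omega>: "open \<Omega>" "bounded \<Omega>" and p: "p >= 0"
 shows "Lp p \<Omega> f"
proof -
 have fm [measurable]: "f \<in> borel_measurable (lebesgue_on \<Omega>)" using assms(1) by (simp add: Linf_def)
 obtain C where C: "AE x in lebesgue_on \<Omega>. norm (f x) <= C" using assms(1) unfolding Linf_def by blast
 have "finite_measure (lebesgue_on \<Omega>)" using \<Omega> by (intro finite_measure_lebesgue_on) auto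
 then have "integrable (lebesgue_on \<Omega>) (%x. norm (f x) powr p)"
 proof (rule finite_measure.integrable_const_bound[of _ _ "C powr p"])
  show "AE x in lebesgue_on \<Omega>. norm (norm (f x) powr p) <= C powr p"
   using C by eventually_elim (simp add: powr_mono2 p)
 qed measurable
 then show ?thesis using fm by (simp add: Lp_def)
qed

lemma W1inf_imp_W1p:
 assumes "W1inf \<Omega> u" "open \<Omega>" "bounded \<Omega>" "p >= 0"
 shows "W1p p \<Omega> u"
proof -
 obtain G where G: "has_weak_gradient \<Omega> u G" "Linf \<Omega> G" and u: "Linf \<Omega> u"
  using assms(1) unfolding W1inf_def by blast
 show ?thesis
  unfolding W1p_def
  by (intro conjI exI[of _ G] G(1) Linf_imp_Lp[OF u assms(2-4)] Linf_imp_Lp[OF G(2) assms(2-4)])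
qed

lemma Lp_diff:
 fixes f g :: "real^2 => 'b::euclidean_space"
 assumes f: "Lp p \<Omega> f" and g: "Lp p \<Omega> g" and p: "p >= 0"
 shows "integrable (lebesgue_on \<Omega>) (%x. norm (f x - g x) powr p)"
proof (rule Bochner_Integration.integrable_bound[where f = "%x. 2 powr p * (norm (f x) powr p + norm (g x) powr p)"])
 have m: "f \<in> borel_measurable (lebesgue_on \<Omega>)" "g \<in> borel_measurable (lebesgue_on \<Omega>)"
  and i: "integrable (lebesgue_on \<Omega>) (%x. norm (f x) powr p)" "integrable (lebesgue_on \<Omega>) (%x. norm (g x) powr p)"
  using f g unfolding Lp_def by blast+
 show "integrable (lebesgue_on \<Omega>) (%x. 2 powr p * (norm (f x) powr p + norm (g x) powr p))"
  by (rule integrable_mult_right[OF Bochner_Integration.integrable_add[OF i]])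
 show "(%x. norm (f x - g x) powr p) \<in> borel_measurable (lebesgue_on \<Omega>)"
  by (rule powr_real_measurable[OF measurable_compose[OF borel_measurable_diff[OF m] borel_measurable_continuous_onI[OF continuous_on_norm[OF continuous_on_id]]] borel_measurable_const])
 show "AE x in lebesgue_on \<Omega>. norm (norm (f x - g x) powr p) <= norm (2 powr p * (norm (f x) powr p + norm (g x) powr p))"
 proof (rule AE_I2)
  fix x
  define s where "s = max (norm (f x)) (norm (g x))"
  have s: "norm (f x) <= s" "norm (g x) <= s" by (simp_all add: s_def)
  then have s0: "0 <= s" using norm_ge_zero[of "f x"] by linarith
  have "norm (f x - g x) <= 2 * s" using norm_triangle_ineq4[of "f x" "g x"] s by linarith
  then have "norm (f x - g x) powr p <= (2 * s) powr p" using p by (intro powr_mono2) simp_all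
  also have "\<dots> = 2 powr p * s powr p" using s0 by (simp add: powr_mult)
  also have "\<dots> <= 2 powr p * (norm (f x) powr p + norm (g x) powr p)"
  proof (rule mult_left_mono[OF _ powr_ge_zero])
   have "s = norm (f x) \<or> s = norm (g x)" by (simp add: s_def max_def)
   then show "s powr p <= norm (f x) powr p + norm (g x) powr p"
    using powr_ge_zero[of "norm (f x)" p] powr_ge_zero[of "norm (g x)" p] by (elim disjE) (simp_all only: le_add_same_cancel1 le_add_same_cancel2)
  qed
  finally have le: "norm (f x - g x) powr p <= 2 powr p * (norm (f x) powr p + norm (g x) powr p)" .
  have e: "norm (norm (f x - g x) powr p) = norm (f x - g x) powr p"
   by (simp only: real_norm_def abs_of_nonneg[OF powr_ge_zero])
  show "norm (norm (f x - g x) powr p) <= norm (2 powr p * (norm (f x) powr p + norm (g x) powr p))"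
   unfolding e by (rule order_trans[OF le]) (simp only: real_norm_def abs_ge_self)
 qed
qed

lemma Lp_imp_square_integrable:
 fixes f :: "real^2 => 'b::euclidean_space"
 assumes f: "Lp p \<Omega> f" and \<Omega>: "open \<Omega>" and p: "p >= 2" and K: "bounded K" "K \<in> sets lebesgue" "K \<subseteq> \<Omega>"
 shows "integrable (lebesgue_on K) (%x. (norm (f x))\<^sup>2)"
proof -
 have \<Omega>L: "\<Omega> \<in> sets lebesgue" using \<Omega> by auto
 have fm: "f \<in> borel_measurable (lebesgue_on K)"
  by (rule measurable_restrict_mono[OF _ K(3)]) (use f in \<open>unfold Lp_def, blast\<close>)
 have "integrable (lebesgue_on \<Omega>) (%x. norm (f x) powr p)" using f by (simp add: Lp_def)
 then have "(\<integral>\<^sup>+x. ennreal (norm (norm (f x) powr p)) \<partial>lebesgue_on \<Omega>) < \<infinity>"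
  unfolding integrable_iff_bounded by blast
 then have "(\<integral>\<^sup>+x. ennreal (norm (norm (f x) powr p)) \<partial>lebesgue_on K) < \<infinity>"
  by (rule le_less_trans[OF nn_integral_lebesgue_on_mono[OF \<Omega>L K(2,3)]])
 moreover have pm: "(%x. norm (f x) powr p) \<in> borel_measurable (lebesgue_on K)" using fm by measurable
 ultimately have i: "integrable (lebesgue_on K) (%x. norm (f x) powr p)"
  by (intro integrableI_bounded)
 have "integrable (lebesgue_on K) (%x. 1 + sqrt 1 powr (2 - p) * norm (f x) powr p)"
  by (intro Bochner_Integration.integrable_add integrable_mult_right i finite_measure.integrable_const finite_measure_lebesgue_on K)
 then show ?thesis
 proof (rule Bochner_Integration.integrable_bound)
  show "(%x. (norm (f x))\<^sup>2) \<in> borel_measurable (lebesgue_on K)" using fm by measurable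
  show "AE x in lebesgue_on K. norm ((norm (f x))\<^sup>2) <= norm (1 + sqrt 1 powr (2 - p) * norm (f x) powr p)"
  proof (rule AE_I2)
   fix x
   show "norm ((norm (f x))\<^sup>2) <= norm (1 + sqrt 1 powr (2 - p) * norm (f x) powr p)"
    using square_le_powr[OF p, of 1 "norm (f x)"] by simp
  qed
 qed
qed

lemma W1p_weak_grad:
 assumes "W1p p \<Omega> u" "open \<Omega>"
 shows "has_weak_gradient \<Omega> u (weak_grad \<Omega> u)" "Lp p \<Omega> (weak_grad \<Omega> u)"
proof -
 obtain G where G: "has_weak_gradient \<Omega> u G" "Lp p \<Omega> G" using assms(1) unfolding W1p_def by blast
 show W: "has_weak_gradient \<Omega> u (weak_grad \<Omega> u)" by (rule has_weak_gradient_weak_grad[OF G(1)])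
 have m [measurable]: "weak_grad \<Omega> u \<in> borel_measurable (lebesgue_on \<Omega>)" by (rule weak_grad_measurable[OF W assms(2)])
 have Gm [measurable]: "G \<in> borel_measurable (lebesgue_on \<Omega>)" using G(2) by (simp add: Lp_def)
 have i: "integrable (lebesgue_on \<Omega>) (%x. norm (G x) powr p)" using G(2) by (simp add: Lp_def)
 have ae: "AE x in lebesgue_on \<Omega>. norm (G x) powr p = norm (weak_grad \<Omega> u x) powr p"
  using weak_grad_AE_eq[OF G(1) assms(2)] by eventually_elim simp
 have mp: "(%x. norm (weak_grad \<Omega> u x) powr p) \<in> borel_measurable (lebesgue_on \<Omega>)" by measurable
 have "integrable (lebesgue_on \<Omega>) (%x. norm (weak_grad \<Omega> u x) powr p)"
  by (rule integrable_cong_AE_imp[OF i mp]) (use ae in \<open>eventually_elim, simp\<close>)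
 then show "Lp p \<Omega> (weak_grad \<Omega> u)" using m by (simp add: Lp_def)
qed

lemma phase_integrand:
 "indicator left_half (frac_vec (x /\<^sub>R \<epsilon>)) * W1 \<Lambda> + indicator right_half (frac_vec (x /\<^sub>R \<epsilon>)) * W2 \<Lambda>
 = (if square_wave (x $ 1 / \<epsilon>) = 1 then W1 \<Lambda> else W2 \<Lambda>)" for W1 W2 :: "real^2^2 => real"
 by (cases "square_wave (x $ 1 / \<epsilon>) = 1") (simp_all add: frac_vec_phase)

text \<open>Laminates have energy exactly 0 and converge to the linear map, so the lower-bound half
  of Gamma-convergence gives the limit energy 0. The gradient there is constant and \<Omega> has
  positive measure.\<close>

lemma Whom_laminate_zero:
 fixes b a g :: real
 assumes \<Omega>: "open \<Omega>" "bounded \<Omega>" "\<Omega> ~= {}" and p: "p >= 2"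
  and W1: "polyconvex_potential p (triple_set (-1/2) 1 (-2) 2) W1" and W2: "polyconvex_potential p (triple_set (5/2) 1 3 2) W2"
  and Whom: "homogenized_integrand p \<Omega> (%y \<Lambda>. indicator left_half y * W1 \<Lambda> + indicator right_half y * W2 \<Lambda>) Whom"
  and T: "(b, a, g) \<in> {(0, 0, 0), (1, -3/2, 1), (1/2, -5/2, 2)}"
 shows "Whom (diag2 b g) = 0"
proof -
 define \<epsilon> where "\<epsilon> h = inverse (real (Suc h))" for h
 have \<epsilon>: "\<epsilon> h > 0" "\<epsilon> \<longlonglongrightarrow> 0" for h using LIMSEQ_inverse_real_of_nat by (auto simp: \<epsilon>_def[abs_def])
 define E where "E h = energy p \<Omega> (%x \<Lambda>. if square_wave (x $ 1 / \<epsilon> h) = 1 then W1 \<Lambda> else W2 \<Lambda>)" for h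
 have gl: "gamma_limit p \<Omega> E (energy p \<Omega> (%x. Whom))"
 proof -
  have fam: "gamma_limit_family p \<Omega> (%\<epsilon>. energy p \<Omega> (%x \<Lambda>. indicator left_half (frac_vec (x /\<^sub>R \<epsilon>)) * W1 \<Lambda> + indicator right_half (frac_vec (x /\<^sub>R \<epsilon>)) * W2 \<Lambda>)) (energy p \<Omega> (%x. Whom))"
   using Whom unfolding homogenized_integrand_def by (elim conjE)
  have "(\<forall>h. \<epsilon> h > 0) \<and> \<epsilon> \<longlonglongrightarrow> 0" using \<epsilon> by blast
  from fam[unfolded gamma_limit_family_def, THEN spec[of _ \<epsilon>], THEN mp, OF this] show ?thesis
   unfolding phase_integrand E_def[abs_def] .
 qed
 define v where "v h = laminate b a g (\<epsilon> h)" for h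
 define u where "u = (*v) (diag2 b g)"
 have p0: "p >= 0" using p by simp
 have vW: "W1p p \<Omega> (v h)" for h
  unfolding v_def by (intro W1inf_imp_W1p laminate_W1inf \<Omega> \<epsilon> p0)
 have uW: "W1p p \<Omega> u"
  unfolding u_def laminate_linear[of b g 1, symmetric] by (intro W1inf_imp_W1p laminate_W1inf \<Omega> p0) simp
 have vL: "Lp p \<Omega> (v h)" and uL: "Lp p \<Omega> u" for h using vW uW unfolding W1p_def by blast+
 have fm: "finite_measure (lebesgue_on \<Omega>)" using \<Omega> by (intro finite_measure_lebesgue_on) auto
 interpret finite_measure "lebesgue_on \<Omega>" by (rule fm)
 define m where "m = measure (lebesgue_on \<Omega>) (space (lebesgue_on \<Omega>))"
 have "(%h. \<integral>x. norm (v h x - u x) powr p \<partial>lebesgue_on \<Omega>) \<longlonglongrightarrow> 0"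
 proof (rule Lim_null_comparison[OF eventuallyI])
  fix h
  have "(\<integral>x. norm (v h x - u x) powr p \<partial>lebesgue_on \<Omega>) <= (\<integral>x. (\<bar>a\<bar> * \<epsilon> h / 2) powr p \<partial>lebesgue_on \<Omega>)"
  proof (rule integral_mono[OF Lp_diff[OF vL uL p0]])
   show "norm (v h x - u x) powr p <= (\<bar>a\<bar> * \<epsilon> h / 2) powr p" for x
    using laminate_bounded(2)[OF \<epsilon>(1)[of h], of b a g x] p0 unfolding v_def u_def by (intro powr_mono2) auto
  qed simp
  then show "norm (\<integral>x. norm (v h x - u x) powr p \<partial>lebesgue_on \<Omega>) <= (\<bar>a\<bar> * \<epsilon> h / 2) powr p * m"
   by (simp add: m_def mult.commute)
 next
  have "(%h. \<bar>a\<bar> * \<epsilon> h / 2) \<longlonglongrightarrow> \<bar>a\<bar> * 0 / 2" by (intro tendsto_mult tendsto_divide tendsto_const \<epsilon>(2)) simp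
  then have l: "(%h. \<bar>a\<bar> * \<epsilon> h / 2) \<longlonglongrightarrow> 0" by simp
  have "(%h. (\<bar>a\<bar> * \<epsilon> h / 2) powr p) \<longlonglongrightarrow> 0 powr p"
  proof (rule tendsto_powr'[OF l tendsto_const])
   have "0 <= \<bar>a\<bar> * \<epsilon> h / 2" for h using \<epsilon>(1)[of h] by simp
   then show "(0::real) ~= 0 \<or> (p > 0 \<and> (\<forall>\<^sub>F h in sequentially. 0 <= \<bar>a\<bar> * \<epsilon> h / 2))" using p by simp
  qed
  then have "(%h. (\<bar>a\<bar> * \<epsilon> h / 2) powr p) \<longlonglongrightarrow> 0" using p by simp
  from tendsto_mult[OF this tendsto_const[of m]] show "(%h. (\<bar>a\<bar> * \<epsilon> h / 2) powr p * m) \<longlonglongrightarrow> 0" by simp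
 qed
 then have v: "v \<in> {v. Lp_tendsto p \<Omega> v u}" using vL by (simp add: Lp_tendsto_def)
 have W0: "W1 \<Lambda> = 0" if "\<Lambda> \<in> phase_set 1" for \<Lambda> using W1 that by (auto simp: polyconvex_potential_def phase_set_def)
 have W0': "W2 \<Lambda> = 0" if "\<Lambda> \<in> phase_set s" "s ~= 1" for \<Lambda> s using W2 that by (auto simp: polyconvex_potential_def phase_set_def)
 have E0: "E h (v h) = 0" for h
 proof -
  have WG: "has_weak_gradient \<Omega> (v h) (laminate_grad b a g (\<epsilon> h))"
   unfolding v_def by (rule laminate_has_weak_gradient[OF \<epsilon>(1) \<Omega>(1)])
  have "AE x in lebesgue_on \<Omega>. ennreal (if square_wave (x $ 1 / \<epsilon> h) = 1 then W1 (weak_grad \<Omega> (v h) x) else W2 (weak_grad \<Omega> (v h) x)) = 0"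
   using weak_grad_AE_eq[OF WG \<Omega>(1)]
  proof eventually_elim
   case (elim x)
   have "laminate_grad b a g (\<epsilon> h) x \<in> phase_set (square_wave (x $ 1 / \<epsilon> h))" by (rule laminate_grad_in_phase_set[OF T])
   then show ?case unfolding elim using W0 W0' by auto
  qed
  then have "(\<integral>\<^sup>+x. ennreal (if square_wave (x $ 1 / \<epsilon> h) = 1 then W1 (weak_grad \<Omega> (v h) x) else W2 (weak_grad \<Omega> (v h) x)) \<partial>lebesgue_on \<Omega>) = (\<integral>\<^sup>+x. 0 \<partial>lebesgue_on \<Omega>)"
   by (rule nn_integral_cong_AE)
  then show ?thesis using vW by (simp add: E_def energy_def)
 qed
 \<comment> \<open>Every converging sequence bounds the limit energy from above through its lower
   limit, and the laminates bound it by 0.\<close>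
 have "energy p \<Omega> (%x. Whom) u <= (INF v\<in>{v. Lp_tendsto p \<Omega> v u}. liminf (%h. E h (v h)))"
  using gl uL unfolding gamma_limit_def by blast
 also have "\<dots> <= liminf (%h. E h (v h))" by (rule INF_lower[OF v])
 also have "\<dots> = 0" by (simp add: E0 Liminf_const)
 finally have "energy p \<Omega> (%x. Whom) u = 0" by simp
 moreover have "energy p \<Omega> (%x. Whom) u = (\<integral>\<^sup>+x. ennreal (Whom (diag2 b g)) \<partial>lebesgue_on \<Omega>)"
 proof -
  have "AE x in lebesgue_on \<Omega>. ennreal (Whom (weak_grad \<Omega> u x)) = ennreal (Whom (diag2 b g))"
   using weak_grad_AE_eq[OF linear_has_weak_gradient[OF \<Omega>(1)] \<Omega>(1), of b g] unfolding u_def by eventually_elim simp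
  then have "(\<integral>\<^sup>+x. ennreal (Whom (weak_grad \<Omega> u x)) \<partial>lebesgue_on \<Omega>) = (\<integral>\<^sup>+x. ennreal (Whom (diag2 b g)) \<partial>lebesgue_on \<Omega>)"
   by (rule nn_integral_cong_AE)
  then show ?thesis using uW by (simp add: energy_def)
 qed
 ultimately have "ennreal (Whom (diag2 b g)) * emeasure lebesgue \<Omega> = 0"
  using \<Omega> by (simp add: emeasure_restrict_space)
 moreover have "emeasure lebesgue \<Omega> ~= 0"
  using \<Omega> open_not_negligible[OF \<Omega>(1,3)] by (auto simp: negligible_iff_null_sets null_sets_def)
 ultimately have "ennreal (Whom (diag2 b g)) = 0" by simp
 moreover have "0 <= Whom (diag2 b g)" using Whom by (simp add: homogenized_integrand_def)
 ultimately show ?thesis by (simp add: ennreal_eq_0_iff)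
qed

text \<open>If the integrand vanished at \<open>C\<close>, the upper-bound half of Gamma-convergence
  would give functions of energy tending to 0 that converge to \<open>C x\<close> in Lp. Small
  energy forces the gradients towards the phase sets in L2, which
  \<open>no_recovery_sequence\<close> excludes.\<close>

lemma Whom_C_nonzero:
 assumes \<Omega>: "open \<Omega>" "bounded \<Omega>" "\<Omega> ~= {}" and p: "p >= 2"
  and W1: "polyconvex_potential p (triple_set (-1/2) 1 (-2) 2) W1" and W2: "polyconvex_potential p (triple_set (5/2) 1 3 2) W2"
  and Whom: "homogenized_integrand p \<Omega> (%y \<Lambda>. indicator left_half y * W1 \<Lambda> + indicator right_half y * W2 \<Lambda>) Whom"
 shows "Whom (diag2 (2/3) (4/3)) ~= 0"
proof
 assume z: "Whom (diag2 (2/3) (4/3)) = 0"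
 define \<epsilon> where "\<epsilon> h = inverse (real (Suc h))" for h
 have \<epsilon>: "\<epsilon> h > 0" "\<epsilon> \<longlonglongrightarrow> 0" for h using LIMSEQ_inverse_real_of_nat by (auto simp: \<epsilon>_def[abs_def])
 define F where "F h x \<Lambda> = (if square_wave (x $ 1 / \<epsilon> h) = 1 then W1 \<Lambda> else W2 \<Lambda>)" for h and x :: "real^2" and \<Lambda>
 define E where "E h = energy p \<Omega> (F h)" for h
 have gl: "gamma_limit p \<Omega> E (energy p \<Omega> (%x. Whom))"
 proof -
  have fam: "gamma_limit_family p \<Omega> (%\<epsilon>. energy p \<Omega> (%x \<Lambda>. indicator left_half (frac_vec (x /\<^sub>R \<epsilon>)) * W1 \<Lambda> + indicator right_half (frac_vec (x /\<^sub>R \<epsilon>)) * W2 \<Lambda>)) (energy p \<Omega> (%x. Whom))"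
   using Whom unfolding homogenized_integrand_def by (elim conjE)
  have "(\<forall>h. \<epsilon> h > 0) \<and> \<epsilon> \<longlonglongrightarrow> 0" using \<epsilon> by blast
  from fam[unfolded gamma_limit_family_def, THEN spec[of _ \<epsilon>], THEN mp, OF this] show ?thesis
   unfolding phase_integrand E_def[abs_def] F_def[abs_def] .
 qed
 define u where "u = (*v) (diag2 (2/3) (4/3))"
 have p0: "p >= 0" using p by simp
 have uW: "W1p p \<Omega> u"
  unfolding u_def laminate_linear[of "2/3" "4/3" 1, symmetric] by (intro W1inf_imp_W1p laminate_W1inf \<Omega> p0) simp
 then have uL: "Lp p \<Omega> u" by (simp add: W1p_def)
 have "energy p \<Omega> (%x. Whom) u = 0"
 proof -
  have "AE x in lebesgue_on \<Omega>. ennreal (Whom (weak_grad \<Omega> u x)) = 0"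
   using weak_grad_AE_eq[OF linear_has_weak_gradient[OF \<Omega>(1)] \<Omega>(1), of "2/3" "4/3"] unfolding u_def
   by eventually_elim (simp add: z)
  then have "(\<integral>\<^sup>+x. ennreal (Whom (weak_grad \<Omega> u x)) \<partial>lebesgue_on \<Omega>) = (\<integral>\<^sup>+x. 0 \<partial>lebesgue_on \<Omega>)"
   by (rule nn_integral_cong_AE)
  then show ?thesis using uW by (simp add: energy_def)
 qed
 have inf0: "(INF v\<in>{v. Lp_tendsto p \<Omega> v u}. limsup (%h. E h (v h))) = 0"
 proof -
  have "(INF v\<in>{v. Lp_tendsto p \<Omega> v u}. limsup (%h. E h (v h))) <= energy p \<Omega> (%x. Whom) u"
   using gl uL unfolding gamma_limit_def by blast
  then show ?thesis using \<open>energy p \<Omega> (%x. Whom) u = 0\<close> by simp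
 qed
 define B where "B k = inverse (real (Suc k))" for k
 have B: "B k > 0" "B \<longlonglongrightarrow> 0" for k using LIMSEQ_inverse_real_of_nat by (auto simp: B_def[abs_def])
 \<comment> \<open>The infimum over sequences is 0 but may not be attained. For each
   \<open>k\<close> one member of a good enough sequence is selected, with index at least
   \<open>k\<close>, so that the selected scales still tend to 0.\<close>
 have "\<forall>k. \<exists>h w. k <= h \<and> Lp p \<Omega> w \<and> (\<integral>x. norm (w x - u x) powr p \<partial>lebesgue_on \<Omega>) < B k \<and> E h w < ennreal (B k)"
 proof
  fix k
  have "(INF v\<in>{v. Lp_tendsto p \<Omega> v u}. limsup (%h. E h (v h))) < ennreal (B k)" unfolding inf0 using B(1)[of k] by simp
  then obtain v where v: "Lp_tendsto p \<Omega> v u" "limsup (%h. E h (v h)) < ennreal (B k)" unfolding INF_less_iff by blast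
  have e1: "\<forall>\<^sub>F h in sequentially. E h (v h) < ennreal (B k)" by (rule Limsup_lessD[OF v(2)])
  have e2: "\<forall>\<^sub>F h in sequentially. (\<integral>x. norm (v h x - u x) powr p \<partial>lebesgue_on \<Omega>) < B k"
  proof -
   have "(%h. \<integral>x. norm (v h x - u x) powr p \<partial>lebesgue_on \<Omega>) \<longlonglongrightarrow> 0" using v(1) unfolding Lp_tendsto_def by blast
   then show ?thesis by (rule order_tendstoD(2)[OF _ B(1)])
  qed
  have e: "\<forall>\<^sub>F h in sequentially. k <= h \<and> E h (v h) < ennreal (B k) \<and> (\<integral>x. norm (v h x - u x) powr p \<partial>lebesgue_on \<Omega>) < B k"
   by (intro eventually_conj eventually_ge_at_top e1 e2)
  obtain h where "k <= h" "E h (v h) < ennreal (B k)" "(\<integral>x. norm (v h x - u x) powr p \<partial>lebesgue_on \<Omega>) < B k"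
   using eventually_happens'[OF sequentially_bot e] by blast
  moreover have "Lp p \<Omega> (v h)" using v(1) by (simp add: Lp_tendsto_def)
  ultimately show "\<exists>h w. k <= h \<and> Lp p \<Omega> w \<and> (\<integral>x. norm (w x - u x) powr p \<partial>lebesgue_on \<Omega>) < B k \<and> E h w < ennreal (B k)" by blast
 qed
 then obtain H w where Hw: "!!k. k <= H k" "!!k. Lp p \<Omega> (w k)" "!!k. (\<integral>x. norm (w k x - u x) powr p \<partial>lebesgue_on \<Omega>) < B k"
  "!!k. E (H k) (w k) < ennreal (B k)"
  unfolding choice_iff by blast
 have wW: "W1p p \<Omega> (w k)" for k
 proof (rule ccontr)
  assume "\<not> W1p p \<Omega> (w k)"
  then show False using Hw(4)[of k] by (simp add: E_def energy_def)
 qed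
 have en: "(\<integral>\<^sup>+x. ennreal (F (H k) x (weak_grad \<Omega> (w k) x)) \<partial>lebesgue_on \<Omega>) <= ennreal (B k)" for k
  using Hw(4)[of k] wW[of k] by (simp add: E_def energy_def)
 \<comment> \<open>The scales at the selected indices; since \<open>H k\<close> is at least
   \<open>k\<close>, they are bounded by \<open>B k\<close>.\<close>
 define \<eta> where "\<eta> k = \<epsilon> (H k)" for k
 have \<eta>: "\<eta> k > 0" "\<eta> \<longlonglongrightarrow> 0" for k
 proof -
  show "\<eta> k > 0" for k by (simp add: \<eta>_def \<epsilon>)
  have "norm (\<eta> k) <= B k" for k
   using Hw(1)[of k] by (simp add: \<eta>_def \<epsilon>_def B_def le_imp_inverse_le)
  then show "\<eta> \<longlonglongrightarrow> 0" using Lim_null_comparison[OF eventuallyI B(2), of \<eta>] by blast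
 qed
 define G where "G k = weak_grad \<Omega> (w k)" for k
 note WG = W1p_weak_grad[OF wW \<Omega>(1), folded G_def]
 obtain q \<rho> where \<rho>: "\<rho> > 0" "cbox (q - vec (6 * \<rho>)) (q + vec (6 * \<rho>)) \<subseteq> \<Omega>" by (rule open_contains_square[OF \<Omega>(1,3)])
 define K where "K = cbox (q - vec (4 * \<rho>)) (q + vec (4 * \<rho>))"
 have K\<Omega>: "K \<subseteq> \<Omega>" using \<rho> by (intro order_trans[OF _ \<rho>(2)]) (auto simp: K_def mem_cbox_2)
 have KL: "bounded K" "K \<in> sets lebesgue" "\<Omega> \<in> sets lebesgue" using \<Omega> by (auto simp: K_def)
 have fm: "finite_measure (lebesgue_on K)" by (rule finite_measure_lebesgue_on[OF KL(1,2)])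
 have m: "w k \<in> borel_measurable (lebesgue_on K)" "G k \<in> borel_measurable (lebesgue_on K)" "u \<in> borel_measurable (lebesgue_on K)" for k
  by (rule measurable_restrict_mono[OF _ K\<Omega>], use Hw(2)[of k] WG(2)[of k] uL in \<open>unfold Lp_def, blast\<close>)+
 have wu [measurable]: "(%x. norm (w k x - u x)) \<in> borel_measurable (lebesgue_on K)" for k
  by (rule measurable_compose[OF borel_measurable_diff[OF m(1) m(3)] borel_measurable_continuous_onI[OF continuous_on_norm[OF continuous_on_id]]])
 have conv: "(%k. \<integral>x. (norm (w k x - u x))\<^sup>2 \<partial>lebesgue_on K) \<longlonglongrightarrow> 0"
 proof (rule dominated_imp_null(2)[OF fm, where g = "%k x. norm (w k x - u x) powr p" and B = B])
  show "\<exists>C\<ge>0. \<forall>k. AE x in lebesgue_on K. (norm (w k x - u x))\<^sup>2 <= \<delta> + C * norm (w k x - u x) powr p" if "\<delta> > 0" for \<delta>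
   using square_le_powr[OF p that] by (intro exI[of _ "sqrt \<delta> powr (2 - p)"]) (auto intro!: AE_I2)
  fix k
  have "(\<integral>\<^sup>+x. ennreal (norm (w k x - u x) powr p) \<partial>lebesgue_on K) <= (\<integral>\<^sup>+x. ennreal (norm (w k x - u x) powr p) \<partial>lebesgue_on \<Omega>)"
   by (rule nn_integral_lebesgue_on_mono[OF KL(3,2) K\<Omega>])
  also have "\<dots> = ennreal (\<integral>x. norm (w k x - u x) powr p \<partial>lebesgue_on \<Omega>)"
   by (rule nn_integral_eq_integral[OF Lp_diff[OF Hw(2) uL p0]]) simp
  also have "\<dots> <= ennreal (B k)" using Hw(3)[of k] by (intro ennreal_leI) simp
  finally show "(\<integral>\<^sup>+x. ennreal (norm (w k x - u x) powr p) \<partial>lebesgue_on K) <= ennreal (B k)" .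
  show "(%x. (norm (w k x - u x))\<^sup>2) \<in> borel_measurable (lebesgue_on K)" by (rule borel_measurable_power[OF wu])
  show "(%x. norm (w k x - u x) powr p) \<in> borel_measurable (lebesgue_on K)" by (intro powr_real_measurable wu borel_measurable_const)
 qed (use B in \<open>auto intro: less_imp_le\<close>)
 define D where "D k x = infdist (G k x) (phase_set (square_wave (x $ 1 / \<eta> k)))" for k x
 have Dm: "D k \<in> borel_measurable (lebesgue_on K)" for k
  unfolding D_def[abs_def] by (rule infdist_phase_measurable[OF m(2)])
 have Wc: "continuous_on UNIV W1" "continuous_on UNIV W2" and W0: "0 <= W1 \<Lambda>" "0 <= W2 \<Lambda>" for \<Lambda>
  using W1 W2 by (auto simp: polyconvex_potential_def intro: polyconvex_fun_continuous)
 have dom: "\<exists>C\<ge>0. \<forall>k. AE x in lebesgue_on K. (D k x)\<^sup>2 <= \<delta> + C * F (H k) x (G k x)" if \<delta>: "\<delta> > 0" for \<delta>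
 proof -
  have c: "closed (triple_set (-1/2) 1 (-2) 2)" "0 \<in> triple_set (-1/2) 1 (-2) 2" "closed (triple_set (5/2) 1 3 2)" "0 \<in> triple_set (5/2) 1 3 2"
   by (auto simp: triple_set_def diag2_zero)
  obtain C1 where C1: "C1 >= 0" "!!\<Lambda>. (infdist \<Lambda> (triple_set (-1/2) 1 (-2) 2))\<^sup>2 <= \<delta> + C1 * W1 \<Lambda>"
   using potential_controls_distance[OF W1 p c(1,2) \<delta>] by blast
  obtain C2 where C2: "C2 >= 0" "!!\<Lambda>. (infdist \<Lambda> (triple_set (5/2) 1 3 2))\<^sup>2 <= \<delta> + C2 * W2 \<Lambda>"
   using potential_controls_distance[OF W2 p c(3,4) \<delta>] by blast
  \<comment> \<open>The sum of the two constants serves both phases because both potentials are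
    nonnegative.\<close>
  have "(D k x)\<^sup>2 <= \<delta> + (C1 + C2) * F (H k) x (G k x)" for k x
  proof (cases "square_wave (x $ 1 / \<eta> k) = 1")
   case True
   have "(D k x)\<^sup>2 <= \<delta> + C1 * W1 (G k x)" using C1(2)[of "G k x"] True by (simp add: D_def phase_set_def)
   also have "\<dots> <= \<delta> + (C1 + C2) * W1 (G k x)" using W0 C2(1) by (intro add_left_mono mult_right_mono) auto
   finally show ?thesis using True by (simp add: F_def \<eta>_def)
  next
   case False
   have "(D k x)\<^sup>2 <= \<delta> + C2 * W2 (G k x)" using C2(2)[of "G k x"] False by (simp add: D_def phase_set_def)
   also have "\<dots> <= \<delta> + (C1 + C2) * W2 (G k x)" using W0 C1(1) by (intro add_left_mono mult_right_mono) auto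
   finally show ?thesis using False by (simp add: F_def \<eta>_def)
  qed
  then show ?thesis using C1(1) C2(1) by (intro exI[of _ "C1 + C2"]) auto
 qed
 have Fm: "(%x. F (H k) x (G k x)) \<in> borel_measurable (lebesgue_on K)" for k
  unfolding F_def by (intro phase_case_measurable measurable_compose[OF m(2) borel_measurable_continuous_onI] Wc)
 have F0: "0 <= F h x \<Lambda>" for h x \<Lambda> by (simp add: F_def W0)
 have FB: "(\<integral>\<^sup>+x. ennreal (F (H k) x (G k x)) \<partial>lebesgue_on K) <= ennreal (B k)" for k
  using order_trans[OF nn_integral_lebesgue_on_mono[OF KL(3,2) K\<Omega>] en[of k]] by (simp add: G_def)
 note null = dominated_imp_null[where f = "%k x. (D k x)\<^sup>2" and g = "%k x. F (H k) x (G k x)" and B = B, OF fm]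
 have Dm2: "(%x. (D k x)\<^sup>2) \<in> borel_measurable (lebesgue_on K)" for k by (rule borel_measurable_power[OF Dm])
 have D2: "integrable (lebesgue_on K) (%x. (D k x)\<^sup>2)" for k
  by (rule null(1)) (fact Dm2 Fm zero_le_power2 F0 dom FB less_imp_le[OF B(1)] B(2))+
 have D0: "(%k. \<integral>x. (D k x)\<^sup>2 \<partial>lebesgue_on K) \<longlonglongrightarrow> 0"
  by (rule null(2)) (fact Dm2 Fm zero_le_power2 F0 dom FB less_imp_le[OF B(1)] B(2))+
 have pairs: "AE x in lebesgue_on K. \<exists>a b. (a, b) \<in> phase_pairs (square_wave (x $ 1 / \<eta> k)) \<and> norm (G k x - diag2 a b) <= D k x" for k
  unfolding D_def by (intro AE_I2 infdist_phase_pairs)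
 note rec = no_recovery_sequence[where \<Omega> = \<Omega> and \<rho> = \<rho> and p = q and \<epsilon> = \<eta> and u = w and G = G and D = D, folded K_def u_def]
 have u2: "integrable (lebesgue_on K) (%x. (norm (w k x))\<^sup>2)" for k
  by (rule Lp_imp_square_integrable[OF Hw(2) \<Omega>(1) p KL(1,2) K\<Omega>])
 have G2: "integrable (lebesgue_on K) (%x. (norm (G k x))\<^sup>2)" for k
  by (rule Lp_imp_square_integrable[OF WG(2) \<Omega>(1) p KL(1,2) K\<Omega>])
 show False
  by (rule rec) (fact \<Omega> \<rho> K\<Omega> \<eta> WG u2 G2 conv Dm D2 D0 pairs)+
qed

text \<open>The weights 1/9, 4/9, 4/9 are realised by two binary combinations: the midpoint of the
  minors of the two nonzero matrices, and then weight 8/9 on this midpoint.\<close>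

lemma polyconvex_vanishes_at_C:
 assumes "polyconvex_fun W" "!!\<Lambda>. 0 <= W \<Lambda>" "W (diag2 0 0) = 0" "W (diag2 1 1) = 0" "W (diag2 (1/2) 2) = 0"
 shows "W (diag2 (2/3) (4/3)) = 0"
proof -
 obtain V where V: "convex_on UNIV V" "!!\<Lambda>. W \<Lambda> = V (minors \<Lambda>)" using assms(1) by (auto simp: polyconvex_fun_def)
 let ?z = "(1 - 1/2) *\<^sub>R minors (diag2 1 1) + (1/2) *\<^sub>R minors (diag2 (1/2) 2)"
 have z: "V ?z <= (1 - 1/2) * V (minors (diag2 1 1)) + 1/2 * V (minors (diag2 (1/2) 2))"
  by (rule convex_onD[OF V(1)]) auto
 have "V ((1 - 8/9) *\<^sub>R minors (diag2 0 0) + (8/9) *\<^sub>R ?z) <= (1 - 8/9) * V (minors (diag2 0 0)) + 8/9 * V ?z"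
  by (rule convex_onD[OF V(1)]) auto
 moreover have "minors (diag2 (2/3) (4/3)) = (1 - 8/9) *\<^sub>R minors (diag2 0 0) + (8/9) *\<^sub>R ?z"
  unfolding minors_C_combination by (simp add: scaleR_right_distrib)
 ultimately have "W (diag2 (2/3) (4/3)) <= 0" using z assms(3-5) unfolding V(2) by simp
 then show ?thesis using assms(2)[of "diag2 (2/3) (4/3)"] by simp
qed

theorem theorem1p3:
  fixes \<Omega> P1 P2 :: "(real^2) set"
    and O2 A11 A12 A21 A22 B1 B2 :: "real^2^2"
    and \<AA>1 \<AA>2 \<BB> \<AA>hom :: "(real^2^2) set"
  assumes "open \<Omega>" and "bounded \<Omega>" and "\<Omega> \<noteq> {}"
    and "P1 = {y. 0 \<le> y $ 1 \<and> y $ 1 < 1/2 \<and> 0 \<le> y $ 2 \<and> y $ 2 < 1}"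
    and "P2 = {y. 1/2 \<le> y $ 1 \<and> y $ 1 < 1 \<and> 0 \<le> y $ 2 \<and> y $ 2 < 1}"
    and "O2 = diag2 0 0"
    and "A11 = diag2 (-1/2) 1" and "A12 = diag2 (-2) 2"
    and "A21 = diag2 (5/2) 1" and "A22 = diag2 3 2"
    and "\<AA>1 = {O2, A11, A12}" and "\<AA>2 = {O2, A21, A22}"
    and "2 *\<^sub>R B1 = A11 + A21" and "2 *\<^sub>R B2 = A12 + A22"
    and "\<BB> = {O2, B1, B2}"
    and "\<AA>hom = hom_set \<Omega> 2 (\<lambda>k. if k = 1 then \<AA>1 else \<AA>2) (\<lambda>k. if k = 1 then P1 else P2)"
  shows "(polyconvex_set \<AA>1 \<and> polyconvex_set \<AA>2) \<and>
    (\<forall>p\<ge>2. \<exists>W1 W2. polyconvex_potential p \<AA>1 W1 \<and> polyconvex_potential p \<AA>2 W2) \<and>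
    (\<not> polyconvex_set \<AA>hom \<and> \<BB> \<subseteq> \<AA>hom \<and> \<not> polyconvex_set hull \<BB> \<subseteq> \<AA>hom) \<and>
    (\<forall>p\<ge>2. \<forall>W1 W2 Whom.
       polyconvex_potential p \<AA>1 W1 \<and> polyconvex_potential p \<AA>2 W2 \<and>
       homogenized_integrand p \<Omega> (\<lambda>y \<Lambda>. indicator P1 y * W1 \<Lambda> + indicator P2 y * W2 \<Lambda>) Whom
       \<longrightarrow> \<not> polyconvex_fun Whom)"
proof -
  have A1: "\<AA>1 = triple_set (-1/2) 1 (-2) 2" and A2: "\<AA>2 = triple_set (5/2) 1 3 2"
    unfolding assms(6-12) triple_set_def by (rule refl)+
  have "B1 = (1/2) *\<^sub>R (2 *\<^sub>R B1)" by simp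
  also have "\<dots> = (1/2) *\<^sub>R diag2 (-1/2) 1 + (1/2) *\<^sub>R diag2 (5/2) 1"
    unfolding assms(13) assms(7,9) by (rule scaleR_right_distrib)
  also have "\<dots> = diag2 1 1" unfolding diag2_combination by simp
  finally have B1: "B1 = diag2 1 1" .
  have "B2 = (1/2) *\<^sub>R (2 *\<^sub>R B2)" by simp
  also have "\<dots> = (1/2) *\<^sub>R diag2 (-2) 2 + (1/2) *\<^sub>R diag2 3 2"
    unfolding assms(14) assms(8,10) by (rule scaleR_right_distrib)
  also have "\<dots> = diag2 (1/2) 2" unfolding diag2_combination by simp
  finally have B2: "B2 = diag2 (1/2) 2" .
  have B: "\<BB> = triple_set 1 1 (1/2) 2" unfolding assms(15) assms(6) B1 B2 triple_set_def by (rule refl)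
  have P: "P1 = left_half" "P2 = right_half" unfolding assms(4,5) left_half_def right_half_def by (rule refl)+
  have hom: "\<AA>hom = hom_set \<Omega> 2 (\<lambda>k. if k = 1 then triple_set (-1/2) 1 (-2) 2 else triple_set (5/2) 1 3 2)
      (\<lambda>k. if k = 1 then left_half else right_half)"
    unfolding assms(16) A1 A2 P by (rule refl)
  have h: "diag2 0 0 \<in> \<AA>hom" "diag2 1 1 \<in> \<AA>hom" "diag2 (1/2) 2 \<in> \<AA>hom"
    unfolding hom
    by (rule laminate_in_hom_set[OF assms(1,2), of 0 0 0], simp,
       rule laminate_in_hom_set[OF assms(1,2), of 1 "-3/2" 1], simp,
       rule laminate_in_hom_set[OF assms(1,2), of "1/2" "-5/2" 2], simp)
  have sub: "\<BB> \<subseteq> \<AA>hom" unfolding B triple_set_def using h by blast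
  have nsub: "\<not> polyconvex_set hull \<BB> \<subseteq> \<AA>hom"
    unfolding B hom using C_in_polyconvex_hull C_not_in_hom_set[OF assms(1-3)] by blast
  have npc: "\<not> polyconvex_set \<AA>hom" using hull_minimal[OF sub, of polyconvex_set] nsub by blast
  have pc: "polyconvex_set \<AA>1" "polyconvex_set \<AA>2"
    unfolding A1 A2 using minors_rigid_A1 minors_rigid_A2 by (auto intro: minors_rigid_imp_polyconvex_set)
  have pot: "\<exists>W. polyconvex_potential p \<AA>1 W" "\<exists>W. polyconvex_potential p \<AA>2 W" if "p \<ge> 2" for p
    unfolding A1 A2 using that minors_rigid_A1 minors_rigid_A2
    by (intro polyconvex_potential_exists; simp add: triple_set_def)+
  \<comment> \<open>The potentials are arbitrary here, not those constructed for (ii). A polyconvex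
    integrand vanishing on \<BB> would also vanish at \<open>C\<close>.\<close>
  have "\<not> polyconvex_fun Whom"
    if p: "p \<ge> 2" and W1: "polyconvex_potential p \<AA>1 W1" and W2: "polyconvex_potential p \<AA>2 W2"
      and H: "homogenized_integrand p \<Omega> (\<lambda>y \<Lambda>. indicator P1 y * W1 \<Lambda> + indicator P2 y * W2 \<Lambda>) Whom" for p W1 W2 Whom
  proof
    assume pf: "polyconvex_fun Whom"
    have nn: "0 \<le> Whom \<Lambda>" for \<Lambda> using H unfolding homogenized_integrand_def by blast
    note z = Whom_laminate_zero[OF assms(1-3) p W1[unfolded A1] W2[unfolded A2] H[unfolded P]]
    have "Whom (diag2 (2/3) (4/3)) = 0"
    proof (rule polyconvex_vanishes_at_C[OF pf nn])
      show "Whom (diag2 0 0) = 0" by (rule z[of 0 0 0]) simp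
      show "Whom (diag2 1 1) = 0" by (rule z[of 1 "-3/2" 1]) simp
      show "Whom (diag2 (1/2) 2) = 0" by (rule z[of "1/2" "-5/2" 2]) simp
    qed
    then show False using Whom_C_nonzero[OF assms(1-3) p W1[unfolded A1] W2[unfolded A2] H[unfolded P]] by blast
  qed
  then show ?thesis using pc pot sub nsub npc by blast
qed

end
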